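(* Let $\varphi_i=P(\tau_i)$, $1\le i\le\mu$, be the distinguished monomial generators of the Brieskorn lattice $\mathcal H_f$ of the log LG model mirror to a projective toric manifold $Y$. Then $\{\varphi_1,\dots,\varphi_\mu\}$ is a good basis, namely $K_f(\varphi_i,\varphi_j)\in\mathbb C\subset\mathbb C[[u]]$ for all $i,j$.
   Context: **Setup.** $N\cong\mathbb Z^n$, $M=\mathrm{Hom}(N,\mathbb Z)$; $\Sigma$ is a smooth complete fan in $N\otimes\mathbb R$ whose toric variety $Y$ is projective; $\rho_1,\dots,\rho_d$ are the primitive ray generators, with $\rho_1,\dots,\rho_n$ a basis of $N$ spanning a maximal cone, and $e^1,\dots,e^n\in M$ the dual basis. $X\subset\mathbb C^d$ is the analytic space defined by the Stanley-Reisner ideal of $\Sigma$, with components $X_i\cong\mathbb C^n$ (coordinate subspaces) corresponding to the maximal cones, equipped with its natural log structure over the log point. Relative log derivations $\Theta^1$: free $\mathcal O_X$-module with frame $\tilde\theta_k=\sum_{i=1}^d\langle\rho_i,e^k\rangle z_i\partial_{z_i}$, $1\le k\le n$; $\Theta^i=\wedge^i\Theta^1$. Relative log forms: free with frame $d\log z_1,\dots,d\log z_n$, where $d\log z_l=\sum_{k=1}^n\langle\rho_l,e^k\rangle d\log z_k$; $\Omega=d\log z_1\wedge\dots\wedge d\log z_n$. $f=z_1+\dots+z_d$, $g_k=\tilde\theta_k(f)=\sum_i\langle\rho_i,e^k\rangle z_i$. **Polyvector fields.** $\mathcal A^{0,j}$: collections of smooth $(0,j)$-forms on the components $X_i$ whose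 pullbacks to intersections agree. $PV_{\log}=\bigoplus\mathcal A^{0,j}\otimes_{\mathcal O_X}\Theta^i$, with the graded-commutative product. With $\partial/\partial\tilde\theta_k$ the odd derivations dual to $\tilde\theta_k$, put $\{f,-\}=\sum_kg_k\,\partial/\partial\tilde\theta_k$, $\partial=\sum_k\tilde\theta_k\circ\partial/\partial\tilde\theta_k$ ($\tilde\theta_k$ acting on coefficients), $Q=\bar\partial+u\partial$, $Q_f=Q+\{f,-\}$. The Brieskorn lattice is $\mathcal H_f=H(PV_{\log}(X)[[u]],Q_f)$, a free $\mathbb C[[u]]$-module. **Higher residue pairing.** $V_f=(\sum_kg_k\bar g_k)^{-1}\sum_k\bar g_k\tilde\theta_k$ on $X\setminus0$, acting by wedge product; $\rho=\rho(|z_1|^2,\dots,|z_d|^2)$ smooth with compact support, $\equiv1$ near $0$; $T^u_\rho=\rho+[Q,\rho]V_f(1+[Q,V_f])^{-1}$ (graded commutators, geometric series), which maps $PV_{\log}(X)[[u]]$ to compactly supported polyvector fields and commutes with $Q_f$. $\mathrm{Tr}\,\alpha=\int_X(\alpha\vdash\Omega)\wedge\Omega:=\sum_i\int_{X_i}(\alpha\vdash\Omega)\wedge\Omega$ on the bidegree $(n,n)$ part of compactly supported $\alpha$ (zero on other bidegrees), $\vdash$ denoting contraction. $K_f(\alpha(u),\beta(u))=\mathrm{Tr}(T^u_\rho\alpha(u)\wedge\overline{T^u_\rho\beta(u)})\in\mathbb C[[u]]$, the bar meaning $u\mapsto-u$; it is well defined on $\mathcal H_f$. **Basis.** Fix an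 ordering $\sigma_1,\dots,\sigma_\mu$ of the $n$-dimensional cones such that, with $\tau_i$ the intersection of $\sigma_i$ with all $\sigma_j$ with $j>i$ and $\dim(\sigma_i\cap\sigma_j)=n-1$ (so $\tau_\mu=\sigma_\mu$), one has: if $\tau_i\subset\sigma_j$ then $i\le j$ (such an ordering exists). For a cone $\tau$ generated by $\rho_{i_1},\dots,\rho_{i_k}$, $P(\tau)=z_{i_1}\cdots z_{i_k}$ ($P(\{0\})=1$). The classes of $P(\tau_1),\dots,P(\tau_\mu)$ form a $\mathbb C[[u]]$-basis of $\mathcal H_f$. *)

theory Defs
  imports "HOL-Analysis.Analysis" "HOL-Computational_Algebra.Formal_Power_Series"
begin

section \<open>The fan\<close>

text \<open>
  The lattice is \<open>N = \<int>\<^sup>n\<close> with \<open>n = CARD('n)\<close>, and \<open>M = Hom(N, \<int>)\<close> is identified with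
  \<open>\<int>\<^sup>n\<close> by the standard pairing.  Rays carry the labels \<open>1, \<dots>, nrays\<close>.  Every cone of a smooth
  fan is simplicial, so it is determined by the rays it contains; \<open>cones\<close> consists of these sets of
  labels, \<open>{}\<close> standing for the zero cone.  The vectors \<open>dual_vec k\<close>, \<open>1 \<le> k \<le> n\<close>, are the
  dual basis \<open>e\<^sup>k\<close>.  Values of \<open>ray\<close> and \<open>dual_vec\<close> at other labels are irrelevant.
\<close>

record ('n::finite) toric =
  nrays :: nat
  ray :: "nat \<Rightarrow> int^'n"
  cones :: "nat set set"
  dual_vec :: "nat \<Rightarrow> int^'n"

definition rk :: "'n::finite toric \<Rightarrow> nat" where
  "rk D = CARD('n)"

definition pairing :: "int^'n \<Rightarrow> int^'n \<Rightarrow> int" where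
  "pairing v m = (\<Sum>l\<in>UNIV. v $ l * m $ l)"

definition real_vec :: "int^'n \<Rightarrow> real^'n" where
  "real_vec v = (\<chi> l. real_of_int (v $ l))"

definition lattice_basis :: "(int^'n) set \<Rightarrow> bool" where
  "lattice_basis B \<longleftrightarrow>
     finite B \<and> (\<forall>v. \<exists>!c. c \<in> B \<rightarrow>\<^sub>E (UNIV :: int set) \<and> v = (\<Sum>b\<in>B. c b *s b))"

definition geom_cone :: "'n::finite toric \<Rightarrow> nat set \<Rightarrow> (real^'n) set" where
  "geom_cone D S = {\<Sum>i\<in>S. a i *\<^sub>R real_vec (ray D i) | a. \<forall>i\<in>S. 0 \<le> a i}"

definition smooth_fan :: "'n::finite toric \<Rightarrow> bool" where
  "smooth_fan D \<longleftrightarrow>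
     (\<forall>S\<in>cones D. S \<subseteq> {1..nrays D} \<and> (\<forall>T\<subseteq>S. T \<in> cones D)) \<and>
     (\<forall>i\<in>{1..nrays D}. {i} \<in> cones D) \<and>
     (\<forall>S\<in>cones D. inj_on (ray D) S \<and> (\<exists>B. lattice_basis B \<and> ray D ` S \<subseteq> B)) \<and>
     (\<forall>S\<in>cones D. \<forall>T\<in>cones D. geom_cone D S \<inter> geom_cone D T = geom_cone D (S \<inter> T))"

definition complete_fan :: "'n::finite toric \<Rightarrow> bool" where
  "complete_fan D \<longleftrightarrow> (\<Union>S\<in>cones D. geom_cone D S) = UNIV"

definition maxcones :: "'n::finite toric \<Rightarrow> nat set set" where
  "maxcones D = {S \<in> cones D. card S = rk D}"

text \<open>
  Projectivity of the toric variety \<open>Y\<close> of a complete fan, in terms of the fan: some torus-invariant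
  divisor \<open>\<Sum> a\<^sub>i D\<^sub>i\<close> is ample, i.e. its support function (given on the maximal cone \<open>S\<close> by the
  linear form \<open>m\<close>) is strictly convex.
\<close>

definition projective_fan :: "'n::finite toric \<Rightarrow> bool" where
  "projective_fan D \<longleftrightarrow>
     (\<exists>a :: nat \<Rightarrow> int. \<forall>S\<in>maxcones D. \<exists>m.
        (\<forall>i\<in>S. pairing (ray D i) m = - a i) \<and>
        (\<forall>i\<in>{1..nrays D} - S. pairing (ray D i) m > - a i))"

definition log_LG :: "'n::finite toric \<Rightarrow> bool" where
  "log_LG D \<longleftrightarrow>
     smooth_fan D \<and> complete_fan D \<and> projective_fan D \<and> {1..rk D} \<in> cones D \<and>
     lattice_basis (ray D ` {1..rk D}) \<and>
     (\<forall>i\<in>{1..rk D}. \<forall>k\<in>{1..rk D}. pairing (ray D i) (dual_vec D k) = (if i = k then 1 else 0))"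

section \<open>Ordering of the maximal cones\<close>

definition tau :: "'n::finite toric \<Rightarrow> (nat \<Rightarrow> nat set) \<Rightarrow> nat \<Rightarrow> nat set" where
  "tau D sg i =
     sg i \<inter> \<Inter>{sg j | j. i < j \<and> j \<le> card (maxcones D) \<and> card (sg i \<inter> sg j) = rk D - 1}"

definition cone_ordering :: "'n::finite toric \<Rightarrow> (nat \<Rightarrow> nat set) \<Rightarrow> bool" where
  "cone_ordering D sg \<longleftrightarrow>
     bij_betw sg {1..card (maxcones D)} (maxcones D) \<and>
     (\<forall>i\<in>{1..card (maxcones D)}. \<forall>j\<in>{1..card (maxcones D)}. tau D sg i \<subseteq> sg j \<longrightarrow> i \<le> j)"

section \<open>Smooth functions on coordinate subspaces\<close>

text \<open>
  \<open>coord_space {1..d}\<close> is the \<open>d\<close>-dimensional affine space, and for a maximal cone \<open>S\<close> the space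
  \<open>coord_space S\<close> is the component of \<open>X\<close> corresponding to \<open>S\<close>.
\<close>

definition coord_space :: "nat set \<Rightarrow> (nat \<Rightarrow> 'a::zero) set" where
  "coord_space S = {z. \<forall>i. i \<notin> S \<longrightarrow> z i = 0}"

definition dir_deriv ::
    "nat \<times> 'a::real_normed_vector \<Rightarrow> ((nat \<Rightarrow> 'a) \<Rightarrow> 'b::real_normed_vector) \<Rightarrow> (nat \<Rightarrow> 'a) \<Rightarrow> 'b" where
  "dir_deriv p F z = (case p of (i, v) \<Rightarrow>
     vector_derivative (\<lambda>t. F (z(i := z i + t *\<^sub>R v))) (at 0))"

text \<open>
  All iterated partial derivatives exist and are continuous.
\<close>

definition smooth_coord ::
    "nat set \<Rightarrow> ((nat \<Rightarrow> 'a::real_normed_vector) \<Rightarrow> 'b::real_normed_vector) \<Rightarrow> bool" where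
  "smooth_coord S F \<longleftrightarrow>
     (\<forall>ds. fst ` set ds \<subseteq> S \<longrightarrow>
        continuous_on (coord_space S) (foldr dir_deriv ds F) \<and>
        (\<forall>z\<in>coord_space S. \<forall>i\<in>S. \<forall>v.
           (\<lambda>t. foldr dir_deriv ds F (z(i := z i + t *\<^sub>R v))) differentiable at (0::real)))"

definition d_z :: "nat \<Rightarrow> ((nat \<Rightarrow> complex) \<Rightarrow> complex) \<Rightarrow> (nat \<Rightarrow> complex) \<Rightarrow> complex" where
  "d_z i F z = (dir_deriv (i, 1) F z - \<i> * dir_deriv (i, \<i>) F z) / 2"

definition d_zbar :: "nat \<Rightarrow> ((nat \<Rightarrow> complex) \<Rightarrow> complex) \<Rightarrow> (nat \<Rightarrow> complex) \<Rightarrow> complex" where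
  "d_zbar i F z = (dir_deriv (i, 1) F z + \<i> * dir_deriv (i, \<i>) F z) / 2"

section \<open>Logarithmic polyvector fields\<close>

text \<open>
  A polyvector field \<open>a\<close> has on the component of the maximal cone \<open>S\<close> the expansion
  \<open>\<Sum> a S J K dzbar\<^sub>J \<theta>\<^sub>K\<close> over \<open>J \<subseteq> S\<close> and \<open>K \<subseteq> {1..n}\<close>, where \<open>dzbar\<^sub>J\<close> and \<open>\<theta>\<^sub>K\<close> are the products
  in increasing order of the indices, and the \<open>dzbar\<^sub>i\<close> and \<open>\<theta>\<^sub>k\<close> all anticommute.  Only the values
  \<open>a S J K z\<close> with \<open>J\<close>, \<open>K\<close> as above and \<open>z \<in> coord_space S\<close> are meaningful.  Pullback to the
  intersection of the components of \<open>S\<close> and \<open>S'\<close> restricts the coefficients to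
  \<open>coord_space (S \<inter> S')\<close> and kills \<open>dzbar\<^sub>J\<close> unless \<open>J \<subseteq> S \<inter> S'\<close>.

  An element of \<open>PV[[u]]\<close> is given by the sequence of its \<open>u\<close>-coefficients.
\<close>

type_synonym pv = "nat set \<Rightarrow> nat set \<Rightarrow> nat set \<Rightarrow> (nat \<Rightarrow> complex) \<Rightarrow> complex"
type_synonym pvu = "nat \<Rightarrow> pv"

definition PV_log :: "'n::finite toric \<Rightarrow> pv set" where
  "PV_log D = {a.
     (\<forall>S\<in>maxcones D. \<forall>J\<subseteq>S. \<forall>K\<subseteq>{1..rk D}. smooth_coord S (a S J K)) \<and>
     (\<forall>S\<in>maxcones D. \<forall>S'\<in>maxcones D. \<forall>J\<subseteq>S \<inter> S'. \<forall>K\<subseteq>{1..rk D}.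
        \<forall>z\<in>coord_space (S \<inter> S'). a S J K z = a S' J K z)}"

definition PV_log_u :: "'n::finite toric \<Rightarrow> pvu set" where
  "PV_log_u D = {\<alpha>. \<forall>m. \<alpha> m \<in> PV_log D}"

text \<open>
  The sign with \<open>\<theta>\<^sub>A \<theta>\<^sub>B = shuffle_sign A B \<theta>\<^sub>A\<^sub>\<union>\<^sub>B\<close> for disjoint \<open>A\<close> and \<open>B\<close>.
\<close>

definition shuffle_sign :: "nat set \<Rightarrow> nat set \<Rightarrow> complex" where
  "shuffle_sign A B = (-1) ^ card {(x, y). x \<in> A \<and> y \<in> B \<and> y < x}"

definition wedge :: "pv \<Rightarrow> pv \<Rightarrow> pv" where
  "wedge a b = (\<lambda>S J K z. \<Sum>J1\<in>Pow J. \<Sum>K1\<in>Pow K.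
     (-1) ^ (card K1 * card (J - J1)) * shuffle_sign J1 (J - J1) * shuffle_sign K1 (K - K1) *
     a S J1 K1 z * b S (J - J1) (K - K1) z)"

definition wedge_u :: "pvu \<Rightarrow> pvu \<Rightarrow> pvu" where
  "wedge_u \<alpha> \<beta> = (\<lambda>m S J K z. \<Sum>l\<le>m. wedge (\<alpha> l) (\<beta> (m - l)) S J K z)"

definition dbar :: "pv \<Rightarrow> pv" where
  "dbar a = (\<lambda>S J K z. \<Sum>i\<in>J. shuffle_sign {i} (J - {i}) * d_zbar i (a S (J - {i}) K) z)"

text \<open>
  The odd derivation dual to \<open>\<theta>\<^sub>k\<close>; the factor \<open>(-1) ^ card J\<close> comes from moving it past \<open>dzbar\<^sub>J\<close>.
\<close>

definition odd_deriv :: "nat \<Rightarrow> pv \<Rightarrow> pv" where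
  "odd_deriv k a = (\<lambda>S J K z.
     if k \<in> K then 0 else (-1) ^ card J * shuffle_sign {k} K * a S J (insert k K) z)"

text \<open>
  On the component of \<open>S\<close> the terms with \<open>i \<notin> S\<close> vanish, because \<open>z i = 0\<close> there.
\<close>

definition theta ::
    "'n::finite toric \<Rightarrow> nat \<Rightarrow> ((nat \<Rightarrow> complex) \<Rightarrow> complex) \<Rightarrow> (nat \<Rightarrow> complex) \<Rightarrow> complex" where
  "theta D k F z =
     (\<Sum>i=1..nrays D. of_int (pairing (ray D i) (dual_vec D k)) * z i * d_z i F z)"

definition del :: "'n::finite toric \<Rightarrow> pv \<Rightarrow> pv" where
  "del D a = (\<lambda>S J K z. \<Sum>k=1..rk D. theta D k (odd_deriv k a S J K) z)"

text \<open>
  \<open>\<theta>\<^sub>k f\<close> for the potential \<open>f = z\<^sub>1 + \<dots> + z\<^sub>d\<close>.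
\<close>

definition g_f :: "'n::finite toric \<Rightarrow> nat \<Rightarrow> (nat \<Rightarrow> complex) \<Rightarrow> complex" where
  "g_f D k z = (\<Sum>i=1..nrays D. of_int (pairing (ray D i) (dual_vec D k)) * z i)"

definition bracket_f :: "'n::finite toric \<Rightarrow> pv \<Rightarrow> pv" where
  "bracket_f D a = (\<lambda>S J K z. \<Sum>k=1..rk D. g_f D k z * odd_deriv k a S J K z)"

definition Q_op :: "'n::finite toric \<Rightarrow> pvu \<Rightarrow> pvu" where
  "Q_op D \<alpha> = (\<lambda>m S J K z.
     dbar (\<alpha> m) S J K z + (if m = 0 then 0 else del D (\<alpha> (m - 1)) S J K z))"

definition Q_f :: "'n::finite toric \<Rightarrow> pvu \<Rightarrow> pvu" where
  "Q_f D \<alpha> = (\<lambda>m S J K z. Q_op D \<alpha> m S J K z + bracket_f D (\<alpha> m) S J K z)"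

text \<open>
  The set of representatives of the class of a \<open>Q_f\<close>-closed \<open>\<alpha>\<close> in the Brieskorn lattice
  \<open>H(PV[[u]], Q_f)\<close>.
\<close>

definition brieskorn_class :: "'n::finite toric \<Rightarrow> pvu \<Rightarrow> pvu set" where
  "brieskorn_class D \<alpha> = {\<beta> \<in> PV_log_u D. \<exists>\<gamma> \<in> PV_log_u D.
     \<forall>m. \<forall>S\<in>maxcones D. \<forall>J\<subseteq>S. \<forall>K\<subseteq>{1..rk D}. \<forall>z\<in>coord_space S.
       \<beta> m S J K z = \<alpha> m S J K z + Q_f D \<gamma> m S J K z}"

definition P_mon :: "nat set \<Rightarrow> pvu" where
  "P_mon T = (\<lambda>m S J K z. if m = 0 \<and> J = {} \<and> K = {} then \<Prod>i\<in>T. z i else 0)"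

section \<open>Higher residue pairing\<close>

text \<open>
  At \<open>z = 0\<close> the value of \<open>V_f\<close> is a dummy.  It has no influence on \<open>T_op\<close> below, since the commutator of
  \<open>Q\<close> with a function that is constant near \<open>0\<close> vanishes near \<open>0\<close>.
\<close>

definition V_f :: "'n::finite toric \<Rightarrow> pv" where
  "V_f D = (\<lambda>S J K z. \<Sum>k=1..rk D.
     if J = {} \<and> K = {k} then cnj (g_f D k z) / (\<Sum>l=1..rk D. g_f D l z * cnj (g_f D l z)) else 0)"

definition mult_V :: "'n::finite toric \<Rightarrow> pvu \<Rightarrow> pvu" where
  "mult_V D \<alpha> = (\<lambda>m. wedge (V_f D) (\<alpha> m))"

definition comm_Q_V :: "'n::finite toric \<Rightarrow> pvu \<Rightarrow> pvu" where
  "comm_Q_V D \<alpha> = (\<lambda>m S J K z.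
     Q_op D (mult_V D \<alpha>) m S J K z + mult_V D (Q_op D \<alpha>) m S J K z)"

text \<open>
  The inverse of \<open>1 + [Q, V_f]\<close>.  Each application of \<open>[Q, V_f]\<close> raises the \<open>u\<close>-order or the degree
  \<open>card J\<close>, so only finitely many terms of the series are nonzero.
\<close>

definition geom_inv :: "'n::finite toric \<Rightarrow> pvu \<Rightarrow> pvu" where
  "geom_inv D \<alpha> = (\<lambda>m S J K z. \<Sum>r. (-1) ^ r * (comm_Q_V D ^^ r) \<alpha> m S J K z)"

text \<open>
  The cutoff is \<open>\<rho> = R(|z\<^sub>1|\<^sup>2, \<dots>, |z\<^sub>d|\<^sup>2)\<close>.
\<close>

definition is_cutoff :: "'n::finite toric \<Rightarrow> ((nat \<Rightarrow> real) \<Rightarrow> real) \<Rightarrow> bool" where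
  "is_cutoff D R \<longleftrightarrow>
     smooth_coord {1..nrays D} R \<and>
     (\<exists>B. \<forall>t\<in>coord_space {1..nrays D}. (\<forall>i. 0 \<le> t i) \<and> (\<exists>i. B < t i) \<longrightarrow> R t = 0) \<and>
     (\<exists>\<epsilon>>0. \<forall>t\<in>coord_space {1..nrays D}. (\<forall>i. 0 \<le> t i \<and> t i < \<epsilon>) \<longrightarrow> R t = 1)"

definition mult_cutoff :: "((nat \<Rightarrow> real) \<Rightarrow> real) \<Rightarrow> pvu \<Rightarrow> pvu" where
  "mult_cutoff R \<alpha> = (\<lambda>m S J K z. of_real (R (\<lambda>i. (cmod (z i))\<^sup>2)) * \<alpha> m S J K z)"

definition comm_Q_cutoff ::
    "'n::finite toric \<Rightarrow> ((nat \<Rightarrow> real) \<Rightarrow> real) \<Rightarrow> pvu \<Rightarrow> pvu" where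
  "comm_Q_cutoff D R \<alpha> = (\<lambda>m S J K z.
     Q_op D (mult_cutoff R \<alpha>) m S J K z - mult_cutoff R (Q_op D \<alpha>) m S J K z)"

definition T_op :: "'n::finite toric \<Rightarrow> ((nat \<Rightarrow> real) \<Rightarrow> real) \<Rightarrow> pvu \<Rightarrow> pvu" where
  "T_op D R \<alpha> = (\<lambda>m S J K z.
     mult_cutoff R \<alpha> m S J K z +
     comm_Q_cutoff D R (mult_V D (geom_inv D \<alpha>)) m S J K z)"

text \<open>
  The determinant of the matrix of the \<open>d log z\<^sub>l\<close>, \<open>l \<in> S\<close> (in increasing order), in the frame
  \<open>d log z\<^sub>1, \<dots>, d log z\<^sub>n\<close>.  Hence \<open>\<Omega>\<close> is the product of the \<open>dz\<^sub>l / z\<^sub>l\<close>, \<open>l \<in> S\<close>, divided by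
  \<open>frame_det D S\<close>.
\<close>

definition frame_det :: "'n::finite toric \<Rightarrow> nat set \<Rightarrow> int" where
  "frame_det D S = (\<Sum>p | p permutes {1..rk D}.
     sign p * (\<Prod>k=1..rk D. pairing (ray D (sorted_list_of_set S ! (k - 1))) (dual_vec D (p k))))"

text \<open>
  The integral of \<open>(a \<turnstile> \<Omega>) \<and> \<Omega>\<close> over all components.  With \<open>(v \<and> w) \<turnstile> \<Omega> = v \<turnstile> (w \<turnstile> \<Omega>)\<close>
  one has \<open>\<theta>\<^sub>1 \<dots> \<theta>\<^sub>n \<turnstile> \<Omega> = (-1) ^ (n (n - 1) / 2)\<close>.  This sign is cancelled when
  \<open>dzbar\<^sub>S \<and> dz\<^sub>S\<close> is rewritten as the product of the \<open>dzbar\<^sub>l \<and> dz\<^sub>l = 2 \<i> dx\<^sub>l \<and> dy\<^sub>l\<close>.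
\<close>

definition Tr :: "'n::finite toric \<Rightarrow> pv \<Rightarrow> complex" where
  "Tr D a = (\<Sum>S\<in>maxcones D. (2 * \<i>) ^ rk D / of_int (frame_det D S) *
     (\<integral>w. (let z = (\<lambda>i. if i \<in> S then w i else 0) in a S S {1..rk D} z / (\<Prod>l\<in>S. z l))
        \<partial>(\<Pi>\<^sub>M l\<in>S. (lborel :: complex measure))))"

definition bar_u :: "pvu \<Rightarrow> pvu" where
  "bar_u \<alpha> = (\<lambda>m S J K z. (-1) ^ m * \<alpha> m S J K z)"

definition K_f ::
    "'n::finite toric \<Rightarrow> ((nat \<Rightarrow> real) \<Rightarrow> real) \<Rightarrow> pvu \<Rightarrow> pvu \<Rightarrow> complex fps" where
  "K_f D R \<alpha> \<beta> = Abs_fps (\<lambda>m. Tr D (wedge_u (T_op D R \<alpha>) (bar_u (T_op D R \<beta>)) m))"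

end

theory Submission
  imports Defs
begin

text \<open>
  Multiplication by \<open>z\<^sub>i\<close> lifts to the operator \<open>D\<^sub>i = z\<^sub>i + u z\<^sub>i\<partial>\<^sub>i\<close>, which commutes with \<open>Q\<^sub>f\<close>.  Words
  in the \<open>D\<^sub>i\<close> applied to \<open>1\<close> give the square-free monomials, they vanish on \<open>X\<close> when their letters do
  not lie in a common cone, and \<open>\<Sum> \<langle>\<rho>\<^sub>i, e\<^sup>k\<rangle> D\<^sub>i\<close> acts by zero on cohomology because
  \<open>\<Sum> \<langle>\<rho>\<^sub>i, e\<^sup>k\<rangle> D\<^sub>i 1 = Q\<^sub>f \<theta>\<^sub>k\<close>.  The operator \<open>T\<close> equals \<open>1 - [Q\<^sub>f, R]\<close> with \<open>R = (1 - \<rho>) V (1 + [Q, V])\<^sup>-\<^sup>1\<close>,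
  so it represents classes by compactly supported ones.  By Stokes' theorem the pairing
  of two monomials is therefore the trace of a word \<open>w\<close> applied to a compactly supported representative of
  \<open>1\<close>; the boundary terms, which are residues along the walls of the fan, cancel since every wall lies in
  exactly two maximal cones, with opposite orientations.

  The grading operator \<open>u\<partial>\<^sub>u + deg\<^sub>\<theta> + \<Sum> z\<^sub>i\<partial>\<^sub>i\<close> commutes with \<open>Q\<^sub>f\<close> as well.  It multiplies a word of length
  \<open>l\<close> by \<open>l\<close>, and in the coefficient of \<open>u\<^sup>m\<close> of the trace it is multiplication by \<open>m + n\<close>.  So this
  coefficient vanishes unless \<open>l = m + n\<close>.  A word with \<open>l > n\<close> whose letters lie in a cone has a repeated letter;
  the linear relations replace it by letters outside of that cone, and induction on the number of distinct
  letters shows that the trace of the word is \<open>0\<close>.  Hence only \<open>m = 0\<close> survives.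
\<close>

section \<open>Calculus on coordinate subspaces\<close>

text \<open>\<open>D_i\<close> is the conjugate of \<open>u z_i d/dz_i\<close> by
  \<open>exp (f / u)\<close>, and \<open>Q_f\<close> that of \<open>Q\<close>. This is why the
  \<open>D_i\<close> commute with one another and with \<open>Q_f\<close>, and why
  \<open>Q_f\<close> is \<open>dbar\<close> plus the Koszul differential of the operators
  \<open>g_k + u theta_k\<close>, which are combinations of the \<open>D_i\<close>. Off the origin
  \<open>{f, -}\<close> and \<open>V\<close> anticommute to \<open>1\<close>, so
  \<open>[Q_f, V] = 1 + [Q, V]\<close>, and \<open>V (1 + [Q, V])^-1\<close> contracts
  \<open>Q_f\<close> there; the factor \<open>1 - \<rho>\<close> makes it smooth at the origin. The
  obstacle is that a compactly supported exact field comes with a primitive of any support, while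
  Stokes' theorem needs a compact one. If \<open>C = Q_f \<delta>\<close>, then
  \<open>T \<delta> + R C\<close> is such a primitive. The bar \<open>u -> - u\<close> of the
  pairing is forced by signs: integration by parts moves \<open>dbar\<close> and
  \<open>{f, -}\<close> across the product with a minus, but \<open>del\<close> with a plus.
  Coefficients are total functions with arbitrary values off their components, so identities hold
  only on \<open>coord_space S\<close> and for admissible indices; hence the relations
  \<open>agree\<close> and \<open>eqv\<close> in place of equality.\<close>

lemma coord_space_upd: "z \<in> coord_space S \<Longrightarrow> i \<in> S \<Longrightarrow> z(i := c) \<in> coord_space S"
  by (auto simp: coord_space_def)

lemma coord_space_mono: "W \<subseteq> S \<Longrightarrow> z \<in> coord_space W \<Longrightarrow> z \<in> coord_space S"
  by (auto simp: coord_space_def)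

lemma coord_space_zero: "z \<in> coord_space S \<Longrightarrow> i \<notin> S \<Longrightarrow> z i = 0"
  by (auto simp: coord_space_def)

lemma continuous_on_fun_upd:
  fixes z :: "nat \<Rightarrow> 'a::topological_space"
  assumes "continuous_on A g"
  shows "continuous_on A (\<lambda>t. z(i := g t))"
proof (rule continuous_on_coordinatewise_then_product)
  fix l show "continuous_on A (\<lambda>t. (z(i := g t)) l)"
    using assms by (cases "l = i") auto
qed

lemma continuous_on_coord: "continuous_on A (\<lambda>z::'a \<Rightarrow> 'b::topological_space. z j)"
  by (rule continuous_on_subset[OF continuous_on_product_coordinates subset_UNIV])

lemma line_in_open:
  fixes z :: "nat \<Rightarrow> 'a::real_normed_vector"
  assumes "open U" "z \<in> U"
  shows "\<forall>\<^sub>F t in nhds (0::real). z(i := z i + t *\<^sub>R v) \<in> U"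
proof -
  have "continuous_on UNIV (\<lambda>t::real. z(i := z i + t *\<^sub>R v))"
    by (intro continuous_on_fun_upd continuous_intros)
  then have "open ((\<lambda>t::real. z(i := z i + t *\<^sub>R v)) -` U)"
    using assms(1) by (simp add: open_vimage)
  moreover have "0 \<in> (\<lambda>t::real. z(i := z i + t *\<^sub>R v)) -` U"
    using assms(2) by simp
  ultimately have "\<forall>\<^sub>F t in nhds (0::real). t \<in> (\<lambda>t::real. z(i := z i + t *\<^sub>R v)) -` U"
    by (rule eventually_nhds_in_open)
  then show ?thesis by simp
qed

text \<open>A coordinate line in a direction of \<open>W\<close> stays in
  \<open>coord_space W\<close>, and for small times in \<open>U\<close>, so the derivative sees only
  values there. This is what allows operators to be compared on the intersection of two components,
  where fields agree only on the smaller subspace.\<close>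

lemma dir_deriv_cong:
  assumes "open U" "i \<in> W" "z \<in> coord_space W \<inter> U"
    and eq: "\<And>z. z \<in> coord_space W \<inter> U \<Longrightarrow> F z = G z"
  shows "dir_deriv (i, v) F z = dir_deriv (i, v) G z"
  unfolding dir_deriv_def prod.case
proof (rule vector_derivative_cong_eq)
  show "\<forall>\<^sub>F t in nhds 0. t \<in> UNIV \<longrightarrow> F (z(i := z i + t *\<^sub>R v)) = G (z(i := z i + t *\<^sub>R v))"
  proof -
    have "z \<in> U" using assms(3) by simp
    from line_in_open[OF assms(1) this, of i v] show ?thesis
    proof eventually_elim
      case (elim t)
      then have "z(i := z i + t *\<^sub>R v) \<in> coord_space W \<inter> U"
        using assms(2,3) by (simp add: coord_space_upd)
      then show ?case using eq by blast
    qed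
  qed
qed auto

section \<open>Smooth functions on open parts of a coordinate subspace\<close>

abbreviation dirs :: "complex set" where "dirs \<equiv> {1, \<i>}"

definition line_diff where
  "line_diff i v F z \<longleftrightarrow> (\<lambda>t::real. F (z(i := z i + t *\<^sub>R v))) differentiable at 0"

lemma line_diff_has:
  "line_diff i v F z \<Longrightarrow>
     ((\<lambda>t::real. F (z(i := z i + t *\<^sub>R v))) has_vector_derivative dir_deriv (i, v) F z) (at 0)"
  unfolding line_diff_def dir_deriv_def by (simp add: vector_derivative_works)

lemma line_diffI:
  assumes "((\<lambda>t::real. F (z(i := z i + t *\<^sub>R v))) has_vector_derivative D) (at 0)"
  shows "line_diff i v F z" "dir_deriv (i, v) F z = D"
  using assms unfolding line_diff_def dir_deriv_def
  by (auto intro: differentiableI_vector simp: vector_derivative_at)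

text \<open>Only the directions \<open>1\<close> and \<open>\<i>\<close> occur, since they determine
  \<open>d_z\<close> and \<open>d_zbar\<close>, and the domain is cut down to \<open>U\<close>,
  since \<open>V_f\<close> is smooth only off the origin. The recursion on the order lets the
  closure properties be proved by induction from the rules of differentiation.\<close>

primrec Ck :: "nat \<Rightarrow> nat set \<Rightarrow> (nat \<Rightarrow> complex) set \<Rightarrow> ((nat \<Rightarrow> complex) \<Rightarrow> complex) \<Rightarrow> bool" where
  "Ck 0 S U F \<longleftrightarrow> continuous_on (coord_space S \<inter> U) F"
| "Ck (Suc k) S U F \<longleftrightarrow> continuous_on (coord_space S \<inter> U) F \<and>
     (\<forall>i\<in>S. \<forall>v\<in>dirs. (\<forall>z\<in>coord_space S \<inter> U. line_diff i v F z) \<and> Ck k S U (dir_deriv (i, v) F))"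

definition smooth_in :: "nat set \<Rightarrow> (nat \<Rightarrow> complex) set \<Rightarrow> ((nat \<Rightarrow> complex) \<Rightarrow> complex) \<Rightarrow> bool" where
  "smooth_in S U F \<longleftrightarrow> (\<forall>k. Ck k S U F)"

lemma Ck_continuous: "Ck k S U F \<Longrightarrow> continuous_on (coord_space S \<inter> U) F"
  by (cases k) auto

lemma Ck_Suc_imp: "Ck (Suc k) S U F \<Longrightarrow> Ck k S U F"
proof (induction k arbitrary: F)
  case 0 then show ?case by simp
next
  case (Suc k) show ?case unfolding Ck.simps(2)[of k] using Suc.prems Suc.IH
    by (metis Ck.simps(2))
qed

lemma Ck_SucI:
  assumes "continuous_on (coord_space S \<inter> U) F"
    "\<And>i v z. i \<in> S \<Longrightarrow> v \<in> dirs \<Longrightarrow> z \<in> coord_space S \<inter> U \<Longrightarrow> line_diff i v F z"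
    "\<And>i v. i \<in> S \<Longrightarrow> v \<in> dirs \<Longrightarrow> Ck k S U (dir_deriv (i, v) F)"
  shows "Ck (Suc k) S U F"
  using assms by auto

text \<open>Values off \<open>coord_space S\<close> carry no meaning, and formulas for coefficients
  hold only on it; smoothness must not depend on the rest.\<close>

lemma Ck_cong:
  assumes "open U" "\<And>z. z \<in> coord_space S \<inter> U \<Longrightarrow> F z = G z"
  shows "Ck k S U F \<Longrightarrow> Ck k S U G"
  using assms(2)
proof (induction k arbitrary: F G)
  case 0 then show ?case by (metis Ck.simps(1) continuous_on_cong)
next
  case (Suc k)
  note eq = Suc.prems(2)
  have dd: "dir_deriv (i, v) F z = dir_deriv (i, v) G z"
    if "i \<in> S" "z \<in> coord_space S \<inter> U" for i v z
    using dir_deriv_cong[OF assms(1) that eq] by simp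
  show ?case
  proof (rule Ck_SucI)
    show "continuous_on (coord_space S \<inter> U) G"
      using Suc.prems by (metis Ck_continuous continuous_on_cong)
    fix i v assume iv: "i \<in> S" "v \<in> dirs"
    show "Ck k S U (dir_deriv (i, v) G)"
      by (rule Suc.IH[of "dir_deriv (i, v) F"]) (use Suc.prems iv dd in auto)
    fix z assume z: "z \<in> coord_space S \<inter> U"
    have "line_diff i v F z" using Suc.prems iv z by auto
    note h = line_diff_has[OF this]
    have "((\<lambda>t::real. G (z(i := z i + t *\<^sub>R v))) has_vector_derivative dir_deriv (i, v) F z) (at 0)"
    proof (rule has_vector_derivative_transform_within_open[OF h])
      let ?T = "(\<lambda>t::real. z(i := z i + t *\<^sub>R v)) -` U"
      have "continuous_on UNIV (\<lambda>t::real. z(i := z i + t *\<^sub>R v))"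
        by (intro continuous_on_fun_upd continuous_intros)
      then show "open ?T" using assms(1) by (simp add: open_vimage)
      show "0 \<in> ?T" using z by simp
      fix t assume "t \<in> ?T"
      then have "z(i := z i + t *\<^sub>R v) \<in> coord_space S \<inter> U"
        using z iv by (simp add: coord_space_upd)
      then show "F (z(i := z i + t *\<^sub>R v)) = G (z(i := z i + t *\<^sub>R v))"
        by (rule eq)
    qed
    then show "line_diff i v G z" by (rule line_diffI)
  qed
qed

lemma smooth_in_cong:
  "open U \<Longrightarrow> smooth_in S U F \<Longrightarrow> (\<And>z. z \<in> coord_space S \<inter> U \<Longrightarrow> F z = G z) \<Longrightarrow> smooth_in S U G"
  unfolding smooth_in_def using Ck_cong by blast

lemma smooth_in_continuous: "smooth_in S U F \<Longrightarrow> continuous_on (coord_space S \<inter> U) F"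
  unfolding smooth_in_def using Ck_continuous by blast

lemma smooth_in_line_diff:
  "smooth_in S U F \<Longrightarrow> i \<in> S \<Longrightarrow> v \<in> dirs \<Longrightarrow> z \<in> coord_space S \<inter> U \<Longrightarrow> line_diff i v F z"
  unfolding smooth_in_def by (metis Ck.simps(2))

lemma smooth_in_dir_deriv:
  "smooth_in S U F \<Longrightarrow> i \<in> S \<Longrightarrow> v \<in> dirs \<Longrightarrow> smooth_in S U (dir_deriv (i, v) F)"
  unfolding smooth_in_def by (metis Ck.simps(2))

lemma Ck_subset:
  "Ck k S U F \<Longrightarrow> U' \<subseteq> U \<Longrightarrow> Ck k S U' F"
proof (induction k arbitrary: F)
  case 0 then show ?case by (auto intro: continuous_on_subset)
next
  case (Suc k)
  then show ?case by (auto intro: continuous_on_subset)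
qed

lemma smooth_in_subset: "smooth_in S U F \<Longrightarrow> U' \<subseteq> U \<Longrightarrow> smooth_in S U' F"
  unfolding smooth_in_def using Ck_subset by blast

text \<open>Smoothness is local because both pieces are relatively open. This glues the homotopy,
  which is smooth on the punctured space, with the zero field near the origin.\<close>

lemma Ck_union:
  assumes "open U" "open U'" "Ck k S U F" "Ck k S U' F"
  shows "Ck k S (U \<union> U') F"
proof -
  have c: "continuous_on (coord_space S \<inter> (U \<union> U')) F"
    if "continuous_on (coord_space S \<inter> U) F" "continuous_on (coord_space S \<inter> U') F" for F :: "(nat \<Rightarrow> complex) \<Rightarrow> complex"
  proof -
    let ?A = "coord_space S \<inter> U" and ?B = "coord_space S \<inter> U'"
    have e: "coord_space S \<inter> (U \<union> U') = ?A \<union> ?B" by auto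
    show ?thesis unfolding e
    proof (rule continuous_on_Un_local_open)
      show "openin (top_of_set (?A \<union> ?B)) ?A" "openin (top_of_set (?A \<union> ?B)) ?B"
        using assms(1,2) by (auto simp: openin_open)
    qed (use that in auto)
  qed
  show ?thesis using assms(3,4)
    by (induction k arbitrary: F) (auto intro!: c)
qed

lemma smooth_in_union:
  "open U \<Longrightarrow> open U' \<Longrightarrow> smooth_in S U F \<Longrightarrow> smooth_in S U' F \<Longrightarrow> smooth_in S (U \<union> U') F"
  unfolding smooth_in_def using Ck_union by blast

section \<open>Rules for directional derivatives and closure properties of smooth functions\<close>

lemma dir_deriv_add:
  assumes "line_diff i v F z" "line_diff i v G z"
  shows "line_diff i v (\<lambda>z. F z + G z) z"
    "dir_deriv (i, v) (\<lambda>z. F z + G z) z = dir_deriv (i, v) F z + dir_deriv (i, v) G z"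
  by (rule line_diffI[OF has_vector_derivative_add[OF assms[THEN line_diff_has]]])+

lemma dir_deriv_mult:
  fixes F G :: "(nat \<Rightarrow> 'a::real_normed_vector) \<Rightarrow> complex"
  assumes "line_diff i v F z" "line_diff i v G z"
  shows "line_diff i v (\<lambda>z. F z * G z) z"
    "dir_deriv (i, v) (\<lambda>z. F z * G z) z = F z * dir_deriv (i, v) G z + dir_deriv (i, v) F z * G z"
  using line_diffI[OF has_vector_derivative_mult[OF assms[THEN line_diff_has]]] by simp_all

lemma dir_deriv_const: "line_diff i v (\<lambda>z. c) z" "dir_deriv (i, v) (\<lambda>z. c) z = 0"
  by (rule line_diffI[OF has_vector_derivative_const])+

lemma dir_deriv_coord:
  "line_diff i v (\<lambda>z. z j) z" "dir_deriv (i, v) (\<lambda>z. z j) z = (if i = j then v else 0)"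
proof -
  have "((\<lambda>t::real. (z(i := z i + t *\<^sub>R v)) j) has_vector_derivative (if i = j then v else 0)) (at 0)"
    by (cases "i = j") (auto intro!: derivative_eq_intros)
  from line_diffI[OF this]
  show "line_diff i v (\<lambda>z. z j) z" "dir_deriv (i, v) (\<lambda>z. z j) z = (if i = j then v else 0)" .
qed

lemma dir_deriv_cnj:
  assumes "line_diff i v F z"
  shows "line_diff i v (\<lambda>z. cnj (F z)) z" "dir_deriv (i, v) (\<lambda>z. cnj (F z)) z = cnj (dir_deriv (i, v) F z)"
  by (rule line_diffI[OF bounded_linear.has_vector_derivative[OF bounded_linear_cnj line_diff_has[OF assms]]])+

lemma dir_deriv_inverse:
  fixes F :: "(nat \<Rightarrow> 'a::real_normed_vector) \<Rightarrow> complex"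
  assumes "line_diff i v F z" "F z \<noteq> 0"
  shows "line_diff i v (\<lambda>z. inverse (F z)) z"
    "dir_deriv (i, v) (\<lambda>z. inverse (F z)) z = - (dir_deriv (i, v) F z * (inverse (F z) * inverse (F z)))"
proof -
  have d: "(inverse has_field_derivative - (inverse (F z) * inverse (F z))) (at (F (z(i := z i + 0 *\<^sub>R v))))"
    using DERIV_inverse[OF assms(2)] by (simp add: power2_eq_square)
  from field_vector_diff_chain_at[OF line_diff_has[OF assms(1)] d]
  have "((\<lambda>t::real. inverse (F (z(i := z i + t *\<^sub>R v)))) has_vector_derivative
     - (dir_deriv (i, v) F z * (inverse (F z) * inverse (F z)))) (at 0)"
    unfolding comp_def by simp
  from line_diffI[OF this]
  show "line_diff i v (\<lambda>z. inverse (F z)) z"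
    "dir_deriv (i, v) (\<lambda>z. inverse (F z)) z = - (dir_deriv (i, v) F z * (inverse (F z) * inverse (F z)))" .
qed

lemma Ck_const: "Ck k S U (\<lambda>z. c)"
proof (induction k arbitrary: c)
  case (Suc k)
  have "dir_deriv (i, v) (\<lambda>z. c) = (\<lambda>z. 0)" for i and v :: complex
    by (rule ext) (simp add: dir_deriv_const)
  then show ?case using Suc by (auto simp: dir_deriv_const)
qed auto

lemma Ck_coord: "Ck k S U (\<lambda>z. z j)"
proof (cases k)
  case 0
  have "continuous_on (coord_space S \<inter> U) (\<lambda>z::nat \<Rightarrow> complex. z j)"
    by (rule continuous_on_coord)
  then show ?thesis using 0 by simp
next
  case (Suc l)
  have "dir_deriv (i, v) (\<lambda>z. z j) = (\<lambda>z. if i = j then v else 0)" for i and v :: complex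
    by (rule ext) (simp add: dir_deriv_coord)
  moreover have "continuous_on (coord_space S \<inter> U) (\<lambda>z::nat \<Rightarrow> complex. z j)"
    by (rule continuous_on_coord)
  ultimately show ?thesis using Suc Ck_const[of l S U] by (auto simp: dir_deriv_coord)
qed

lemma Ck_add: "open U \<Longrightarrow> Ck k S U F \<Longrightarrow> Ck k S U G \<Longrightarrow> Ck k S U (\<lambda>z. F z + G z)"
proof (induction k arbitrary: F G)
  case 0 then show ?case by (auto intro: continuous_on_add)
next
  case (Suc k)
  show ?case
  proof (rule Ck_SucI)
    show "continuous_on (coord_space S \<inter> U) (\<lambda>z. F z + G z)"
      using Suc.prems by (auto intro: continuous_on_add)
    fix i v assume iv: "i \<in> S" "v \<in> dirs"
    show "Ck k S U (dir_deriv (i, v) (\<lambda>z. F z + G z))"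
      by (rule Ck_cong[OF Suc.prems(1) _ Suc.IH[of "dir_deriv (i, v) F" "dir_deriv (i, v) G"]])
        (use Suc.prems iv in \<open>auto simp: dir_deriv_add\<close>)
    fix z assume "z \<in> coord_space S \<inter> U"
    then show "line_diff i v (\<lambda>z. F z + G z) z"
      using Suc.prems iv by (auto intro!: dir_deriv_add)
  qed
qed

lemma Ck_mult: "open U \<Longrightarrow> Ck k S U F \<Longrightarrow> Ck k S U G \<Longrightarrow> Ck k S U (\<lambda>z. F z * G z)"
proof (induction k arbitrary: F G)
  case 0 then show ?case by (auto intro: continuous_on_mult)
next
  case (Suc k)
  show ?case
  proof (rule Ck_SucI)
    show "continuous_on (coord_space S \<inter> U) (\<lambda>z. F z * G z)"
      using Suc.prems by (auto intro: continuous_on_mult)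
    fix i v assume iv: "i \<in> S" "v \<in> dirs"
    show "Ck k S U (dir_deriv (i, v) (\<lambda>z. F z * G z))"
    proof (rule Ck_cong[OF Suc.prems(1)])
      show "Ck k S U (\<lambda>z. F z * dir_deriv (i, v) G z + dir_deriv (i, v) F z * G z)"
        by (intro Ck_add Suc.IH Suc.prems(1) Ck_Suc_imp[OF Suc.prems(2)] Ck_Suc_imp[OF Suc.prems(3)])
          (use Suc.prems iv in auto)
    qed (use Suc.prems iv in \<open>auto simp: dir_deriv_mult\<close>)
    fix z assume "z \<in> coord_space S \<inter> U"
    then show "line_diff i v (\<lambda>z. F z * G z) z"
      using Suc.prems iv by (auto intro!: dir_deriv_mult)
  qed
qed

lemma Ck_cnj: "open U \<Longrightarrow> Ck k S U F \<Longrightarrow> Ck k S U (\<lambda>z. cnj (F z))"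
proof (induction k arbitrary: F)
  case 0 then show ?case by (auto intro: continuous_on_cnj)
next
  case (Suc k)
  show ?case
  proof (rule Ck_SucI)
    show "continuous_on (coord_space S \<inter> U) (\<lambda>z. cnj (F z))"
      using Suc.prems by (auto intro: continuous_on_cnj)
    fix i v assume iv: "i \<in> S" "v \<in> dirs"
    show "Ck k S U (dir_deriv (i, v) (\<lambda>z. cnj (F z)))"
      by (rule Ck_cong[OF Suc.prems(1) _ Suc.IH[of "dir_deriv (i, v) F"]])
        (use Suc.prems iv in \<open>auto simp: dir_deriv_cnj\<close>)
    fix z assume "z \<in> coord_space S \<inter> U"
    then show "line_diff i v (\<lambda>z. cnj (F z)) z"
      using Suc.prems iv by (auto intro!: dir_deriv_cnj)
  qed
qed

lemma Ck_uminus: "open U \<Longrightarrow> Ck k S U F \<Longrightarrow> Ck k S U (\<lambda>z. - F z)"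
  using Ck_mult[OF _ Ck_const[of k S U "- 1"], of F] by simp

lemma Ck_inverse:
  "open U \<Longrightarrow> Ck k S U F \<Longrightarrow> (\<And>z. z \<in> coord_space S \<inter> U \<Longrightarrow> F z \<noteq> 0) \<Longrightarrow> Ck k S U (\<lambda>z. inverse (F z))"
proof (induction k)
  case 0 then show ?case by (auto intro!: continuous_on_inverse)
next
  case (Suc k)
  \<comment> \<open>The derivative of \<open>1 / F\<close> contains \<open>1 / F\<close> again, so
    order \<open>k\<close> for the same \<open>F\<close> is derived first.\<close>
  have k: "Ck k S U (\<lambda>z. inverse (F z))"
    using Suc.IH Suc.prems Ck_Suc_imp by blast
  show ?case
  proof (rule Ck_SucI)
    show "continuous_on (coord_space S \<inter> U) (\<lambda>z. inverse (F z))"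
      using Suc.prems by (auto intro!: continuous_on_inverse)
    fix i v assume iv: "i \<in> S" "v \<in> dirs"
    show "Ck k S U (dir_deriv (i, v) (\<lambda>z. inverse (F z)))"
    proof (rule Ck_cong[OF Suc.prems(1)])
      show "Ck k S U (\<lambda>z. - (dir_deriv (i, v) F z * (inverse (F z) * inverse (F z))))"
        by (intro Ck_uminus Ck_mult Suc.prems(1) k) (use Suc.prems iv in auto)
    qed (use Suc.prems iv in \<open>auto simp: dir_deriv_inverse\<close>)
    fix z assume "z \<in> coord_space S \<inter> U"
    then show "line_diff i v (\<lambda>z. inverse (F z)) z"
      using Suc.prems iv by (auto intro!: dir_deriv_inverse)
  qed
qed

lemma smooth_in_const [simp]: "smooth_in S U (\<lambda>z. c)"
  and smooth_in_coord [simp]: "smooth_in S U (\<lambda>z. z j)"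
  and smooth_in_add: "open U \<Longrightarrow> smooth_in S U F \<Longrightarrow> smooth_in S U G \<Longrightarrow> smooth_in S U (\<lambda>z. F z + G z)"
  and smooth_in_mult: "open U \<Longrightarrow> smooth_in S U F \<Longrightarrow> smooth_in S U G \<Longrightarrow> smooth_in S U (\<lambda>z. F z * G z)"
  and smooth_in_cnj: "open U \<Longrightarrow> smooth_in S U F \<Longrightarrow> smooth_in S U (\<lambda>z. cnj (F z))"
  and smooth_in_uminus: "open U \<Longrightarrow> smooth_in S U F \<Longrightarrow> smooth_in S U (\<lambda>z. - F z)"
  and smooth_in_inverse: "open U \<Longrightarrow> smooth_in S U F \<Longrightarrow> (\<And>z. z \<in> coord_space S \<inter> U \<Longrightarrow> F z \<noteq> 0) \<Longrightarrow>
      smooth_in S U (\<lambda>z. inverse (F z))"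
  unfolding smooth_in_def
  by (blast intro: Ck_const Ck_coord Ck_add Ck_mult Ck_cnj Ck_uminus Ck_inverse)+

lemma smooth_in_diff: "open U \<Longrightarrow> smooth_in S U F \<Longrightarrow> smooth_in S U G \<Longrightarrow> smooth_in S U (\<lambda>z. F z - G z)"
  using smooth_in_add[OF _ _ smooth_in_uminus, of U S F G] by simp

lemma smooth_in_divide:
  "open U \<Longrightarrow> smooth_in S U F \<Longrightarrow> smooth_in S U G \<Longrightarrow> (\<And>z. z \<in> coord_space S \<inter> U \<Longrightarrow> G z \<noteq> 0) \<Longrightarrow>
     smooth_in S U (\<lambda>z. F z / G z)"
  unfolding divide_inverse by (intro smooth_in_mult smooth_in_inverse)

lemma smooth_in_sum:
  "open U \<Longrightarrow> (\<And>x. x \<in> A \<Longrightarrow> smooth_in S U (F x)) \<Longrightarrow> smooth_in S U (\<lambda>z. \<Sum>x\<in>A. F x z)"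
  by (induction A rule: infinite_finite_induct) (auto intro!: smooth_in_add)

lemma smooth_in_prod:
  "open U \<Longrightarrow> (\<And>x. x \<in> A \<Longrightarrow> smooth_in S U (F x)) \<Longrightarrow> smooth_in S U (\<lambda>z. \<Prod>x\<in>A. F x z)"
  by (induction A rule: infinite_finite_induct) (auto intro!: smooth_in_mult)

lemma smooth_coord_imp_smooth_in:
  assumes "smooth_coord S (F :: (nat \<Rightarrow> complex) \<Rightarrow> complex)"
  shows "smooth_in S UNIV F"
proof -
  have "Ck k S UNIV (foldr dir_deriv ds F)" if "fst ` set ds \<subseteq> S" for k ds
    using that
  proof (induction k arbitrary: ds)
    case 0 then show ?case using assms unfolding smooth_coord_def by simp
  next
    case (Suc k)
    have "Ck k S UNIV (foldr dir_deriv ((i, v) # ds) F)" if "i \<in> S" for i v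
      using Suc.IH[of "(i, v) # ds"] Suc.prems that by simp
    then show ?case using assms Suc.prems unfolding smooth_coord_def
      by (auto simp: line_diff_def)
  qed
  from this[of "[]"] show ?thesis by (simp add: smooth_in_def)
qed

section \<open>Symmetry of second derivatives\<close>

lemma has_vector_derivative_shift0:
  fixes f :: "real \<Rightarrow> 'a::real_normed_vector"
  assumes "((\<lambda>h. f (s + h)) has_vector_derivative D) (at 0)"
  shows "(f has_vector_derivative D) (at s)"
proof -
  have 1: "((\<lambda>x. x - s) has_vector_derivative 1) (at s)"
    by (auto intro!: derivative_eq_intros)
  have 2: "((\<lambda>h. f (s + h)) has_vector_derivative D) (at (s - s))"
    using assms by simp
  from vector_diff_chain_at[OF 1 2] show ?thesis by (simp add: o_def)
qed

text \<open>Two applications of the mean value theorem write the second difference of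
  \<open>g\<close> over a square of side \<open>h\<close> as \<open>h^2\<close> times either mixed
  derivative at some point of the square; continuity at the origin then forces the two to
  agree.\<close>

lemma mixed_second_derivatives_eq:
  fixes g gs gt gst gts :: "real \<Rightarrow> real \<Rightarrow> real"
  assumes e: "e > 0"
    and 1: "\<And>s t. \<bar>s\<bar> < e \<Longrightarrow> \<bar>t\<bar> < e \<Longrightarrow> ((\<lambda>s. g s t) has_real_derivative gs s t) (at s)"
    and 2: "\<And>s t. \<bar>s\<bar> < e \<Longrightarrow> \<bar>t\<bar> < e \<Longrightarrow> ((\<lambda>t. g s t) has_real_derivative gt s t) (at t)"
    and 3: "\<And>s t. \<bar>s\<bar> < e \<Longrightarrow> \<bar>t\<bar> < e \<Longrightarrow> ((\<lambda>t. gs s t) has_real_derivative gst s t) (at t)"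
    and 4: "\<And>s t. \<bar>s\<bar> < e \<Longrightarrow> \<bar>t\<bar> < e \<Longrightarrow> ((\<lambda>s. gt s t) has_real_derivative gts s t) (at s)"
    and c1: "isCont (\<lambda>(s, t). gst s t) (0, 0)" and c2: "isCont (\<lambda>(s, t). gts s t) (0, 0)"
  shows "gst 0 0 = gts 0 0"
proof (rule ccontr)
  assume ne: "gst 0 0 \<noteq> gts 0 0"
  define d where "d = \<bar>gst 0 0 - gts 0 0\<bar> / 2"
  have d: "d > 0" using ne by (simp add: d_def)
  obtain r1 where r1: "r1 > 0" "\<And>x. dist x (0, 0) < r1 \<Longrightarrow> \<bar>(case x of (s, t) \<Rightarrow> gst s t) - gst 0 0\<bar> < d"
    using c1 d unfolding continuous_at_eps_delta dist_real_def by auto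
  obtain r2 where r2: "r2 > 0" "\<And>x. dist x (0, 0) < r2 \<Longrightarrow> \<bar>(case x of (s, t) \<Rightarrow> gts s t) - gts 0 0\<bar> < d"
    using c2 d unfolding continuous_at_eps_delta dist_real_def by auto
  \<comment> \<open>Points of the square of side \<open>h\<close> are at distance at most
    \<open>2 * h\<close> from the origin, so a quarter of each radius is small enough; half of
    \<open>e\<close> keeps the closed square in the domain.\<close>
  define h where "h = min (e / 2) (min (r1 / 4) (r2 / 4))"
  have h: "h > 0" "h < e" "2 * h < r1" "2 * h < r2"
    using e r1(1) r2(1) by (auto simp: h_def)
  have near: "dist (a, b) (0, 0) \<le> 2 * h" if "0 < a" "a < h" "0 < b" "b < h" for a b :: real
    using that norm_Pair_le[of a b] by (simp add: dist_norm)
  obtain a where a: "0 < a" "a < h" "(g h h - g h 0) - (g 0 h - g 0 0) = (h - 0) * (gs a h - gs a 0)"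
    using MVT2[OF h(1), of "\<lambda>s. g s h - g s 0" "\<lambda>s. gs s h - gs s 0"] 1 h
    by (fastforce intro!: DERIV_diff)
  obtain b where b: "0 < b" "b < h" "gs a h - gs a 0 = (h - 0) * gst a b"
    using MVT2[OF h(1), of "\<lambda>t. gs a t" "\<lambda>t. gst a t"] 3 h a by fastforce
  obtain b' where b': "0 < b'" "b' < h" "(g h h - g 0 h) - (g h 0 - g 0 0) = (h - 0) * (gt h b' - gt 0 b')"
    using MVT2[OF h(1), of "\<lambda>t. g h t - g 0 t" "\<lambda>t. gt h t - gt 0 t"] 2 h
    by (fastforce intro!: DERIV_diff)
  obtain a' where a': "0 < a'" "a' < h" "gt h b' - gt 0 b' = (h - 0) * gts a' b'"
    using MVT2[OF h(1), of "\<lambda>s. gt s b'" "\<lambda>s. gts s b'"] 4 h b' by fastforce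
  have "h * (h * gst a b) = h * (h * gts a' b')"
    using a(3) b(3) b'(3) a'(3) by (simp add: algebra_simps)
  then have "gst a b = gts a' b'" using h by simp
  moreover have "\<bar>gst a b - gst 0 0\<bar> < d"
    using r1(2)[of "(a, b)"] near[OF a(1,2) b(1,2)] h by simp
  moreover have "\<bar>gts a' b' - gts 0 0\<bar> < d"
    using r2(2)[of "(a', b')"] near[OF a'(1,2) b'(1,2)] h by simp
  ultimately show False unfolding d_def by (simp add: abs_if split: if_splits)
qed

lemma dir_deriv_commute:
  assumes U: "open U" and F: "smooth_in S U F" and i: "i \<in> S" "v \<in> dirs" and j: "j \<in> S" "w \<in> dirs"
    and z: "z \<in> coord_space S \<inter> U"
  shows "dir_deriv (i, v) (dir_deriv (j, w) F) z = dir_deriv (j, w) (dir_deriv (i, v) F) z"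
proof -
  \<comment> \<open>The two increments are added, so that the case \<open>i = j\<close>, with the
    directions \<open>1\<close> and \<open>\<i>\<close> in one coordinate, is covered as
    well.\<close>
  define pt where "pt = (\<lambda>(s::real, t::real). \<lambda>l. z l + (if l = i then s *\<^sub>R v else 0) + (if l = j then t *\<^sub>R w else 0))"
  have pt0: "pt (0, 0) = z" by (auto simp: pt_def)
  have cpt: "continuous_on UNIV pt"
  proof (rule continuous_on_coordinatewise_then_product)
    fix l
    have "(\<lambda>p. pt p l) = (\<lambda>p. z l + (if l = i then fst p *\<^sub>R v else 0) + (if l = j then snd p *\<^sub>R w else 0))"
      by (auto simp: pt_def fun_eq_iff)
    moreover have "continuous_on UNIV \<dots>"
      by (cases "l = i"; cases "l = j") (auto intro!: continuous_intros)
    ultimately show "continuous_on UNIV (\<lambda>p. pt p l)" by metis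
  qed
  have ptS: "pt p \<in> coord_space S" for p
    using z i j by (auto simp: pt_def coord_space_def split: prod.splits)
  have opn: "open (pt -` U)" using cpt U by (simp add: open_vimage)
  have "(0, 0) \<in> pt -` U" using z pt0 by simp
  then obtain A B where AB: "open A" "open B" "(0, 0) \<in> A \<times> B" "A \<times> B \<subseteq> pt -` U"
    using open_prod_elim[OF opn] by metis
  obtain e1 where e1: "e1 > 0" "\<And>s. \<bar>s\<bar> < e1 \<Longrightarrow> s \<in> A"
    using AB(1,3) unfolding open_dist by (auto simp: dist_real_def)
  obtain e2 where e2: "e2 > 0" "\<And>s. \<bar>s\<bar> < e2 \<Longrightarrow> s \<in> B"
    using AB(2,3) unfolding open_dist by (auto simp: dist_real_def)
  define e where "e = min e1 e2"
  have e: "e > 0" "\<And>s t. \<bar>s\<bar> < e \<Longrightarrow> \<bar>t\<bar> < e \<Longrightarrow> pt (s, t) \<in> coord_space S \<inter> U"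
    using e1 e2 AB(4) ptS by (auto simp: e_def)
  have ds: "((\<lambda>s. G (pt (s, t))) has_vector_derivative dir_deriv (i, v) G (pt (s, t))) (at s)"
    if "smooth_in S U G" "\<bar>s\<bar> < e" "\<bar>t\<bar> < e" for G :: "(nat \<Rightarrow> complex) \<Rightarrow> complex" and s t
  proof (rule has_vector_derivative_shift0)
    have "pt (s + h, t) = (pt (s, t))(i := pt (s, t) i + h *\<^sub>R v)" for h
      by (auto simp: pt_def fun_eq_iff algebra_simps)
    then show "((\<lambda>h. G (pt (s + h, t))) has_vector_derivative dir_deriv (i, v) G (pt (s, t))) (at 0)"
      using line_diff_has[OF smooth_in_line_diff[OF that(1) i e(2)[OF that(2,3)]]] by simp
  qed
  have dt: "((\<lambda>t. G (pt (s, t))) has_vector_derivative dir_deriv (j, w) G (pt (s, t))) (at t)"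
    if "smooth_in S U G" "\<bar>s\<bar> < e" "\<bar>t\<bar> < e" for G :: "(nat \<Rightarrow> complex) \<Rightarrow> complex" and s t
  proof (rule has_vector_derivative_shift0)
    have "pt (s, t + h) = (pt (s, t))(j := pt (s, t) j + h *\<^sub>R w)" for h
      by (auto simp: pt_def fun_eq_iff algebra_simps)
    then show "((\<lambda>h. G (pt (s, t + h))) has_vector_derivative dir_deriv (j, w) G (pt (s, t))) (at 0)"
      using line_diff_has[OF smooth_in_line_diff[OF that(1) j e(2)[OF that(2,3)]]] by simp
  qed
  have ct: "isCont (\<lambda>p. G (pt p)) (0, 0)" if "smooth_in S U G" for G :: "(nat \<Rightarrow> complex) \<Rightarrow> complex"
  proof -
    have "continuous_on (pt -` U) (\<lambda>p. G (pt p))"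
      using continuous_on_compose2[OF smooth_in_continuous[OF that] continuous_on_subset[OF cpt subset_UNIV]]
        ptS by (simp add: image_subset_iff)
    then show ?thesis using opn \<open>(0, 0) \<in> pt -` U\<close> by (simp add: continuous_on_eq_continuous_at)
  qed
  note sm = F smooth_in_dir_deriv[OF F i] smooth_in_dir_deriv[OF F j]
    smooth_in_dir_deriv[OF smooth_in_dir_deriv[OF F i] j] smooth_in_dir_deriv[OF smooth_in_dir_deriv[OF F j] i]
  \<comment> \<open>The mean value theorem is about real functions, so a real linear functional is
    applied first; below it is the real and the imaginary part.\<close>
  have key: "L (dir_deriv (j, w) (dir_deriv (i, v) F) z) = L (dir_deriv (i, v) (dir_deriv (j, w) F) z)"
    if L: "bounded_linear L" for L :: "complex \<Rightarrow> real"
  proof -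
    note bl = bounded_linear.has_vector_derivative[OF L]
    have "L (dir_deriv (j, w) (dir_deriv (i, v) F) (pt (0, 0))) = L (dir_deriv (i, v) (dir_deriv (j, w) F) (pt (0, 0)))"
    proof (rule mixed_second_derivatives_eq[where g = "\<lambda>s t. L (F (pt (s, t)))"
          and gs = "\<lambda>s t. L (dir_deriv (i, v) F (pt (s, t)))"
          and gt = "\<lambda>s t. L (dir_deriv (j, w) F (pt (s, t)))"
          and gst = "\<lambda>s t. L (dir_deriv (j, w) (dir_deriv (i, v) F) (pt (s, t)))"
          and gts = "\<lambda>s t. L (dir_deriv (i, v) (dir_deriv (j, w) F) (pt (s, t)))", OF e(1)])
      show "isCont (\<lambda>(s, t). L (dir_deriv (j, w) (dir_deriv (i, v) F) (pt (s, t)))) (0, 0)"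
        using bounded_linear.continuous[OF L ct[OF sm(4)]] by (simp add: case_prod_unfold)
      show "isCont (\<lambda>(s, t). L (dir_deriv (i, v) (dir_deriv (j, w) F) (pt (s, t)))) (0, 0)"
        using bounded_linear.continuous[OF L ct[OF sm(5)]] by (simp add: case_prod_unfold)
    qed (auto simp: has_real_derivative_iff_has_vector_derivative intro!: bl ds dt sm)
    then show ?thesis by (simp add: pt0)
  qed
  show ?thesis
    using key[OF bounded_linear_Re] key[OF bounded_linear_Im] by (simp add: complex_eq_iff)
qed

text \<open>The claim is generalised to all iterated partial derivatives of \<open>R\<close>: by the
  chain rule, a derivative along \<open>z i\<close> is one more derivative of \<open>R\<close> times
  the derivative of \<open>|z i|^2\<close>.\<close>

lemma smooth_in_cutoff:
  assumes R: "smooth_coord {1..d} (R :: (nat \<Rightarrow> real) \<Rightarrow> real)" and S: "S \<subseteq> {1..d}"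
  shows "smooth_in S UNIV (\<lambda>z. of_real (R (\<lambda>i. (cmod (z i))\<^sup>2)))"
proof -
  let ?sq = "\<lambda>z::nat \<Rightarrow> complex. \<lambda>i. (cmod (z i))\<^sup>2"
  have sqS: "?sq z \<in> coord_space {1..d}" if "z \<in> coord_space S" for z :: "nat \<Rightarrow> complex"
    using that S by (auto simp: coord_space_def)
  have csq: "continuous_on A ?sq" for A
    by (rule continuous_on_coordinatewise_then_product)
      (intro continuous_intros continuous_on_coord)
  have "Ck k S UNIV (\<lambda>z. of_real (foldr dir_deriv ds R (?sq z)))" if "fst ` set ds \<subseteq> {1..d}" for k ds
    using that
  proof (induction k arbitrary: ds)
    case ds: 0
    have "continuous_on (coord_space {1..d}) (foldr dir_deriv ds R)"
      using R ds unfolding smooth_coord_def by blast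
    from continuous_on_compose2[OF this csq] sqS
    have "continuous_on (coord_space S) (\<lambda>z. foldr dir_deriv ds R (?sq z))" by auto
    then show ?case by (auto intro!: continuous_on_of_real)
  next
    case (Suc k)
    define G where "G = foldr dir_deriv ds R"
    have cG: "continuous_on (coord_space {1..d}) G"
      using R Suc.prems unfolding smooth_coord_def G_def by blast
    have dG: "(\<lambda>t. G (x(i := x i + t *\<^sub>R 1))) differentiable at (0::real)"
      if "x \<in> coord_space {1..d}" "i \<in> {1..d}" for x i
      using R Suc.prems that unfolding smooth_coord_def G_def by blast
    have vd: "((\<lambda>t::real. of_real (G (?sq (z(i := z i + t *\<^sub>R v)))) :: complex) has_vector_derivative
        of_real (dir_deriv (i, 1) G (?sq z)) * (cnj v * z i + v * cnj (z i))) (at 0)"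
      if z: "z \<in> coord_space S" "i \<in> S" for z :: "nat \<Rightarrow> complex" and i v
    proof -
      define x where "x = ?sq z"
      \<comment> \<open>The derivative of \<open>|z i + t v|^2\<close> at \<open>t = 0\<close>. The
        image of the line moves in the \<open>i\<close>-th coordinate alone, so the chain rule is
        that of one real variable.\<close>
      define c where "c = 2 * Re (cnj (z i) * v)"
      have x: "x \<in> coord_space {1..d}" using sqS z x_def by simp
      have 1: "((\<lambda>t. (cmod (z i + t *\<^sub>R v))\<^sup>2 - x i) has_vector_derivative c) (at (0::real))"
      proof -
        have "(\<lambda>t. (cmod (z i + t *\<^sub>R v))\<^sup>2 - x i) = (\<lambda>t. t * c + t\<^sup>2 * (cmod v)\<^sup>2)"
          unfolding fun_eq_iff x_def c_def cmod_power2
          by (simp add: power2_eq_square algebra_simps)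
        then show ?thesis by (auto intro!: derivative_eq_intros simp: has_real_derivative_iff_has_vector_derivative[symmetric])
      qed
      have "((\<lambda>t. G (x(i := x i + t *\<^sub>R 1))) has_vector_derivative dir_deriv (i, 1) G x) (at 0)"
        using line_diff_has[of i 1 G x] dG[OF x] z(2) S by (auto simp: line_diff_def)
      then have 2: "((\<lambda>t. G (x(i := x i + t *\<^sub>R 1))) has_vector_derivative dir_deriv (i, 1) G x)
          (at ((cmod (z i + 0 *\<^sub>R v))\<^sup>2 - x i))"
        by (simp add: x_def)
      have "(\<lambda>t. G (x(i := x i + t *\<^sub>R 1))) \<circ> (\<lambda>t. (cmod (z i + t *\<^sub>R v))\<^sup>2 - x i) = (\<lambda>t. G (?sq (z(i := z i + t *\<^sub>R v))))"
        by (auto simp: fun_eq_iff x_def intro!: arg_cong[of _ _ G])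
      with vector_diff_chain_at[OF 1 2]
      have "((\<lambda>t. G (?sq (z(i := z i + t *\<^sub>R v)))) has_vector_derivative c * dir_deriv (i, 1) G x) (at 0)"
        by simp
      from bounded_linear.has_vector_derivative[OF bounded_linear_of_real[where 'a=complex] this]
      have "((\<lambda>t. of_real (G (?sq (z(i := z i + t *\<^sub>R v)))) :: complex) has_vector_derivative of_real (c * dir_deriv (i, 1) G x)) (at 0)" .
      moreover have "of_real (c * dir_deriv (i, 1) G x) = of_real (dir_deriv (i, 1) G (?sq z)) * (cnj v * z i + v * cnj (z i))"
        by (auto simp: x_def c_def complex_eq_iff algebra_simps)
      ultimately show ?thesis by simp
    qed
    have "Ck (Suc k) S UNIV (\<lambda>z. of_real (G (?sq z)))"
    proof (rule Ck_SucI)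
      show "continuous_on (coord_space S \<inter> UNIV) (\<lambda>z. of_real (G (?sq z)) :: complex)"
        using continuous_on_compose2[OF cG csq] sqS by (auto intro!: continuous_on_of_real)
      fix i v assume iv: "i \<in> S" "v \<in> dirs"
      show "Ck k S UNIV (dir_deriv (i, v) (\<lambda>z. of_real (G (?sq z))))"
      proof (rule Ck_cong)
        have "Ck k S UNIV (\<lambda>z. of_real (foldr dir_deriv ((i, 1) # ds) R (?sq z)))"
          using Suc.IH[of "(i, 1) # ds"] Suc.prems iv S by auto
        then have "Ck k S UNIV (\<lambda>z. of_real (dir_deriv (i, 1) G (?sq z)))"
          by (simp add: G_def)
        then show "Ck k S UNIV (\<lambda>z. of_real (dir_deriv (i, 1) G (?sq z)) * (cnj v * z i + v * cnj (z i)))"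
          by (intro Ck_mult Ck_add Ck_const Ck_cnj Ck_coord) auto
        fix z :: "nat \<Rightarrow> complex" assume "z \<in> coord_space S \<inter> UNIV"
        then show "of_real (dir_deriv (i, 1) G (?sq z)) * (cnj v * z i + v * cnj (z i)) =
            dir_deriv (i, v) (\<lambda>z. of_real (G (?sq z))) z"
          using line_diffI(2)[OF vd[of z i v]] iv by auto
      qed auto
      fix z :: "nat \<Rightarrow> complex" assume "z \<in> coord_space S \<inter> UNIV"
      then show "line_diff i v (\<lambda>z. of_real (G (?sq z)) :: complex) z"
        using line_diffI(1)[OF vd[of z i v]] iv by auto
    qed
    then show ?case by (simp add: G_def)
  qed
  from this[of "[]"] show ?thesis by (simp add: smooth_in_def)
qed

section \<open>Wirtinger derivatives and their commutation\<close>

lemma d_z_cong: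
  assumes "open U" "i \<in> W" "z \<in> coord_space W \<inter> U" "\<And>z. z \<in> coord_space W \<inter> U \<Longrightarrow> F z = G z"
  shows "d_z i F z = d_z i G z"
  unfolding d_z_def using dir_deriv_cong[OF assms(1-3), of F G] assms(4) by simp

lemma d_zbar_cong:
  assumes "open U" "i \<in> W" "z \<in> coord_space W \<inter> U" "\<And>z. z \<in> coord_space W \<inter> U \<Longrightarrow> F z = G z"
  shows "d_zbar i F z = d_zbar i G z"
  unfolding d_zbar_def using dir_deriv_cong[OF assms(1-3), of F G] assms(4) by simp

lemma d_z_const [simp]: "d_z i (\<lambda>z. c) z = 0"
  and d_zbar_const [simp]: "d_zbar i (\<lambda>z. c) z = 0"
  unfolding d_z_def d_zbar_def by (simp_all add: dir_deriv_const)

lemma d_z_coord: "d_z i (\<lambda>z. z j) z = (if i = j then 1 else 0)"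
  and d_zbar_coord: "d_zbar i (\<lambda>z. z j) z = 0"
  unfolding d_z_def d_zbar_def by (simp_all add: dir_deriv_coord)

lemma smooth_in_d_z: "open U \<Longrightarrow> smooth_in S U F \<Longrightarrow> i \<in> S \<Longrightarrow> smooth_in S U (d_z i F)"
  unfolding d_z_def[abs_def]
  by (intro smooth_in_divide smooth_in_diff smooth_in_mult smooth_in_dir_deriv) auto

lemma smooth_in_d_zbar: "open U \<Longrightarrow> smooth_in S U F \<Longrightarrow> i \<in> S \<Longrightarrow> smooth_in S U (d_zbar i F)"
  unfolding d_zbar_def[abs_def]
  by (intro smooth_in_divide smooth_in_add smooth_in_mult smooth_in_dir_deriv) auto

context
  fixes S :: "nat set" and U :: "(nat \<Rightarrow> complex) set" and i :: nat and z :: "nat \<Rightarrow> complex"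
  assumes i: "i \<in> S" and z: "z \<in> coord_space S \<inter> U"
begin

lemma line_diff_dirs:
  "smooth_in S U F \<Longrightarrow> line_diff i 1 F z" "smooth_in S U F \<Longrightarrow> line_diff i \<i> F z"
  using i z by (auto intro: smooth_in_line_diff)

lemma d_z_add: "smooth_in S U F \<Longrightarrow> smooth_in S U G \<Longrightarrow> d_z i (\<lambda>z. F z + G z) z = d_z i F z + d_z i G z"
  and d_zbar_add: "smooth_in S U F \<Longrightarrow> smooth_in S U G \<Longrightarrow> d_zbar i (\<lambda>z. F z + G z) z = d_zbar i F z + d_zbar i G z"
  unfolding d_z_def d_zbar_def
  by (simp_all add: dir_deriv_add line_diff_dirs algebra_simps add_divide_distrib diff_divide_distrib)

lemma d_z_mult: "smooth_in S U F \<Longrightarrow> smooth_in S U G \<Longrightarrow> d_z i (\<lambda>z. F z * G z) z = d_z i F z * G z + F z * d_z i G z"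
  and d_zbar_mult: "smooth_in S U F \<Longrightarrow> smooth_in S U G \<Longrightarrow>
     d_zbar i (\<lambda>z. F z * G z) z = d_zbar i F z * G z + F z * d_zbar i G z"
  unfolding d_z_def d_zbar_def
  by (simp_all add: dir_deriv_mult line_diff_dirs algebra_simps add_divide_distrib diff_divide_distrib)

lemma d_z_cmult: "smooth_in S U F \<Longrightarrow> d_z i (\<lambda>z. c * F z) z = c * d_z i F z"
  and d_zbar_cmult: "smooth_in S U F \<Longrightarrow> d_zbar i (\<lambda>z. c * F z) z = c * d_zbar i F z"
  by (simp_all add: d_z_mult d_zbar_mult)

lemma d_z_lin:
  assumes "open U" "\<And>x. x \<in> A \<Longrightarrow> smooth_in S U (F x)"
  shows "d_z i (\<lambda>z. \<Sum>x\<in>A. c x * F x z) z = (\<Sum>x\<in>A. c x * d_z i (F x) z)"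
  using assms(2)
proof (induction A rule: infinite_finite_induct)
  case (insert a A)
  have "smooth_in S U (\<lambda>z. \<Sum>x\<in>A. c x * F x z)"
    by (intro smooth_in_sum smooth_in_mult assms(1)) (use insert in auto)
  moreover have "smooth_in S U (\<lambda>z. c a * F a z)"
    by (intro smooth_in_mult assms(1)) (use insert in auto)
  ultimately show ?case using insert by (simp add: d_z_add d_z_cmult)
qed auto

lemma d_zbar_lin:
  assumes "open U" "\<And>x. x \<in> A \<Longrightarrow> smooth_in S U (F x)"
  shows "d_zbar i (\<lambda>z. \<Sum>x\<in>A. c x * F x z) z = (\<Sum>x\<in>A. c x * d_zbar i (F x) z)"
  using assms(2)
proof (induction A rule: infinite_finite_induct)
  case (insert a A)
  have "smooth_in S U (\<lambda>z. \<Sum>x\<in>A. c x * F x z)"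
    by (intro smooth_in_sum smooth_in_mult assms(1)) (use insert in auto)
  moreover have "smooth_in S U (\<lambda>z. c a * F a z)"
    by (intro smooth_in_mult assms(1)) (use insert in auto)
  ultimately show ?case using insert by (simp add: d_zbar_add d_zbar_cmult)
qed auto

lemma dir_deriv_comb:
  assumes "open U" "smooth_in S U F" "smooth_in S U G" "v \<in> dirs"
  shows "dir_deriv (i, v) (\<lambda>z. (F z + c * G z) / 2) z =
      (dir_deriv (i, v) F z + c * dir_deriv (i, v) G z) / 2"
proof -
  have l: "line_diff i v F z" "line_diff i v G z"
    using assms i z by (auto intro: smooth_in_line_diff)
  have "dir_deriv (i, v) (\<lambda>z. (F z + c * G z) * h) z = (dir_deriv (i, v) F z + c * dir_deriv (i, v) G z) * h" for h
    using l by (simp add: dir_deriv_mult dir_deriv_add dir_deriv_const)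
  from this[of "inverse 2"] show ?thesis unfolding divide_inverse .
qed

end

text \<open>Both \<open>d_z\<close> and \<open>d_zbar\<close> are half of the derivative along
  \<open>1\<close> plus \<open>c\<close> times the one along \<open>\<i>\<close>, with
  \<open>c = - \<i>\<close> and \<open>c = \<i>\<close>. The three commutation rules below are this
  identity for different choices of the two constants.\<close>

lemma d_comm_aux:
  assumes "open U" "smooth_in S U F" "i \<in> S" "j \<in> S" "z \<in> coord_space S \<inter> U"
  shows "(dir_deriv (i, 1) (\<lambda>z. (dir_deriv (j, 1) F z + c * dir_deriv (j, \<i>) F z) / 2) z +
      c' * dir_deriv (i, \<i>) (\<lambda>z. (dir_deriv (j, 1) F z + c * dir_deriv (j, \<i>) F z) / 2) z) / 2 =
     (dir_deriv (j, 1) (\<lambda>z. (dir_deriv (i, 1) F z + c' * dir_deriv (i, \<i>) F z) / 2) z +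
      c * dir_deriv (j, \<i>) (\<lambda>z. (dir_deriv (i, 1) F z + c' * dir_deriv (i, \<i>) F z) / 2) z) / 2"
proof -
  have s: "smooth_in S U (dir_deriv (l, v) F)" if "l \<in> S" "v \<in> dirs" for l v
    using smooth_in_dir_deriv[OF assms(2)] that by simp
  have c: "dir_deriv (i, v) (dir_deriv (j, w) F) z = dir_deriv (j, w) (dir_deriv (i, v) F) z"
    if "v \<in> dirs" "w \<in> dirs" for v w
    using dir_deriv_commute[OF assms(1,2,3) that(1) assms(4) that(2) assms(5)] .
  have 1: "dir_deriv (i, v) (\<lambda>z. (dir_deriv (j, 1) F z + c * dir_deriv (j, \<i>) F z) / 2) z =
      (dir_deriv (i, v) (dir_deriv (j, 1) F) z + c * dir_deriv (i, v) (dir_deriv (j, \<i>) F) z) / 2" if "v \<in> dirs" for v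
    by (rule dir_deriv_comb[OF assms(3,5,1)]) (use s assms(4) that in auto)
  have 2: "dir_deriv (j, v) (\<lambda>z. (dir_deriv (i, 1) F z + c' * dir_deriv (i, \<i>) F z) / 2) z =
      (dir_deriv (j, v) (dir_deriv (i, 1) F) z + c' * dir_deriv (j, v) (dir_deriv (i, \<i>) F) z) / 2" if "v \<in> dirs" for v
    by (rule dir_deriv_comb[OF assms(4,5,1)]) (use s assms(3) that in auto)
  have d: "1 \<in> dirs" "\<i> \<in> dirs" by simp_all
  have alg: "((a + c * b) / 2 + c' * ((e + c * f) / 2)) / 2 = ((a + c' * e) / 2 + c * ((b + c' * f) / 2)) / 2" for a b e f :: complex
    by (simp add: add_divide_distrib algebra_simps)
  show ?thesis unfolding 1[OF d(1)] 1[OF d(2)] 2[OF d(1)] 2[OF d(2)] c[OF d(1) d(1)] c[OF d(1) d(2)] c[OF d(2) d(1)] c[OF d(2) d(2)]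
    by (rule alg)
qed

lemma d_z_eq: "d_z i F z = (dir_deriv (i, 1) F z + (- \<i>) * dir_deriv (i, \<i>) F z) / 2"
  unfolding d_z_def by simp

lemma d_z_d_z:
  assumes "open U" "smooth_in S U F" "i \<in> S" "j \<in> S" "z \<in> coord_space S \<inter> U"
  shows "d_z i (d_z j F) z = d_z j (d_z i F) z"
  using d_comm_aux[OF assms, of "- \<i>" "- \<i>"] unfolding d_z_eq[abs_def] .

lemma d_zbar_d_zbar:
  assumes "open U" "smooth_in S U F" "i \<in> S" "j \<in> S" "z \<in> coord_space S \<inter> U"
  shows "d_zbar i (d_zbar j F) z = d_zbar j (d_zbar i F) z"
  using d_comm_aux[OF assms, of "\<i>" "\<i>"] unfolding d_zbar_def[abs_def] .

lemma d_zbar_d_z: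
  assumes "open U" "smooth_in S U F" "i \<in> S" "j \<in> S" "z \<in> coord_space S \<inter> U"
  shows "d_zbar i (d_z j F) z = d_z j (d_zbar i F) z"
  using d_comm_aux[OF assms, of "- \<i>" "\<i>"] unfolding d_zbar_def[abs_def] d_z_eq[abs_def] .

section \<open>The operators \<open>z\<^sub>i + u z\<^sub>i\<partial>\<^sub>i\<close>\<close>

type_synonym useries = "nat \<Rightarrow> (nat \<Rightarrow> complex) \<Rightarrow> complex"

definition euler :: "nat \<Rightarrow> ((nat \<Rightarrow> complex) \<Rightarrow> complex) \<Rightarrow> (nat \<Rightarrow> complex) \<Rightarrow> complex" where
  "euler i F z = z i * d_z i F z"

text \<open>A \<open>useries\<close> lists the coefficients of the powers of \<open>u\<close>, so
  multiplication by \<open>u\<close> is the shift from \<open>m - 1\<close> to \<open>m\<close>,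
  with nothing to shift in at \<open>m = 0\<close>.\<close>

definition Dop :: "nat \<Rightarrow> useries \<Rightarrow> useries" where
  "Dop i F = (\<lambda>m z. z i * F m z + (if m = 0 then 0 else euler i (F (m - 1)) z))"

definition smooth_us :: "nat set \<Rightarrow> (nat \<Rightarrow> complex) set \<Rightarrow> useries \<Rightarrow> bool" where
  "smooth_us S U F \<longleftrightarrow> (\<forall>m. smooth_in S U (F m))"

text \<open>For \<open>i\<close> outside of \<open>S\<close> the derivative leaves the component and
  depends on meaningless values of \<open>F\<close>, but its factor \<open>z i\<close> is zero. Sums
  over all rays therefore need no restriction to \<open>S\<close>.\<close>

lemma euler_outside: "z \<in> coord_space S \<Longrightarrow> i \<notin> S \<Longrightarrow> euler i F z = 0"
  by (simp add: euler_def coord_space_zero)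

lemma euler_outside': "z \<in> coord_space S \<inter> U \<Longrightarrow> i \<notin> S \<Longrightarrow> euler i F z = 0"
  using euler_outside by blast

lemma Dop_0: "Dop i F 0 z = z i * F 0 z"
  and Dop_Suc: "Dop i F (Suc m) z = z i * F (Suc m) z + euler i (F m) z"
  by (simp_all add: Dop_def)

text \<open>This is how the Stanley-Reisner relations enter: a letter that is not a ray of
  \<open>S\<close> acts by zero on its component.\<close>

lemma Dop_outside: "z \<in> coord_space S \<Longrightarrow> i \<notin> S \<Longrightarrow> Dop i F m z = 0"
  by (simp add: Dop_def euler_outside coord_space_zero)

lemma smooth_in_zero_on:
  "open U \<Longrightarrow> (\<And>z. z \<in> coord_space S \<inter> U \<Longrightarrow> F z = 0) \<Longrightarrow> smooth_in S U F"
  using smooth_in_cong[of U S "\<lambda>z. 0" F] by simp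

lemma smooth_in_euler: "open U \<Longrightarrow> smooth_in S U F \<Longrightarrow> smooth_in S U (euler i F)"
proof (cases "i \<in> S")
  case True
  assume "open U" "smooth_in S U F"
  then show ?thesis unfolding euler_def[abs_def]
    by (intro smooth_in_mult smooth_in_d_z) (use True in auto)
next
  case False
  assume "open U" "smooth_in S U F"
  then show ?thesis using smooth_in_zero_on[of U S "euler i F"] euler_outside'[OF _ False] by blast
qed

lemma smooth_in_Dop: "open U \<Longrightarrow> smooth_us S U F \<Longrightarrow> smooth_in S U (Dop i F m)"
  unfolding Dop_def smooth_us_def by (cases m) (auto intro!: smooth_in_add smooth_in_mult smooth_in_euler)

lemma smooth_us_Dop: "open U \<Longrightarrow> smooth_us S U F \<Longrightarrow> smooth_us S U (Dop i F)"
  using smooth_in_Dop by (simp add: smooth_us_def)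

lemma euler_cong:
  assumes "open U" "z \<in> coord_space W \<inter> U" "\<And>z. z \<in> coord_space W \<inter> U \<Longrightarrow> F z = G z"
  shows "euler i F z = euler i G z"
proof (cases "i \<in> W")
  case True then show ?thesis using d_z_cong[OF assms(1) True assms(2,3)] by (simp add: euler_def)
next
  case False then show ?thesis using euler_outside'[OF assms(2) False] by simp
qed

lemma Dop_cong:
  assumes "open U" "z \<in> coord_space W \<inter> U" "\<And>l z. l \<le> m \<Longrightarrow> z \<in> coord_space W \<inter> U \<Longrightarrow> F l z = G l z"
  shows "Dop i F m z = Dop i G m z"
  unfolding Dop_def using euler_cong[OF assms(1,2), of "F (m - 1)" "G (m - 1)"] assms(2,3) by simp

lemma euler_lin:
  assumes "open U" "z \<in> coord_space S \<inter> U" "\<And>x. x \<in> A \<Longrightarrow> smooth_in S U (F x)"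
  shows "euler i (\<lambda>z. \<Sum>x\<in>A. c x * F x z) z = (\<Sum>x\<in>A. c x * euler i (F x) z)"
proof (cases "i \<in> S")
  case True then show ?thesis
    using d_z_lin[OF True assms(2,1), of A F c] assms(3) by (simp add: euler_def sum_distrib_left algebra_simps)
next
  case False then show ?thesis using euler_outside'[OF assms(2) False] by simp
qed

lemma Dop_lin:
  assumes "open U" "z \<in> coord_space S \<inter> U" "\<And>x. x \<in> A \<Longrightarrow> smooth_us S U (F x)"
  shows "Dop i (\<lambda>m z. \<Sum>x\<in>A. c x * F x m z) m z = (\<Sum>x\<in>A. c x * Dop i (F x) m z)"
proof -
  have "euler i (\<lambda>z. \<Sum>x\<in>A. c x * F x (m - 1) z) z = (\<Sum>x\<in>A. c x * euler i (F x (m - 1)) z)"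
    by (rule euler_lin[OF assms(1,2)]) (use assms(3) in \<open>auto simp: smooth_us_def\<close>)
  then show ?thesis
    by (cases m) (simp_all add: Dop_0 Dop_Suc sum_distrib_left algebra_simps sum.distrib)
qed

lemma euler_mult:
  assumes "z \<in> coord_space S \<inter> U" "smooth_in S U F" "smooth_in S U G"
  shows "euler i (\<lambda>z. F z * G z) z = euler i F z * G z + F z * euler i G z"
proof (cases "i \<in> S")
  case True then show ?thesis using d_z_mult[OF True assms(1-3)] by (simp add: euler_def algebra_simps)
next
  case False then show ?thesis using euler_outside'[OF assms(1) False] by simp
qed

lemma euler_add:
  assumes "z \<in> coord_space S \<inter> U" "smooth_in S U F" "smooth_in S U G"
  shows "euler i (\<lambda>z. F z + G z) z = euler i F z + euler i G z"
proof (cases "i \<in> S")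
  case True then show ?thesis using d_z_add[OF True assms(1-3)] by (simp add: euler_def algebra_simps)
next
  case False then show ?thesis using euler_outside'[OF assms(1) False] by simp
qed

lemma euler_const [simp]: "euler i (\<lambda>z. c) z = 0"
  by (simp add: euler_def)

lemma euler_coord: "euler i (\<lambda>z. z j) z = (if i = j then z i else 0)"
  by (simp add: euler_def d_z_coord)

lemma euler_cmult:
  "z \<in> coord_space S \<inter> U \<Longrightarrow> smooth_in S U F \<Longrightarrow> euler i (\<lambda>z. c * F z) z = c * euler i F z"
  by (simp add: euler_mult)

lemma euler_euler:
  assumes "open U" "smooth_in S U F" "z \<in> coord_space S \<inter> U"
  shows "euler i (euler j F) z = euler j (euler i F) z"
proof (cases "i \<in> S \<and> j \<in> S")
  case True
  have 1: "euler i (\<lambda>z. z j * d_z j F z) z = euler i (\<lambda>z. z j) z * d_z j F z + z j * euler i (d_z j F) z"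
    by (rule euler_mult[OF assms(3)]) (use True assms in \<open>auto intro: smooth_in_d_z\<close>)
  have 2: "euler j (\<lambda>z. z i * d_z i F z) z = euler j (\<lambda>z. z i) z * d_z i F z + z i * euler j (d_z i F) z"
    by (rule euler_mult[OF assms(3)]) (use True assms in \<open>auto intro: smooth_in_d_z\<close>)
  show ?thesis
    using 1 2 d_z_d_z[OF assms(1,2) _ _ assms(3), of i j] True
    by (auto simp: euler_def[abs_def] d_z_coord)
next
  case False
  then consider "i \<notin> S" | "j \<notin> S" by blast
  then show ?thesis
  proof cases
    case 1
    have "euler j (euler i F) z = euler j (\<lambda>z. 0) z"
      by (rule euler_cong[OF assms(1,3)]) (use 1 in \<open>auto simp: euler_outside\<close>)
    then show ?thesis using euler_outside'[OF assms(3) 1] by simp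
  next
    case 2
    have "euler i (euler j F) z = euler i (\<lambda>z. 0) z"
      by (rule euler_cong[OF assms(1,3)]) (use 2 in \<open>auto simp: euler_outside\<close>)
    then show ?thesis using euler_outside'[OF assms(3) 2] by simp
  qed
qed

lemma euler_Dop:
  assumes "open U" "smooth_us S U F" "z \<in> coord_space S \<inter> U"
  shows "euler i (Dop j F m) z = (if i = j then z i * F m z else 0) + z j * euler i (F m) z +
     (if m = 0 then 0 else euler i (euler j (F (m - 1))) z)"
proof -
  have F: "smooth_in S U (F l)" for l using assms(2) by (simp add: smooth_us_def)
  have 1: "euler i (\<lambda>z. z j * F m z) z = (if i = j then z i * F m z else 0) + z j * euler i (F m) z"
    using euler_mult[OF assms(3) _ F, of "\<lambda>z. z j" i m] by (simp add: euler_coord)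
  show ?thesis
  proof (cases m)
    case 0 then show ?thesis using 1 by (simp add: Dop_def)
  next
    case (Suc l)
    have "euler i (\<lambda>z. z j * F m z + euler j (F l) z) z = euler i (\<lambda>z. z j * F m z) z + euler i (euler j (F l)) z"
      by (rule euler_add[OF assms(3)]) (use F assms in \<open>auto intro!: smooth_in_mult smooth_in_euler\<close>)
    then show ?thesis using 1 Suc by (simp add: Dop_def)
  qed
qed

text \<open>For \<open>i \<noteq> j\<close> the derivative in one operator does not see the
  coordinate in the other, so the symmetry of second derivatives is all that is left.\<close>

lemma Dop_Dop:
  assumes "open U" "smooth_us S U F" "z \<in> coord_space S \<inter> U"
  shows "Dop i (Dop j F) m z = Dop j (Dop i F) m z"
proof (cases "i = j")
  case False
  have F: "smooth_in S U (F l)" for l using assms(2) by (simp add: smooth_us_def)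
  show ?thesis
  proof (cases m)
    case 0 then show ?thesis by (simp add: Dop_0)
  next
    case (Suc l)
    have e: "euler i (euler j (F (l - 1))) z = euler j (euler i (F (l - 1))) z"
      by (rule euler_euler[OF assms(1) F assms(3)])
    have 1: "euler i (Dop j F l) z = z j * euler i (F l) z + (if l = 0 then 0 else euler i (euler j (F (l - 1))) z)"
      and 2: "euler j (Dop i F l) z = z i * euler j (F l) z + (if l = 0 then 0 else euler j (euler i (F (l - 1))) z)"
      using euler_Dop[OF assms, of i j l] euler_Dop[OF assms, of j i l] False by simp_all
    show ?thesis unfolding Suc Dop_Suc 1 2 e by (simp add: algebra_simps)
  qed
qed auto

lemma d_zbar_euler:
  assumes "open U" "smooth_in S U F" "z \<in> coord_space S \<inter> U" "j \<in> S"
  shows "d_zbar j (euler i F) z = euler i (d_zbar j F) z"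
proof (cases "i \<in> S")
  case True
  have "d_zbar j (\<lambda>z. z i * d_z i F z) z = d_zbar j (\<lambda>z. z i) z * d_z i F z + z i * d_zbar j (d_z i F) z"
    by (rule d_zbar_mult[OF assms(4,3)]) (use True assms in \<open>auto intro: smooth_in_d_z\<close>)
  then show ?thesis
    using d_zbar_d_z[OF assms(1,2,4) True assms(3)] by (simp add: euler_def[abs_def] d_zbar_coord)
next
  case False
  have "d_zbar j (euler i F) z = d_zbar j (\<lambda>z. 0) z"
    by (rule d_zbar_cong[OF assms(1,4,3)]) (use False in \<open>auto simp: euler_outside\<close>)
  then show ?thesis using euler_outside'[OF assms(3) False] by simp
qed

lemma d_zbar_Dop:
  assumes "open U" "smooth_us S U F" "z \<in> coord_space S \<inter> U" "j \<in> S"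
  shows "d_zbar j (Dop i F m) z = Dop i (\<lambda>m. d_zbar j (F m)) m z"
proof -
  have F: "smooth_in S U (F l)" for l using assms(2) by (simp add: smooth_us_def)
  have 1: "d_zbar j (\<lambda>z. z i * F m z) z = z i * d_zbar j (F m) z"
    using d_zbar_mult[OF assms(4,3) _ F, of "\<lambda>z. z i" m] by (simp add: d_zbar_coord)
  show ?thesis
  proof (cases m)
    case 0 then show ?thesis using 1 by (simp add: Dop_def)
  next
    case (Suc l)
    have "d_zbar j (\<lambda>z. z i * F m z + euler i (F l) z) z = d_zbar j (\<lambda>z. z i * F m z) z + d_zbar j (euler i (F l)) z"
      by (rule d_zbar_add[OF assms(4,3)]) (use F assms in \<open>auto intro!: smooth_in_mult smooth_in_euler\<close>)
    then show ?thesis using 1 Suc d_zbar_euler[OF assms(1) F assms(3,4)] by (simp add: Dop_def)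
  qed
qed

section \<open>Signs\<close>

lemma shuffle_sign_singleton: "shuffle_sign {i} B = (-1) ^ card {y \<in> B. y < i}"
proof -
  have "{(x, y). x \<in> {i} \<and> y \<in> B \<and> y < x} = Pair i ` {y \<in> B. y < i}" by auto
  then show ?thesis unfolding shuffle_sign_def by (simp add: card_image inj_on_def)
qed

lemma shuffle_sign_cases: "shuffle_sign A B = 1 \<or> shuffle_sign A B = -1"
  unfolding shuffle_sign_def by (simp add: minus_one_power_iff)

lemma shuffle_sign_square [simp]: "shuffle_sign A B * shuffle_sign A B = 1"
  "shuffle_sign A B * (shuffle_sign A B * x) = x"
  using shuffle_sign_cases[of A B] by auto

lemma shuffle_sign_Un_left:
  assumes "finite A" "finite B" "finite C" "A \<inter> B = {}"
  shows "shuffle_sign (A \<union> B) C = shuffle_sign A C * shuffle_sign B C"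
proof -
  have f: "finite {(x, y). x \<in> X \<and> y \<in> C \<and> y < x}" if "finite X" for X
    by (rule finite_subset[of _ "X \<times> C"]) (use that assms in auto)
  have "{(x, y). x \<in> A \<union> B \<and> y \<in> C \<and> y < x} = {(x, y). x \<in> A \<and> y \<in> C \<and> y < x} \<union> {(x, y). x \<in> B \<and> y \<in> C \<and> y < x}"
    by auto
  also have "card \<dots> = card {(x, y). x \<in> A \<and> y \<in> C \<and> y < x} + card {(x, y). x \<in> B \<and> y \<in> C \<and> y < x}"
    by (rule card_Un_disjoint) (use f assms in auto)
  finally show ?thesis unfolding shuffle_sign_def by (simp add: power_add)
qed

lemma shuffle_sign_Un_right:
  assumes "finite A" "finite B" "finite C" "B \<inter> C = {}"
  shows "shuffle_sign A (B \<union> C) = shuffle_sign A B * shuffle_sign A C"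
proof -
  have f: "finite {(x, y). x \<in> A \<and> y \<in> X \<and> y < x}" if "finite X" for X
    by (rule finite_subset[of _ "A \<times> X"]) (use that assms in auto)
  have "{(x, y). x \<in> A \<and> y \<in> B \<union> C \<and> y < x} = {(x, y). x \<in> A \<and> y \<in> B \<and> y < x} \<union> {(x, y). x \<in> A \<and> y \<in> C \<and> y < x}"
    by auto
  also have "card \<dots> = card {(x, y). x \<in> A \<and> y \<in> B \<and> y < x} + card {(x, y). x \<in> A \<and> y \<in> C \<and> y < x}"
    by (rule card_Un_disjoint) (use f assms in auto)
  finally show ?thesis unfolding shuffle_sign_def by (simp add: power_add)
qed

lemma shuffle_sign_swap:
  assumes "finite A" "i \<notin> A"
  shows "shuffle_sign A {i} = (-1) ^ card A * shuffle_sign {i} A"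
proof -
  have "{(x, y). x \<in> A \<and> y \<in> {i} \<and> y < x} = (\<lambda>x. (x, i)) ` {x \<in> A. i < x}" by auto
  then have 1: "shuffle_sign A {i} = (-1) ^ card {x \<in> A. i < x}"
    unfolding shuffle_sign_def by (simp add: card_image inj_on_def)
  have "A = {x \<in> A. i < x} \<union> {x \<in> A. x < i}" using assms(2) nat_neq_iff by blast
  then have "card A = card {x \<in> A. i < x} + card {x \<in> A. x < i}"
    using card_Un_disjoint[of "{x \<in> A. i < x}" "{x \<in> A. x < i}"] assms(1) by fastforce
  then show ?thesis unfolding 1 shuffle_sign_singleton
    by (simp add: power_add minus_one_power_iff)
qed

lemma shuffle_sign_insert:
  assumes "finite B" "j \<notin> B"
  shows "shuffle_sign {i} (insert j B) = (if j < i then -1 else 1) * shuffle_sign {i} B"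
proof -
  have "shuffle_sign {i} (insert j B) = shuffle_sign {i} {j} * shuffle_sign {i} B"
    using shuffle_sign_Un_right[of "{i}" "{j}" B] assms by simp
  moreover have "{y. y = j \<and> y < i} = (if j < i then {j} else {})" by auto
  ultimately show ?thesis by (simp add: shuffle_sign_singleton[of i "{j}"])
qed

text \<open>The two orders of removal differ by a transposition of \<open>dzbar_i\<close> and
  \<open>dzbar_j\<close>; this is the sign behind \<open>dbar_dbar\<close>.\<close>

lemma shuffle_sign_remove_anti:
  assumes "finite J" "i \<in> J" "j \<in> J" "i \<noteq> j"
  shows "shuffle_sign {i} (J - {i}) * shuffle_sign {j} (J - {i} - {j}) =
    - (shuffle_sign {j} (J - {j}) * shuffle_sign {i} (J - {j} - {i}))"
proof -
  let ?B = "J - {i} - {j}"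
  have e: "J - {i} = insert j ?B" "J - {j} = insert i ?B" "J - {j} - {i} = ?B" using assms by auto
  have f: "finite ?B" "i \<notin> ?B" "j \<notin> ?B" using assms by auto
  have 1: "shuffle_sign {i} (J - {i}) = (if j < i then -1 else 1) * shuffle_sign {i} ?B"
    by (subst e(1)) (rule shuffle_sign_insert[OF f(1,3)])
  have 2: "shuffle_sign {j} (J - {j}) = (if i < j then -1 else 1) * shuffle_sign {j} ?B"
    by (subst e(2)) (rule shuffle_sign_insert[OF f(1,2)])
  have "(if j < i then -1 else 1) = - (if i < j then -1 else 1 :: complex)"
    using assms(4) by auto
  then show ?thesis unfolding e(3) 1 2 by (simp only: mult_ac mult_minus_left mult_minus_right)
qed

text \<open>The sign by which the odd derivations dual to \<open>theta_k\<close> and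
  \<open>theta_l\<close> anticommute.\<close>

lemma shuffle_sign_insert_anti:
  assumes "finite K" "k \<notin> K" "l \<notin> K" "k \<noteq> l"
  shows "shuffle_sign {k} K * shuffle_sign {l} (insert k K) = - (shuffle_sign {l} K * shuffle_sign {k} (insert l K))"
  using assms by (auto simp: shuffle_sign_insert)

lemma sum_antisym_zero:
  fixes f :: "'a \<Rightarrow> 'a \<Rightarrow> complex"
  assumes "finite J" "\<And>i j. i \<in> J \<Longrightarrow> j \<in> J \<Longrightarrow> i \<noteq> j \<Longrightarrow> f i j = - f j i"
  shows "(\<Sum>i\<in>J. \<Sum>j\<in>J - {i}. f i j) = 0"
proof -
  let ?X = "\<Sum>i\<in>J. \<Sum>j\<in>J. if i = j then 0 else f i j"
  have 1: "(\<Sum>i\<in>J. \<Sum>j\<in>J - {i}. f i j) = ?X"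
  proof (rule sum.cong[OF refl])
    fix i assume "i \<in> J"
    show "(\<Sum>j\<in>J - {i}. f i j) = (\<Sum>j\<in>J. if i = j then 0 else f i j)"
      by (rule sum.mono_neutral_cong_left) (use assms(1) in auto)
  qed
  have "?X = (\<Sum>j\<in>J. \<Sum>i\<in>J. if i = j then 0 else f i j)" by (rule sum.swap)
  also have "\<dots> = (\<Sum>j\<in>J. \<Sum>i\<in>J. - (if j = i then 0 else f j i))"
  proof (intro sum.cong refl)
    fix i j assume "j \<in> J" "i \<in> J"
    then show "(if i = j then 0 else f i j) = - (if j = i then 0 else f j i)"
      using assms(2)[of i j] by (cases "i = j") simp_all
  qed
  also have "\<dots> = - ?X" by (simp only: sum_negf)
  finally have "?X = - ?X" .
  moreover have "x = - x \<Longrightarrow> x = 0" for x :: complex by (simp add: complex_eq_iff)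
  ultimately have "?X = 0" by blast
  then show ?thesis unfolding 1 .
qed

section \<open>Stokes' theorem with logarithmic poles\<close>

text \<open>This takes the place of polar coordinates: \<open>f\<close> is dominated by a countable
  sum of constants on discs, and the disc of radius \<open>r k\<close> has area
  \<open>pi * (r k)^2\<close>.\<close>

lemma integrable_by_discs:
  fixes f :: "complex \<Rightarrow> real"
  assumes f: "f \<in> borel_measurable borel" and nn: "\<And>z. 0 \<le> f z" "\<And>k. 0 \<le> c k" "\<And>k. 0 \<le> r k"
    and b: "\<And>z. f z \<noteq> 0 \<Longrightarrow> \<exists>k. cmod z < r k \<and> f z \<le> c k"
    and s: "summable (\<lambda>k. c k * (r k)\<^sup>2)"
  shows "integrable lborel f"
proof (rule integrableI_bounded)
  show "f \<in> borel_measurable lborel" using f by simp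
  have le: "ennreal (norm (f z)) \<le> (\<Sum>k. ennreal (c k) * indicator (ball 0 (r k)) z)" for z
  proof (cases "f z = 0")
    case False
    then obtain k where k: "cmod z < r k" "f z \<le> c k" using b by blast
    have "ennreal (norm (f z)) \<le> ennreal (c k)"
      using k(2) nn(1)[of z] by (simp add: ennreal_leI)
    also have "\<dots> = (\<Sum>k\<in>{k}. ennreal (c k) * indicator (ball 0 (r k)) z)"
      using k(1) by simp
    also have "\<dots> \<le> (\<Sum>k. ennreal (c k) * indicator (ball 0 (r k)) z)"
      by (rule sum_le_suminf) (auto intro: summableI)
    finally show ?thesis .
  qed auto
  have "(\<integral>\<^sup>+ z. ennreal (norm (f z)) \<partial>lborel) \<le> (\<integral>\<^sup>+ z. (\<Sum>k. ennreal (c k) * indicator (ball (0::complex) (r k)) z) \<partial>lborel)"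
    by (rule nn_integral_mono, rule le)
  also have "\<dots> = (\<Sum>k. \<integral>\<^sup>+ z. ennreal (c k) * indicator (ball (0::complex) (r k)) z \<partial>lborel)"
    by (rule nn_integral_suminf)
      (auto intro!: borel_measurable_times_ennreal borel_measurable_const borel_measurable_indicator)
  also have "\<dots> = (\<Sum>k. ennreal (pi * (c k * (r k)\<^sup>2)))"
  proof (rule suminf_cong)
    fix k
    have "(\<integral>\<^sup>+ z. ennreal (c k) * indicator (ball (0::complex) (r k)) z \<partial>lborel) = ennreal (c k) * emeasure lborel (ball (0::complex) (r k))"
      by (rule nn_integral_cmult_indicator) simp
    also have "emeasure lborel (ball (0::complex) (r k)) = ennreal (pi * (r k)\<^sup>2)"
      using emeasure_ball[OF nn(3)[of k], of "0::complex"] by (simp add: unit_ball_vol_2)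
    also have "ennreal (c k) * ennreal (pi * (r k)\<^sup>2) = ennreal (c k * (pi * (r k)\<^sup>2))"
      by (rule ennreal_mult[symmetric]) (use nn in auto)
    also have "c k * (pi * (r k)\<^sup>2) = pi * (c k * (r k)\<^sup>2)" by (simp only: mult_ac)
    finally show "(\<integral>\<^sup>+ z. ennreal (c k) * indicator (ball (0::complex) (r k)) z \<partial>lborel) = ennreal (pi * (c k * (r k)\<^sup>2))" .
  qed
  also have "\<dots> < \<infinity>"
  proof -
    have "summable (\<lambda>k. pi * (c k * (r k)\<^sup>2))" using s by (rule summable_mult)
    then have "(\<Sum>k. ennreal (pi * (c k * (r k)\<^sup>2))) = ennreal (\<Sum>k. pi * (c k * (r k)\<^sup>2))"
      using nn by (intro suminf_ennreal2) auto
    then show ?thesis by simp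
  qed
  finally show "(\<integral>\<^sup>+ z. ennreal (norm (f z)) \<partial>lborel) < \<infinity>" .
qed

lemma integrable_inverse_norm:
  assumes "B > 0"
  shows "integrable lborel (\<lambda>z::complex. indicator (cball 0 B) z / cmod z)"
\<comment> \<open>Dyadic rings: where \<open>B / 2 ^ k \<le> |z| < 2 * B / 2 ^ k\<close> the
  function is at most \<open>2 ^ k / B\<close>, and the terms
  \<open>c k * (r k)^2 = 4 * B / 2 ^ k\<close> are summable.\<close>
proof (rule integrable_by_discs[where r = "\<lambda>k. 2 * B / 2 ^ k" and c = "\<lambda>k. 2 ^ k / B"])
  show "(\<lambda>z::complex. indicator (cball 0 B) z / cmod z) \<in> borel_measurable borel"
    by (intro borel_measurable_divide borel_measurable_indicator borel_measurable_norm) auto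
  fix z :: complex assume nz: "indicator (cball 0 B) z / cmod z \<noteq> 0"
  then have z: "z \<noteq> 0" "cmod z \<le> B" by (auto simp: indicator_def split: if_splits)
  have "(\<lambda>k. B / 2 ^ k) \<longlonglongrightarrow> 0"
    by (rule LIMSEQ_divide_realpow_zero) simp
  then have "\<forall>\<^sub>F k in sequentially. B / 2 ^ k < cmod z"
    using order_tendstoD(2)[of "\<lambda>k. B / 2 ^ k" 0 sequentially "cmod z"] z(1) by simp
  then have ex: "\<exists>k. B / 2 ^ k \<le> cmod z"
    using eventually_happens[of _ sequentially] by (fastforce intro: less_imp_le)
  define k where "k = (LEAST k. B / 2 ^ k \<le> cmod z)"
  have k: "B / 2 ^ k \<le> cmod z" unfolding k_def by (rule LeastI_ex[OF ex])
  have "cmod z < 2 * B / 2 ^ k"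
  proof (cases k)
    case 0 then show ?thesis using z(2) assms by simp
  next
    case (Suc l)
    then have "\<not> B / 2 ^ l \<le> cmod z"
      using not_less_Least[of l "\<lambda>k. B / 2 ^ k \<le> cmod z"] by (simp add: k_def)
    then show ?thesis using Suc by simp
  qed
  moreover have "1 / cmod z \<le> 2 ^ k / B"
    using k z assms by (simp add: field_simps)
  ultimately show "\<exists>k. cmod z < 2 * B / 2 ^ k \<and> indicator (cball 0 B) z / cmod z \<le> 2 ^ k / B"
    using z by (auto simp: indicator_def)
next
  have "(\<lambda>k. 2 ^ k / B * (2 * B / 2 ^ k)\<^sup>2) = (\<lambda>k. 4 * B * (1 / 2) ^ k)"
    using assms by (auto simp: fun_eq_iff field_simps power2_eq_square)
  then show "summable (\<lambda>k. 2 ^ k / B * (2 * B / 2 ^ k)\<^sup>2)"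
    by (auto intro!: summable_mult summable_geometric)
qed (use assms in auto)

lemma integrable_bump:
  "integrable lborel (\<lambda>z::complex. 1 / ((cmod z)\<^sup>2 + 1)\<^sup>2)"
\<comment> \<open>On the ring \<open>2 ^ (k - 1) \<le> |z| < 2 ^ k\<close> the function is at most
  \<open>1 / 16 ^ (k - 1)\<close>, whence the constant \<open>16 / 16 ^ k\<close>.\<close>
proof (rule integrable_by_discs[where r = "\<lambda>k. 2 ^ k" and c = "\<lambda>k. 16 / 16 ^ k"])
  show "(\<lambda>z::complex. 1 / ((cmod z)\<^sup>2 + 1)\<^sup>2) \<in> borel_measurable borel"
    by (intro borel_measurable_continuous_onI continuous_intros) (auto simp: add_nonneg_eq_0_iff)
  fix z :: complex
  have ex: "\<exists>k. cmod z < 2 ^ k" using real_arch_pow[of 2 "cmod z"] by simp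
  define k where "k = (LEAST k. cmod z < 2 ^ k)"
  have k: "cmod z < 2 ^ k" unfolding k_def by (rule LeastI_ex[OF ex])
  have "1 / ((cmod z)\<^sup>2 + 1)\<^sup>2 \<le> 16 / 16 ^ k"
  proof (cases k)
    case 0
    have "1 \<le> ((cmod z)\<^sup>2 + 1)\<^sup>2" by (rule one_le_power) simp
    then have "1 / ((cmod z)\<^sup>2 + 1)\<^sup>2 \<le> 1 / 1"
      by (intro divide_left_mono) (auto simp: add_nonneg_eq_0_iff)
    then show ?thesis using 0 by simp
  next
    case (Suc l)
    then have "2 ^ l \<le> cmod z" 
      using not_less_Least[of l "\<lambda>k. cmod z < 2 ^ k"] by (simp add: k_def)
    then have "(2 ^ l)\<^sup>2 \<le> (cmod z)\<^sup>2" by (intro power_mono) auto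
    then have "(2 ^ l)\<^sup>2 \<le> (cmod z)\<^sup>2 + 1" by linarith
    then have "((2 ^ l)\<^sup>2)\<^sup>2 \<le> ((cmod z)\<^sup>2 + 1)\<^sup>2" by (intro power_mono) auto
    moreover have "((2 ^ l)\<^sup>2)\<^sup>2 = (16::real) ^ l"
      by (induction l) (simp_all add: power_mult_distrib)
    ultimately have "16 ^ l \<le> ((cmod z)\<^sup>2 + 1)\<^sup>2" by simp
    then have "1 / ((cmod z)\<^sup>2 + 1)\<^sup>2 \<le> 1 / 16 ^ l"
      by (intro divide_left_mono) (auto intro!: mult_pos_pos zero_less_power add_nonneg_pos)
    then show ?thesis using Suc by simp
  qed
  then show "\<exists>k. cmod z < 2 ^ k \<and> 1 / ((cmod z)\<^sup>2 + 1)\<^sup>2 \<le> 16 / 16 ^ k" using k by blast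
next
  have "(\<lambda>k. 16 / 16 ^ k * (2 ^ k)\<^sup>2 :: real) = (\<lambda>k. 16 * (1 / 4) ^ k)"
  proof
    fix k
    have "(16::real) ^ k = 4 ^ k * 4 ^ k" by (simp add: power_mult_distrib[symmetric])
    moreover have "((2::real) ^ k)\<^sup>2 = 4 ^ k" by (simp add: power2_eq_square power_mult_distrib[symmetric])
    ultimately show "16 / 16 ^ k * (2 ^ k)\<^sup>2 = 16 * (1 / 4 :: real) ^ k" by (simp add: power_divide)
  qed
  then show "summable (\<lambda>k. 16 / 16 ^ k * (2 ^ k)\<^sup>2 :: real)"
    by (auto intro!: summable_mult summable_geometric)
qed auto

section \<open>Compactly supported functions of one complex variable\<close>

lemma has_vector_derivative_outside_support:
  fixes h :: "complex \<Rightarrow> complex"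
  assumes "((\<lambda>t::real. h (y + t *\<^sub>R v)) has_vector_derivative D) (at 0)"
    and "\<And>y. B < cmod y \<Longrightarrow> h y = 0" "B < cmod y"
  shows "D = 0"
proof -
  have "open ((\<lambda>t::real. y + t *\<^sub>R v) -` {w. B < cmod w})"
    by (intro open_vimage open_Collect_less continuous_intros)
  then have "((\<lambda>t::real. 0 :: complex) has_vector_derivative D) (at 0)"
    by (rule has_vector_derivative_transform_within_open[OF assms(1)]) (use assms in auto)
  from vector_derivative_unique_at[OF this has_vector_derivative_const] show ?thesis .
qed

lemma bounded_if_compact_support:
  fixes h :: "complex \<Rightarrow> complex"
  assumes "continuous_on UNIV h" "\<And>y. B < cmod y \<Longrightarrow> h y = 0"
  shows "\<exists>M\<ge>0. \<forall>y. cmod (h y) \<le> M"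
proof -
  have "compact (h ` cball 0 B)"
    by (intro compact_continuous_image continuous_on_subset[OF assms(1)]) auto
  then obtain M where M: "\<And>y. y \<in> cball 0 B \<Longrightarrow> cmod (h y) \<le> M"
    using compact_imp_bounded[of "h ` cball 0 B"] unfolding bounded_iff by blast
  have "cmod (h y) \<le> max M 0" for y
    using M[of y] assms(2)[of y] by (cases "cmod y \<le> B") (auto simp: le_max_iff_disj)
  then show ?thesis by (intro exI[of _ "max M 0"]) simp
qed

lemma integrable_if_compact_support:
  fixes h :: "complex \<Rightarrow> complex"
  assumes "continuous_on UNIV h" "\<And>y. B < cmod y \<Longrightarrow> h y = 0"
  shows "integrable lborel h"
proof -
  obtain M where M: "0 \<le> M" "\<And>y. cmod (h y) \<le> M" using bounded_if_compact_support[OF assms] by auto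
  show ?thesis
    by (rule integrableI_bounded_set[where A = "cball 0 B" and B = M])
      (use M assms in \<open>auto simp: emeasure_lborel_cball_finite[unfolded infinity_ennreal_def] intro!: borel_measurable_continuous_onI AE_I2\<close>)
qed

lemma has_vector_derivative_imp_tendsto:
  fixes f :: "real \<Rightarrow> 'a::real_normed_vector"
  assumes "(f has_vector_derivative D) (at 0)"
  shows "((\<lambda>t. (f t - f 0) /\<^sub>R t) \<longlongrightarrow> D) (at 0)"
proof -
  have "((\<lambda>t. norm (f (0 + t) - f 0 - t *\<^sub>R D) / norm t) \<longlongrightarrow> 0) (at 0)"
    using assms unfolding has_vector_derivative_def has_derivative_at by simp
  moreover have "\<forall>\<^sub>F t in at 0. norm (f (0 + t) - f 0 - t *\<^sub>R D) / norm t = norm ((f t - f 0) /\<^sub>R t - D)"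
    unfolding eventually_at_filter
  proof (intro always_eventually allI impI)
    fix t :: real assume "t \<noteq> 0"
    then have "(f t - f 0) /\<^sub>R t - D = (f (0 + t) - f 0 - t *\<^sub>R D) /\<^sub>R t"
      by (simp add: scaleR_diff_right)
    then show "norm (f (0 + t) - f 0 - t *\<^sub>R D) / norm t = norm ((f t - f 0) /\<^sub>R t - D)"
      by (simp add: divide_inverse mult.commute)
  qed
  ultimately have "((\<lambda>t. norm ((f t - f 0) /\<^sub>R t - D)) \<longlongrightarrow> 0) (at 0)"
    by (rule Lim_transform_eventually)
  then show ?thesis by (simp add: tendsto_norm_zero_iff LIM_zero_iff)
qed

text \<open>Difference quotients have integral zero by translation invariance of the measure, and
  dominated convergence passes to the derivative.\<close>

lemma integral_dir_deriv:
  fixes h h' :: "complex \<Rightarrow> complex"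
  assumes d: "\<And>y. ((\<lambda>t::real. h (y + t *\<^sub>R v)) has_vector_derivative h' y) (at 0)"
    and c: "continuous_on UNIV h" "continuous_on UNIV h'"
    and supp: "\<And>y. B < cmod y \<Longrightarrow> h y = 0"
  shows "integral\<^sup>L lborel h' = 0"
proof -
  have supp': "h' y = 0" if "B < cmod y" for y
    by (rule has_vector_derivative_outside_support[OF d supp that])
  obtain M where M: "0 \<le> M" "\<And>y. cmod (h' y) \<le> M" using bounded_if_compact_support[OF c(2) supp'] by auto
  define q where "q n y = (h (y + (1 / real (Suc n)) *\<^sub>R v) - h y) * of_nat (Suc n)" for n y
  have int0: "integral\<^sup>L lborel (q n) = 0" for n
  proof -
    let ?w = "(1 / real (Suc n)) *\<^sub>R v"
    have c': "continuous_on UNIV (\<lambda>y. h (y + ?w))"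
      by (rule continuous_on_compose2[OF c(1)]) (auto intro!: continuous_intros)
    have i1: "integrable lborel h" by (rule integrable_if_compact_support[OF c(1) supp])
    have i2: "integrable lborel (\<lambda>y. h (y + ?w))"
    proof (rule integrable_if_compact_support[OF c'])
      fix y assume "B + cmod ?w < cmod y"
      moreover have "cmod y \<le> cmod (y + ?w) + cmod ?w" 
        using norm_triangle_ineq4[of "y + ?w" ?w] by simp
      ultimately show "h (y + ?w) = 0" by (intro supp) linarith
    qed
    have "integral\<^sup>L lborel h = integral\<^sup>L (distr lborel borel ((+) ?w)) h"
      by (simp only: lborel_distr_plus)
    also have "\<dots> = integral\<^sup>L lborel (\<lambda>y. h (?w + y))"
      by (rule integral_distr) (auto intro!: borel_measurable_continuous_onI c)
    also have "\<dots> = integral\<^sup>L lborel (\<lambda>y. h (y + ?w))"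
      unfolding add.commute[of ?w] ..
    finally have "integral\<^sup>L lborel (\<lambda>y. h (y + ?w)) = integral\<^sup>L lborel h" ..
    then show ?thesis unfolding q_def
      by (simp only: integral_mult_left_zero Bochner_Integration.integral_diff[OF i2 i1]) simp
  qed
  have "(\<lambda>n. integral\<^sup>L lborel (q n)) \<longlonglongrightarrow> integral\<^sup>L lborel h'"
  \<comment> \<open>The increments have length at most \<open>cmod v\<close>, so all quotients are
    supported in the disc of radius \<open>B + cmod v\<close>; the mean value inequality bounds them
    by the bound \<open>M\<close> of the derivative.\<close>
  proof (rule integral_dominated_convergence[where w = "\<lambda>y. M * indicator (cball 0 (B + cmod v)) y"])
    show "h' \<in> borel_measurable lborel" using c by (auto intro!: borel_measurable_continuous_onI)
    show "q n \<in> borel_measurable lborel" for n unfolding q_def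
    proof -
      have "continuous_on UNIV (\<lambda>y. h (y + (1 / real (Suc n)) *\<^sub>R v))"
        by (rule continuous_on_compose2[OF c(1)]) (auto intro!: continuous_intros)
      then have "continuous_on UNIV (\<lambda>y. (h (y + (1 / real (Suc n)) *\<^sub>R v) - h y) * of_nat (Suc n))"
        by (intro continuous_on_mult continuous_on_diff c continuous_on_const)
      from borel_measurable_continuous_onI[OF this]
      show "(\<lambda>y. (h (y + (1 / real (Suc n)) *\<^sub>R v) - h y) * of_nat (Suc n)) \<in> borel_measurable lborel"
        by simp
    qed
    show "integrable lborel (\<lambda>y. M * indicator (cball 0 (B + cmod v)) y)"
      by (intro integrable_mult_right integrable_real_indicator) (auto simp: emeasure_lborel_cball_finite[unfolded infinity_ennreal_def])
    show "AE y in lborel. (\<lambda>n. q n y) \<longlonglongrightarrow> h' y"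
    proof (rule AE_I2)
      fix y
      have t1: "((\<lambda>t. (h (y + t *\<^sub>R v) - h y) /\<^sub>R t) \<longlongrightarrow> h' y) (at 0)"
        using has_vector_derivative_imp_tendsto[OF d[of y]] by simp
      have t2: "filterlim (\<lambda>n. 1 / real (Suc n)) (at 0) sequentially"
        unfolding filterlim_at using LIMSEQ_inverse_real_of_nat by (simp add: inverse_eq_divide del: of_nat_Suc)
      have "((\<lambda>n. (h (y + (1 / real (Suc n)) *\<^sub>R v) - h y) /\<^sub>R (1 / real (Suc n))) \<longlongrightarrow> h' y) sequentially"
        by (rule filterlim_compose[OF t1 t2])
      then show "(\<lambda>n. q n y) \<longlonglongrightarrow> h' y"
        unfolding q_def by (simp add: scaleR_conv_of_real mult.commute del: of_nat_Suc)
    qed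
    fix n
    show "AE y in lborel. norm (q n y) \<le> M * indicator (cball 0 (B + cmod v)) y"
    proof (rule AE_I2)
      fix y
      let ?s = "1 / real (Suc n)"
      have s: "0 < ?s" "?s \<le> 1" by (auto simp: divide_le_eq)
      show "norm (q n y) \<le> M * indicator (cball 0 (B + cmod v)) y"
      proof (cases "cmod y \<le> B + cmod v")
        case True
        have "norm (h (y + ?s *\<^sub>R v) - h (y + 0 *\<^sub>R v)) \<le> M * norm (?s - 0)"
        proof (rule differentiable_bound[where S = UNIV and f' = "\<lambda>t x. x *\<^sub>R h' (y + t *\<^sub>R v)"])
          fix t :: real
          have "((\<lambda>t. h (y + t *\<^sub>R v)) has_vector_derivative h' (y + t *\<^sub>R v)) (at t)"
            by (rule has_vector_derivative_shift0) (use d[of "y + t *\<^sub>R v"] in \<open>simp add: scaleR_add_left add.assoc\<close>)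
          then show "((\<lambda>t. h (y + t *\<^sub>R v)) has_derivative (\<lambda>x. x *\<^sub>R h' (y + t *\<^sub>R v))) (at t within UNIV)"
            by (simp add: has_vector_derivative_def)
          show "onorm (\<lambda>x. x *\<^sub>R h' (y + t *\<^sub>R v)) \<le> M"
          proof (rule onorm_le)
            fix x :: real
            have "\<bar>x\<bar> * cmod (h' (y + t *\<^sub>R v)) \<le> \<bar>x\<bar> * M" by (rule mult_left_mono) (use M in auto)
            then show "norm (x *\<^sub>R h' (y + t *\<^sub>R v)) \<le> M * norm x" by (simp add: mult.commute)
          qed
        qed auto
        then have "cmod (h (y + ?s *\<^sub>R v) - h y) \<le> M * ?s" by (simp del: of_nat_Suc)
        then have "cmod (h (y + ?s *\<^sub>R v) - h y) * real (Suc n) \<le> M * ?s * real (Suc n)"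
          by (intro mult_right_mono) auto
        then show ?thesis using True by (simp add: q_def norm_mult del: of_nat_Suc)
      next
        case False
        have "?s * cmod v \<le> cmod v" by (rule mult_left_le_one_le) (use s in auto)
        then have "cmod (?s *\<^sub>R v) \<le> cmod v" by simp
        moreover have "cmod y \<le> cmod (y + ?s *\<^sub>R v) + cmod (?s *\<^sub>R v)"
          using norm_triangle_ineq4[of "y + ?s *\<^sub>R v" "?s *\<^sub>R v"] by simp
        ultimately have "B < cmod (y + ?s *\<^sub>R v)" "B < cmod y" using False norm_ge_zero[of v] by linarith+
        then show ?thesis using supp M(1) unfolding q_def by simp
      qed
    qed
  qed
  then show ?thesis using int0 by (simp add: LIMSEQ_const_iff)
qed

text \<open>The residue produced by the pole \<open>1 / y\<close>. Its value is \<open>- pi\<close>,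
  but what matters is that it is the same along every wall. The integrand is the
  \<open>dbar\<close>-derivative of \<open>cnj y / (|y|^2 + 1)\<close>.\<close>

definition residue_const :: complex where
  "residue_const = - integral\<^sup>L lborel (\<lambda>z::complex. complex_of_real (1 / ((cmod z)\<^sup>2 + 1)\<^sup>2))"

text \<open>Instead of cutting out a disc around the pole, \<open>1 / y\<close> is regularised to
  \<open>cnj y / (|y|^2 + e)\<close>. Integration by parts moves the derivative onto this kernel,
  and its \<open>dbar\<close>-derivative \<open>e / (|y|^2 + e)^2\<close> concentrates at the origin
  as \<open>e\<close> tends to \<open>0\<close>.\<close>

lemma cauchy_pompeiu:
  fixes h hx hy :: "complex \<Rightarrow> complex"
  assumes dx: "\<And>y. ((\<lambda>t::real. h (y + t *\<^sub>R 1)) has_vector_derivative hx y) (at 0)"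
    and dy: "\<And>y. ((\<lambda>t::real. h (y + t *\<^sub>R \<i>)) has_vector_derivative hy y) (at 0)"
    and c: "continuous_on UNIV h" "continuous_on UNIV hx" "continuous_on UNIV hy"
    and supp: "\<And>y. B < cmod y \<Longrightarrow> h y = 0"
  shows "integral\<^sup>L lborel (\<lambda>y. (hx y + \<i> * hy y) / 2 / y) = residue_const * h 0"
proof -
  define p where "p y = (hx y + \<i> * hy y) / 2" for y
  \<comment> \<open>A square, so that the substitution \<open>y = w / (n + 1)\<close> below removes
    \<open>e n\<close> from the kernel.\<close>
  define e where "e n = (inverse (real (Suc n)))\<^sup>2" for n
  have e: "e n > 0" for n by (simp add: e_def)
  define N where "N n y = y * cnj y + of_real (e n)" for n and y :: complex
  have N: "N n y = of_real ((cmod y)\<^sup>2 + e n)" for n y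
    by (simp only: N_def of_real_add complex_norm_square)
  have Nnz: "N n y \<noteq> 0" for n y
    unfolding N of_real_eq_0_iff using e[of n] zero_le_power2[of "cmod y"] by linarith
  define g where "g n y = cnj y / N n y" for n y
  define gv where "gv n v y = cnj v / N n y - cnj y * (v * cnj y + y * cnj v) / (N n y)\<^sup>2" for n v y
  have cN: "continuous_on UNIV (N n)" for n unfolding N_def[abs_def] by (intro continuous_intros)
  have cg: "continuous_on UNIV (g n)" for n unfolding g_def[abs_def] by (intro continuous_intros cN) (use Nnz in auto)
  have cgv: "continuous_on UNIV (gv n v)" for n v unfolding gv_def[abs_def]
    by (intro continuous_intros cN) (use Nnz in auto)
  have dg: "((\<lambda>t::real. g n (y + t *\<^sub>R v)) has_vector_derivative gv n v y) (at 0)" for n v y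
  proof -
    have 1: "((\<lambda>t::real. cnj (y + t *\<^sub>R v)) has_vector_derivative cnj v) (at 0)"
      by (auto intro!: derivative_eq_intros)
    have 2: "((\<lambda>t::real. N n (y + t *\<^sub>R v)) has_vector_derivative v * cnj y + y * cnj v) (at 0)"
      unfolding N_def by (auto intro!: derivative_eq_intros)
    have 3: "((\<lambda>t::real. inverse (N n (y + t *\<^sub>R v))) has_vector_derivative (v * cnj y + y * cnj v) * - (inverse (N n y) * inverse (N n y))) (at 0)"
    proof -
      have "(inverse has_field_derivative - (inverse (N n y) * inverse (N n y))) (at (N n (y + 0 *\<^sub>R v)))"
        using DERIV_inverse[OF Nnz, of n y] by (simp add: power2_eq_square)
      from field_vector_diff_chain_at[OF 2 this] show ?thesis unfolding comp_def .
    qed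
    have "((\<lambda>t::real. cnj (y + t *\<^sub>R v) * inverse (N n (y + t *\<^sub>R v))) has_vector_derivative
        cnj (y + 0 *\<^sub>R v) * ((v * cnj y + y * cnj v) * - (inverse (N n y) * inverse (N n y))) + cnj v * inverse (N n (y + 0 *\<^sub>R v))) (at 0)"
      by (rule has_vector_derivative_mult[OF 1 3])
    then show ?thesis unfolding g_def gv_def divide_inverse
      by (simp add: power2_eq_square algebra_simps)
  qed
  have gsum: "gv n 1 y + \<i> * gv n \<i> y = of_real (2 * e n / ((cmod y)\<^sup>2 + e n)\<^sup>2)" for n y
  proof -
    have "gv n 1 y + \<i> * gv n \<i> y = 2 / N n y - 2 * (y * cnj y) / (N n y)\<^sup>2"
      unfolding gv_def by (simp add: algebra_simps diff_divide_distrib add_divide_distrib)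
    also have "\<dots> = 2 * (N n y - y * cnj y) / (N n y)\<^sup>2"
      using Nnz[of n y] by (simp add: field_simps power2_eq_square)
    also have "N n y - y * cnj y = of_real (e n)" by (simp add: N_def)
    finally show ?thesis unfolding N by simp
  qed
  have supp_v: "hx y = 0" "hy y = 0" if "B < cmod y" for y
    using has_vector_derivative_outside_support[OF dx[of y] supp that]
      has_vector_derivative_outside_support[OF dy[of y] supp that] by blast+
  have I: "integral\<^sup>L lborel (\<lambda>y. h y * gv n v y + h' y * g n y) = 0"
    if "\<And>y. ((\<lambda>t::real. h (y + t *\<^sub>R v)) has_vector_derivative h' y) (at 0)" "continuous_on UNIV h'" for n v h'
  proof (rule integral_dir_deriv[where h = "\<lambda>y. h y * g n y" and v = v and B = B])
    fix y
    show "((\<lambda>t::real. h (y + t *\<^sub>R v) * g n (y + t *\<^sub>R v)) has_vector_derivative h y * gv n v y + h' y * g n y) (at 0)"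
      using has_vector_derivative_mult[OF that(1) dg, of y n] by simp
  qed (use supp in \<open>auto intro!: continuous_intros c cg cgv that\<close>)
  have ic: "integrable lborel (\<lambda>y. h y * gv n v y + h' y * g n y)"
    if "continuous_on UNIV h'" "\<And>y. B < cmod y \<Longrightarrow> h' y = 0" for n v h'
    by (rule integrable_if_compact_support[where B = B]) (use supp that in \<open>auto intro!: continuous_intros c cg cgv\<close>)
  have eq: "integral\<^sup>L lborel (\<lambda>y. p y * g n y) = - integral\<^sup>L lborel (\<lambda>y. h y * of_real (e n / ((cmod y)\<^sup>2 + e n)\<^sup>2))" for n
  proof -
    have "0 = integral\<^sup>L lborel (\<lambda>y. h y * gv n 1 y + hx y * g n y) + \<i> * integral\<^sup>L lborel (\<lambda>y. h y * gv n \<i> y + hy y * g n y)"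
      using I[OF dx c(2)] I[OF dy c(3)] by simp
    also have "\<dots> = integral\<^sup>L lborel (\<lambda>y. (h y * gv n 1 y + hx y * g n y) + \<i> * (h y * gv n \<i> y + hy y * g n y))"
      using ic[OF c(2) supp_v(1)] ic[OF c(3) supp_v(2)] by simp
    also have "\<dots> = integral\<^sup>L lborel (\<lambda>y. 2 * (p y * g n y) + h y * of_real (2 * e n / ((cmod y)\<^sup>2 + e n)\<^sup>2))"
      unfolding gsum[symmetric] p_def by (rule Bochner_Integration.integral_cong) (auto simp: algebra_simps)
    also have "\<dots> = 2 * integral\<^sup>L lborel (\<lambda>y. p y * g n y) + 2 * integral\<^sup>L lborel (\<lambda>y. h y * of_real (e n / ((cmod y)\<^sup>2 + e n)\<^sup>2))"
    proof -
      have i1: "integrable lborel (\<lambda>y. p y * g n y)"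
        unfolding p_def by (rule integrable_if_compact_support[where B = B])
          (use supp_v in \<open>auto intro!: continuous_intros c cg\<close>)
      have "continuous_on UNIV (\<lambda>y. complex_of_real (e n / ((cmod y)\<^sup>2 + e n)\<^sup>2))"
        using e[of n] by (intro continuous_intros) (auto simp: add_nonneg_eq_0_iff)
      then have i2: "integrable lborel (\<lambda>y. h y * of_real (e n / ((cmod y)\<^sup>2 + e n)\<^sup>2))"
        by (intro integrable_if_compact_support[where B = B] continuous_on_mult c) (use supp in auto)
      have "h y * of_real (2 * e n / ((cmod y)\<^sup>2 + e n)\<^sup>2) = 2 * (h y * of_real (e n / ((cmod y)\<^sup>2 + e n)\<^sup>2))" for y
        by simp
      then show ?thesis using i1 i2 by (simp only: Bochner_Integration.integral_add integrable_mult_right integral_mult_right_zero)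
    qed
    finally have z: "0 = 2 * integral\<^sup>L lborel (\<lambda>y. p y * g n y) + 2 * integral\<^sup>L lborel (\<lambda>y. h y * of_real (e n / ((cmod y)\<^sup>2 + e n)\<^sup>2))" .
    have neg: "a = - b" if "0 = 2 * a + 2 * b" for a b :: complex
    proof -
      have "2 * (a + b) = 0" using that by (simp only: distrib_left)
      then have "a + b = 0" unfolding mult_eq_0_iff by simp
      then show ?thesis by (simp only: eq_neg_iff_add_eq_0)
    qed
    show ?thesis by (rule neg[OF z])
  qed
  have lim1: "(\<lambda>n. integral\<^sup>L lborel (\<lambda>y. p y * g n y)) \<longlonglongrightarrow> integral\<^sup>L lborel (\<lambda>y. p y / y)"
  proof -
    have cp: "continuous_on UNIV p" unfolding p_def[abs_def] by (intro continuous_intros c) auto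
    have sp: "p y = 0" if "B < cmod y" for y using supp_v[OF that] by (simp add: p_def)
    obtain M where M: "0 \<le> M" "\<And>y. cmod (p y) \<le> M" using bounded_if_compact_support[OF cp sp] by auto
    define B' where "B' = max B 1"
    have B': "B' > 0" "B \<le> B'" by (auto simp: B'_def)
    show ?thesis
    proof (rule integral_dominated_convergence[where w = "\<lambda>y. M * (indicator (cball 0 B') y / cmod y)"])
      have "p \<in> borel_measurable borel" by (rule borel_measurable_continuous_onI[OF cp])
      then show "(\<lambda>y. p y / y) \<in> borel_measurable lborel" by simp
      show "(\<lambda>y. p y * g n y) \<in> borel_measurable lborel" for n
        using borel_measurable_continuous_onI[OF continuous_on_mult[OF cp cg]] by simp
      show "integrable lborel (\<lambda>y. M * (indicator (cball 0 B') y / cmod y))"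
        by (intro integrable_mult_right integrable_inverse_norm B')
      show "AE y in lborel. (\<lambda>n. p y * g n y) \<longlonglongrightarrow> p y / y"
      proof (rule AE_I2)
        fix y :: complex
        have "e \<longlonglongrightarrow> 0\<^sup>2" unfolding e_def[abs_def] by (intro tendsto_power LIMSEQ_inverse_real_of_nat)
        then have "(\<lambda>n. N n y) \<longlonglongrightarrow> y * cnj y + of_real 0" unfolding N_def
          by (intro tendsto_intros) simp
        then have 1: "(\<lambda>n. p y * (cnj y / N n y)) \<longlonglongrightarrow> p y * (cnj y / (y * cnj y))" if "y \<noteq> 0"
          by (intro tendsto_intros) (use that in auto)
        show "(\<lambda>n. p y * g n y) \<longlonglongrightarrow> p y / y"
        \<comment> \<open>At \<open>y = 0\<close> both sides are \<open>0\<close>: the regularised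
          kernel vanishes there, and division by zero gives \<open>0\<close>.\<close>
        proof (cases "y = 0")
          case False then show ?thesis using 1 by (simp add: g_def)
        qed (simp add: g_def)
      qed
      fix n
      show "AE y in lborel. norm (p y * g n y) \<le> M * (indicator (cball 0 B') y / cmod y)"
      proof (rule AE_I2)
        fix y
        show "norm (p y * g n y) \<le> M * (indicator (cball 0 B') y / cmod y)"
        proof (cases "y = 0 \<or> B' < cmod y")
          case True
          then show ?thesis using sp[of y] B' M(1) by (auto simp: g_def)
        next
          case False
          have "cmod (g n y) = cmod y / ((cmod y)\<^sup>2 + e n)"
            using e[of n] by (simp add: g_def N norm_divide del: of_real_add of_real_power)
          also have "\<dots> \<le> cmod y / (cmod y)\<^sup>2"
            using e[of n] False by (intro divide_left_mono mult_pos_pos add_pos_pos) auto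
          also have "cmod y / (cmod y)\<^sup>2 = 1 / cmod y" using False by (simp add: power2_eq_square)
          finally have "cmod (g n y) \<le> 1 / cmod y" .
          then have "cmod (p y) * cmod (g n y) \<le> M * (1 / cmod y)"
            by (intro mult_mono M) auto
          then show ?thesis using False by (simp add: norm_mult indicator_def)
        qed
      qed
    qed
  qed
  have scale: "integral\<^sup>L lborel (\<lambda>y. h y * of_real (e n / ((cmod y)\<^sup>2 + e n)\<^sup>2)) =
      integral\<^sup>L lborel (\<lambda>w. h (inverse (real (Suc n)) *\<^sub>R w) * of_real (1 / ((cmod w)\<^sup>2 + 1)\<^sup>2))" for n
  proof -
    define d where "d = inverse (real (Suc n))"
    have d: "d > 0" "e n = d\<^sup>2" by (auto simp: d_def e_def)
    define f where "f y = h y * of_real (e n / ((cmod y)\<^sup>2 + e n)\<^sup>2)" for y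
    have "continuous_on UNIV (\<lambda>y. complex_of_real (e n / ((cmod y)\<^sup>2 + e n)\<^sup>2))"
      using e[of n] by (intro continuous_intros) (auto simp: add_nonneg_eq_0_iff)
    then have cf: "continuous_on UNIV f" unfolding f_def[abs_def] by (intro continuous_on_mult c)
    have mf: "f \<in> borel_measurable borel" by (rule borel_measurable_continuous_onI[OF cf])
    have "integral\<^sup>L lborel f = integral\<^sup>L (density (distr lborel borel (\<lambda>x. 0 + d *\<^sub>R x)) (\<lambda>x::complex. ennreal (\<bar>d\<bar> ^ DIM(complex)))) f"
      using lborel_affine[of d "0::complex"] d(1) by simp
    also have "\<dots> = integral\<^sup>L (distr lborel borel (\<lambda>x. 0 + d *\<^sub>R x)) (\<lambda>x. \<bar>d\<bar> ^ DIM(complex) *\<^sub>R f x)"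
      by (rule integral_density) (use mf in auto)
    also have "\<dots> = integral\<^sup>L lborel (\<lambda>x. \<bar>d\<bar> ^ DIM(complex) *\<^sub>R f (0 + d *\<^sub>R x))"
      by (rule integral_distr) (use mf in auto)
    also have "\<dots> = integral\<^sup>L lborel (\<lambda>w. h (d *\<^sub>R w) * of_real (1 / ((cmod w)\<^sup>2 + 1)\<^sup>2))"
    proof (rule Bochner_Integration.integral_cong[OF refl])
      fix w :: complex
      have "d\<^sup>2 * (d\<^sup>2 / ((d * cmod w)\<^sup>2 + d\<^sup>2)\<^sup>2) = 1 / ((cmod w)\<^sup>2 + 1)\<^sup>2"
      proof -
        have "(d * cmod w)\<^sup>2 + d\<^sup>2 = d\<^sup>2 * ((cmod w)\<^sup>2 + 1)" by (simp add: power_mult_distrib algebra_simps)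
        then show ?thesis using d(1) by (simp add: power_mult_distrib power2_eq_square)
      qed
      then have "of_real (1 / ((cmod w)\<^sup>2 + 1)\<^sup>2) = (of_real (d\<^sup>2 * (d\<^sup>2 / ((d * cmod w)\<^sup>2 + d\<^sup>2)\<^sup>2)) :: complex)"
        by simp
      then show "\<bar>d\<bar> ^ DIM(complex) *\<^sub>R f (0 + d *\<^sub>R w) = h (d *\<^sub>R w) * of_real (1 / ((cmod w)\<^sup>2 + 1)\<^sup>2)"
        using d(1) by (simp only: f_def d(2)) (simp add: scaleR_conv_of_real norm_mult mult_ac)
    qed
    finally show ?thesis unfolding f_def d_def .
  qed
  \<comment> \<open>After rescaling the kernel is fixed and the argument of \<open>h\<close> tends
    to \<open>0\<close>, so the limit is \<open>h 0\<close> times the total mass of the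
    kernel.\<close>
  have lim2: "(\<lambda>n. integral\<^sup>L lborel (\<lambda>w. h (inverse (real (Suc n)) *\<^sub>R w) * of_real (1 / ((cmod w)\<^sup>2 + 1)\<^sup>2)))
      \<longlonglongrightarrow> integral\<^sup>L lborel (\<lambda>w. h 0 * of_real (1 / ((cmod w)\<^sup>2 + 1)\<^sup>2))"
  proof -
    obtain M where M: "0 \<le> M" "\<And>y. cmod (h y) \<le> M" using bounded_if_compact_support[OF c(1) supp] by auto
    have cb: "continuous_on UNIV (\<lambda>w::complex. complex_of_real (1 / ((cmod w)\<^sup>2 + 1)\<^sup>2))"
      by (intro continuous_intros) (auto simp: add_nonneg_eq_0_iff)
    have ch: "continuous_on UNIV (\<lambda>w. h (r *\<^sub>R w))" for r
      by (rule continuous_on_compose2[OF c(1)]) (auto intro!: continuous_intros)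
    show ?thesis
    proof (rule integral_dominated_convergence[where w = "\<lambda>w. M * (1 / ((cmod w)\<^sup>2 + 1)\<^sup>2)"])
      show "(\<lambda>w. h 0 * of_real (1 / ((cmod w)\<^sup>2 + 1)\<^sup>2)) \<in> borel_measurable lborel"
        using borel_measurable_continuous_onI[OF continuous_on_mult[OF continuous_on_const cb]] by simp
      show "(\<lambda>w. h (inverse (real (Suc n)) *\<^sub>R w) * of_real (1 / ((cmod w)\<^sup>2 + 1)\<^sup>2)) \<in> borel_measurable lborel" for n
        using borel_measurable_continuous_onI[OF continuous_on_mult[OF ch cb]] by simp
      show "integrable lborel (\<lambda>w::complex. M * (1 / ((cmod w)\<^sup>2 + 1)\<^sup>2))"
        by (intro integrable_mult_right integrable_bump)
      show "AE w in lborel. (\<lambda>n. h (inverse (real (Suc n)) *\<^sub>R w) * of_real (1 / ((cmod w)\<^sup>2 + 1)\<^sup>2)) \<longlonglongrightarrow> h 0 * of_real (1 / ((cmod w)\<^sup>2 + 1)\<^sup>2)"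
      proof (rule AE_I2)
        fix w :: complex
        have "(\<lambda>n. inverse (real (Suc n)) *\<^sub>R w) \<longlonglongrightarrow> 0 *\<^sub>R w"
          by (intro tendsto_scaleR LIMSEQ_inverse_real_of_nat tendsto_const)
        then have "(\<lambda>n. h (inverse (real (Suc n)) *\<^sub>R w)) \<longlonglongrightarrow> h 0"
          using c(1) by (intro continuous_on_tendsto_compose[of UNIV h]) auto
        then show "(\<lambda>n. h (inverse (real (Suc n)) *\<^sub>R w) * of_real (1 / ((cmod w)\<^sup>2 + 1)\<^sup>2)) \<longlonglongrightarrow> h 0 * of_real (1 / ((cmod w)\<^sup>2 + 1)\<^sup>2)"
          by (intro tendsto_mult tendsto_const)
      qed
      show "AE w in lborel. norm (h (inverse (real (Suc n)) *\<^sub>R w) * of_real (1 / ((cmod w)\<^sup>2 + 1)\<^sup>2)) \<le> M * (1 / ((cmod w)\<^sup>2 + 1)\<^sup>2)" for n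
        unfolding norm_mult norm_of_real by (intro AE_I2 mult_mono M) auto
    qed
  qed
  have "integral\<^sup>L lborel (\<lambda>w. h 0 * of_real (1 / ((cmod w)\<^sup>2 + 1)\<^sup>2)) = - (residue_const * h 0)"
    unfolding residue_const_def by (simp only: integral_mult_right_zero) simp
  with lim2 have "(\<lambda>n. - integral\<^sup>L lborel (\<lambda>w. h (inverse (real (Suc n)) *\<^sub>R w) * of_real (1 / ((cmod w)\<^sup>2 + 1)\<^sup>2))) \<longlonglongrightarrow> residue_const * h 0"
    using tendsto_minus by fastforce
  then have "(\<lambda>n. integral\<^sup>L lborel (\<lambda>y. p y * g n y)) \<longlonglongrightarrow> residue_const * h 0"
    unfolding eq scale .
  from LIMSEQ_unique[OF lim1 this] show ?thesis unfolding p_def .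
qed

section \<open>Integrals with logarithmic poles over one component\<close>

definition ext :: "nat set \<Rightarrow> (nat \<Rightarrow> complex) \<Rightarrow> nat \<Rightarrow> complex" where
  "ext S w = (\<lambda>i. if i \<in> S then w i else 0)"

text \<open>The integral in \<open>Tr\<close> without its constant factor. Points of the product
  measure over \<open>S\<close> carry \<open>undefined\<close> outside of \<open>S\<close>;
  \<open>ext S\<close> replaces it by \<open>0\<close> in order to land on the component.\<close>

definition log_integral :: "nat set \<Rightarrow> ((nat \<Rightarrow> complex) \<Rightarrow> complex) \<Rightarrow> complex" where
  "log_integral S F = (\<integral>w. F (ext S w) / (\<Prod>l\<in>S. ext S w l) \<partial>(\<Pi>\<^sub>M l\<in>S. (lborel :: complex measure)))"

lemma ext_in_coord_space: "ext S w \<in> coord_space S"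
  by (simp add: ext_def coord_space_def)

lemma ext_coord_space: "z \<in> coord_space S \<Longrightarrow> ext S z = z"
  by (auto simp: ext_def coord_space_def fun_eq_iff)

lemma ext_insert: "i \<notin> W \<Longrightarrow> ext (insert i W) (x(i := y)) = (ext W x)(i := y)"
  by (auto simp: ext_def fun_eq_iff)

lemma measurable_ext: "ext S \<in> (\<Pi>\<^sub>M l\<in>S. (lborel :: complex measure)) \<rightarrow>\<^sub>M borel"
proof -
  have "(\<lambda>w i. (\<lambda>w. if i \<in> S then w i else 0) w) \<in> (\<Pi>\<^sub>M l\<in>S. (lborel :: complex measure)) \<rightarrow>\<^sub>M Pi\<^sub>M UNIV (\<lambda>i::nat. borel :: complex measure)"
  proof (rule measurable_PiM_single')
    fix i :: nat
    show "(\<lambda>w. if i \<in> S then w i else 0) \<in> (\<Pi>\<^sub>M l\<in>S. (lborel :: complex measure)) \<rightarrow>\<^sub>M borel"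
      using measurable_component_singleton[of i S "\<lambda>l. lborel :: complex measure"] by (cases "i \<in> S") simp_all
  qed simp
  then show ?thesis unfolding ext_def[abs_def]
    using measurable_cong_sets[OF refl sets_PiM_equal_borel] by blast
qed

lemma measurable_ext_compose:
  assumes "continuous_on (coord_space S) (F :: (nat \<Rightarrow> complex) \<Rightarrow> complex)"
  shows "(\<lambda>w. F (ext S w)) \<in> borel_measurable (\<Pi>\<^sub>M l\<in>S. (lborel :: complex measure))"
proof -
  have "continuous_on UNIV (ext S)"
  proof (rule continuous_on_coordinatewise_then_product)
    fix i show "continuous_on UNIV (\<lambda>w. ext S w i)"
      by (cases "i \<in> S") (simp_all add: ext_def continuous_on_coord)
  qed
  then have "continuous_on UNIV (\<lambda>z. F (ext S z))"
    by (rule continuous_on_compose2[OF assms]) (auto simp: ext_in_coord_space)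
  from measurable_compose[OF measurable_ext[of S] borel_measurable_continuous_onI[OF this]]
  show ?thesis by (simp add: ext_coord_space[OF ext_in_coord_space])
qed

text \<open>The part of the component with all coordinates bounded by \<open>B\<close> is a product
  of discs and single points, hence compact by Tychonoff's theorem.\<close>

lemma bounded_on_coord_space:
  fixes F :: "(nat \<Rightarrow> complex) \<Rightarrow> complex"
  assumes "continuous_on (coord_space S) F"
    and supp: "\<And>z i. z \<in> coord_space S \<Longrightarrow> i \<in> S \<Longrightarrow> B < cmod (z i) \<Longrightarrow> F z = 0"
  shows "\<exists>M\<ge>0. \<forall>z\<in>coord_space S. cmod (F z) \<le> M"
proof -
  define K where "K = Pi\<^sub>E UNIV (\<lambda>i. if i \<in> S then cball (0::complex) B else {0})"
  have "compactin (product_topology (\<lambda>i::nat. euclidean) UNIV) K"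
    unfolding K_def compactin_PiE by (auto simp: compactin_euclidean_iff)
  then have cK: "compact K" by (simp add: euclidean_product_topology)
  have KS: "K \<subseteq> coord_space S" unfolding K_def coord_space_def
    by (auto simp: PiE_def Pi_def split: if_splits)
  have "compact (F ` K)" by (intro compact_continuous_image continuous_on_subset[OF assms(1)] KS cK)
  then obtain M where M: "\<And>y. y \<in> K \<Longrightarrow> cmod (F y) \<le> M"
    using compact_imp_bounded[of "F ` K"] unfolding bounded_iff by blast
  have "cmod (F z) \<le> max M 0" if z: "z \<in> coord_space S" for z
  proof (cases "\<exists>i\<in>S. B < cmod (z i)")
    case True then show ?thesis using supp[OF z] by auto
  next
    case False
    then have "z \<in> K" using z unfolding K_def coord_space_def by (auto simp: PiE_def Pi_def)
    then show ?thesis using M[of z] by (simp add: le_max_iff_disj)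
  qed
  then show ?thesis by (intro exI[of _ "max M 0"]) simp
qed

text \<open>The poles are simple and lie along different coordinate hyperplanes, so a bounded
  \<open>F\<close> with compact support is dominated by a product of functions of one variable each,
  all of them integrable on a disc.\<close>

lemma log_integrable:
  fixes F :: "(nat \<Rightarrow> complex) \<Rightarrow> complex"
  assumes S: "finite S" "T \<subseteq> S" and c: "continuous_on (coord_space S) F"
    and supp: "\<And>z i. z \<in> coord_space S \<Longrightarrow> i \<in> S \<Longrightarrow> B < cmod (z i) \<Longrightarrow> F z = 0"
  shows "integrable (\<Pi>\<^sub>M l\<in>S. (lborel :: complex measure)) (\<lambda>w. F (ext S w) / (\<Prod>l\<in>T. ext S w l))"
proof -
  interpret product_sigma_finite "\<lambda>l::nat. lborel :: complex measure"
    by unfold_locales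
  obtain M where M: "0 \<le> M" "\<And>z. z \<in> coord_space S \<Longrightarrow> cmod (F z) \<le> M"
    using bounded_on_coord_space[OF c, of B] supp by blast
  define B' where "B' = max B 1"
  have B': "B' > 0" "B \<le> B'" by (auto simp: B'_def)
  define ph where "ph l y = indicator (cball 0 B') y * (if l \<in> T then 1 / cmod y else 1)" for l :: nat and y :: complex
  have iph: "integrable lborel (ph l)" for l
  proof (cases "l \<in> T")
    case True
    then show ?thesis using integrable_inverse_norm[OF B'(1)] by (simp add: ph_def[abs_def])
  next
    case False
    have "integrable lborel (indicator (cball 0 B') :: complex \<Rightarrow> real)"
      by (intro integrable_real_indicator) (auto simp: emeasure_lborel_cball_finite[unfolded infinity_ennreal_def])
    then show ?thesis using False by (simp add: ph_def[abs_def])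
  qed
  have int: "integrable (\<Pi>\<^sub>M l\<in>S. (lborel :: complex measure)) (\<lambda>w. M * (\<Prod>l\<in>S. ph l (w l)))"
    by (intro integrable_mult_right product_integrable_prod S iph)
  show ?thesis
  proof (rule Bochner_Integration.integrable_bound[OF int])
    have "(\<lambda>w. ext S w l) \<in> borel_measurable (\<Pi>\<^sub>M l\<in>S. (lborel :: complex measure))" for l
      by (rule measurable_ext_compose[of S "\<lambda>z. z l"]) (rule continuous_on_coord)
    then show "(\<lambda>w. F (ext S w) / (\<Prod>l\<in>T. ext S w l)) \<in> borel_measurable (\<Pi>\<^sub>M l\<in>S. (lborel :: complex measure))"
      by (intro borel_measurable_divide measurable_ext_compose[OF c] borel_measurable_prod)
    show "AE w in (\<Pi>\<^sub>M l\<in>S. (lborel :: complex measure)). norm (F (ext S w) / (\<Prod>l\<in>T. ext S w l)) \<le> norm (M * (\<Prod>l\<in>S. ph l (w l)))"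
    proof (rule AE_I2)
      fix w :: "nat \<Rightarrow> complex"
      have nn: "0 \<le> (\<Prod>l\<in>S. ph l (w l))" by (rule prod_nonneg) (simp add: ph_def)
      show "norm (F (ext S w) / (\<Prod>l\<in>T. ext S w l)) \<le> norm (M * (\<Prod>l\<in>S. ph l (w l)))"
      proof (cases "\<exists>i\<in>S. B' < cmod (w i)")
        case True
        then obtain i where "i \<in> S" "B < cmod (ext S w i)" using B' by (auto simp: ext_def)
        then show ?thesis using supp[OF ext_in_coord_space] by simp
      next
        case False
        then have "(\<Prod>l\<in>S. ph l (w l)) = (\<Prod>l\<in>S. if l \<in> T then 1 / cmod (w l) else 1)"
          by (intro prod.cong) (auto simp: ph_def indicator_def)
        also have "\<dots> = (\<Prod>l\<in>T. 1 / cmod (w l))"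
          using S by (intro prod.mono_neutral_cong_right) auto
        also have "\<dots> = 1 / (\<Prod>l\<in>T. cmod (w l))" by (simp add: prod_dividef)
        also have "(\<Prod>l\<in>T. cmod (w l)) = (\<Prod>l\<in>T. cmod (ext S w l))"
          using S(2) by (intro prod.cong) (auto simp: ext_def)
        also have "\<dots> = cmod (\<Prod>l\<in>T. ext S w l)" by (rule prod_norm)
        finally have e: "(\<Prod>l\<in>S. ph l (w l)) = 1 / cmod (\<Prod>l\<in>T. ext S w l)" .
        have "norm (F (ext S w) / (\<Prod>l\<in>T. ext S w l)) = cmod (F (ext S w)) * (1 / cmod (\<Prod>l\<in>T. ext S w l))"
          by (simp add: norm_divide)
        also have "\<dots> \<le> M * (1 / cmod (\<Prod>l\<in>T. ext S w l))"
          by (intro mult_right_mono M ext_in_coord_space) simp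
        also have "\<dots> \<le> norm (M * (\<Prod>l\<in>S. ph l (w l)))" unfolding e using M(1) by simp
        finally show ?thesis .
      qed
    qed
  qed
qed

lemma log_integral_lin:
  assumes "finite S" "\<And>x. x \<in> A \<Longrightarrow> continuous_on (coord_space S) (F x)"
    and "\<And>x z i. x \<in> A \<Longrightarrow> z \<in> coord_space S \<Longrightarrow> i \<in> S \<Longrightarrow> B < cmod (z i) \<Longrightarrow> F x z = 0"
  shows "log_integral S (\<lambda>z. \<Sum>x\<in>A. c x * F x z) = (\<Sum>x\<in>A. c x * log_integral S (F x))"
proof -
  let ?M = "\<Pi>\<^sub>M l\<in>S. (lborel :: complex measure)"
  have "log_integral S (\<lambda>z. \<Sum>x\<in>A. c x * F x z) = (\<integral>w. (\<Sum>x\<in>A. c x * (F x (ext S w) / (\<Prod>l\<in>S. ext S w l))) \<partial>?M)"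
    unfolding log_integral_def sum_divide_distrib by (simp add: mult.assoc)
  also have "\<dots> = (\<Sum>x\<in>A. \<integral>w. c x * (F x (ext S w) / (\<Prod>l\<in>S. ext S w l)) \<partial>?M)"
  proof (rule Bochner_Integration.integral_sum)
    fix x assume x: "x \<in> A"
    show "integrable ?M (\<lambda>w. c x * (F x (ext S w) / (\<Prod>l\<in>S. ext S w l)))"
      by (intro integrable_mult_right log_integrable[where B = B] assms(1) order_refl assms(2)[OF x])
        (rule assms(3)[OF x])
  qed
  also have "\<dots> = (\<Sum>x\<in>A. c x * log_integral S (F x))"
    unfolding log_integral_def by (simp only: integral_mult_right_zero)
  finally show ?thesis .
qed

lemma log_integral_cong:
  "(\<And>z. z \<in> coord_space S \<Longrightarrow> F z = G z) \<Longrightarrow> log_integral S F = log_integral S G"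
  unfolding log_integral_def using ext_in_coord_space by (metis (no_types, lifting))

lemma open_outside: "open {z :: nat \<Rightarrow> complex. \<exists>i\<in>S. B < cmod (z i)}"
proof -
  have "{z :: nat \<Rightarrow> complex. \<exists>i\<in>S. B < cmod (z i)} = (\<Union>i\<in>S. {z. B < cmod (z i)})" by auto
  moreover have "open {z :: nat \<Rightarrow> complex. B < cmod (z i)}" for i
    by (intro open_Collect_less continuous_intros continuous_on_coord)
  ultimately show ?thesis by auto
qed

context
  fixes F :: "(nat \<Rightarrow> complex) \<Rightarrow> complex" and W :: "nat set" and i :: nat and B :: real
  assumes W: "finite W" "i \<notin> W" and F: "smooth_in (insert i W) UNIV F"
    and supp: "\<And>z l. z \<in> coord_space (insert i W) \<Longrightarrow> l \<in> insert i W \<Longrightarrow> B < cmod (z l) \<Longrightarrow> F z = 0"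
begin

lemma d_supp:
  assumes "z \<in> coord_space (insert i W)" "l \<in> insert i W" "B < cmod (z l)"
  shows "d_z i F z = 0" "d_zbar i F z = 0"
proof -
  let ?U = "{z. \<exists>l\<in>insert i W. B < cmod (z l)}"
  have z: "z \<in> coord_space (insert i W) \<inter> ?U" using assms by auto
  have "d_z i F z = d_z i (\<lambda>z. 0) z" "d_zbar i F z = d_zbar i (\<lambda>z. 0) z"
    by (rule d_z_cong[OF open_outside _ z] d_zbar_cong[OF open_outside _ z]; use supp in auto)+
  then show "d_z i F z = 0" "d_zbar i F z = 0" by simp_all
qed

lemma slice:
  assumes z: "z \<in> coord_space W"
  shows "((\<lambda>t::real. F (z(i := y + t *\<^sub>R 1))) has_vector_derivative dir_deriv (i, 1) F (z(i := y))) (at 0)"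
    "((\<lambda>t::real. F (z(i := y + t *\<^sub>R \<i>))) has_vector_derivative dir_deriv (i, \<i>) F (z(i := y))) (at 0)"
    "continuous_on UNIV (\<lambda>y. F (z(i := y)))"
    "continuous_on UNIV (\<lambda>y. dir_deriv (i, 1) F (z(i := y)))"
    "continuous_on UNIV (\<lambda>y. dir_deriv (i, \<i>) F (z(i := y)))"
    "B < cmod y \<Longrightarrow> F (z(i := y)) = 0"
proof -
  have zi: "z(i := y) \<in> coord_space (insert i W)" for y
    using z by (auto simp: coord_space_def)
  have l: "line_diff i v F (z(i := y))" if "v \<in> dirs" for v
    by (rule smooth_in_line_diff[OF F _ that]) (use zi in auto)
  show "((\<lambda>t::real. F (z(i := y + t *\<^sub>R 1))) has_vector_derivative dir_deriv (i, 1) F (z(i := y))) (at 0)"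
    "((\<lambda>t::real. F (z(i := y + t *\<^sub>R \<i>))) has_vector_derivative dir_deriv (i, \<i>) F (z(i := y))) (at 0)"
    using line_diff_has[OF l[of 1]] line_diff_has[OF l[of \<i>]] by simp_all
  have c: "continuous_on UNIV (\<lambda>y. G (z(i := y)))" if "smooth_in (insert i W) UNIV G" for G
    using continuous_on_compose2[OF smooth_in_continuous[OF that] continuous_on_fun_upd[OF continuous_on_id]] zi by auto
  show "continuous_on UNIV (\<lambda>y. F (z(i := y)))"
    "continuous_on UNIV (\<lambda>y. dir_deriv (i, 1) F (z(i := y)))"
    "continuous_on UNIV (\<lambda>y. dir_deriv (i, \<i>) F (z(i := y)))"
    using F by (auto intro!: c smooth_in_dir_deriv)
  show "B < cmod y \<Longrightarrow> F (z(i := y)) = 0"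
    using supp[OF zi, of i] by simp
qed

text \<open>Fubini with \<open>z i\<close> as the inner variable, so that the next two lemmas become
  statements about one complex variable.\<close>

lemma log_integral_insert:
  assumes c: "continuous_on (coord_space (insert i W)) G"
    and sG: "\<And>z l. z \<in> coord_space (insert i W) \<Longrightarrow> l \<in> insert i W \<Longrightarrow> B < cmod (z l) \<Longrightarrow> G z = 0"
  shows "log_integral (insert i W) G =
    (\<integral>x. (\<integral>y. G ((ext W x)(i := y)) / y \<partial>lborel) / (\<Prod>l\<in>W. ext W x l) \<partial>(\<Pi>\<^sub>M l\<in>W. (lborel :: complex measure)))"
proof -
  interpret product_sigma_finite "\<lambda>l::nat. lborel :: complex measure"
    by unfold_locales
  have "log_integral (insert i W) G = (\<integral>x. (\<integral>y. G (ext (insert i W) (x(i := y))) / (\<Prod>l\<in>insert i W. ext (insert i W) (x(i := y)) l) \<partial>lborel) \<partial>(\<Pi>\<^sub>M l\<in>W. (lborel :: complex measure)))"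
    unfolding log_integral_def
    by (rule product_integral_insert[OF W])
      (rule log_integrable[where B = B], use W c sG in auto)
  also have "\<dots> = (\<integral>x. (\<integral>y. G ((ext W x)(i := y)) / y \<partial>lborel) / (\<Prod>l\<in>W. ext W x l) \<partial>(\<Pi>\<^sub>M l\<in>W. (lborel :: complex measure)))"
  proof (rule Bochner_Integration.integral_cong[OF refl])
    fix x :: "nat \<Rightarrow> complex"
    have "(\<Prod>l\<in>insert i W. ((ext W x)(i := y)) l) = y * (\<Prod>l\<in>W. ext W x l)" for y
    proof -
      have "(\<Prod>l\<in>W. ((ext W x)(i := y)) l) = (\<Prod>l\<in>W. ext W x l)"
        using W by (intro prod.cong) auto
      then show ?thesis using W by simp
    qed
    then have "G (ext (insert i W) (x(i := y))) / (\<Prod>l\<in>insert i W. ext (insert i W) (x(i := y)) l) =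
       (G ((ext W x)(i := y)) / y) / (\<Prod>l\<in>W. ext W x l)" for y
      by (simp only: ext_insert[OF W(2)]) simp
    then show "(\<integral>y. G (ext (insert i W) (x(i := y))) / (\<Prod>l\<in>insert i W. ext (insert i W) (x(i := y)) l) \<partial>lborel) =
       (\<integral>y. G ((ext W x)(i := y)) / y \<partial>lborel) / (\<Prod>l\<in>W. ext W x l)"
      by (simp only: integral_divide_zero)
  qed
  finally show ?thesis .
qed

text \<open>By \<open>cauchy_pompeiu\<close> in the variable \<open>z i\<close>, what survives is
  the restriction to the wall \<open>z i = 0\<close>, with one pole fewer.\<close>

lemma log_integral_d_zbar: "log_integral (insert i W) (d_zbar i F) = residue_const * log_integral W F"
proof -
  have "smooth_in (insert i W) UNIV (d_zbar i F)" by (intro smooth_in_d_zbar F) auto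
  from smooth_in_continuous[OF this]
  have c: "continuous_on (coord_space (insert i W)) (d_zbar i F)" by simp
  have inner: "(\<integral>y. d_zbar i F ((ext W x)(i := y)) / y \<partial>lborel) = residue_const * F (ext W x)" for x
  proof -
    note s = slice[OF ext_in_coord_space[of W x]]
    have "(ext W x)(i := 0) = ext W x" using W by (auto simp: ext_def fun_eq_iff)
    then show ?thesis
      using cauchy_pompeiu[of "\<lambda>y. F ((ext W x)(i := y))", OF s(1) s(2) s(3) s(4) s(5) s(6)]
      by (simp add: d_zbar_def)
  qed
  have "log_integral (insert i W) (d_zbar i F) =
    (\<integral>x. (\<integral>y. d_zbar i F ((ext W x)(i := y)) / y \<partial>lborel) / (\<Prod>l\<in>W. ext W x l) \<partial>(\<Pi>\<^sub>M l\<in>W. (lborel :: complex measure)))"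
    by (rule log_integral_insert[OF c]) (rule d_supp(2))
  also have "\<dots> = (\<integral>x. residue_const * (F (ext W x) / (\<Prod>l\<in>W. ext W x l)) \<partial>(\<Pi>\<^sub>M l\<in>W. (lborel :: complex measure)))"
    unfolding inner times_divide_eq_right ..
  finally show ?thesis unfolding log_integral_def by (simp only: integral_mult_right_zero)
qed

text \<open>The factor \<open>z i\<close> of the Euler field cancels the pole, so there is no
  residue, and the inner integral is that of a derivative of a compactly supported function.\<close>

lemma log_integral_euler: "log_integral (insert i W) (euler i F) = 0"
proof -
  have sm: "smooth_in (insert i W) UNIV (euler i F)" by (intro smooth_in_euler F) auto
  from smooth_in_continuous[OF this]
  have c: "continuous_on (coord_space (insert i W)) (euler i F)" by simp
  have supp': "euler i F z = 0" if "z \<in> coord_space (insert i W)" "l \<in> insert i W" "B < cmod (z l)" for z l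
    using d_supp(1)[OF that] by (simp add: euler_def)
  have inner: "(\<integral>y. euler i F ((ext W x)(i := y)) / y \<partial>lborel) = 0" for x
  proof -
    note s = slice[OF ext_in_coord_space[of W x]]
    let ?hx = "\<lambda>y. dir_deriv (i, 1) F ((ext W x)(i := y))" and ?hy = "\<lambda>y. dir_deriv (i, \<i>) F ((ext W x)(i := y))"
    have z: "?hx y = 0" "?hy y = 0" if "B < cmod y" for y
      using has_vector_derivative_outside_support[OF s(1) s(6) that] has_vector_derivative_outside_support[OF s(2) s(6) that] by auto
    have i: "integrable lborel ?hx" "integrable lborel ?hy"
      by (rule integrable_if_compact_support[OF s(4) z(1)], simp, rule integrable_if_compact_support[OF s(5) z(2)], simp)
    have 0: "integral\<^sup>L lborel ?hx = 0" "integral\<^sup>L lborel ?hy = 0"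
      by (rule integral_dir_deriv[OF s(1,3,4,6)], simp, rule integral_dir_deriv[OF s(2,3,5,6)], simp)
    have m: "?hx \<in> borel_measurable lborel" "?hy \<in> borel_measurable lborel"
      using i by auto
    \<comment> \<open>At \<open>y = 0\<close> the division yields \<open>0\<close> instead of the
      continuous value; a single point is a null set.\<close>
    have e: "euler i F ((ext W x)(i := y)) / y = (if y = 0 then 0 else (?hx y - \<i> * ?hy y) / 2)" for y
      by (simp add: euler_def d_z_def)
    have "(\<integral>y. euler i F ((ext W x)(i := y)) / y \<partial>lborel) = (\<integral>y. (?hx y - \<i> * ?hy y) / 2 \<partial>lborel)"
      unfolding e
    proof (rule integral_cong_AE)
      show "(\<lambda>y. if y = 0 then 0 else (?hx y - \<i> * ?hy y) / 2) \<in> borel_measurable lborel"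
        "(\<lambda>y. (?hx y - \<i> * ?hy y) / 2) \<in> borel_measurable lborel"
        using m by measurable
      show "AE y in lborel. (if y = 0 then 0 else (?hx y - \<i> * ?hy y) / 2) = (?hx y - \<i> * ?hy y) / 2"
        using AE_lborel_singleton[of "0::complex"] by eventually_elim simp
    qed
    also have "\<dots> = 0" using i 0 by simp
    finally show ?thesis .
  qed
  have "log_integral (insert i W) (euler i F) =
    (\<integral>x. (\<integral>y. euler i F ((ext W x)(i := y)) / y \<partial>lborel) / (\<Prod>l\<in>W. ext W x l) \<partial>(\<Pi>\<^sub>M l\<in>W. (lborel :: complex measure)))"
    by (rule log_integral_insert[OF c]) (rule supp')
  then show ?thesis unfolding inner by simp
qed

end

section \<open>Walls of the fan\<close>

lemma sum_mult_delta:
  fixes c :: "'b \<Rightarrow> 'a::comm_ring_1"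
  assumes "finite A" "a \<in> A"
  shows "(\<Sum>x\<in>A. c x * (if a = x then 1 else 0)) = c a" "(\<Sum>x\<in>A. c x * (if x = a then 1 else 0)) = c a"
proof -
  have "(\<Sum>x\<in>A. c x * (if a = x then 1 else 0)) = (\<Sum>x\<in>A. if a = x then c x else 0)"
    "(\<Sum>x\<in>A. c x * (if x = a then 1 else 0)) = (\<Sum>x\<in>A. if a = x then c x else 0)"
    by (auto intro!: sum.cong)
  then show "(\<Sum>x\<in>A. c x * (if a = x then 1 else 0)) = c a" "(\<Sum>x\<in>A. c x * (if x = a then 1 else 0)) = c a"
    using assms by simp_all
qed

definition zlin :: "(int^'n \<Rightarrow> 'a::comm_ring_1) \<Rightarrow> bool" where
  "zlin f \<longleftrightarrow> (\<forall>v w. f (v + w) = f v + f w) \<and> (\<forall>c v. f (c *s v) = of_int c * f v)"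

lemma zlin_add: "zlin f \<Longrightarrow> f (v + w) = f v + f w"
  and zlin_scale: "zlin f \<Longrightarrow> f (c *s v) = of_int c * f v"
  by (simp_all add: zlin_def)

lemma zlin_zero: "zlin f \<Longrightarrow> f 0 = 0"
  using zlin_add[of f 0 0] by simp

lemma zlin_sum: "zlin f \<Longrightarrow> f (\<Sum>b\<in>B. c b *s h b) = (\<Sum>b\<in>B. of_int (c b) * f (h b))"
  by (induction B rule: infinite_finite_induct) (simp_all add: zlin_zero zlin_add zlin_scale)

lemma zlin_pairing: "zlin (\<lambda>v. pairing v m)"
  unfolding zlin_def pairing_def by (simp add: sum.distrib algebra_simps sum_distrib_left)

lemma real_vec_add: "real_vec (v + w) = real_vec v + real_vec w"
  and real_vec_scale: "real_vec (c *s v) = real_of_int c *\<^sub>R real_vec v"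
  and real_vec_sum: "real_vec (\<Sum>b\<in>B. h b) = (\<Sum>b\<in>B. real_vec (h b))"
proof -
  show a: "real_vec (v + w) = real_vec v + real_vec w" for v w :: "int^'n"
    by (simp add: real_vec_def vec_eq_iff)
  show "real_vec (c *s v) = real_of_int c *\<^sub>R real_vec v"
    by (simp add: real_vec_def vec_eq_iff)
  show "real_vec (\<Sum>b\<in>B. h b) = (\<Sum>b\<in>B. real_vec (h b))"
    by (simp add: real_vec_def vec_eq_iff)
qed

text \<open>Smoothness of the fan speaks of the lattice, the cones are sets of real vectors;
  functionals on the lattice are evaluated on cones through this extension.\<close>

lemma zlin_extends:
  fixes f :: "int^'n \<Rightarrow> int"
  assumes "zlin f"
  shows "\<exists>F :: real^'n \<Rightarrow> real. linear F \<and> (\<forall>v. F (real_vec v) = real_of_int (f v))"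
proof (intro exI conjI allI)
  let ?F = "\<lambda>x :: real^'n. \<Sum>l\<in>UNIV. real_of_int (f (axis l 1)) * x $ l"
  show "linear ?F"
    by (rule linearI) (simp_all add: sum.distrib algebra_simps sum_distrib_left)
  fix v
  have "f v = f (\<Sum>l\<in>UNIV. (v $ l) *s axis l 1)" by (simp only: basis_expansion)
  also have "\<dots> = (\<Sum>l\<in>UNIV. (v $ l) * f (axis l 1))" using zlin_sum[OF assms, of "\<lambda>l. v $ l"] by simp
  finally show "?F (real_vec v) = real_of_int (f v)" by (simp add: real_vec_def mult.commute)
qed

definition basis_coords :: "(int^'n) set \<Rightarrow> (int^'n \<Rightarrow> int^'n \<Rightarrow> int) \<Rightarrow> bool" where
  "basis_coords B f \<longleftrightarrow> (\<forall>b\<in>B. zlin (f b)) \<and> (\<forall>v. v = (\<Sum>b\<in>B. f b v *s b)) \<and>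
     (\<forall>b\<in>B. \<forall>b'\<in>B. f b b' = (if b = b' then 1 else 0))"

lemma basis_coordsD:
  assumes "basis_coords B f"
  shows "b \<in> B \<Longrightarrow> zlin (f b)" "v = (\<Sum>b\<in>B. f b v *s b)"
    "b \<in> B \<Longrightarrow> b' \<in> B \<Longrightarrow> f b b' = (if b = b' then 1 else 0)"
  using assms unfolding basis_coords_def by blast+

lemma lattice_basis_coords:
  assumes B: "lattice_basis (B :: (int^'n) set)"
  shows "\<exists>f. basis_coords B f"
proof -
  have ex: "\<exists>!c. c \<in> B \<rightarrow>\<^sub>E (UNIV :: int set) \<and> v = (\<Sum>b\<in>B. c b *s b)" for v
    using B by (simp add: lattice_basis_def)
  have fin: "finite B" using B by (simp add: lattice_basis_def)
  define C where "C v = (THE c. c \<in> B \<rightarrow>\<^sub>E (UNIV :: int set) \<and> v = (\<Sum>b\<in>B. c b *s b))" for v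
  have C: "C v \<in> B \<rightarrow>\<^sub>E UNIV" "v = (\<Sum>b\<in>B. C v b *s b)" for v
    using theI'[OF ex[of v]] by (simp_all add: C_def)
  have uniq: "C v b = c b" if "v = (\<Sum>b\<in>B. c b *s b)" "b \<in> B" for v c b
  proof -
    have "restrict c B \<in> B \<rightarrow>\<^sub>E UNIV" by simp
    moreover have "v = (\<Sum>b\<in>B. restrict c B b *s b)" using that(1) by simp
    ultimately have "C v = restrict c B" using ex[of v] C[of v] by blast
    then show ?thesis using that(2) by simp
  qed
  have lin: "zlin (\<lambda>v. C v b)" if b: "b \<in> B" for b
  proof -
    have "C (v + w) b = C v b + C w b" for v w
    proof (rule uniq[OF _ b])
      show "v + w = (\<Sum>b\<in>B. (C v b + C w b) *s b)"
        using C(2)[of v] C(2)[of w] by (simp add: vector_sadd_rdistrib sum.distrib)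
    qed
    moreover have "C (k *s v) b = k * C v b" for k v
    proof (rule uniq[OF _ b])
      have "k *s v = k *s (\<Sum>b\<in>B. C v b *s b)" using C(2)[of v] by simp
      also have "\<dots> = (\<Sum>b\<in>B. (k * C v b) *s b)"
        by (simp add: vec_eq_iff sum_distrib_left mult.assoc)
      finally show "k *s v = (\<Sum>b\<in>B. (k * C v b) *s b)" .
    qed
    ultimately show ?thesis by (simp add: zlin_def)
  qed
  have delta: "C b' b = (if b = b' then 1 else 0)" if b: "b \<in> B" and b': "b' \<in> B" for b b'
  proof (rule uniq[OF _ b])
    have "(\<Sum>b\<in>B. (if b = b' then 1 else 0) *s b) = (\<Sum>b\<in>B. if b = b' then b else 0)"
      by (intro sum.cong) (auto simp: vec_eq_iff)
    then show "b' = (\<Sum>b\<in>B. (if b = b' then 1 else 0) *s b)" using fin b' by simp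
  qed
  show ?thesis unfolding basis_coords_def using lin delta C(2)
    by (intro exI[of _ "\<lambda>b v. C v b"]) blast
qed

text \<open>The integral coordinates extend to real functionals, which show that the basis is
  linearly independent over the reals.\<close>

lemma lattice_basis_card_le:
  assumes B: "lattice_basis (B :: (int^'n) set)"
  shows "card B \<le> CARD('n)"
proof -
  obtain f where bc: "basis_coords B f" using lattice_basis_coords[OF B] ..
  note f = basis_coordsD(1)[OF bc] basis_coordsD(3)[OF bc]
  have fin: "finite B" using B by (simp add: lattice_basis_def)
  have inj: "inj_on (real_vec :: int^'n \<Rightarrow> real^'n) B"
    by (auto simp: inj_on_def real_vec_def vec_eq_iff)
  have "independent ((real_vec :: int^'n \<Rightarrow> real^'n) ` B)"
  proof (rule ccontr)
    assume "\<not> independent ((real_vec :: int^'n \<Rightarrow> real^'n) ` B)"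
    then obtain u where u: "\<exists>v\<in>real_vec ` B. u v \<noteq> 0" "(\<Sum>v\<in>real_vec ` B. u v *\<^sub>R v) = (0 :: real^'n)"
      using dependent_finite[of "real_vec ` B"] fin by auto
    then obtain b where b: "b \<in> B" "u (real_vec b) \<noteq> 0" by auto
    obtain F where F: "linear F" "\<And>v. F (real_vec v) = real_of_int (f b v)"
      using zlin_extends[OF f(1)[OF b(1)]] by auto
    have "0 = F (\<Sum>v\<in>B. u (real_vec v) *\<^sub>R real_vec v)"
      using u(2) inj linear_0[OF F(1)] by (simp add: sum.reindex)
    also have "\<dots> = (\<Sum>v\<in>B. u (real_vec v) * (if b = v then 1 else 0))"
      using f(2)[OF b(1)] by (auto simp: linear_sum[OF F(1)] linear_cmul[OF F(1)] F(2) intro!: sum.cong)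
    also have "\<dots> = u (real_vec b)" by (rule sum_mult_delta[OF fin b(1)])
    finally show False using b(2) by simp
  qed
  from independent_bound[OF this] show ?thesis
    using card_image[OF inj] by simp
qed

text \<open>\<open>f i\<close> reads off the coefficient of \<open>ray D i\<close>, and
  \<open>F i\<close> is its real extension for use on \<open>geom_cone\<close>. Only the rays of a
  maximal cone span the lattice, whence the condition on the expansion.\<close>

definition cone_coords :: "'n::finite toric \<Rightarrow> nat set \<Rightarrow> (nat \<Rightarrow> int^'n \<Rightarrow> int) \<Rightarrow> (nat \<Rightarrow> real^'n \<Rightarrow> real) \<Rightarrow> bool" where
  "cone_coords D S f F \<longleftrightarrow>
     (\<forall>i\<in>S. zlin (f i) \<and> linear (F i) \<and> (\<forall>v. F i (real_vec v) = real_of_int (f i v)) \<and>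
        (\<forall>j\<in>S. f i (ray D j) = (if i = j then 1 else 0))) \<and>
     (card S = rk D \<longrightarrow> (\<forall>v. v = (\<Sum>i\<in>S. f i v *s ray D i)))"

lemma cone_coordsD:
  assumes "cone_coords D S f F"
  shows "i \<in> S \<Longrightarrow> zlin (f i)" "i \<in> S \<Longrightarrow> linear (F i)"
    "i \<in> S \<Longrightarrow> F i (real_vec v) = real_of_int (f i v)"
    "i \<in> S \<Longrightarrow> j \<in> S \<Longrightarrow> f i (ray D j) = (if i = j then 1 else 0)"
    "card S = rk D \<Longrightarrow> v = (\<Sum>i\<in>S. f i v *s ray D i)"
  using assms unfolding cone_coords_def by blast+

lemma cone_coords_exist:
  assumes D: "smooth_fan (D :: 'n::finite toric)" and S: "S \<in> cones D"
  shows "\<exists>f F. cone_coords D S f F"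
proof -
  have inj: "inj_on (ray D) S" using D S by (auto simp: smooth_fan_def)
  obtain B where B: "lattice_basis B" "ray D ` S \<subseteq> B" using D S by (auto simp: smooth_fan_def)
  obtain f where bc: "basis_coords B f" using lattice_basis_coords[OF B(1)] ..
  note f = basis_coordsD[OF bc]
  have "\<forall>i\<in>S. \<exists>F :: real^'n \<Rightarrow> real. linear F \<and> (\<forall>v. F (real_vec v) = real_of_int (f (ray D i) v))"
    using zlin_extends f(1) B(2) by blast
  from bchoice[OF this] obtain F where
    F: "\<forall>i\<in>S. linear (F i :: real^'n \<Rightarrow> real) \<and> (\<forall>v. F i (real_vec v) = real_of_int (f (ray D i) v))" ..
  have "zlin (f (ray D i))" if "i \<in> S" for i using f(1) B(2) that by auto
  moreover have "f (ray D i) (ray D j) = (if i = j then 1 else 0)" if "i \<in> S" "j \<in> S" for i j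
  proof -
    have "ray D i \<in> B" "ray D j \<in> B" using B(2) that by auto
    then show ?thesis using f(3) inj_on_eq_iff[OF inj that] by simp
  qed
  moreover have "v = (\<Sum>i\<in>S. f (ray D i) v *s ray D i)" if c: "card S = rk D" for v
  proof -
    have "finite B" using B(1) by (simp add: lattice_basis_def)
    \<comment> \<open>A lattice basis has at most \<open>n\<close> elements, so one that contains
      the \<open>n\<close> rays of \<open>S\<close> contains nothing else.\<close>
    moreover have "card (ray D ` S) = card B"
      using c lattice_basis_card_le[OF B(1)] card_mono[OF \<open>finite B\<close> B(2)] card_image[OF inj] by (simp add: rk_def)
    ultimately have e: "ray D ` S = B" using B(2) card_subset_eq by blast
    show "v = (\<Sum>i\<in>S. f (ray D i) v *s ray D i)"
      using f(2)[of v] unfolding e[symmetric] sum.reindex[OF inj] by (simp add: comp_def)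
  qed
  ultimately have "cone_coords D S (\<lambda>i. f (ray D i)) F"
    unfolding cone_coords_def using F by blast
  then show ?thesis by blast
qed

section \<open>Adjacent maximal cones\<close>

context
  fixes D :: "'n::finite toric"
  assumes D: "log_LG D"
begin

lemma smooth: "smooth_fan D"
  using D by (simp add: log_LG_def)

lemma cone_finite: "S \<in> cones D \<Longrightarrow> finite S"
  using smooth unfolding smooth_fan_def by (meson finite_atLeastAtMost finite_subset)

lemma cone_rays: "S \<in> cones D \<Longrightarrow> S \<subseteq> {1..nrays D}"
  using smooth by (auto simp: smooth_fan_def)

lemma cone_face: "S \<in> cones D \<Longrightarrow> T \<subseteq> S \<Longrightarrow> T \<in> cones D"
  using smooth by (auto simp: smooth_fan_def)

lemma finite_cones: "finite (cones D)"
  by (rule finite_subset[of _ "Pow {1..nrays D}"]) (use cone_rays in auto)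

lemma finite_maxcones: "finite (maxcones D)"
  unfolding maxcones_def using finite_cones by simp

lemma maxcone_cone: "S \<in> maxcones D \<Longrightarrow> S \<in> cones D"
  and maxcone_card: "S \<in> maxcones D \<Longrightarrow> card S = rk D"
  and maxcone_finite: "S \<in> maxcones D \<Longrightarrow> finite S"
  and maxcone_rays: "S \<in> maxcones D \<Longrightarrow> S \<subseteq> {1..nrays D}"
  using cone_finite cone_rays by (auto simp: maxcones_def)

lemma cone_card_le: "S \<in> cones D \<Longrightarrow> card S \<le> rk D"
proof -
  assume S: "S \<in> cones D"
  then obtain B where B: "lattice_basis B" "ray D ` S \<subseteq> B" "inj_on (ray D) S"
    using smooth by (auto simp: smooth_fan_def)
  then show ?thesis using lattice_basis_card_le[OF B(1)] card_mono[OF _ B(2)] card_image[OF B(3)]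
    by (auto simp: lattice_basis_def rk_def)
qed

lemma geom_cone_Int: "S \<in> cones D \<Longrightarrow> T \<in> cones D \<Longrightarrow> geom_cone D S \<inter> geom_cone D T = geom_cone D (S \<inter> T)"
  using smooth by (auto simp: smooth_fan_def)

text \<open>The rays of either cone form a basis of the lattice, so the coordinate of
  \<open>ray D i'\<close> along \<open>ray D i\<close> is a unit. Were it \<open>1\<close>, the two
  cones would lie on the same side of the wall and overlap outside of it.\<close>

lemma adjacent_coordinate:
  fixes f :: "int^'n \<Rightarrow> int"
  assumes W: "i \<notin> W" "insert i W \<in> maxcones D" "i' \<notin> W" "insert i' W \<in> maxcones D" "i \<noteq> i'"
    and f: "zlin f" "f (ray D i) = 1" "\<And>w. w \<in> W \<Longrightarrow> f (ray D w) = 0"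
  shows "f (ray D i') = -1"
proof -
  obtain h H where hc: "cone_coords D (insert i W) h H"
    using cone_coords_exist[OF smooth maxcone_cone[OF W(2)]] by blast
  note h = cone_coordsD[OF hc]
  obtain h' H' where hc': "cone_coords D (insert i' W) h' H'"
    using cone_coords_exist[OF smooth maxcone_cone[OF W(4)]] by blast
  note h' = cone_coordsD(1,5)[OF hc']
  have fW: "finite W" using maxcone_finite[OF W(2)] by simp
  have e: "v = h i v *s ray D i + (\<Sum>j\<in>W. h j v *s ray D j)" for v
    using h(5)[OF maxcone_card[OF W(2)], of v] fW W(1) by simp
  have e': "v = h' i' v *s ray D i' + (\<Sum>j\<in>W. h' j v *s ray D j)" for v
    using h'(2)[OF maxcone_card[OF W(4)], of v] fW W(3) by simp
  have "f v = f (h i v *s ray D i + (\<Sum>j\<in>W. h j v *s ray D j))" for v using e[of v] by simp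
  then have fh: "f v = h i v" for v
    using f(2,3) by (simp add: zlin_add[OF f(1)] zlin_scale[OF f(1)] zlin_sum[OF f(1)])
  have "f (ray D i) = f (h' i' (ray D i) *s ray D i' + (\<Sum>j\<in>W. h' j (ray D i) *s ray D j))"
    using e'[of "ray D i"] by simp
  then have "1 = h' i' (ray D i) * f (ray D i')"
    using f(2,3) by (simp add: zlin_add[OF f(1)] zlin_scale[OF f(1)] zlin_sum[OF f(1)])
  then have unit: "f (ray D i') = 1 \<or> f (ray D i') = -1"
    by (metis mult.commute zmult_eq_1_iff)
  have "f (ray D i') \<noteq> 1"
  proof
    assume one: "f (ray D i') = 1"
    define c where "c j = h j (ray D i')" for j
    \<comment> \<open>With this multiple of the sum of the wall rays added, all coefficients over
      \<open>W\<close> become nonnegative, so that \<open>x\<close> lies in both cones.\<close>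
    define M where "M = (\<Sum>j\<in>W. \<bar>c j\<bar>)"
    have M: "0 \<le> M" "\<And>j. j \<in> W \<Longrightarrow> 0 \<le> M + c j"
    proof -
      show "0 \<le> M" by (simp add: M_def sum_nonneg)
      fix j assume "j \<in> W"
      then have "\<bar>c j\<bar> \<le> M" unfolding M_def using fW by (intro member_le_sum) auto
      then show "0 \<le> M + c j" by linarith
    qed
    have ri': "ray D i' = ray D i + (\<Sum>j\<in>W. c j *s ray D j)"
      using e[of "ray D i'"] one fh[of "ray D i'"] by (simp add: c_def)
    define x where "x = real_vec (ray D i') + (\<Sum>j\<in>W. real_of_int M *\<^sub>R real_vec (ray D j))"
    have "x \<in> geom_cone D (insert i' W)"
      unfolding geom_cone_def x_def
      by (rule CollectI, rule exI[of _ "\<lambda>j. if j = i' then 1 else real_of_int M"])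
        (use fW W(3) M(1) in \<open>auto intro!: sum.cong\<close>)
    moreover have "x \<in> geom_cone D (insert i W)"
    proof -
      have "x = real_vec (ray D i) + (\<Sum>j\<in>W. real_of_int (M + c j) *\<^sub>R real_vec (ray D j))"
        unfolding x_def ri' real_vec_add real_vec_sum real_vec_scale
        by (simp add: scaleR_add_left sum.distrib algebra_simps)
      also have "\<dots> = (\<Sum>j\<in>insert i W. (if j = i then 1 else real_of_int (M + c j)) *\<^sub>R real_vec (ray D j))"
        using fW W(1) by (auto intro!: sum.cong)
      finally show ?thesis unfolding geom_cone_def using M(2)
        by (intro CollectI exI[of _ "\<lambda>j. if j = i then 1 else real_of_int (M + c j)"]) (auto simp del: of_int_add)
    qed
    moreover have "insert i W \<inter> insert i' W = W" using W by auto
    ultimately have "x \<in> geom_cone D W"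
      using geom_cone_Int[OF maxcone_cone[OF W(2)] maxcone_cone[OF W(4)]] by auto
    then obtain a where a: "x = (\<Sum>j\<in>W. a j *\<^sub>R real_vec (ray D j))" unfolding geom_cone_def by auto
    have "H i x = 0"
      unfolding a using W(1) by (auto simp: linear_sum[OF h(2)] linear_cmul[OF h(2)] h(3) h(4) intro!: sum.neutral)
    moreover have "H i x = 1"
      unfolding x_def using W(1) one fh[of "ray D i'"]
      by (auto simp: linear_add[OF h(2)] linear_sum[OF h(2)] linear_cmul[OF h(2)] h(3) h(4) intro!: sum.neutral)
    ultimately show False by simp
  qed
  with unit show ?thesis by simp
qed


text \<open>By completeness, points just beyond the wall on the side away from
  \<open>ray D i\<close> lie in some cone. That cone contains \<open>W\<close> and also a ray
  outside of \<open>insert i W\<close>; its face on these rays is the required cone.\<close>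

lemma opposite_cone_exists:
  assumes W: "i \<notin> W" "insert i W \<in> maxcones D"
  shows "\<exists>i'. i' \<noteq> i \<and> i' \<notin> W \<and> insert i' W \<in> maxcones D"
proof -
  let ?S = "insert i W"
  note Sc = maxcone_cone[OF W(2)]
  obtain h H where hc: "cone_coords D ?S h H"
    using cone_coords_exist[OF smooth Sc] by blast
  note h = cone_coordsD[OF hc]
  have fW: "finite W" using maxcone_finite[OF W(2)] by simp
  have Wc: "W \<in> cones D" using cone_face[OF Sc] by auto
  define w where "w = (\<Sum>j\<in>W. real_vec (ray D j))"
  \<comment> \<open>Up to scaling this is \<open>w - ray D i / N\<close>, which approaches the
    interior point \<open>w\<close> of the wall from the far side.\<close>
  define x where "x N = real N *\<^sub>R w - real_vec (ray D i)" for N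
  have "complete_fan D" using D by (simp add: log_LG_def)
  then have cover: "\<exists>T\<in>cones D. y \<in> geom_cone D T" for y unfolding complete_fan_def by auto
  \<comment> \<open>There are finitely many cones and infinitely many \<open>N\<close>, so one cone
    contains infinitely many of the points.\<close>
  have "\<exists>T\<in>cones D. infinite {N. x N \<in> geom_cone D T}"
  proof (rule ccontr)
    assume "\<not> ?thesis"
    then have "finite (\<Union>T\<in>cones D. {N. x N \<in> geom_cone D T})" using finite_cones by blast
    moreover have "(\<Union>T\<in>cones D. {N. x N \<in> geom_cone D T}) = (UNIV :: nat set)" using cover by auto
    ultimately show False by simp
  qed
  then obtain T where T: "T \<in> cones D" "infinite {N. x N \<in> geom_cone D T}" by blast
  obtain k K where kc: "cone_coords D T k K"
    using cone_coords_exist[OF smooth T(1)] by blast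
  note k = cone_coordsD[OF kc]
  have fT: "finite T" using cone_finite[OF T(1)] .
  have rep: "y = (\<Sum>t\<in>T. K t y *\<^sub>R real_vec (ray D t)) \<and> (\<forall>t\<in>T. 0 \<le> K t y)" if y: "y \<in> geom_cone D T" for y
  proof -
    obtain a where a: "y = (\<Sum>t\<in>T. a t *\<^sub>R real_vec (ray D t))" "\<forall>t\<in>T. 0 \<le> a t"
      using y unfolding geom_cone_def by auto
    have "K t y = a t" if t: "t \<in> T" for t
    proof -
      have "K t y = (\<Sum>s\<in>T. a s * (if t = s then 1 else 0))"
        unfolding a(1) using t by (auto simp: linear_sum[OF k(2)] linear_cmul[OF k(2)] k(3) k(4) intro!: sum.cong)
      then show ?thesis using sum_mult_delta(1)[OF fT t] by metis
    qed
    then show ?thesis using a by simp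
  qed
  \<comment> \<open>The limit \<open>w\<close> of the directions lies in the closed cone
    \<open>T\<close>: it is in the span as a multiple of \<open>x N2 - x N1\<close>, and a negative
    coordinate of \<open>w\<close> would make the same coordinate of \<open>x N\<close> negative for
    large \<open>N\<close>.\<close>
  have wT: "w \<in> geom_cone D T"
  proof -
    obtain N1 where N1: "x N1 \<in> geom_cone D T" using T(2) by (metis (mono_tags) empty_Collect_eq finite.emptyI)
    obtain N2 where N2: "N1 < N2" "x N2 \<in> geom_cone D T"
      using T(2) unfolding infinite_nat_iff_unbounded by blast
    define c where "c = real N2 - real N1"
    have c: "c > 0" using N2(1) by (simp add: c_def)
    have d: "x N2 - x N1 = c *\<^sub>R w" by (simp add: x_def c_def scaleR_diff_left)
    have "c *\<^sub>R w = (\<Sum>t\<in>T. K t (x N2) *\<^sub>R real_vec (ray D t)) - (\<Sum>t\<in>T. K t (x N1) *\<^sub>R real_vec (ray D t))"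
      using rep[OF N1] rep[OF N2(2)] d by simp
    also have "\<dots> = (\<Sum>t\<in>T. (c * K t w) *\<^sub>R real_vec (ray D t))"
      unfolding sum_subtractf[symmetric] scaleR_diff_left[symmetric]
    proof (rule sum.cong[OF refl])
      fix t assume t: "t \<in> T"
      have "K t (x N2) - K t (x N1) = c * K t w"
        using linear_diff[OF k(2)[OF t], of "x N2" "x N1"] linear_cmul[OF k(2)[OF t], of c w] d by simp
      then show "(K t (x N2) - K t (x N1)) *\<^sub>R real_vec (ray D t) = (c * K t w) *\<^sub>R real_vec (ray D t)" by simp
    qed
    also have "\<dots> = c *\<^sub>R (\<Sum>t\<in>T. K t w *\<^sub>R real_vec (ray D t))" by (simp add: scaleR_sum_right)
    finally have "w = (\<Sum>t\<in>T. K t w *\<^sub>R real_vec (ray D t))" using c by simp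
    moreover have "0 \<le> K t w" if t: "t \<in> T" for t
    proof (rule ccontr)
      assume neg: "\<not> 0 \<le> K t w"
      obtain m :: nat where m: "real m > K t (real_vec (ray D i)) / K t w" using reals_Archimedean2 by blast
      obtain N where N: "m < N" "x N \<in> geom_cone D T"
        using T(2) unfolding infinite_nat_iff_unbounded by blast
      have "0 \<le> K t (x N)" using rep[OF N(2)] t by blast
      then have "K t (real_vec (ray D i)) \<le> real N * K t w"
        by (simp add: x_def linear_diff[OF k(2)[OF t]] linear_cmul[OF k(2)[OF t]])
      then have "real N \<le> K t (real_vec (ray D i)) / K t w"
        using neg by (simp add: neg_le_divide_eq mult.commute)
      then show False using m N(1) by simp
    qed
    ultimately show ?thesis unfolding geom_cone_def
      by (intro CollectI exI[of _ "\<lambda>t. K t w"]) simp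
  qed
  have "w \<in> geom_cone D W" unfolding geom_cone_def w_def
    by (intro CollectI exI[of _ "\<lambda>j. 1"]) simp
  then have "w \<in> geom_cone D (T \<inter> W)" using wT geom_cone_Int[OF T(1) Wc] by blast
  then obtain a where a: "w = (\<Sum>j\<in>T \<inter> W. a j *\<^sub>R real_vec (ray D j))" unfolding geom_cone_def by auto
  have WT: "W \<subseteq> T"
  proof
    fix v assume v: "v \<in> W"
    then have vS: "v \<in> ?S" by simp
    have "H v w = (\<Sum>j\<in>W. if v = j then 1 else 0)" unfolding w_def
      using vS by (auto simp: linear_sum[OF h(2)] h(3) h(4) intro!: sum.cong)
    then have "H v w = 1" using fW v by simp
    moreover have "H v w = 0" if "v \<notin> T" unfolding a
      using vS that by (auto simp: linear_sum[OF h(2)] linear_cmul[OF h(2)] h(3) h(4) intro!: sum.neutral)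
    ultimately show "v \<in> T" by fastforce
  qed
  have "\<not> T \<subseteq> ?S"
  proof
    assume TS: "T \<subseteq> ?S"
    obtain N where N: "x N \<in> geom_cone D T" using T(2) by (metis (mono_tags) empty_Collect_eq finite.emptyI)
    have iS: "i \<in> ?S" by simp
    have "H i w = 0" unfolding w_def
      using W(1) by (auto simp: linear_sum[OF h(2)[OF iS]] h(3)[OF iS] h(4)[OF iS] intro!: sum.neutral)
    then have "H i (x N) = -1"
      by (simp add: x_def linear_diff[OF h(2)[OF iS]] linear_cmul[OF h(2)[OF iS]] h(3)[OF iS] h(4)[OF iS])
    moreover have "H i (x N) = H i (\<Sum>t\<in>T. K t (x N) *\<^sub>R real_vec (ray D t))"
      by (rule arg_cong[OF conjunct1[OF rep[OF N]]])
    then have "H i (x N) = (\<Sum>t\<in>T. K t (x N) * H i (real_vec (ray D t)))"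
      by (simp only: linear_sum[OF h(2)[OF iS]] linear_cmul[OF h(2)[OF iS]] real_scaleR_def)
    moreover have "0 \<le> (\<Sum>t\<in>T. K t (x N) * H i (real_vec (ray D t)))"
    proof (rule sum_nonneg)
      fix t assume t: "t \<in> T"
      then have "0 \<le> H i (real_vec (ray D t))" using TS by (auto simp: h(3)[OF iS] h(4)[OF iS])
      then show "0 \<le> K t (x N) * H i (real_vec (ray D t))" using rep[OF N] t by simp
    qed
    ultimately show False by simp
  qed
  then obtain i' where i': "i' \<in> T" "i' \<noteq> i" "i' \<notin> W" by blast
  have "insert i' W \<in> cones D" by (rule cone_face[OF T(1)]) (use i' WT in auto)
  moreover have "card (insert i' W) = rk D"
    using maxcone_card[OF W(2)] W(1) i'(3) fW by simp
  ultimately show ?thesis using i' by (auto simp: maxcones_def)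
qed

text \<open>The two rays off a common wall add up to an element of the span of the wall, because the
  coordinate of \<open>ray D i'\<close> along \<open>ray D i\<close> is \<open>-1\<close>.\<close>

lemma zlin_wall:
  fixes g :: "int^'n \<Rightarrow> int"
  assumes W: "i \<notin> W" "insert i W \<in> maxcones D" "i' \<notin> W" "insert i' W \<in> maxcones D" "i \<noteq> i'"
    and g: "zlin g" "\<And>w. w \<in> W \<Longrightarrow> g (ray D w) = 0"
  shows "g (ray D i') = - g (ray D i)"
proof -
  obtain h H where hc: "cone_coords D (insert i W) h H"
    using cone_coords_exist[OF smooth maxcone_cone[OF W(2)]] by blast
  note h = cone_coordsD[OF hc]
  have fW: "finite W" using maxcone_finite[OF W(2)] by simp
  have "h i (ray D i') = -1"
    by (rule adjacent_coordinate[OF W h(1)]) (use h(4) W(1) in auto)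
  moreover have "ray D i' = h i (ray D i') *s ray D i + (\<Sum>j\<in>W. h j (ray D i') *s ray D j)"
    using h(5)[OF maxcone_card[OF W(2)], of "ray D i'"] fW W(1) by simp
  then have "g (ray D i') = g (h i (ray D i') *s ray D i + (\<Sum>j\<in>W. h j (ray D i') *s ray D j))" by simp
  ultimately show ?thesis
    using g(2) by (simp add: zlin_add[OF g(1)] zlin_scale[OF g(1)] zlin_sum[OF g(1)])
qed

lemma wall_two_cones:
  assumes W: "i \<notin> W" "insert i W \<in> maxcones D"
  shows "\<exists>i'. i' \<noteq> i \<and> {j. j \<notin> W \<and> insert j W \<in> maxcones D} = {i, i'}"
proof -
  obtain i' where i': "i' \<noteq> i" "i' \<notin> W" "insert i' W \<in> maxcones D"
    using opposite_cone_exists[OF W] by blast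
  obtain h H where hc: "cone_coords D (insert i W) h H"
    using cone_coords_exist[OF smooth maxcone_cone[OF W(2)]] by blast
  note h = cone_coordsD[OF hc]
  have z: "zlin (h i)" "\<And>w. w \<in> W \<Longrightarrow> h i (ray D w) = 0" "h i (ray D i) = 1" using h(1,4) W(1) by auto
  have "j = i \<or> j = i'" if j: "j \<notin> W" "insert j W \<in> maxcones D" for j
  proof (rule ccontr)
    assume n: "\<not> (j = i \<or> j = i')"
    \<comment> \<open>On a third ray \<open>j\<close> the functional would be \<open>-1\<close> by
      comparison with \<open>i\<close>, and \<open>1\<close> by comparison with
      \<open>i'\<close>.\<close>
    have "h i (ray D i') = - 1" "h i (ray D j) = - 1" "h i (ray D j) = - h i (ray D i')"
      using zlin_wall[OF W i'(2,3) i'(1)[symmetric] z(1,2)] zlin_wall[OF W j _ z(1,2)]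
        zlin_wall[OF i'(2,3) j _ z(1,2)] n z(3) by auto
    then show False by simp
  qed
  then show ?thesis using i' W by blast
qed

end

section \<open>The dual basis and functionals adapted to a cone\<close>

lemma dual_expansion:
  assumes D: "log_LG (D :: 'n::finite toric)"
  shows "v = (\<Sum>k=1..rk D. pairing v (dual_vec D k) *s ray D k)"
proof -
  have dual: "pairing (ray D i) (dual_vec D k) = (if i = k then 1 else 0)" if "i \<in> {1..rk D}" "k \<in> {1..rk D}" for i k
    using D that by (simp add: log_LG_def)
  have inj: "inj_on (ray D) {1..rk D}"
  proof (rule inj_onI)
    fix i k assume "i \<in> {1..rk D}" "k \<in> {1..rk D}" "ray D i = ray D k"
    then show "i = k" using dual[of i k] dual[of k k] by (auto split: if_splits)
  qed
  have "lattice_basis (ray D ` {1..rk D})" using D by (simp add: log_LG_def)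
  then obtain f where f: "basis_coords (ray D ` {1..rk D}) f" using lattice_basis_coords by blast
  have e: "v = (\<Sum>k=1..rk D. f (ray D k) v *s ray D k)"
    using basis_coordsD(2)[OF f, of v] unfolding sum.reindex[OF inj] comp_def .
  have "f (ray D k) v = pairing v (dual_vec D k)" if k: "k \<in> {1..rk D}" for k
  proof -
    have "pairing v (dual_vec D k) = pairing (\<Sum>k=1..rk D. f (ray D k) v *s ray D k) (dual_vec D k)" using e by simp
    also have "\<dots> = (\<Sum>l=1..rk D. f (ray D l) v * pairing (ray D l) (dual_vec D k))"
      using zlin_sum[OF zlin_pairing, of "\<lambda>k. f (ray D k) v"] by simp
    also have "\<dots> = (\<Sum>l=1..rk D. f (ray D l) v * (if l = k then 1 else 0))"
      using dual k by (intro sum.cong) auto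
    also have "\<dots> = f (ray D k) v" by (rule sum_mult_delta) (use k in auto)
    finally show ?thesis by simp
  qed
  then show ?thesis using e by (metis (no_types, lifting) sum.cong)
qed

text \<open>Combined with these coefficients, the relations of the dual basis isolate the ray
  \<open>i\<close> among the rays of \<open>S\<close>. This gives both the nonvanishing of the
  \<open>g_k\<close> off the origin and the elimination of repeated letters in words.\<close>

lemma dual_functional:
  assumes D: "log_LG (D :: 'n::finite toric)" and S: "S \<in> cones D" "i \<in> S"
  shows "\<exists>c :: nat \<Rightarrow> int. \<forall>j\<in>S. (\<Sum>k=1..rk D. c k * pairing (ray D j) (dual_vec D k)) = (if i = j then 1 else 0)"
proof -
  obtain h H where hc: "cone_coords D S h H"
    using cone_coords_exist[OF smooth[OF D] S(1)] by blast
  note h = cone_coordsD[OF hc]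
  have "h i (ray D j) = (\<Sum>k=1..rk D. h i (ray D k) * pairing (ray D j) (dual_vec D k))" for j
  proof -
    have "h i (ray D j) = h i (\<Sum>k=1..rk D. pairing (ray D j) (dual_vec D k) *s ray D k)"
      using dual_expansion[OF D, of "ray D j"] by simp
    also have "\<dots> = (\<Sum>k=1..rk D. h i (ray D k) * pairing (ray D j) (dual_vec D k))"
      using zlin_sum[OF h(1)[OF S(2)], of "\<lambda>k. pairing (ray D j) (dual_vec D k)"] by (simp add: mult.commute)
    finally show ?thesis .
  qed
  then show ?thesis using h(4)[OF S(2)] by (intro exI[of _ "\<lambda>k. h i (ray D k)"]) metis
qed

section \<open>Orientation of the maximal cones\<close>

definition row_det :: "nat \<Rightarrow> (nat \<Rightarrow> nat \<Rightarrow> int) \<Rightarrow> int" where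
  "row_det n r = (\<Sum>p | p permutes {1..n}. sign p * (\<Prod>k=1..n. r k (p k)))"

lemma row_det_cong: "(\<And>k l. k \<in> {1..n} \<Longrightarrow> r k l = s k l) \<Longrightarrow> row_det n r = row_det n s"
  unfolding row_det_def by (intro sum.cong arg_cong2[of _ _ _ _ "(*)"] prod.cong refl) auto

lemma row_det_swap:
  assumes ab: "a \<in> {1..n}" "b \<in> {1..n}" "a \<noteq> b"
  shows "row_det n (r \<circ> Transposition.transpose a b) = - row_det n r"
proof -
  let ?t = "Transposition.transpose a b"
  have t: "?t permutes {1..n}" using ab by (intro permutes_swap_id) auto
  have "row_det n (r \<circ> ?t) = (\<Sum>p | p permutes {1..n}. sign (p \<circ> ?t) * (\<Prod>k=1..n. (r \<circ> ?t) k ((p \<circ> ?t) k)))"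
    unfolding row_det_def by (rule sum_permutations_compose_right[OF t])
  also have "\<dots> = (\<Sum>p | p permutes {1..n}. - (sign p * (\<Prod>k=1..n. r k (p k))))"
  proof (rule sum.cong[OF refl])
    fix p assume "p \<in> {p. p permutes {1..n}}"
    then have p: "p permutes {1..n}" by simp
    have "sign (p \<circ> ?t) = sign p * sign ?t"
      by (rule sign_compose) (use p t in \<open>auto intro: permutation_permutes[THEN iffD2]\<close>)
    then have s: "sign (p \<circ> ?t) = - sign p" using ab(3) by (simp add: sign_swap_id)
    have "(\<Prod>k=1..n. (r \<circ> ?t) k ((p \<circ> ?t) k)) = (\<Prod>k=1..n. r k (p k))"
      using prod.permute[OF t, of "\<lambda>k. r k (p k)"] by (simp add: comp_def)
    then show "sign (p \<circ> ?t) * (\<Prod>k=1..n. (r \<circ> ?t) k ((p \<circ> ?t) k)) = - (sign p * (\<Prod>k=1..n. r k (p k)))"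
      using s by simp
  qed
  finally show ?thesis by (simp add: sum_negf row_det_def)
qed

lemma row_det_equal_rows:
  assumes ab: "a \<in> {1..n}" "b \<in> {1..n}" "a \<noteq> b" and "r a = r b"
  shows "row_det n r = 0"
proof -
  have "r \<circ> Transposition.transpose a b = r"
    using assms(4) by (auto simp: fun_eq_iff Transposition.transpose_def)
  then show ?thesis using row_det_swap[OF ab, of r] by simp
qed

lemma row_det_linear_first:
  fixes q :: "int^'n \<Rightarrow> nat \<Rightarrow> int"
  assumes n: "n \<ge> 1" and q: "\<And>l. zlin (\<lambda>v. q v l)"
  shows "zlin (\<lambda>v. row_det n (\<lambda>k. if k = 1 then q v else r k))"
proof -
  have e: "row_det n (\<lambda>k. if k = 1 then s else r k) =
      (\<Sum>p | p permutes {1..n}. s (p 1) * (sign p * (\<Prod>k\<in>{1..n} - {1}. r k (p k))))" for s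
    unfolding row_det_def
  proof (rule sum.cong[OF refl])
    fix p :: "nat \<Rightarrow> nat"
    have "(\<Prod>k=1..n. (if k = 1 then s else r k) (p k)) = s (p 1) * (\<Prod>k\<in>{1..n} - {1}. (if k = 1 then s else r k) (p k))"
      using n by (subst prod.remove[of "{1..n}" 1]) auto
    also have "(\<Prod>k\<in>{1..n} - {1}. (if k = 1 then s else r k) (p k)) = (\<Prod>k\<in>{1..n} - {1}. r k (p k))"
      by (intro prod.cong) auto
    finally show "sign p * (\<Prod>k=1..n. (if k = 1 then s else r k) (p k)) = s (p 1) * (sign p * (\<Prod>k\<in>{1..n} - {1}. r k (p k)))"
      by simp
  qed
  show ?thesis unfolding e zlin_def
    by (simp add: zlin_add[OF q] zlin_scale[OF q] distrib_right sum.distrib sum_distrib_left mult.assoc)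
qed

definition cone_row :: "'n::finite toric \<Rightarrow> nat list \<Rightarrow> nat \<Rightarrow> nat \<Rightarrow> int" where
  "cone_row D xs k l = pairing (ray D (xs ! (k - 1))) (dual_vec D l)"

lemma frame_det_row_det: "frame_det D S = row_det (rk D) (cone_row D (sorted_list_of_set S))"
  unfolding frame_det_def row_det_def cone_row_def ..

text \<open>Induction from the right end of \<open>as\<close>: each step exchanges \<open>i\<close>
  with its left neighbour.\<close>

lemma row_det_move_front:
  "length (as @ i # bs) = n \<Longrightarrow> row_det n (cone_row D (as @ i # bs)) = (-1) ^ length as * row_det n (cone_row D (i # as @ bs))"
proof (induction as arbitrary: bs rule: rev_induct)
  case (snoc a as)
  let ?m = "length as"
  let ?t = "Transposition.transpose (?m + 1) (?m + 2)"
  have l: "length (as @ i # a # bs) = n" using snoc.prems by simp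
  have "row_det n (cone_row D ((as @ [a]) @ i # bs)) = row_det n (cone_row D (as @ i # a # bs) \<circ> ?t)"
  proof (rule row_det_cong)
    fix k q assume k: "k \<in> {1..n}"
    have "((as @ [a]) @ i # bs) ! (k - 1) = (as @ i # a # bs) ! (?t k - 1)"
    proof -
      consider "k - 1 < ?m" | "k = ?m + 1" | "k = ?m + 2" | "k > ?m + 2" using k by fastforce
      then show ?thesis
        by cases (use k in \<open>auto simp: nth_append Transposition.transpose_def nth_Cons split: nat.splits\<close>)
    qed
    then show "cone_row D ((as @ [a]) @ i # bs) k q = (cone_row D (as @ i # a # bs) \<circ> ?t) k q"
      by (simp add: cone_row_def)
  qed
  also have "\<dots> = - row_det n (cone_row D (as @ i # a # bs))"
    by (rule row_det_swap) (use l in auto)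
  also have "\<dots> = - ((-1) ^ length as * row_det n (cone_row D (i # as @ a # bs)))"
    using snoc.IH[OF l] by simp
  finally show ?case by simp
qed simp

lemma insort_split:
  "sorted xs \<Longrightarrow> i \<notin> set xs \<Longrightarrow> distinct xs \<Longrightarrow>
     \<exists>as bs. xs = as @ bs \<and> insort i xs = as @ i # bs \<and> length as = card {x \<in> set xs. x < i}" for i :: nat
proof (induction xs)
  case (Cons x xs)
  show ?case
  proof (cases "i \<le> x")
    case True
    then have "{y \<in> set (x # xs). y < i} = {}" using Cons.prems by auto
    then show ?thesis using True by (intro exI[of _ "[]"] exI[of _ "x # xs"]) simp
  next
    case False
    obtain as bs where ab: "xs = as @ bs" "insort i xs = as @ i # bs" "length as = card {x \<in> set xs. x < i}"
      using Cons by auto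
    have "{y \<in> set (x # xs). y < i} = insert x {y \<in> set xs. y < i}" using False by auto
    then have "card {y \<in> set (x # xs). y < i} = Suc (card {y \<in> set xs. y < i})" using Cons.prems by simp
    then show ?thesis using False ab by (intro exI[of _ "x # as"] exI[of _ bs]) simp
  qed
qed simp

text \<open>Sorting \<open>i\<close> into \<open>W\<close> costs exactly the sign
  \<open>shuffle_sign {i} W\<close>, which is why the two signs cancel in
  \<open>wall_balance\<close>.\<close>

lemma frame_det_insert:
  assumes "finite W" "i \<notin> W" "card W + 1 = rk D"
  shows "frame_det D (insert i W) = (-1) ^ card {w \<in> W. w < i} * row_det (rk D) (cone_row D (i # sorted_list_of_set W))"
proof -
  let ?xs = "sorted_list_of_set W"
  have "sorted_list_of_set (insert i W) = insort i ?xs" using assms by simp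
  moreover have "\<exists>as bs. ?xs = as @ bs \<and> insort i ?xs = as @ i # bs \<and> length as = card {x \<in> set ?xs. x < i}"
    by (rule insort_split) (use assms in auto)
  then obtain as bs where ab: "?xs = as @ bs" "insort i ?xs = as @ i # bs" "length as = card {x \<in> set ?xs. x < i}"
    by blast
  moreover have "length (as @ i # bs) = rk D"
    using arg_cong[OF ab(1), of length] assms(3) by simp
  moreover have "{x \<in> set ?xs. x < i} = {w \<in> W. w < i}" using assms(1) by simp
  ultimately show ?thesis
    using row_det_move_front[of as i bs "rk D" D] unfolding frame_det_row_det by metis
qed

text \<open>With the row of \<open>i\<close> in front, the determinant is a linear functional of
  \<open>ray D i\<close> that vanishes on the rays of \<open>W\<close>; by the wall relation it
  changes sign between the two cones at the wall.\<close>

lemma wall_balance: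
  assumes D: "log_LG (D :: 'n::finite toric)"
  shows "(\<Sum>i | i \<notin> W \<and> insert i W \<in> maxcones D. shuffle_sign {i} W / of_int (frame_det D (insert i W))) = (0 :: complex)"
proof (cases "\<exists>i. i \<notin> W \<and> insert i W \<in> maxcones D")
  case False
  then have "{i. i \<notin> W \<and> insert i W \<in> maxcones D} = {}" by blast
  then show ?thesis by (simp only: sum.empty)
next
  case True
  then obtain i where i: "i \<notin> W" "insert i W \<in> maxcones D" by blast
  obtain i' where i': "i' \<noteq> i" "{j. j \<notin> W \<and> insert j W \<in> maxcones D} = {i, i'}"
    using wall_two_cones[OF D i] by blast
  have fW: "finite W" using maxcone_finite[OF D i(2)] by simp
  have cW: "card W + 1 = rk D" using maxcone_card[OF D i(2)] i(1) fW by simp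
  \<comment> \<open>The label \<open>0\<close> is a placeholder: the case \<open>k = 1\<close>
    overrides its row, and it moves the rows of \<open>W\<close> to the places from \<open>2\<close>
    on.\<close>
  define g where "g v = row_det (rk D) (\<lambda>k. if k = 1 then (\<lambda>l. pairing v (dual_vec D l)) else cone_row D (0 # sorted_list_of_set W) k)" for v
  have g: "zlin g" unfolding g_def
    by (rule row_det_linear_first) (use cW in \<open>auto intro: zlin_pairing\<close>)
  have g_ray: "g (ray D j) = row_det (rk D) (cone_row D (j # sorted_list_of_set W))" for j
    unfolding g_def by (rule row_det_cong) (auto simp: cone_row_def nth_Cons split: nat.splits)
  have gW: "g (ray D w) = 0" if w: "w \<in> W" for w
  proof -
    obtain a where a: "a < length (sorted_list_of_set W)" "sorted_list_of_set W ! a = w"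
      using w fW by (metis in_set_conv_nth set_sorted_list_of_set)
    show ?thesis unfolding g_ray
      by (rule row_det_equal_rows[of 1 _ "a + 2"]) (use a cW in \<open>auto simp: cone_row_def fun_eq_iff\<close>)
  qed
  have opp: "g (ray D i') = - g (ray D i)"
    using zlin_wall[OF D i _ _ _ g gW] i' by blast
  have tm: "shuffle_sign {j} W / of_int (frame_det D (insert j W)) = 1 / (of_int (g (ray D j)) :: complex)"
    if "j \<notin> W" for j
  proof -
    have "frame_det D (insert j W) = (-1) ^ card {w \<in> W. w < j} * g (ray D j)"
      using frame_det_insert[OF fW that cW] g_ray by simp
    then have "of_int (frame_det D (insert j W)) = shuffle_sign {j} W * (of_int (g (ray D j)) :: complex)"
      by (simp add: shuffle_sign_singleton)
    then show ?thesis using shuffle_sign_cases[of "{j}" W] by auto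
  qed
  have "i' \<notin> W" using i' by blast
  then show ?thesis unfolding i'(2) using i'(1) by (simp add: tm i(1) opp)
qed

section \<open>Operators on polyvector fields\<close>

text \<open>
  The fields \<open>\<alpha>\<close> on the component of \<open>S\<close> and \<open>\<beta>\<close> on the component of \<open>S'\<close> have the same restriction to
  the part of \<open>coord_space W\<close> in \<open>U\<close>, up to order \<open>M\<close> in \<open>u\<close>.
\<close>

definition agree :: "'n::finite toric \<Rightarrow> nat set \<Rightarrow> (nat \<Rightarrow> complex) set \<Rightarrow> nat \<Rightarrow> pvu \<Rightarrow> nat set \<Rightarrow> pvu \<Rightarrow> nat set \<Rightarrow> bool" where
  "agree D W U M \<alpha> S \<beta> S' \<longleftrightarrow>
     (\<forall>m\<le>M. \<forall>J\<subseteq>W. \<forall>K\<subseteq>{1..rk D}. \<forall>z\<in>coord_space W \<inter> U. \<alpha> m S J K z = \<beta> m S' J K z)"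

definition smooth_pv :: "'n::finite toric \<Rightarrow> nat set \<Rightarrow> (nat \<Rightarrow> complex) set \<Rightarrow> pvu \<Rightarrow> bool" where
  "smooth_pv D S U \<alpha> \<longleftrightarrow> (\<forall>m. \<forall>J\<subseteq>S. \<forall>K\<subseteq>{1..rk D}. smooth_in S U (\<alpha> m S J K))"

definition lincomb :: "'x set \<Rightarrow> ('x \<Rightarrow> complex) \<Rightarrow> ('x \<Rightarrow> pvu) \<Rightarrow> pvu" where
  "lincomb A c \<alpha> = (\<lambda>m S J K z. \<Sum>x\<in>A. c x * \<alpha> x m S J K z)"

lemma agreeI:
  "(\<And>m J K z. m \<le> M \<Longrightarrow> J \<subseteq> W \<Longrightarrow> K \<subseteq> {1..rk D} \<Longrightarrow> z \<in> coord_space W \<Longrightarrow> z \<in> U \<Longrightarrow> \<alpha> m S J K z = \<beta> m S' J K z) \<Longrightarrow>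
     agree D W U M \<alpha> S \<beta> S'"
  by (auto simp: agree_def)

lemma agreeD:
  "agree D W U M \<alpha> S \<beta> S' \<Longrightarrow> m \<le> M \<Longrightarrow> J \<subseteq> W \<Longrightarrow> K \<subseteq> {1..rk D} \<Longrightarrow> z \<in> coord_space W \<Longrightarrow> z \<in> U \<Longrightarrow>
     \<alpha> m S J K z = \<beta> m S' J K z"
  by (auto simp: agree_def)

lemma agree_refl: "agree D W U M \<alpha> S \<alpha> S"
  by (simp add: agree_def)

lemma agree_sym: "agree D W U M \<alpha> S \<beta> S' \<Longrightarrow> agree D W U M \<beta> S' \<alpha> S"
  by (simp add: agree_def)

lemma agree_trans: "agree D W U M \<alpha> S \<beta> S' \<Longrightarrow> agree D W U M \<beta> S' \<gamma> S'' \<Longrightarrow> agree D W U M \<alpha> S \<gamma> S''"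
  by (simp add: agree_def)

lemma agree_lincomb:
  "(\<And>x. x \<in> A \<Longrightarrow> agree D W U M (\<alpha> x) S (\<beta> x) S') \<Longrightarrow> agree D W U M (lincomb A c \<alpha>) S (lincomb A c \<beta>) S'"
  unfolding agree_def lincomb_def by (auto intro!: sum.cong)

lemma smooth_pvD: "smooth_pv D S U \<alpha> \<Longrightarrow> J \<subseteq> S \<Longrightarrow> K \<subseteq> {1..rk D} \<Longrightarrow> smooth_in S U (\<alpha> m S J K)"
  by (simp add: smooth_pv_def)

lemma smooth_pv_us: "smooth_pv D S U \<alpha> \<Longrightarrow> J \<subseteq> S \<Longrightarrow> K \<subseteq> {1..rk D} \<Longrightarrow> smooth_us S U (\<lambda>m. \<alpha> m S J K)"
  by (simp add: smooth_pv_def smooth_us_def)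

lemma smooth_pv_cong:
  assumes "open U" "smooth_pv D S U \<alpha>" "\<And>M. agree D S U M \<alpha> S \<beta> S"
  shows "smooth_pv D S U \<beta>"
  unfolding smooth_pv_def
proof (intro allI impI)
  fix m J K assume "J \<subseteq> S" "K \<subseteq> {1..rk D}"
  then show "smooth_in S U (\<beta> m S J K)"
    using smooth_in_cong[OF assms(1) smooth_pvD[OF assms(2)]] agreeD[OF assms(3)[of m]] by blast
qed

lemma smooth_pv_lincomb:
  "open U \<Longrightarrow> (\<And>x. x \<in> A \<Longrightarrow> smooth_pv D S U (\<alpha> x)) \<Longrightarrow> smooth_pv D S U (lincomb A c \<alpha>)"
  unfolding smooth_pv_def lincomb_def by (auto intro!: smooth_in_sum smooth_in_mult)

lemma smooth_pv_subset: "smooth_pv D S U \<alpha> \<Longrightarrow> U' \<subseteq> U \<Longrightarrow> smooth_pv D S U' \<alpha>"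
  unfolding smooth_pv_def using smooth_in_subset by blast

lemma theta_euler: "theta D k F z = (\<Sum>i=1..nrays D. of_int (pairing (ray D i) (dual_vec D k)) * euler i F z)"
  by (simp add: theta_def euler_def mult.assoc)

lemma del_cong:
  assumes "open U" "J \<subseteq> W" "K \<subseteq> {1..rk D}" "z \<in> coord_space W \<inter> U"
    and eq: "\<And>K z. K \<subseteq> {1..rk D} \<Longrightarrow> z \<in> coord_space W \<inter> U \<Longrightarrow> a S J K z = b S' J K z"
  shows "del D a S J K z = del D b S' J K z"
  unfolding del_def theta_euler
proof (intro sum.cong refl arg_cong2[of _ _ _ _ "(*)"])
  fix k i assume k: "k \<in> {1..rk D}"
  show "euler i (odd_deriv k a S J K) z = euler i (odd_deriv k b S' J K) z"
  proof (rule euler_cong[OF assms(1,4)])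
    fix z' assume "z' \<in> coord_space W \<inter> U"
    then show "odd_deriv k a S J K z' = odd_deriv k b S' J K z'"
      using eq[of "insert k K" z'] k assms(3) by (simp add: odd_deriv_def)
  qed
qed

lemma dbar_cong:
  assumes "open U" "J \<subseteq> W" "z \<in> coord_space W \<inter> U"
    and eq: "\<And>J z. J \<subseteq> W \<Longrightarrow> z \<in> coord_space W \<inter> U \<Longrightarrow> a S J K z = b S' J K z"
  shows "dbar a S J K z = dbar b S' J K z"
  unfolding dbar_def
proof (intro sum.cong refl arg_cong2[of _ _ _ _ "(*)"])
  fix i assume i: "i \<in> J"
  show "d_zbar i (a S (J - {i}) K) z = d_zbar i (b S' (J - {i}) K) z"
    by (rule d_zbar_cong[OF assms(1) _ assms(3) eq]) (use assms(2) i in auto)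
qed

text \<open>All operators are local, and one lemma of this form serves three purposes: replacing a
  field by an equivalent one, compatibility on the intersection of two components, and, with the
  zero field as \<open>\<beta>\<close>, control of supports.\<close>

lemma agree_Q_op:
  assumes "open U" "agree D W U M \<alpha> S \<beta> S'"
  shows "agree D W U M (Q_op D \<alpha>) S (Q_op D \<beta>) S'"
proof (rule agreeI)
  fix m J K z assume *: "m \<le> M" "J \<subseteq> W" "K \<subseteq> {1..rk D}" "z \<in> coord_space W" "z \<in> U"
  have 1: "dbar (\<alpha> m) S J K z = dbar (\<beta> m) S' J K z"
    by (rule dbar_cong[OF assms(1), where W = W]) (use * agreeD[OF assms(2)] in auto)
  have 2: "del D (\<alpha> (m - 1)) S J K z = del D (\<beta> (m - 1)) S' J K z"
    by (rule del_cong[OF assms(1), where W = W]) (use * agreeD[OF assms(2)] in auto)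
  show "Q_op D \<alpha> m S J K z = Q_op D \<beta> m S' J K z" unfolding Q_op_def 1 2 ..
qed

lemma agree_bracket:
  assumes "agree D W U M \<alpha> S \<beta> S'"
  shows "agree D W U M (\<lambda>m. bracket_f D (\<alpha> m)) S (\<lambda>m. bracket_f D (\<beta> m)) S'"
  by (rule agreeI) (use agreeD[OF assms] in \<open>auto simp: bracket_f_def odd_deriv_def intro!: sum.cong\<close>)

lemma Q_f_alt: "Q_f D \<alpha> m S J K z = Q_op D \<alpha> m S J K z + bracket_f D (\<alpha> m) S J K z"
  by (simp add: Q_f_def)

lemma agree_Q_f:
  assumes "open U" "agree D W U M \<alpha> S \<beta> S'"
  shows "agree D W U M (Q_f D \<alpha>) S (Q_f D \<beta>) S'"
  using agree_Q_op[OF assms] agree_bracket[OF assms(2)] by (auto simp: agree_def Q_f_alt)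

text \<open>On the component of \<open>S\<close> this is \<open>g_k + u theta_k\<close>.\<close>

definition Bop :: "'n::finite toric \<Rightarrow> nat set \<Rightarrow> nat \<Rightarrow> useries \<Rightarrow> useries" where
  "Bop D S k F = (\<lambda>m z. \<Sum>i\<in>S. of_int (pairing (ray D i) (dual_vec D k)) * Dop i F m z)"

text \<open>The part \<open>u del + {f, -}\<close> of \<open>Q_f\<close>, written as the Koszul
  differential of the operators \<open>Bop D S k\<close>. In this form \<open>Q_f\<close> is built
  from \<open>d_zbar\<close> and \<open>Dop\<close> alone.\<close>

definition iota_part :: "'n::finite toric \<Rightarrow> pvu \<Rightarrow> pvu" where
  "iota_part D \<alpha> = (\<lambda>m S J K z. (-1) ^ card J *
     (\<Sum>k\<in>{1..rk D} - K. shuffle_sign {k} K * Bop D S k (\<lambda>m. \<alpha> m S J (insert k K)) m z))"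

definition dbar_u :: "pvu \<Rightarrow> pvu" where
  "dbar_u \<alpha> = (\<lambda>m. dbar (\<alpha> m))"

lemma sum_coord_space:
  assumes "S \<subseteq> {1..n::nat}" "\<And>i. i \<notin> S \<Longrightarrow> h i = (0::complex)"
  shows "(\<Sum>i=1..n. h i) = (\<Sum>i\<in>S. h i)"
  by (rule sum.mono_neutral_right) (use assms in auto)

lemma subset_Diff1: "J \<subseteq> S \<Longrightarrow> J - A \<subseteq> S"
  by auto

lemma sum_restrict:
  assumes "finite N" "\<And>k. k \<in> N \<Longrightarrow> h k = (if k \<in> K then 0 else h' k)"
  shows "(\<Sum>k\<in>N. h k) = (\<Sum>k\<in>N - K. h' k :: complex)"
  by (rule sum.mono_neutral_cong_right) (use assms in auto)

section \<open>The differential as \<open>dbar\<close> plus a Koszul differential\<close>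

context
  fixes D :: "'n::finite toric" and S :: "nat set" and U :: "(nat \<Rightarrow> complex) set"
  assumes S: "S \<subseteq> {1..nrays D}" and U: "open U"
begin

lemma finite_S: "finite S"
  using S finite_subset by blast

lemma Q_f_split:
  assumes \<alpha>: "smooth_pv D S U \<alpha>"
  shows "agree D S U M (Q_f D \<alpha>) S (\<lambda>m S J K z. dbar_u \<alpha> m S J K z + iota_part D \<alpha> m S J K z) S"
proof (rule agreeI)
  fix m J K z assume J: "J \<subseteq> S" and K: "K \<subseteq> {1..rk D}" and z: "z \<in> coord_space S" "z \<in> U"
  let ?p = "\<lambda>i k. of_int (pairing (ray D i) (dual_vec D k)) :: complex"
  let ?F = "\<lambda>k m. \<alpha> m S J (insert k K)"
  have zz: "z \<in> coord_space S \<inter> U" using z by simp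
  have br: "bracket_f D (\<alpha> m) S J K z =
    (\<Sum>k\<in>{1..rk D} - K. (\<Sum>i\<in>S. ?p i k * z i) * ((-1) ^ card J * shuffle_sign {k} K * ?F k m z))"
    unfolding bracket_f_def
  proof (rule sum_restrict)
    fix k
    have "g_f D k z = (\<Sum>i\<in>S. ?p i k * z i)" unfolding g_f_def
      by (rule sum_coord_space[OF S]) (use coord_space_zero[OF z(1)] in auto)
    then show "g_f D k z * odd_deriv k (\<alpha> m) S J K z = (if k \<in> K then 0 else (\<Sum>i\<in>S. ?p i k * z i) * ((-1) ^ card J * shuffle_sign {k} K * ?F k m z))"
      by (simp add: odd_deriv_def)
  qed simp
  have dl: "del D (\<alpha> l) S J K z =
    (\<Sum>k\<in>{1..rk D} - K. (-1) ^ card J * shuffle_sign {k} K * (\<Sum>i\<in>S. ?p i k * euler i (?F k l) z))" for l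
    unfolding del_def
  proof (rule sum_restrict)
    fix k assume k: "k \<in> {1..rk D}"
    have sm: "smooth_in S U (?F k l)" by (rule smooth_pvD[OF \<alpha> J]) (use K k in auto)
    have e: "euler i (odd_deriv k (\<alpha> l) S J K) z = (if k \<in> K then 0 else (-1) ^ card J * shuffle_sign {k} K * euler i (?F k l) z)" for i
      using euler_cmult[OF zz sm, of i "(-1) ^ card J * shuffle_sign {k} K"] by (simp add: odd_deriv_def)
    have "theta D k (odd_deriv k (\<alpha> l) S J K) z = (\<Sum>i\<in>S. ?p i k * euler i (odd_deriv k (\<alpha> l) S J K) z)"
      unfolding theta_euler by (rule sum_coord_space[OF S]) (use euler_outside[OF z(1)] in auto)
    also have "\<dots> = (if k \<in> K then 0 else (-1) ^ card J * shuffle_sign {k} K * (\<Sum>i\<in>S. ?p i k * euler i (?F k l) z))"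
      unfolding e by (simp add: sum_distrib_left mult_ac)
    finally show "theta D k (odd_deriv k (\<alpha> l) S J K) z = (if k \<in> K then 0 else (-1) ^ card J * shuffle_sign {k} K * (\<Sum>i\<in>S. ?p i k * euler i (?F k l) z))" .
  qed simp
  have B: "Bop D S k (?F k) m z = (\<Sum>i\<in>S. ?p i k * z i) * ?F k m z + (if m = 0 then 0 else \<Sum>i\<in>S. ?p i k * euler i (?F k (m - 1)) z)" for k
    by (simp add: Bop_def Dop_def distrib_left sum.distrib sum_distrib_right mult.assoc)
  have "iota_part D \<alpha> m S J K z = (if m = 0 then 0 else del D (\<alpha> (m - 1)) S J K z) + bracket_f D (\<alpha> m) S J K z"
    unfolding iota_part_def B br dl
    by (simp add: distrib_left sum.distrib sum_distrib_left mult_ac)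
  then show "Q_f D \<alpha> m S J K z = dbar_u \<alpha> m S J K z + iota_part D \<alpha> m S J K z"
    by (simp add: Q_f_def Q_op_def dbar_u_def)
qed

lemma smooth_in_Bop: "smooth_us S U F \<Longrightarrow> smooth_in S U (Bop D S k F m)"
  unfolding Bop_def by (intro smooth_in_sum smooth_in_mult smooth_in_Dop U) auto

lemma smooth_us_Bop: "smooth_us S U F \<Longrightarrow> smooth_us S U (Bop D S k F)"
  using smooth_in_Bop by (simp add: smooth_us_def)

lemma smooth_dbar: "smooth_pv D S U \<alpha> \<Longrightarrow> smooth_pv D S U (dbar_u \<alpha>)"
  unfolding smooth_pv_def dbar_u_def dbar_def
  by (auto simp: subset_Diff1 intro!: smooth_in_sum smooth_in_mult smooth_in_d_zbar U)

lemma smooth_iota: "smooth_pv D S U \<alpha> \<Longrightarrow> smooth_pv D S U (iota_part D \<alpha>)"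
  unfolding iota_part_def
  by (auto simp: smooth_pv_def smooth_us_def intro!: smooth_in_sum smooth_in_mult smooth_in_Bop U)

lemma smooth_Q_f:
  assumes "smooth_pv D S U \<alpha>"
  shows "smooth_pv D S U (Q_f D \<alpha>)"
proof (rule smooth_pv_cong[OF U])
  show "smooth_pv D S U (\<lambda>m S J K z. dbar_u \<alpha> m S J K z + iota_part D \<alpha> m S J K z)"
    using smooth_dbar[OF assms] smooth_iota[OF assms] by (auto simp: smooth_pv_def intro!: smooth_in_add U)
  show "agree D S U M (\<lambda>m S J K z. dbar_u \<alpha> m S J K z + iota_part D \<alpha> m S J K z) S (Q_f D \<alpha>) S" for M
    by (rule agree_sym[OF Q_f_split[OF assms]])
qed

lemma smooth_bracket:
  assumes "smooth_pv D S U \<alpha>"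
  shows "smooth_pv D S U (\<lambda>m. bracket_f D (\<alpha> m))"
proof -
  have "smooth_in S U (\<lambda>z. g_f D k z * odd_deriv k (\<alpha> m) S J K z)" if "J \<subseteq> S" "K \<subseteq> {1..rk D}" "k \<in> {1..rk D}" for k m J K
    unfolding g_f_def odd_deriv_def using that smooth_pvD[OF assms, of J "insert k K" m]
    by (cases "k \<in> K") (auto intro!: smooth_in_sum smooth_in_mult U)
  then show ?thesis unfolding smooth_pv_def bracket_f_def by (auto intro!: smooth_in_sum U)
qed

lemma smooth_Q_op:
  assumes "smooth_pv D S U \<alpha>"
  shows "smooth_pv D S U (Q_op D \<alpha>)"
proof -
  have "Q_op D \<alpha> = (\<lambda>m S J K z. Q_f D \<alpha> m S J K z - bracket_f D (\<alpha> m) S J K z)"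
    by (simp add: Q_f_alt fun_eq_iff)
  then show ?thesis
    using smooth_Q_f[OF assms] smooth_bracket[OF assms] by (auto simp: smooth_pv_def intro!: smooth_in_diff U)
qed

lemma Bop_lin:
  assumes "z \<in> coord_space S \<inter> U" "\<And>x. x \<in> A \<Longrightarrow> smooth_us S U (F x)"
  shows "Bop D S k (\<lambda>m z. \<Sum>x\<in>A. c x * F x m z) m z = (\<Sum>x\<in>A. c x * Bop D S k (F x) m z)"
  unfolding Bop_def
  by (simp add: Dop_lin[OF U assms] sum_distrib_left sum.swap[of _ S] mult_ac)

lemma Bop_cong:
  assumes "z \<in> coord_space S \<inter> U" "\<And>l z. l \<le> m \<Longrightarrow> z \<in> coord_space S \<inter> U \<Longrightarrow> F l z = G l z"
  shows "Bop D S k F m z = Bop D S k G m z"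
  unfolding Bop_def using Dop_cong[OF U assms] by simp

lemma dbar_lincomb:
  assumes "\<And>x. x \<in> A \<Longrightarrow> smooth_pv D S U (\<alpha> x)"
  shows "agree D S U M (dbar_u (lincomb A c \<alpha>)) S (lincomb A c (\<lambda>x. dbar_u (\<alpha> x))) S"
proof (rule agreeI)
  fix m J K z assume J: "J \<subseteq> S" and K: "K \<subseteq> {1..rk D}" and z: "z \<in> coord_space S" "z \<in> U"
  have "d_zbar i (\<lambda>z. \<Sum>x\<in>A. c x * \<alpha> x m S (J - {i}) K z) z = (\<Sum>x\<in>A. c x * d_zbar i (\<alpha> x m S (J - {i}) K) z)" if "i \<in> J" for i
    by (rule d_zbar_lin[of i S z U]) (use that J K z U smooth_pvD[OF assms] in \<open>auto simp: subset_Diff1\<close>)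
  then have "dbar_u (lincomb A c \<alpha>) m S J K z = (\<Sum>i\<in>J. \<Sum>x\<in>A. c x * (shuffle_sign {i} (J - {i}) * d_zbar i (\<alpha> x m S (J - {i}) K) z))"
    unfolding dbar_u_def dbar_def lincomb_def by (simp add: sum_distrib_left mult_ac)
  also have "\<dots> = (\<Sum>x\<in>A. \<Sum>i\<in>J. c x * (shuffle_sign {i} (J - {i}) * d_zbar i (\<alpha> x m S (J - {i}) K) z))"
    by (rule sum.swap)
  finally show "dbar_u (lincomb A c \<alpha>) m S J K z = lincomb A c (\<lambda>x. dbar_u (\<alpha> x)) m S J K z"
    by (simp add: dbar_u_def dbar_def lincomb_def sum_distrib_left)
qed

lemma iota_lincomb:
  assumes "\<And>x. x \<in> A \<Longrightarrow> smooth_pv D S U (\<alpha> x)"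
  shows "agree D S U M (iota_part D (lincomb A c \<alpha>)) S (lincomb A c (\<lambda>x. iota_part D (\<alpha> x))) S"
proof (rule agreeI)
  fix m J K z assume J: "J \<subseteq> S" and K: "K \<subseteq> {1..rk D}" and z: "z \<in> coord_space S" "z \<in> U"
  have "Bop D S k (\<lambda>m z. \<Sum>x\<in>A. c x * \<alpha> x m S J (insert k K) z) m z = (\<Sum>x\<in>A. c x * Bop D S k (\<lambda>m. \<alpha> x m S J (insert k K)) m z)"
    if "k \<in> {1..rk D} - K" for k
    by (rule Bop_lin) (use that J K z smooth_pv_us[OF assms] in auto)
  then have "iota_part D (lincomb A c \<alpha>) m S J K z = (\<Sum>k\<in>{1..rk D} - K. \<Sum>x\<in>A.
      c x * ((-1) ^ card J * (shuffle_sign {k} K * Bop D S k (\<lambda>m. \<alpha> x m S J (insert k K)) m z)))"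
    unfolding iota_part_def lincomb_def by (simp add: sum_distrib_left mult_ac)
  also have "\<dots> = (\<Sum>x\<in>A. \<Sum>k\<in>{1..rk D} - K.
      c x * ((-1) ^ card J * (shuffle_sign {k} K * Bop D S k (\<lambda>m. \<alpha> x m S J (insert k K)) m z)))"
    by (rule sum.swap)
  finally show "iota_part D (lincomb A c \<alpha>) m S J K z = lincomb A c (\<lambda>x. iota_part D (\<alpha> x)) m S J K z"
    by (simp add: iota_part_def lincomb_def sum_distrib_left)
qed

lemma Q_f_lincomb:
  assumes "\<And>x. x \<in> A \<Longrightarrow> smooth_pv D S U (\<alpha> x)"
  shows "agree D S U M (Q_f D (lincomb A c \<alpha>)) S (lincomb A c (\<lambda>x. Q_f D (\<alpha> x))) S"
proof (rule agreeI)
  fix m J K z assume *: "m \<le> M" "J \<subseteq> S" "K \<subseteq> {1..rk D}" "z \<in> coord_space S" "z \<in> U"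
  have s: "smooth_pv D S U (lincomb A c \<alpha>)" by (rule smooth_pv_lincomb[OF U assms])
  have 1: "agree D S U M (dbar_u (lincomb A c \<alpha>)) S (lincomb A c (\<lambda>x. dbar_u (\<alpha> x))) S"
    by (rule dbar_lincomb[OF assms])
  have 2: "agree D S U M (iota_part D (lincomb A c \<alpha>)) S (lincomb A c (\<lambda>x. iota_part D (\<alpha> x))) S"
    by (rule iota_lincomb[OF assms])
  have "Q_f D (lincomb A c \<alpha>) m S J K z = lincomb A c (\<lambda>x. dbar_u (\<alpha> x)) m S J K z + lincomb A c (\<lambda>x. iota_part D (\<alpha> x)) m S J K z"
    using agreeD[OF Q_f_split[OF s] *] agreeD[OF 1 *] agreeD[OF 2 *] by simp
  also have "\<dots> = lincomb A c (\<lambda>x. Q_f D (\<alpha> x)) m S J K z"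
    unfolding lincomb_def sum.distrib[symmetric] distrib_left[symmetric]
    by (intro sum.cong refl arg_cong2[of _ _ _ _ "(*)"]) (use agreeD[OF Q_f_split[OF assms] *] in simp)
  finally show "Q_f D (lincomb A c \<alpha>) m S J K z = lincomb A c (\<lambda>x. Q_f D (\<alpha> x)) m S J K z" .
qed

lemma Q_op_lincomb:
  assumes "\<And>x. x \<in> A \<Longrightarrow> smooth_pv D S U (\<alpha> x)"
  shows "agree D S U M (Q_op D (lincomb A c \<alpha>)) S (lincomb A c (\<lambda>x. Q_op D (\<alpha> x))) S"
proof (rule agreeI)
  fix m J K z assume *: "m \<le> M" "J \<subseteq> S" "K \<subseteq> {1..rk D}" "z \<in> coord_space S" "z \<in> U"
  have l: "agree D S U M (Q_f D (lincomb A c \<alpha>)) S (lincomb A c (\<lambda>x. Q_f D (\<alpha> x))) S"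
    by (rule Q_f_lincomb[OF assms])
  have e: "Q_op D \<alpha> m S J K z = Q_f D \<alpha> m S J K z - bracket_f D (\<alpha> m) S J K z" for \<alpha> by (simp add: Q_f_alt)
  have b: "bracket_f D (lincomb A c \<alpha> m) S J K z = (\<Sum>x\<in>A. c x * bracket_f D (\<alpha> x m) S J K z)"
    unfolding bracket_f_def sum_distrib_left
    by (subst sum.swap, intro sum.cong) (auto simp: odd_deriv_def lincomb_def sum_distrib_left mult_ac)
  have f: "lincomb A c (\<lambda>x. Q_f D (\<alpha> x)) m S J K z = (\<Sum>x\<in>A. c x * Q_f D (\<alpha> x) m S J K z)"
    "lincomb A c (\<lambda>x. Q_op D (\<alpha> x)) m S J K z = (\<Sum>x\<in>A. c x * Q_op D (\<alpha> x) m S J K z)"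
    by (simp_all add: lincomb_def)
  show "Q_op D (lincomb A c \<alpha>) m S J K z = lincomb A c (\<lambda>x. Q_op D (\<alpha> x)) m S J K z"
    unfolding f(2) e b agreeD[OF l *] f(1) by (simp add: right_diff_distrib sum_subtractf)
qed

lemma Bop_Bop:
  assumes "smooth_us S U F" "z \<in> coord_space S \<inter> U"
  shows "Bop D S k (Bop D S l F) m z = Bop D S l (Bop D S k F) m z"
proof -
  let ?p = "\<lambda>i k. of_int (pairing (ray D i) (dual_vec D k)) :: complex"
  have e: "Bop D S k (Bop D S l F) m z = (\<Sum>i\<in>S. \<Sum>j\<in>S. ?p i k * ?p j l * Dop i (Dop j F) m z)" for k l
  proof -
    have "Bop D S k (Bop D S l F) m z = (\<Sum>j\<in>S. ?p j l * Bop D S k (Dop j F) m z)"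
      unfolding Bop_def[of D S l]
      by (rule Bop_lin[OF assms(2)]) (rule smooth_us_Dop[OF U assms(1)])
    also have "\<dots> = (\<Sum>j\<in>S. \<Sum>i\<in>S. ?p i k * ?p j l * Dop i (Dop j F) m z)"
      unfolding Bop_def sum_distrib_left by (simp add: mult_ac)
    also have "\<dots> = (\<Sum>i\<in>S. \<Sum>j\<in>S. ?p i k * ?p j l * Dop i (Dop j F) m z)"
      by (rule sum.swap)
    finally show ?thesis .
  qed
  have "(\<Sum>i\<in>S. \<Sum>j\<in>S. ?p i l * ?p j k * Dop i (Dop j F) m z) = (\<Sum>j\<in>S. \<Sum>i\<in>S. ?p i l * ?p j k * Dop i (Dop j F) m z)"
    by (rule sum.swap)
  also have "\<dots> = (\<Sum>i\<in>S. \<Sum>j\<in>S. ?p i k * ?p j l * Dop i (Dop j F) m z)"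
  proof (intro sum.cong refl)
    fix i j
    show "?p j l * ?p i k * Dop j (Dop i F) m z = ?p i k * ?p j l * Dop i (Dop j F) m z"
      unfolding Dop_Dop[OF U assms, of j i] by simp
  qed
  finally show ?thesis unfolding e by simp
qed

lemma d_zbar_Bop:
  assumes "smooth_us S U F" "z \<in> coord_space S \<inter> U" "j \<in> S"
  shows "d_zbar j (Bop D S k F m) z = Bop D S k (\<lambda>m. d_zbar j (F m)) m z"
proof -
  have "d_zbar j (Bop D S k F m) z = (\<Sum>i\<in>S. of_int (pairing (ray D i) (dual_vec D k)) * d_zbar j (Dop i F m) z)"
    unfolding Bop_def
    by (rule d_zbar_lin[OF assms(3,2) U]) (use smooth_in_Dop[OF U assms(1)] in auto)
  then show ?thesis unfolding Bop_def d_zbar_Dop[OF U assms] .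
qed

lemma agree_dbar_u:
  assumes "agree D S U M \<alpha> S \<beta> S"
  shows "agree D S U M (dbar_u \<alpha>) S (dbar_u \<beta>) S"
proof (rule agreeI)
  fix m J K z assume *: "m \<le> M" "J \<subseteq> S" "K \<subseteq> {1..rk D}" "z \<in> coord_space S" "z \<in> U"
  show "dbar_u \<alpha> m S J K z = dbar_u \<beta> m S J K z" unfolding dbar_u_def
    by (rule dbar_cong[OF U, where W = S]) (use * agreeD[OF assms] in auto)
qed

lemma agree_iota:
  assumes "agree D S U M \<alpha> S \<beta> S"
  shows "agree D S U M (iota_part D \<alpha>) S (iota_part D \<beta>) S"
proof (rule agreeI)
  fix m J K z assume *: "m \<le> M" "J \<subseteq> S" "K \<subseteq> {1..rk D}" "z \<in> coord_space S" "z \<in> U"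
  have "Bop D S k (\<lambda>m. \<alpha> m S J (insert k K)) m z = Bop D S k (\<lambda>m. \<beta> m S J (insert k K)) m z"
    if "k \<in> {1..rk D} - K" for k
    by (rule Bop_cong) (use * that agreeD[OF assms] in auto)
  then show "iota_part D \<alpha> m S J K z = iota_part D \<beta> m S J K z"
    unfolding iota_part_def by simp
qed

lemma dbar_dbar:
  assumes "smooth_pv D S U \<alpha>" and J: "J \<subseteq> S" and K: "K \<subseteq> {1..rk D}" and z: "z \<in> coord_space S \<inter> U"
  shows "dbar_u (dbar_u \<alpha>) m S J K z = 0"
proof -
  let ?f = "\<lambda>i j. shuffle_sign {i} (J - {i}) * shuffle_sign {j} (J - {i} - {j}) *
    d_zbar i (d_zbar j (\<alpha> m S (J - {i} - {j}) K)) z"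
  have fJ: "finite J" using J finite_S finite_subset by blast
  have sm: "smooth_in S U (\<alpha> m S (J - {i} - {j}) K)" for i j
    by (rule smooth_pvD[OF assms(1) _ K]) (use J in auto)
  have "dbar_u (dbar_u \<alpha>) m S J K z = (\<Sum>i\<in>J. \<Sum>j\<in>J - {i}. ?f i j)"
    unfolding dbar_u_def dbar_def[of "dbar _"]
  proof (rule sum.cong[OF refl])
    fix i assume i: "i \<in> J"
    have "d_zbar i (dbar (\<alpha> m) S (J - {i}) K) z =
       (\<Sum>j\<in>J - {i}. shuffle_sign {j} (J - {i} - {j}) * d_zbar i (d_zbar j (\<alpha> m S (J - {i} - {j}) K)) z)"
      unfolding dbar_def
      by (rule d_zbar_lin[OF _ z U]) (use i J sm in \<open>auto intro!: smooth_in_d_zbar U\<close>)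
    then show "shuffle_sign {i} (J - {i}) * d_zbar i (dbar (\<alpha> m) S (J - {i}) K) z = (\<Sum>j\<in>J - {i}. ?f i j)"
      by (simp add: sum_distrib_left mult.assoc)
  qed
  also have "\<dots> = 0"
  proof (rule sum_antisym_zero[OF fJ])
    fix i j assume ij: "i \<in> J" "j \<in> J" "i \<noteq> j"
    have e: "J - {j} - {i} = J - {i} - {j}" by auto
    have c: "d_zbar i (d_zbar j (\<alpha> m S (J - {i} - {j}) K)) z = d_zbar j (d_zbar i (\<alpha> m S (J - {i} - {j}) K)) z"
      by (rule d_zbar_d_zbar[OF U sm _ _ z]) (use ij J in auto)
    show "?f i j = - ?f j i"
      unfolding shuffle_sign_remove_anti[OF fJ ij] c e by simp
  qed
  finally show ?thesis .
qed

text \<open>The Koszul argument: the operators \<open>Bop\<close> commute, while the contractions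
  anticommute.\<close>

lemma iota_iota:
  assumes "smooth_pv D S U \<alpha>" and J: "J \<subseteq> S" and K: "K \<subseteq> {1..rk D}" and z: "z \<in> coord_space S \<inter> U"
  shows "iota_part D (iota_part D \<alpha>) m S J K z = 0"
proof -
  let ?F = "\<lambda>k l. Bop D S k (Bop D S l (\<lambda>m. \<alpha> m S J (insert l (insert k K)))) m z"
  let ?f = "\<lambda>k l. shuffle_sign {k} K * shuffle_sign {l} (insert k K) * ?F k l"
  have fK: "finite K" using K finite_subset by blast
  have sm: "smooth_us S U (\<lambda>m. \<alpha> m S J (insert l (insert k K)))" if "k \<in> {1..rk D}" "l \<in> {1..rk D}" for k l
    by (rule smooth_pv_us[OF assms(1) J]) (use K that in auto)
  have B: "Bop D S k (\<lambda>m. iota_part D \<alpha> m S J (insert k K)) m z =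
      (\<Sum>l\<in>{1..rk D} - K - {k}. (-1) ^ card J * shuffle_sign {l} (insert k K) * ?F k l)" if k: "k \<in> {1..rk D} - K" for k
  proof -
    have e: "{1..rk D} - insert k K = {1..rk D} - K - {k}" by auto
    have "(\<lambda>m. iota_part D \<alpha> m S J (insert k K)) = (\<lambda>m z. \<Sum>l\<in>{1..rk D} - K - {k}.
        ((-1) ^ card J * shuffle_sign {l} (insert k K)) * Bop D S l (\<lambda>m. \<alpha> m S J (insert l (insert k K))) m z)"
      unfolding iota_part_def e by (simp add: sum_distrib_left mult.assoc)
    then show ?thesis
      using Bop_lin[OF z, of "{1..rk D} - K - {k}" "\<lambda>l. Bop D S l (\<lambda>m. \<alpha> m S J (insert l (insert k K)))" k
          "\<lambda>l. (-1) ^ card J * shuffle_sign {l} (insert k K)" m] smooth_us_Bop[OF sm] k by auto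
  qed
  have s: "(\<Sum>k\<in>{1..rk D} - K. shuffle_sign {k} K * Bop D S k (\<lambda>m. iota_part D \<alpha> m S J (insert k K)) m z) =
      (-1) ^ card J * (\<Sum>k\<in>{1..rk D} - K. \<Sum>l\<in>{1..rk D} - K - {k}. ?f k l)"
    unfolding sum_distrib_left
  proof (rule sum.cong[OF refl])
    fix k assume k: "k \<in> {1..rk D} - K"
    show "shuffle_sign {k} K * Bop D S k (\<lambda>m. iota_part D \<alpha> m S J (insert k K)) m z =
        (\<Sum>l\<in>{1..rk D} - K - {k}. (-1) ^ card J * ?f k l)"
      unfolding B[OF k] sum_distrib_left by (intro sum.cong refl) simp
  qed
  have "iota_part D (iota_part D \<alpha>) m S J K z = (-1) ^ card J * ((-1) ^ card J * (\<Sum>k\<in>{1..rk D} - K. \<Sum>l\<in>{1..rk D} - K - {k}. ?f k l))"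
    unfolding iota_part_def[of D "iota_part D \<alpha>"] s ..
  also have "(\<Sum>k\<in>{1..rk D} - K. \<Sum>l\<in>{1..rk D} - K - {k}. ?f k l) = 0"
  proof (rule sum_antisym_zero)
    fix k l assume kl: "k \<in> {1..rk D} - K" "l \<in> {1..rk D} - K" "k \<noteq> l"
    have c: "?F k l = ?F l k"
      using Bop_Bop[OF sm z, of k l k l m] kl by (simp add: insert_commute)
    have sg: "shuffle_sign {k} K * shuffle_sign {l} (insert k K) = - (shuffle_sign {l} K * shuffle_sign {k} (insert l K))"
      by (rule shuffle_sign_insert_anti[OF fK]) (use kl in auto)
    show "?f k l = - ?f l k" unfolding c sg by simp
  qed simp
  finally show ?thesis by simp
qed

text \<open>\<open>dbar\<close> raises \<open>card J\<close> by one, which the factor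
  \<open>(-1) ^ card J\<close> of the contraction turns into a relative sign.\<close>

lemma dbar_iota:
  assumes "smooth_pv D S U \<alpha>" and J: "J \<subseteq> S" and K: "K \<subseteq> {1..rk D}" and z: "z \<in> coord_space S \<inter> U"
  shows "dbar_u (iota_part D \<alpha>) m S J K z + iota_part D (dbar_u \<alpha>) m S J K z = 0"
proof -
  let ?F = "\<lambda>i k. Bop D S k (\<lambda>m. d_zbar i (\<alpha> m S (J - {i}) (insert k K))) m z"
  let ?f = "\<lambda>i k. shuffle_sign {i} (J - {i}) * shuffle_sign {k} K * ?F i k"
  have fJ: "finite J" using J finite_S finite_subset by blast
  have sm: "smooth_us S U (\<lambda>m. \<alpha> m S (J - {i}) (insert k K))" if "k \<in> {1..rk D}" for i k
    by (rule smooth_pv_us[OF assms(1)]) (use J K that in auto)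
  have 1: "dbar_u (iota_part D \<alpha>) m S J K z = - ((-1) ^ card J * (\<Sum>i\<in>J. \<Sum>k\<in>{1..rk D} - K. ?f i k))"
  proof -
    have "d_zbar i (iota_part D \<alpha> m S (J - {i}) K) z = - ((-1) ^ card J * (\<Sum>k\<in>{1..rk D} - K. shuffle_sign {k} K * ?F i k))"
      if i: "i \<in> J" for i
    proof -
      have "card J = Suc (card (J - {i}))" by (rule card.remove[OF fJ i])
      then have "(-1 :: complex) ^ card (J - {i}) = - ((-1) ^ card J)" by simp
      then have "iota_part D \<alpha> m S (J - {i}) K = (\<lambda>z. \<Sum>k\<in>{1..rk D} - K. (- ((-1) ^ card J) * shuffle_sign {k} K) * Bop D S k (\<lambda>m. \<alpha> m S (J - {i}) (insert k K)) m z)"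
        unfolding iota_part_def by (simp add: sum_distrib_left mult.assoc)
      then have "d_zbar i (iota_part D \<alpha> m S (J - {i}) K) z = (\<Sum>k\<in>{1..rk D} - K. (- ((-1) ^ card J) * shuffle_sign {k} K) * d_zbar i (Bop D S k (\<lambda>m. \<alpha> m S (J - {i}) (insert k K)) m) z)"
        using d_zbar_lin[OF _ z U, of i "{1..rk D} - K" "\<lambda>k. Bop D S k (\<lambda>m. \<alpha> m S (J - {i}) (insert k K)) m" "\<lambda>k. - ((-1) ^ card J) * shuffle_sign {k} K"]
          i J smooth_in_Bop[OF sm] by auto
      also have "\<dots> = (\<Sum>k\<in>{1..rk D} - K. (- ((-1) ^ card J) * shuffle_sign {k} K) * ?F i k)"
        using d_zbar_Bop[OF sm z, of _ i] i J by (intro sum.cong refl) auto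
      finally show ?thesis by (simp add: sum_distrib_left sum_negf mult.assoc)
    qed
    then show ?thesis unfolding dbar_u_def dbar_def
      by (simp add: sum_distrib_left sum_negf mult_ac)
  qed
  have 2: "iota_part D (dbar_u \<alpha>) m S J K z = (-1) ^ card J * (\<Sum>k\<in>{1..rk D} - K. \<Sum>i\<in>J. ?f i k)"
  proof -
    have "Bop D S k (\<lambda>m. dbar_u \<alpha> m S J (insert k K)) m z = (\<Sum>i\<in>J. shuffle_sign {i} (J - {i}) * ?F i k)"
      if k: "k \<in> {1..rk D} - K" for k
    proof -
      have "smooth_us S U (\<lambda>m. d_zbar i (\<alpha> m S (J - {i}) (insert k K)))" if "i \<in> J" for i
        using sm[of k i] k that J by (auto simp: smooth_us_def intro!: smooth_in_d_zbar U)
      then show ?thesis unfolding dbar_u_def dbar_def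
        by (intro Bop_lin z) auto
    qed
    then show ?thesis unfolding iota_part_def by (simp add: sum_distrib_left mult_ac)
  qed
  show ?thesis unfolding 1 2 by (subst sum.swap) simp
qed

lemma Q_f_Q_f:
  assumes "smooth_pv D S U \<alpha>"
  shows "agree D S U M (Q_f D (Q_f D \<alpha>)) S (\<lambda>m S J K z. 0) S"
proof (rule agreeI)
  fix m J K z assume *: "m \<le> M" "J \<subseteq> S" "K \<subseteq> {1..rk D}" "z \<in> coord_space S" "z \<in> U"
  define a where "a b = (if b then dbar_u \<alpha> else iota_part D \<alpha>)" for b
  have sa: "smooth_pv D S U (a b)" for b using smooth_dbar[OF assms] smooth_iota[OF assms] by (simp add: a_def)
  have Y: "agree D S U M (Q_f D \<alpha>) S (lincomb UNIV (\<lambda>b. 1) a) S"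
    using Q_f_split[OF assms, of M] by (simp add: agree_def lincomb_def UNIV_bool a_def add.commute)
  have 1: "dbar_u (Q_f D \<alpha>) m S J K z = lincomb UNIV (\<lambda>b. 1) (\<lambda>x. dbar_u (a x)) m S J K z"
    by (rule agreeD[OF agree_trans[OF agree_dbar_u[OF Y] dbar_lincomb] *]) (rule sa)
  have 2: "iota_part D (Q_f D \<alpha>) m S J K z = lincomb UNIV (\<lambda>b. 1) (\<lambda>x. iota_part D (a x)) m S J K z"
    by (rule agreeD[OF agree_trans[OF agree_iota[OF Y] iota_lincomb] *]) (rule sa)
  have "Q_f D (Q_f D \<alpha>) m S J K z = dbar_u (Q_f D \<alpha>) m S J K z + iota_part D (Q_f D \<alpha>) m S J K z"
    by (rule agreeD[OF Q_f_split[OF smooth_Q_f[OF assms]] *])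
  also have "\<dots> = 0"
    unfolding 1 2 using dbar_dbar[OF assms *(2,3), of z m] iota_iota[OF assms *(2,3), of z m] dbar_iota[OF assms *(2,3), of z m] *(4,5)
    by (simp add: lincomb_def UNIV_bool a_def)
  finally show "Q_f D (Q_f D \<alpha>) m S J K z = 0" .
qed

text \<open>Contraction takes the coefficient at \<open>insert k K\<close> to the one at
  \<open>K\<close>, so an operator that depends on the \<open>theta\<close>-degree has to satisfy
  \<open>X k \<circ> D_i = D_i \<circ> X (k + 1)\<close>. The instances are the \<open>D_i\<close>
  themselves and the grading operator.\<close>

lemma Q_f_coefficientwise:
  fixes X :: "nat \<Rightarrow> useries \<Rightarrow> useries"
  assumes lin: "\<And>A :: nat set. \<And>c F k m z. z \<in> coord_space S \<inter> U \<Longrightarrow> (\<And>x. x \<in> A \<Longrightarrow> smooth_us S U (F x)) \<Longrightarrow>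
      X k (\<lambda>m z. \<Sum>x\<in>A. c x * F x m z) m z = (\<Sum>x\<in>A. c x * X k (F x) m z)"
    and add: "\<And>F G k m z. z \<in> coord_space S \<inter> U \<Longrightarrow> smooth_us S U F \<Longrightarrow> smooth_us S U G \<Longrightarrow>
      X k (\<lambda>m z. F m z + G m z) m z = X k F m z + X k G m z"
    and dz: "\<And>F i k m z. z \<in> coord_space S \<inter> U \<Longrightarrow> smooth_us S U F \<Longrightarrow> i \<in> S \<Longrightarrow>
      d_zbar i (X k F m) z = X k (\<lambda>m. d_zbar i (F m)) m z"
    and dop: "\<And>F i k m z. z \<in> coord_space S \<inter> U \<Longrightarrow> smooth_us S U F \<Longrightarrow>
      X k (Dop i F) m z = Dop i (X (Suc k) F) m z"
    and sm: "\<And>F k. smooth_us S U F \<Longrightarrow> smooth_us S U (X k F)"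
    and cong: "\<And>F G k m z. z \<in> coord_space S \<inter> U \<Longrightarrow> (\<And>l z. l \<le> m \<Longrightarrow> z \<in> coord_space S \<inter> U \<Longrightarrow> F l z = G l z) \<Longrightarrow>
      X k F m z = X k G m z"
    and \<alpha>: "smooth_pv D S U \<alpha>"
  shows "agree D S U M (Q_f D (\<lambda>m S J K z. X (card K) (\<lambda>m. \<alpha> m S J K) m z)) S
      (\<lambda>m S J K z. X (card K) (\<lambda>m. Q_f D \<alpha> m S J K) m z) S"
proof (rule agreeI)
  fix m J K z assume *: "m \<le> M" "J \<subseteq> S" "K \<subseteq> {1..rk D}" "z \<in> coord_space S" "z \<in> U"
  define \<beta> :: pvu where "\<beta> = (\<lambda>m S J K z. X (card K) (\<lambda>m. \<alpha> m S J K) m z)"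
  have z: "z \<in> coord_space S \<inter> U" using * by simp
  have fK: "finite K" using *(3) finite_subset by blast
  have \<beta>: "smooth_pv D S U \<beta>"
    unfolding smooth_pv_def \<beta>_def using sm[OF smooth_pv_us[OF \<alpha>]] by (simp add: smooth_us_def)
  have smA: "smooth_us S U (\<lambda>m. \<alpha> m S (J - {i}) K)" for i
    by (rule smooth_pv_us[OF \<alpha>]) (use * in auto)
  have smB: "smooth_us S U (\<lambda>m. \<alpha> m S J (insert k K))" if "k \<in> {1..rk D}" for k
    by (rule smooth_pv_us[OF \<alpha>]) (use * that in auto)
  have smC: "smooth_us S U (\<lambda>m. d_zbar i (\<alpha> m S (J - {i}) K))" if "i \<in> J" for i
    using smA[of i] that *(2) by (auto simp: smooth_us_def intro!: smooth_in_d_zbar U)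
  have d: "dbar_u \<beta> m S J K z = X (card K) (\<lambda>m. dbar_u \<alpha> m S J K) m z"
  proof -
    have "X (card K) (\<lambda>m z. \<Sum>i\<in>J. shuffle_sign {i} (J - {i}) * d_zbar i (\<alpha> m S (J - {i}) K) z) m z =
      (\<Sum>i\<in>J. shuffle_sign {i} (J - {i}) * X (card K) (\<lambda>m. d_zbar i (\<alpha> m S (J - {i}) K)) m z)"
      by (rule lin[OF z]) (rule smC)
    also have "\<dots> = (\<Sum>i\<in>J. shuffle_sign {i} (J - {i}) * d_zbar i (X (card K) (\<lambda>m. \<alpha> m S (J - {i}) K) m) z)"
      using dz[OF z smA, symmetric] *(2) by (intro sum.cong refl arg_cong2[of _ _ _ _ "(*)"]) auto
    finally show ?thesis unfolding dbar_u_def dbar_def \<beta>_def by simp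
  qed
  have Bk: "Bop D S k (\<lambda>m. \<beta> m S J (insert k K)) m z = X (card K) (Bop D S k (\<lambda>m. \<alpha> m S J (insert k K))) m z"
    if k: "k \<in> {1..rk D} - K" for k
  proof -
    have c: "card (insert k K) = Suc (card K)" using fK k by simp
    have "X (card K) (\<lambda>m z. \<Sum>i\<in>S. of_int (pairing (ray D i) (dual_vec D k)) * Dop i (\<lambda>m. \<alpha> m S J (insert k K)) m z) m z =
      (\<Sum>i\<in>S. of_int (pairing (ray D i) (dual_vec D k)) * X (card K) (Dop i (\<lambda>m. \<alpha> m S J (insert k K))) m z)"
      by (rule lin[OF z]) (use smB k in \<open>auto intro!: smooth_us_Dop U\<close>)
    also have "\<dots> = (\<Sum>i\<in>S. of_int (pairing (ray D i) (dual_vec D k)) * Dop i (X (Suc (card K)) (\<lambda>m. \<alpha> m S J (insert k K))) m z)"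
      using dop[OF z smB] k by (intro sum.cong refl arg_cong2[of _ _ _ _ "(*)"]) auto
    finally show ?thesis unfolding Bop_def \<beta>_def c by simp
  qed
  have i: "iota_part D \<beta> m S J K z = X (card K) (\<lambda>m. iota_part D \<alpha> m S J K) m z"
  proof -
    have "X (card K) (\<lambda>m z. \<Sum>k\<in>{1..rk D} - K. ((-1) ^ card J * shuffle_sign {k} K) * Bop D S k (\<lambda>m. \<alpha> m S J (insert k K)) m z) m z =
      (\<Sum>k\<in>{1..rk D} - K. ((-1) ^ card J * shuffle_sign {k} K) * X (card K) (Bop D S k (\<lambda>m. \<alpha> m S J (insert k K))) m z)"
      by (rule lin[OF z]) (use smB in \<open>auto intro!: smooth_us_Bop\<close>)
    then show ?thesis unfolding iota_part_def by (simp add: Bk sum_distrib_left mult.assoc)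
  qed
  have "Q_f D \<beta> m S J K z = dbar_u \<beta> m S J K z + iota_part D \<beta> m S J K z"
    by (rule agreeD[OF Q_f_split[OF \<beta>] *])
  also have "\<dots> = X (card K) (\<lambda>m z. dbar_u \<alpha> m S J K z + iota_part D \<alpha> m S J K z) m z"
    unfolding d i
    by (rule add[OF z, symmetric])
      (use smooth_pv_us[OF smooth_dbar[OF \<alpha>] *(2,3)] smooth_pv_us[OF smooth_iota[OF \<alpha>] *(2,3)] in auto)
  also have "\<dots> = X (card K) (\<lambda>m. Q_f D \<alpha> m S J K) m z"
    by (rule cong[OF z]) (use agreeD[OF Q_f_split[OF \<alpha>]] * in auto)
  finally show "Q_f D (\<lambda>m S J K z. X (card K) (\<lambda>m. \<alpha> m S J K) m z) m S J K z = X (card K) (\<lambda>m. Q_f D \<alpha> m S J K) m z"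
    unfolding \<beta>_def .
qed

end

section \<open>The contracting homotopy\<close>

definition vf :: "'n::finite toric \<Rightarrow> nat \<Rightarrow> (nat \<Rightarrow> complex) \<Rightarrow> complex" where
  "vf D l z = cnj (g_f D l z) / (\<Sum>k=1..rk D. g_f D k z * cnj (g_f D k z))"

lemma wedge_lin_right:
  "wedge a (\<lambda>S J K z. \<Sum>x\<in>A. c x * b x S J K z) S J K z = (\<Sum>x\<in>A. c x * wedge a (b x) S J K z)"
proof (induction A rule: infinite_finite_induct)
  case (insert x A)
  have "wedge a (\<lambda>S J K z. \<Sum>x\<in>insert x A. c x * b x S J K z) S J K z =
    c x * wedge a (b x) S J K z + wedge a (\<lambda>S J K z. \<Sum>x\<in>A. c x * b x S J K z) S J K z"
    using insert.hyps unfolding wedge_def by (simp add: sum.distrib algebra_simps sum_distrib_left)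
  then show ?case using insert by simp
qed (simp_all add: wedge_def)

lemma mult_V_lincomb: "mult_V D (lincomb A c \<alpha>) m S J K z = lincomb A c (\<lambda>x. mult_V D (\<alpha> x)) m S J K z"
  unfolding mult_V_def lincomb_def by (rule wedge_lin_right)

text \<open>\<open>V_f\<close> has degree one in the \<open>theta_k\<close> and contains no
  \<open>dzbar\<close>, so only the singletons \<open>K1 = {l}\<close> with \<open>J1 = {}\<close>
  survive in \<open>wedge\<close>.\<close>

lemma mult_V_eq:
  assumes "finite J" "K \<subseteq> {1..rk D}"
  shows "mult_V D \<alpha> m S J K z = (-1) ^ card J * (\<Sum>l\<in>K. shuffle_sign {l} (K - {l}) * (vf D l z * \<alpha> m S J (K - {l}) z))"
proof -
  have fK: "finite K" using assms(2) finite_subset by blast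
  let ?t = "\<lambda>J1 K1. (-1) ^ (card K1 * card (J - J1)) * shuffle_sign J1 (J - J1) * shuffle_sign K1 (K - K1) *
     V_f D S J1 K1 z * \<alpha> m S (J - J1) (K - K1) z"
  have V1: "V_f D S {} {l} z = vf D l z" if "l \<in> K" for l
  proof -
    have "V_f D S {} {l} z = (\<Sum>k=1..rk D. if k = l then vf D l z else 0)"
      unfolding V_f_def vf_def by (intro sum.cong) auto
    then show ?thesis using that assms(2) by auto
  qed
  have V0: "V_f D S J1 K1 z = 0" if "J1 \<noteq> {} \<or> K1 \<notin> (\<lambda>l. {l}) ` K" "K1 \<subseteq> K" for J1 K1
    unfolding V_f_def using that by (intro sum.neutral) auto
  have "mult_V D \<alpha> m S J K z = (\<Sum>J1\<in>Pow J. \<Sum>K1\<in>Pow K. ?t J1 K1)"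
    by (simp add: mult_V_def wedge_def)
  also have "\<dots> = (\<Sum>J1\<in>{{}}. \<Sum>K1\<in>Pow K. ?t J1 K1)"
    by (rule sum.mono_neutral_right) (use assms(1) V0 in \<open>auto intro!: sum.neutral\<close>)
  also have "\<dots> = (\<Sum>K1\<in>Pow K. ?t {} K1)" by simp
  also have "\<dots> = (\<Sum>K1\<in>(\<lambda>l. {l}) ` K. ?t {} K1)"
    by (rule sum.mono_neutral_right) (use fK V0 in auto)
  also have "\<dots> = (\<Sum>l\<in>K. ?t {} {l})"
    by (subst sum.reindex) (auto simp: inj_on_def)
  also have "\<dots> = (\<Sum>l\<in>K. (-1) ^ card J * (shuffle_sign {l} (K - {l}) * (vf D l z * \<alpha> m S J (K - {l}) z)))"
    by (intro sum.cong refl) (simp add: V1 shuffle_sign_def)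
  finally show ?thesis by (simp add: sum_distrib_left)
qed

lemma bracket_eq:
  "bracket_f D a S J K z = (-1) ^ card J * (\<Sum>k\<in>{1..rk D} - K. shuffle_sign {k} K * (g_f D k z * a S J (insert k K) z))"
  unfolding bracket_f_def sum_distrib_left by (rule sum_restrict) (auto simp: odd_deriv_def)

text \<open>Contraction with \<open>df\<close> is an odd derivation with value \<open>1\<close> on
  \<open>V_f\<close>. The mixed terms, \<open>k\<close> outside of \<open>K\<close> and
  \<open>l\<close> inside, cancel between the two compositions, and the diagonal terms add up to
  \<open>\<alpha>\<close>.\<close>

lemma bracket_mult_V:
  assumes "finite J" and K: "K \<subseteq> {1..rk D}" and one: "(\<Sum>k=1..rk D. g_f D k z * vf D k z) = 1"
  shows "bracket_f D (mult_V D \<alpha> m) S J K z + mult_V D (\<lambda>m. bracket_f D (\<alpha> m)) m S J K z = \<alpha> m S J K z"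
proof -
  let ?N = "{1..rk D}"
  have fK: "finite K" using K finite_subset by blast
  have sq: "(-1 :: complex) ^ card J * ((-1) ^ card J * x) = x" for x
    by (simp add: power_mult_distrib[symmetric] mult.assoc[symmetric])
  let ?x = "\<lambda>k l. shuffle_sign {l} (K - {l}) * (shuffle_sign {k} (K - {l}) * (g_f D k z * (vf D l z * \<alpha> m S J (insert k (K - {l})) z)))"
  have 1: "bracket_f D (mult_V D \<alpha> m) S J K z =
    (\<Sum>k\<in>?N - K. g_f D k z * vf D k z * \<alpha> m S J K z) - (\<Sum>k\<in>?N - K. \<Sum>l\<in>K. ?x k l)"
  proof -
    have "(-1) ^ card J * (shuffle_sign {k} K * (g_f D k z * mult_V D \<alpha> m S J (insert k K) z)) =
       g_f D k z * vf D k z * \<alpha> m S J K z - (\<Sum>l\<in>K. ?x k l)" if k: "k \<in> ?N - K" for k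
    proof -
      have "mult_V D \<alpha> m S J (insert k K) z = (-1) ^ card J *
         (\<Sum>l\<in>insert k K. shuffle_sign {l} (insert k K - {l}) * (vf D l z * \<alpha> m S J (insert k K - {l}) z))"
        by (rule mult_V_eq[OF assms(1)]) (use k K in auto)
      also have "(\<Sum>l\<in>insert k K. shuffle_sign {l} (insert k K - {l}) * (vf D l z * \<alpha> m S J (insert k K - {l}) z)) =
         shuffle_sign {k} K * (vf D k z * \<alpha> m S J K z) + (\<Sum>l\<in>K. shuffle_sign {l} (insert k (K - {l})) * (vf D l z * \<alpha> m S J (insert k (K - {l})) z))"
      proof -
        have "insert k K - {l} = insert k (K - {l})" if "l \<in> K" for l using that k by auto
        moreover have "insert k K - {k} = K" using k by auto
        ultimately show ?thesis using fK k by simp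
      qed
      finally have e: "(-1) ^ card J * (shuffle_sign {k} K * (g_f D k z * mult_V D \<alpha> m S J (insert k K) z)) =
         shuffle_sign {k} K * (g_f D k z * (shuffle_sign {k} K * (vf D k z * \<alpha> m S J K z))) +
         (\<Sum>l\<in>K. shuffle_sign {k} K * (g_f D k z * (shuffle_sign {l} (insert k (K - {l})) * (vf D l z * \<alpha> m S J (insert k (K - {l})) z))))"
        using sq by (simp add: algebra_simps sum_distrib_left)
      have "shuffle_sign {k} K * (g_f D k z * (shuffle_sign {l} (insert k (K - {l})) * (vf D l z * \<alpha> m S J (insert k (K - {l})) z))) = - ?x k l"
        if l: "l \<in> K" for l
      proof -
        let ?B = "K - {l}"
        have B: "finite ?B" "l \<notin> ?B" "k \<notin> ?B" "k \<noteq> l" using fK k l by auto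
        have K: "K = insert l ?B" using l by auto
        have "shuffle_sign {k} K = (if l < k then -1 else 1) * shuffle_sign {k} ?B"
          by (subst K) (rule shuffle_sign_insert[OF B(1,2)])
        moreover have "shuffle_sign {l} (insert k ?B) = (if k < l then -1 else 1) * shuffle_sign {l} ?B"
          by (rule shuffle_sign_insert[OF B(1,3)])
        moreover have "(if l < k then -1 else 1) * (if k < l then -1 else 1) = (-1 :: complex)" using B(4) by auto
        ultimately show ?thesis using B(4) by (cases "l < k") (simp_all add: not_less)
      qed
      then show ?thesis unfolding e by (simp add: sum_negf mult_ac)
    qed
    then show ?thesis unfolding bracket_eq sum_distrib_left by (simp add: sum_subtractf)
  qed
  have 2: "mult_V D (\<lambda>m. bracket_f D (\<alpha> m)) m S J K z =
    (\<Sum>l\<in>K. g_f D l z * vf D l z * \<alpha> m S J K z) + (\<Sum>l\<in>K. \<Sum>k\<in>?N - K. ?x k l)"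
  proof -
    have "(-1) ^ card J * (shuffle_sign {l} (K - {l}) * (vf D l z * bracket_f D (\<alpha> m) S J (K - {l}) z)) =
       g_f D l z * vf D l z * \<alpha> m S J K z + (\<Sum>k\<in>?N - K. ?x k l)" if l: "l \<in> K" for l
    proof -
      have "?N - (K - {l}) = insert l (?N - K)" "l \<notin> ?N - K" "insert l (K - {l}) = K" using l K by auto
      then have "bracket_f D (\<alpha> m) S J (K - {l}) z = (-1) ^ card J * (shuffle_sign {l} (K - {l}) * (g_f D l z * \<alpha> m S J K z) +
         (\<Sum>k\<in>?N - K. shuffle_sign {k} (K - {l}) * (g_f D k z * \<alpha> m S J (insert k (K - {l})) z)))"
        unfolding bracket_eq by simp
      then have "(-1) ^ card J * (shuffle_sign {l} (K - {l}) * (vf D l z * bracket_f D (\<alpha> m) S J (K - {l}) z)) =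
         shuffle_sign {l} (K - {l}) * (vf D l z * (shuffle_sign {l} (K - {l}) * (g_f D l z * \<alpha> m S J K z) +
         (\<Sum>k\<in>?N - K. shuffle_sign {k} (K - {l}) * (g_f D k z * \<alpha> m S J (insert k (K - {l})) z))))"
        using sq by (simp add: mult_ac)
      also have "\<dots> = g_f D l z * vf D l z * \<alpha> m S J K z + (\<Sum>k\<in>?N - K. ?x k l)"
        by (simp add: distrib_left sum_distrib_left mult_ac)
      finally show ?thesis .
    qed
    then show ?thesis unfolding mult_V_eq[OF assms(1) K] sum_distrib_left by (simp add: sum.distrib)
  qed
  have "(\<Sum>k\<in>?N - K. g_f D k z * vf D k z * \<alpha> m S J K z) + (\<Sum>l\<in>K. g_f D l z * vf D l z * \<alpha> m S J K z) =
     (\<Sum>k\<in>?N. g_f D k z * vf D k z * \<alpha> m S J K z)"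
    using sum.subset_diff[OF K, of "\<lambda>k. g_f D k z * vf D k z * \<alpha> m S J K z"] by simp
  also have "\<dots> = \<alpha> m S J K z" unfolding sum_distrib_right[symmetric] one by simp
  finally show ?thesis unfolding 1 2 using sum.swap[of ?x K "?N - K"] by (simp add: sum.swap[of _ K])
qed

lemma agree_mult_V:
  assumes "agree D W U M \<alpha> S \<beta> S'"
  shows "agree D W U M (mult_V D \<alpha>) S (mult_V D \<beta>) S'"
proof (rule agreeI)
  fix m J K z assume *: "m \<le> M" "J \<subseteq> W" "K \<subseteq> {1..rk D}" "z \<in> coord_space W" "z \<in> U"
  have "\<alpha> m S (J - J1) (K - K1) z = \<beta> m S' (J - J1) (K - K1) z" for J1 K1
    by (rule agreeD[OF assms *(1) _ _ *(4,5)]) (use * in auto)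
  moreover have "V_f D S J1 K1 z = V_f D S' J1 K1 z" for J1 K1 by (simp add: V_f_def)
  ultimately show "mult_V D \<alpha> m S J K z = mult_V D \<beta> m S' J K z"
    unfolding mult_V_def wedge_def by simp
qed

lemma agree_comm_Q_V:
  assumes "open U" "agree D W U M \<alpha> S \<beta> S'"
  shows "agree D W U M (comm_Q_V D \<alpha>) S (comm_Q_V D \<beta>) S'"
  using agree_Q_op[OF assms(1) agree_mult_V[OF assms(2)]] agree_mult_V[OF agree_Q_op[OF assms]]
  unfolding comm_Q_V_def agree_def by simp

lemma agree_comm_Q_V_pow:
  assumes "open U" "agree D W U M \<alpha> S \<beta> S'"
  shows "agree D W U M ((comm_Q_V D ^^ r) \<alpha>) S ((comm_Q_V D ^^ r) \<beta>) S'"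
  by (induction r) (use assms agree_comm_Q_V[OF assms(1)] in simp_all)

lemma agree_geom_inv:
  assumes "open U" "agree D W U M \<alpha> S \<beta> S'"
  shows "agree D W U M (geom_inv D \<alpha>) S (geom_inv D \<beta>) S'"
  using agree_comm_Q_V_pow[OF assms] unfolding geom_inv_def agree_def by simp

definition R_op :: "'n::finite toric \<Rightarrow> ((nat \<Rightarrow> real) \<Rightarrow> real) \<Rightarrow> pvu \<Rightarrow> pvu" where
  "R_op D R \<alpha> = (\<lambda>m S J K z. (1 - of_real (R (\<lambda>i. (cmod (z i))\<^sup>2))) * mult_V D (geom_inv D \<alpha>) m S J K z)"

lemma agree_R_op:
  assumes "open U" "agree D W U M \<alpha> S \<beta> S'"
  shows "agree D W U M (R_op D R \<alpha>) S (R_op D R \<beta>) S'"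
  using agree_mult_V[OF agree_geom_inv[OF assms]] unfolding R_op_def agree_def by simp

lemma agree_mult_cutoff:
  "agree D W U M \<alpha> S \<beta> S' \<Longrightarrow> agree D W U M (mult_cutoff R \<alpha>) S (mult_cutoff R \<beta>) S'"
  unfolding mult_cutoff_def agree_def by simp

lemma agree_comm_Q_cutoff:
  assumes "open U" "agree D W U M \<alpha> S \<beta> S'"
  shows "agree D W U M (comm_Q_cutoff D R \<alpha>) S (comm_Q_cutoff D R \<beta>) S'"
  using agree_Q_op[OF assms(1) agree_mult_cutoff[OF assms(2)]] agree_mult_cutoff[OF agree_Q_op[OF assms]]
  unfolding comm_Q_cutoff_def agree_def by simp

lemma agree_T_op:
  assumes "open U" "agree D W U M \<alpha> S \<beta> S'"
  shows "agree D W U M (T_op D R \<alpha>) S (T_op D R \<beta>) S'"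
  using agree_mult_cutoff[OF assms(2), of R] agree_comm_Q_cutoff[OF assms(1) agree_mult_V[OF agree_geom_inv[OF assms]], of R]
  unfolding T_op_def agree_def by simp

lemma zero_pv:
  "Q_op D (\<lambda>m S J K z. 0) m S J K z = 0" "Q_f D (\<lambda>m S J K z. 0) m S J K z = 0"
  "mult_V D (\<lambda>m S J K z. 0) m S J K z = 0" "comm_Q_V D (\<lambda>m S J K z. 0) = (\<lambda>m S J K z. 0)"
  "(comm_Q_V D ^^ r) (\<lambda>m S J K z. 0) = (\<lambda>m S J K z. 0)"
  "geom_inv D (\<lambda>m S J K z. 0) = (\<lambda>m S J K z. 0)"
  "R_op D R (\<lambda>m S J K z. 0) m S J K z = 0" "T_op D R (\<lambda>m S J K z. 0) m S J K z = 0"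
proof -
  have o: "odd_deriv k (\<lambda>S J K z. 0) S J K = (\<lambda>z. 0)" for k S J K by (simp add: odd_deriv_def fun_eq_iff)
  have Q: "Q_op D (\<lambda>m S J K z. 0) = (\<lambda>m S J K z. 0)"
    by (auto simp: Q_op_def dbar_def del_def o theta_euler fun_eq_iff)
  then show "Q_op D (\<lambda>m S J K z. 0) m S J K z = 0" by simp
  show "Q_f D (\<lambda>m S J K z. 0) m S J K z = 0" by (simp add: Q_f_def Q bracket_f_def o)
  have V: "mult_V D (\<lambda>m S J K z. 0) = (\<lambda>m S J K z. 0)" by (simp add: mult_V_def wedge_def fun_eq_iff)
  then show "mult_V D (\<lambda>m S J K z. 0) m S J K z = 0" by simp
  show C: "comm_Q_V D (\<lambda>m S J K z. 0) = (\<lambda>m S J K z. 0)" by (simp add: comm_Q_V_def V Q)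
  show CP: "(comm_Q_V D ^^ r) (\<lambda>m S J K z. 0) = (\<lambda>m S J K z. 0)" for r by (induction r) (simp_all add: C)
  show G: "geom_inv D (\<lambda>m S J K z. 0) = (\<lambda>m S J K z. 0)" by (simp add: geom_inv_def CP)
  show "R_op D R (\<lambda>m S J K z. 0) m S J K z = 0" by (simp add: R_op_def G V)
  show "T_op D R (\<lambda>m S J K z. 0) m S J K z = 0"
    by (simp add: T_op_def G V mult_cutoff_def comm_Q_cutoff_def Q)
qed

section \<open>The homotopy away from the origin\<close>

definition punctured :: "nat set \<Rightarrow> (nat \<Rightarrow> complex) set" where
  "punctured S = {z. \<exists>i\<in>S. 0 < cmod (z i)}"

lemma open_punctured: "open (punctured S)"
  unfolding punctured_def by (rule open_outside)

text \<open>Encoded as a \<open>lincomb\<close> over the booleans, so that linearity is proved only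
  once.\<close>

definition padd :: "complex \<Rightarrow> pvu \<Rightarrow> complex \<Rightarrow> pvu \<Rightarrow> pvu" where
  "padd c \<alpha> d \<beta> = lincomb UNIV (\<lambda>b. if b then c else d) (\<lambda>b. if b then \<alpha> else \<beta>)"

abbreviation zero_u :: pvu where "zero_u \<equiv> (\<lambda>m S J K z. 0)"

lemma padd_eq: "padd c \<alpha> d \<beta> m S J K z = c * \<alpha> m S J K z + d * \<beta> m S J K z"
  by (simp add: padd_def lincomb_def UNIV_bool add.commute)

lemma agree_padd:
  "agree D W U M \<alpha> S \<alpha>' S' \<Longrightarrow> agree D W U M \<beta> S \<beta>' S' \<Longrightarrow> agree D W U M (padd c \<alpha> d \<beta>) S (padd c \<alpha>' d \<beta>') S'"
  by (simp add: agree_def padd_eq)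

lemma smooth_pv_padd: "open U \<Longrightarrow> smooth_pv D S U \<alpha> \<Longrightarrow> smooth_pv D S U \<beta> \<Longrightarrow> smooth_pv D S U (padd c \<alpha> d \<beta>)"
  unfolding padd_def by (rule smooth_pv_lincomb) auto

lemma Q_f_padd:
  assumes "S \<subseteq> {1..nrays D}" "open U" "smooth_pv D S U \<alpha>" "smooth_pv D S U \<beta>"
  shows "agree D S U M (Q_f D (padd c \<alpha> d \<beta>)) S (padd c (Q_f D \<alpha>) d (Q_f D \<beta>)) S"
proof -
  have "agree D S U M (Q_f D (padd c \<alpha> d \<beta>)) S (lincomb UNIV (\<lambda>b. if b then c else d) (\<lambda>b. Q_f D (if b then \<alpha> else \<beta>))) S"
    unfolding padd_def by (rule Q_f_lincomb[OF assms(1,2)]) (use assms in auto)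
  then show ?thesis by (simp add: padd_def if_distrib[of "Q_f D"])
qed

lemma smooth_in_region_eq:
  assumes "coord_space S \<inter> U = coord_space S \<inter> U'" "smooth_in S U F"
  shows "smooth_in S U' F"
proof -
  have "Ck k S U F = Ck k S U' F" for k F
    by (induction k arbitrary: F) (simp_all add: assms(1))
  then show ?thesis using assms(2) by (simp add: smooth_in_def)
qed

context
  fixes D :: "'n::finite toric" and S :: "nat set"
  assumes D: "log_LG D" and S: "S \<in> maxcones D"
begin

lemma S_rays: "S \<subseteq> {1..nrays D}" and fin_S: "finite S"
  using maxcone_rays[OF D S] maxcone_finite[OF D S] by auto

text \<open>The functional dual to a ray of the cone recovers \<open>z i\<close> from the values
  \<open>g_f D k z\<close>, so these vanish together only at the origin.\<close>

lemma norm_g_nonzero: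
  assumes z: "z \<in> coord_space S" "z \<in> punctured S"
  shows "(\<Sum>k=1..rk D. g_f D k z * cnj (g_f D k z)) \<noteq> 0"
proof
  assume "(\<Sum>k=1..rk D. g_f D k z * cnj (g_f D k z)) = 0"
  then have "complex_of_real (\<Sum>k=1..rk D. (cmod (g_f D k z))\<^sup>2) = 0"
    by (simp only: of_real_sum complex_norm_square)
  then have "(\<Sum>k=1..rk D. (cmod (g_f D k z))\<^sup>2) = 0" by (simp only: of_real_eq_0_iff)
  then have g0: "g_f D k z = 0" if "k \<in> {1..rk D}" for k
    using that by (subst (asm) sum_nonneg_eq_0_iff) auto
  obtain i where i: "i \<in> S" "z i \<noteq> 0" using z(2) by (auto simp: punctured_def)
  obtain c :: "nat \<Rightarrow> int" where c: "\<forall>j\<in>S. (\<Sum>k=1..rk D. c k * pairing (ray D j) (dual_vec D k)) = (if i = j then 1 else 0)"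
    using dual_functional[OF D maxcone_cone[OF D S] i(1)] by blast
  have g: "g_f D k z = (\<Sum>j\<in>S. of_int (pairing (ray D j) (dual_vec D k)) * z j)" for k
    unfolding g_f_def by (rule sum_coord_space[OF S_rays]) (use coord_space_zero[OF z(1)] in auto)
  have "0 = (\<Sum>k=1..rk D. of_int (c k) * g_f D k z)" using g0 by simp
  also have "\<dots> = (\<Sum>j\<in>S. \<Sum>k=1..rk D. of_int (c k) * (of_int (pairing (ray D j) (dual_vec D k)) * z j))"
    unfolding g sum_distrib_left by (rule sum.swap)
  also have "\<dots> = (\<Sum>j\<in>S. z j * of_int (\<Sum>k=1..rk D. c k * pairing (ray D j) (dual_vec D k)))"
    by (simp add: sum_distrib_left mult_ac)
  also have "\<dots> = (\<Sum>j\<in>S. z j * (if i = j then 1 else 0))"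
    using c by (intro sum.cong) auto
  also have "\<dots> = z i" by (rule sum_mult_delta[OF fin_S i(1)])
  finally show False using i(2) by simp
qed

lemma sum_g_vf:
  assumes "z \<in> coord_space S" "z \<in> punctured S"
  shows "(\<Sum>k=1..rk D. g_f D k z * vf D k z) = 1"
  using norm_g_nonzero[OF assms] by (simp add: vf_def sum_divide_distrib[symmetric])

lemma smooth_in_g_f: "open U \<Longrightarrow> smooth_in S U (g_f D k)"
  unfolding g_f_def[abs_def] by (intro smooth_in_sum smooth_in_mult) auto

lemma smooth_vf: "smooth_in S (punctured S) (vf D l)"
  unfolding vf_def[abs_def]
  by (intro smooth_in_divide smooth_in_cnj smooth_in_sum smooth_in_mult smooth_in_g_f open_punctured)
    (use norm_g_nonzero in auto)

lemma smooth_mult_V: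
  assumes "smooth_pv D S (punctured S) \<alpha>"
  shows "smooth_pv D S (punctured S) (mult_V D \<alpha>)"
  unfolding smooth_pv_def
proof (intro allI impI)
  fix m J K assume J: "J \<subseteq> S" and K: "K \<subseteq> {1..rk D}"
  have "finite J" using J fin_S finite_subset by blast
  then have e: "mult_V D \<alpha> m S J K = (\<lambda>z. (-1) ^ card J * (\<Sum>l\<in>K. shuffle_sign {l} (K - {l}) * (vf D l z * \<alpha> m S J (K - {l}) z)))"
    using mult_V_eq[OF _ K] by blast
  show "smooth_in S (punctured S) (mult_V D \<alpha> m S J K)" unfolding e
    by (intro smooth_in_mult smooth_in_sum smooth_vf open_punctured smooth_in_const)
      (use smooth_pvD[OF assms J] K in \<open>auto simp: subset_Diff1\<close>)
qed

lemma smooth_comm_Q_V: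
  assumes "smooth_pv D S (punctured S) \<alpha>"
  shows "smooth_pv D S (punctured S) (comm_Q_V D \<alpha>)"
  using smooth_Q_op[OF S_rays open_punctured smooth_mult_V[OF assms]]
    smooth_mult_V[OF smooth_Q_op[OF S_rays open_punctured assms]]
  unfolding smooth_pv_def comm_Q_V_def by (auto intro!: smooth_in_add open_punctured)

lemma smooth_comm_Q_V_pow:
  "smooth_pv D S (punctured S) \<alpha> \<Longrightarrow> smooth_pv D S (punctured S) ((comm_Q_V D ^^ r) \<alpha>)"
  by (induction r) (simp_all add: smooth_comm_Q_V)

lemma mult_V_add:
  "mult_V D (\<lambda>m S J K z. a m S J K z + b m S J K z) m S' J K z = mult_V D a m S' J K z + mult_V D b m S' J K z"
  unfolding mult_V_def wedge_def by (simp add: distrib_left sum.distrib)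

text \<open>Since \<open>{f, -}\<close> and \<open>V_f\<close> anticommute to \<open>1\<close>, one
  has \<open>[Q, V] = [Q_f, V] - 1\<close>.\<close>

lemma comm_Q_V_eq:
  "agree D S (punctured S) M (comm_Q_V D \<alpha>) S
     (padd 1 (padd 1 (Q_f D (mult_V D \<alpha>)) 1 (mult_V D (Q_f D \<alpha>))) (-1) \<alpha>) S"
proof (rule agreeI)
  fix m J K z assume *: "m \<le> M" "J \<subseteq> S" "K \<subseteq> {1..rk D}" "z \<in> coord_space S" "z \<in> punctured S"
  have "finite J" using *(2) fin_S finite_subset by blast
  note b = bracket_mult_V[OF this *(3) sum_g_vf[OF *(4,5)], of \<alpha> m S]
  have Q: "Q_f D \<alpha> = (\<lambda>m S J K z. Q_op D \<alpha> m S J K z + bracket_f D (\<alpha> m) S J K z)"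
    by (simp add: Q_f_alt fun_eq_iff)
  show "comm_Q_V D \<alpha> m S J K z = padd 1 (padd 1 (Q_f D (mult_V D \<alpha>)) 1 (mult_V D (Q_f D \<alpha>))) (-1) \<alpha> m S J K z"
    unfolding padd_eq Q_f_alt[of D "mult_V D \<alpha>"] Q mult_V_add comm_Q_V_def b[symmetric] by simp
qed

text \<open>As \<open>Q_f\<close> squares to zero, \<open>[Q_f, V]\<close> commutes with
  \<open>Q_f\<close>: both compositions reduce to \<open>Q_f V Q_f\<close>.\<close>

lemma comm_Q_V_Q_f:
  assumes \<alpha>: "smooth_pv D S (punctured S) \<alpha>"
  shows "agree D S (punctured S) M (comm_Q_V D (Q_f D \<alpha>)) S (Q_f D (comm_Q_V D \<alpha>)) S"
proof (rule agreeI)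
  fix m J K z assume *: "m \<le> M" "J \<subseteq> S" "K \<subseteq> {1..rk D}" "z \<in> coord_space S" "z \<in> punctured S"
  note s = S_rays open_punctured[of S]
  note smQ = smooth_Q_f[OF s]
  note smV = smooth_mult_V
  have "mult_V D (Q_f D (Q_f D \<alpha>)) m S J K z = mult_V D zero_u m S J K z"
    by (rule agreeD[OF agree_mult_V[OF Q_f_Q_f[OF s \<alpha>]] *])
  then have 1: "comm_Q_V D (Q_f D \<alpha>) m S J K z = Q_f D (mult_V D (Q_f D \<alpha>)) m S J K z - Q_f D \<alpha> m S J K z"
    using agreeD[OF comm_Q_V_eq[of M "Q_f D \<alpha>"] *] by (simp add: padd_eq zero_pv)
  have "Q_f D (comm_Q_V D \<alpha>) m S J K z = Q_f D (padd 1 (padd 1 (Q_f D (mult_V D \<alpha>)) 1 (mult_V D (Q_f D \<alpha>))) (-1) \<alpha>) m S J K z"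
    by (rule agreeD[OF agree_Q_f[OF s(2) comm_Q_V_eq] *])
  also have "\<dots> = padd 1 (Q_f D (padd 1 (Q_f D (mult_V D \<alpha>)) 1 (mult_V D (Q_f D \<alpha>)))) (-1) (Q_f D \<alpha>) m S J K z"
    by (rule agreeD[OF Q_f_padd[OF s] *]) (intro smooth_pv_padd s smQ smV \<alpha>)+
  also have "\<dots> = padd 1 (Q_f D (Q_f D (mult_V D \<alpha>))) 1 (Q_f D (mult_V D (Q_f D \<alpha>))) m S J K z - Q_f D \<alpha> m S J K z"
  proof -
    have "Q_f D (padd 1 (Q_f D (mult_V D \<alpha>)) 1 (mult_V D (Q_f D \<alpha>))) m S J K z =
      padd 1 (Q_f D (Q_f D (mult_V D \<alpha>))) 1 (Q_f D (mult_V D (Q_f D \<alpha>))) m S J K z"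
      by (rule agreeD[OF Q_f_padd[OF s] *]) (intro smQ smV \<alpha>)+
    then show ?thesis by (simp add: padd_eq)
  qed
  also have "\<dots> = Q_f D (mult_V D (Q_f D \<alpha>)) m S J K z - Q_f D \<alpha> m S J K z"
    using agreeD[OF Q_f_Q_f[OF s smV[OF \<alpha>]] *] by (simp add: padd_eq)
  finally show "comm_Q_V D (Q_f D \<alpha>) m S J K z = Q_f D (comm_Q_V D \<alpha>) m S J K z" using 1 by simp
qed

lemma comm_Q_V_pow_Q_f:
  assumes \<alpha>: "smooth_pv D S (punctured S) \<alpha>"
  shows "agree D S (punctured S) M ((comm_Q_V D ^^ r) (Q_f D \<alpha>)) S (Q_f D ((comm_Q_V D ^^ r) \<alpha>)) S"
proof (induction r)
  case 0 then show ?case by (simp add: agree_refl)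
next
  case (Suc r)
  show ?case unfolding funpow.simps comp_def
    by (rule agree_trans[OF agree_comm_Q_V[OF open_punctured Suc] comm_Q_V_Q_f[OF smooth_comm_Q_V_pow[OF \<alpha>]]])
qed

lemma comm_Q_V_lincomb:
  assumes "\<And>x. x \<in> A \<Longrightarrow> smooth_pv D S (punctured S) (\<alpha> x)"
  shows "agree D S (punctured S) M (comm_Q_V D (lincomb A c \<alpha>)) S (lincomb A c (\<lambda>x. comm_Q_V D (\<alpha> x))) S"
proof (rule agreeI)
  fix m J K z assume *: "m \<le> M" "J \<subseteq> S" "K \<subseteq> {1..rk D}" "z \<in> coord_space S" "z \<in> punctured S"
  have V: "mult_V D (lincomb A c \<alpha>) = lincomb A c (\<lambda>x. mult_V D (\<alpha> x))" for c and \<alpha> :: "'a \<Rightarrow> pvu"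
    by (simp add: mult_V_lincomb fun_eq_iff)
  have 1: "agree D S (punctured S) M (Q_op D (lincomb A c (\<lambda>x. mult_V D (\<alpha> x)))) S (lincomb A c (\<lambda>x. Q_op D (mult_V D (\<alpha> x)))) S"
    by (rule Q_op_lincomb[OF S_rays open_punctured]) (rule smooth_mult_V[OF assms])
  have 2: "agree D S (punctured S) M (mult_V D (Q_op D (lincomb A c \<alpha>))) S (mult_V D (lincomb A c (\<lambda>x. Q_op D (\<alpha> x)))) S"
    by (rule agree_mult_V, rule Q_op_lincomb[OF S_rays open_punctured assms])
  show "comm_Q_V D (lincomb A c \<alpha>) m S J K z = lincomb A c (\<lambda>x. comm_Q_V D (\<alpha> x)) m S J K z"
    unfolding comm_Q_V_def V agreeD[OF 1 *] agreeD[OF 2 *]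
    by (simp add: lincomb_def sum.distrib distrib_left)
qed

text \<open>The filtration by the \<open>u\<close>-order plus the \<open>dzbar\<close>-degree.
  \<open>Q\<close> raises it by one and \<open>V_f\<close> preserves it; as the second summand is at
  most \<open>card S\<close>, the geometric series is finite in each \<open>u\<close>-order.\<close>

definition vanishes :: "nat \<Rightarrow> pvu \<Rightarrow> bool" where
  "vanishes r \<alpha> \<longleftrightarrow> (\<forall>m. \<forall>J\<subseteq>S. \<forall>K\<subseteq>{1..rk D}. \<forall>z\<in>coord_space S \<inter> punctured S. m + card J < r \<longrightarrow> \<alpha> m S J K z = 0)"

lemma vanishes_Q_op:
  assumes "vanishes r \<alpha>" shows "vanishes (Suc r) (Q_op D \<alpha>)"
  unfolding vanishes_def
proof (intro allI ballI impI)
  fix m J K z assume J: "J \<subseteq> S" and K: "K \<subseteq> {1..rk D}" and z: "z \<in> coord_space S \<inter> punctured S" and r: "m + card J < Suc r"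
  have fJ: "finite J" using J fin_S finite_subset by blast
  have "dbar (\<alpha> m) S J K z = 0" unfolding dbar_def
  proof (rule sum.neutral, rule ballI)
    fix i assume i: "i \<in> J"
    have "m + card (J - {i}) < r" using card.remove[OF fJ i] r by simp
    then have "d_zbar i (\<alpha> m S (J - {i}) K) z = d_zbar i (\<lambda>z. 0) z"
      using assms i J K unfolding vanishes_def by (intro d_zbar_cong[OF open_punctured _ z]) (auto simp: subset_Diff1)
    then show "shuffle_sign {i} (J - {i}) * d_zbar i (\<alpha> m S (J - {i}) K) z = 0" by simp
  qed
  moreover have "del D (\<alpha> (m - 1)) S J K z = 0" if "m \<noteq> 0"
  proof -
    have "del D (\<alpha> (m - 1)) S J K z = del D (\<lambda>S J K z. 0) S J K z"
      by (rule del_cong[OF open_punctured J K z]) (use assms that J r in \<open>auto simp: vanishes_def\<close>)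
    also have "\<dots> = 0" by (simp add: del_def theta_euler odd_deriv_def)
    finally show ?thesis .
  qed
  ultimately show "Q_op D \<alpha> m S J K z = 0" by (simp add: Q_op_def)
qed

lemma vanishes_mult_V:
  assumes "vanishes r \<alpha>" shows "vanishes r (mult_V D \<alpha>)"
  unfolding vanishes_def
proof (intro allI ballI impI)
  fix m J K z assume J: "J \<subseteq> S" and K: "K \<subseteq> {1..rk D}" and z: "z \<in> coord_space S \<inter> punctured S" and r: "m + card J < r"
  have fJ: "finite J" using J fin_S finite_subset by blast
  show "mult_V D \<alpha> m S J K z = 0" unfolding mult_V_eq[OF fJ K]
    using assms J K z r by (auto simp: vanishes_def subset_Diff1 intro!: sum.neutral)
qed

lemma vanishes_comm_Q_V_pow: "vanishes r ((comm_Q_V D ^^ r) \<alpha>)"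
proof (induction r)
  case 0 show ?case by (simp add: vanishes_def)
next
  case (Suc r)
  show ?case
    using vanishes_Q_op[OF vanishes_mult_V[OF Suc]] vanishes_mult_V[OF vanishes_Q_op[OF Suc]]
    by (simp add: vanishes_def comm_Q_V_def)
qed

definition partial_inv :: "nat \<Rightarrow> pvu \<Rightarrow> pvu" where
  "partial_inv N \<alpha> = lincomb {..N} (\<lambda>r. (-1) ^ r) (\<lambda>r. (comm_Q_V D ^^ r) \<alpha>)"

text \<open>Beyond \<open>M + card S\<close> the terms are zero by the filtration. Linearity,
  smoothness and commutation are available for finite sums, and pass to the series through this
  lemma.\<close>

lemma geom_inv_partial:
  assumes N: "M + card S \<le> N"
  shows "agree D S (punctured S) M (geom_inv D \<alpha>) S (partial_inv N \<alpha>) S"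
proof (rule agreeI)
  fix m J K z assume *: "m \<le> M" "J \<subseteq> S" "K \<subseteq> {1..rk D}" "z \<in> coord_space S" "z \<in> punctured S"
  have "card J \<le> card S" using *(2) fin_S by (rule card_mono[rotated])
  then have "(comm_Q_V D ^^ r) \<alpha> m S J K z = 0" if "r \<notin> {..N}" for r
    using vanishes_comm_Q_V_pow[of r \<alpha>] * that N by (auto simp: vanishes_def)
  then show "geom_inv D \<alpha> m S J K z = partial_inv N \<alpha> m S J K z"
    unfolding geom_inv_def partial_inv_def lincomb_def by (intro suminf_finite) auto
qed

lemma smooth_partial_inv:
  "smooth_pv D S (punctured S) \<alpha> \<Longrightarrow> smooth_pv D S (punctured S) (partial_inv N \<alpha>)"
  unfolding partial_inv_def by (intro smooth_pv_lincomb open_punctured smooth_comm_Q_V_pow)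

lemma smooth_geom_inv:
  assumes "smooth_pv D S (punctured S) \<alpha>"
  shows "smooth_pv D S (punctured S) (geom_inv D \<alpha>)"
  unfolding smooth_pv_def
proof (intro allI impI)
  fix m J K assume J: "J \<subseteq> S" and K: "K \<subseteq> {1..rk D}"
  show "smooth_in S (punctured S) (geom_inv D \<alpha> m S J K)"
    by (rule smooth_in_cong[OF open_punctured smooth_pvD[OF smooth_partial_inv[OF assms, of "m + card S"] J K, of m]])
      (use agreeD[OF geom_inv_partial[of m "m + card S" \<alpha>] order_refl J K] in auto)
qed

lemma geom_inv_Q_f:
  assumes \<alpha>: "smooth_pv D S (punctured S) \<alpha>"
  shows "agree D S (punctured S) M (geom_inv D (Q_f D \<alpha>)) S (Q_f D (geom_inv D \<alpha>)) S"
proof -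
  let ?N = "M + card S"
  have 1: "agree D S (punctured S) M (partial_inv ?N (Q_f D \<alpha>)) S (lincomb {..?N} (\<lambda>r. (-1) ^ r) (\<lambda>r. Q_f D ((comm_Q_V D ^^ r) \<alpha>))) S"
    unfolding partial_inv_def by (rule agree_lincomb) (rule comm_Q_V_pow_Q_f[OF \<alpha>])
  have 2: "agree D S (punctured S) M (Q_f D (partial_inv ?N \<alpha>)) S (lincomb {..?N} (\<lambda>r. (-1) ^ r) (\<lambda>r. Q_f D ((comm_Q_V D ^^ r) \<alpha>))) S"
    unfolding partial_inv_def by (rule Q_f_lincomb[OF S_rays open_punctured]) (rule smooth_comm_Q_V_pow[OF \<alpha>])
  show ?thesis
    by (rule agree_trans[OF geom_inv_partial[OF order_refl] agree_trans[OF 1 agree_trans[OF agree_sym[OF 2]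
          agree_sym[OF agree_Q_f[OF open_punctured geom_inv_partial[OF order_refl]]]]]])
qed

lemma geom_inv_right_inverse:
  assumes \<alpha>: "smooth_pv D S (punctured S) \<alpha>"
  shows "agree D S (punctured S) M (padd 1 (geom_inv D \<alpha>) 1 (comm_Q_V D (geom_inv D \<alpha>))) S \<alpha> S"
proof (rule agreeI)
  fix m J K z assume *: "m \<le> M" "J \<subseteq> S" "K \<subseteq> {1..rk D}" "z \<in> coord_space S" "z \<in> punctured S"
  let ?N = "M + card S"
  let ?w = "\<lambda>r. (comm_Q_V D ^^ r) \<alpha> m S J K z"
  have 1: "geom_inv D \<alpha> m S J K z = (\<Sum>r\<le>?N. (-1) ^ r * ?w r)"
    using agreeD[OF geom_inv_partial[OF order_refl] *] by (simp add: partial_inv_def lincomb_def)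
  have "agree D S (punctured S) M (comm_Q_V D (partial_inv ?N \<alpha>)) S (lincomb {..?N} (\<lambda>r. (-1) ^ r) (\<lambda>r. comm_Q_V D ((comm_Q_V D ^^ r) \<alpha>))) S"
    unfolding partial_inv_def by (rule comm_Q_V_lincomb) (rule smooth_comm_Q_V_pow[OF \<alpha>])
  from agreeD[OF agree_trans[OF agree_comm_Q_V[OF open_punctured geom_inv_partial[OF order_refl]] this] *]
  have 2: "comm_Q_V D (geom_inv D \<alpha>) m S J K z = (\<Sum>r\<le>?N. (-1) ^ r * ?w (Suc r))"
    by (simp add: lincomb_def)
  \<comment> \<open>Telescoping; the remaining term is zero because its order in the filtration
    exceeds \<open>m + card J\<close>.\<close>
  have tel: "(\<Sum>r\<le>n. (-1) ^ r * ?w r) + (\<Sum>r\<le>n. (-1) ^ r * ?w (Suc r)) = ?w 0 + (-1) ^ n * ?w (Suc n)" for n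
    by (induction n) (simp_all add: algebra_simps del: funpow.simps)
  have "card J \<le> card S" using *(2) fin_S by (rule card_mono[rotated])
  then have "?w (Suc ?N) = 0"
    using vanishes_comm_Q_V_pow[of "Suc ?N" \<alpha>] * by (auto simp: vanishes_def simp del: funpow.simps)
  then show "padd 1 (geom_inv D \<alpha>) 1 (comm_Q_V D (geom_inv D \<alpha>)) m S J K z = \<alpha> m S J K z"
    unfolding padd_eq 1 2 mult_1 tel by simp
qed

text \<open>Apply \<open>[Q_f, V] = 1 + [Q, V]\<close> to \<open>(1 + [Q, V])^-1 \<alpha>\<close>,
  and move \<open>Q_f\<close> through the inverse, with which it commutes.\<close>

lemma homotopy_punctured:
  assumes \<alpha>: "smooth_pv D S (punctured S) \<alpha>"
  shows "agree D S (punctured S) M (padd 1 (Q_f D (mult_V D (geom_inv D \<alpha>))) 1 (mult_V D (geom_inv D (Q_f D \<alpha>)))) S \<alpha> S"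
proof (rule agreeI)
  fix m J K z assume *: "m \<le> M" "J \<subseteq> S" "K \<subseteq> {1..rk D}" "z \<in> coord_space S" "z \<in> punctured S"
  have "mult_V D (geom_inv D (Q_f D \<alpha>)) m S J K z = mult_V D (Q_f D (geom_inv D \<alpha>)) m S J K z"
    by (rule agreeD[OF agree_mult_V[OF geom_inv_Q_f[OF \<alpha>]] *])
  then show "padd 1 (Q_f D (mult_V D (geom_inv D \<alpha>))) 1 (mult_V D (geom_inv D (Q_f D \<alpha>))) m S J K z = \<alpha> m S J K z"
    using agreeD[OF comm_Q_V_eq[of M "geom_inv D \<alpha>"] *] agreeD[OF geom_inv_right_inverse[OF \<alpha>] *]
    by (simp add: padd_eq)
qed

end

section \<open>The cutoff and the homotopy across the origin\<close>

lemma cutoff_near_zero: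
  assumes R: "is_cutoff D R" and S: "S \<subseteq> {1..nrays D}"
  shows "\<exists>V. open V \<and> coord_space S \<subseteq> punctured S \<union> V \<and>
     (\<forall>z\<in>coord_space S \<inter> V. R (\<lambda>i. (cmod (z i))\<^sup>2) = 1)"
proof -
  obtain e where e: "e > 0" "\<forall>t\<in>coord_space {1..nrays D}. (\<forall>i. 0 \<le> t i \<and> t i < e) \<longrightarrow> R t = 1"
    using R by (auto simp: is_cutoff_def)
  define V :: "(nat \<Rightarrow> complex) set" where "V = (\<Inter>i\<in>S. {z. (cmod (z i))\<^sup>2 < e})"
  have "finite S" using S finite_subset by blast
  moreover have "open {z :: nat \<Rightarrow> complex. (cmod (z i))\<^sup>2 < e}" for i
    by (intro open_Collect_less continuous_intros continuous_on_coord)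
  ultimately have "open V" unfolding V_def by blast
  moreover have "coord_space S \<subseteq> punctured S \<union> V"
    using e(1) by (auto simp: punctured_def V_def)
  moreover have "R (\<lambda>i. (cmod (z i))\<^sup>2) = 1" if "z \<in> coord_space S \<inter> V" for z
  proof -
    have z: "z i = 0" if "i \<notin> S" for i using \<open>z \<in> coord_space S \<inter> V\<close> that by (simp add: coord_space_def)
    have "(cmod (z i))\<^sup>2 = 0" if "i \<notin> {1..nrays D}" for i
    proof -
      have "i \<notin> S" using S that by blast
      then show ?thesis using z by simp
    qed
    then have "(\<lambda>i. (cmod (z i))\<^sup>2) \<in> coord_space {1..nrays D}"
      unfolding coord_space_def by blast
    moreover have "(cmod (z i))\<^sup>2 < e" for i
      using that z[of i] e(1) by (cases "i \<in> S") (auto simp: V_def)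
    ultimately show ?thesis using e(2) by simp
  qed
  ultimately show ?thesis by blast
qed

lemma cutoff_far:
  assumes R: "is_cutoff D R"
  shows "\<exists>B. \<forall>S\<subseteq>{1..nrays D}. \<forall>z\<in>coord_space S \<inter> {z. \<exists>i\<in>S. B < cmod (z i)}. R (\<lambda>i. (cmod (z i))\<^sup>2) = 0"
proof -
  obtain B where B: "\<forall>t\<in>coord_space {1..nrays D}. (\<forall>i. 0 \<le> t i) \<and> (\<exists>i. B < t i) \<longrightarrow> R t = 0"
    using R by (auto simp: is_cutoff_def)
  have "R (\<lambda>i. (cmod (z i))\<^sup>2) = 0" if S: "S \<subseteq> {1..nrays D}" and z: "z \<in> coord_space S" "i \<in> S" "max 1 B < cmod (z i)" for S z i
  proof -
    have "(\<lambda>i. (cmod (z i))\<^sup>2) \<in> coord_space {1..nrays D}"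
      using z(1) S by (auto simp: coord_space_def)
    \<comment> \<open>The \<open>1\<close> in \<open>max 1 B\<close> ensures that
      \<open>|z i|^2\<close> is at least \<open>|z i|\<close>.\<close>
    moreover have "B < (cmod (z i))\<^sup>2"
    proof -
      have "1 * cmod (z i) \<le> cmod (z i) * cmod (z i)" by (rule mult_right_mono) (use z(3) in auto)
      then show ?thesis using z(3) by (simp add: power2_eq_square)
    qed
    ultimately show ?thesis using B by (auto intro: zero_le_power2)
  qed
  then show ?thesis by (intro exI[of _ "max 1 B"]) blast
qed

context
  fixes D :: "'n::finite toric" and S :: "nat set" and R :: "(nat \<Rightarrow> real) \<Rightarrow> real"
  assumes D: "log_LG D" and S: "S \<in> maxcones D" and R: "is_cutoff D R"
begin

lemma smooth_cutoff: "open U \<Longrightarrow> smooth_in S U (\<lambda>z. of_real (R (\<lambda>i. (cmod (z i))\<^sup>2)))"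
proof -
  have "smooth_coord {1..nrays D} R" using R by (simp add: is_cutoff_def)
  from smooth_in_cutoff[OF this maxcone_rays[OF D S]]
  show "smooth_in S U (\<lambda>z. of_real (R (\<lambda>i. (cmod (z i))\<^sup>2)))" by (rule smooth_in_subset) simp
qed

lemma smooth_mult_cutoff: "open U \<Longrightarrow> smooth_pv D S U \<alpha> \<Longrightarrow> smooth_pv D S U (mult_cutoff R \<alpha>)"
  unfolding smooth_pv_def mult_cutoff_def by (auto intro!: smooth_in_mult smooth_cutoff)

lemma bracket_mult_cutoff:
  "bracket_f D (mult_cutoff R \<alpha> m) S' J K z = of_real (R (\<lambda>i. (cmod (z i))\<^sup>2)) * bracket_f D (\<alpha> m) S' J K z"
  unfolding bracket_eq mult_cutoff_def by (simp add: sum_distrib_left mult_ac)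

lemma comm_Q_cutoff_eq:
  "comm_Q_cutoff D R \<alpha> m S' J K z = Q_f D (mult_cutoff R \<alpha>) m S' J K z - of_real (R (\<lambda>i. (cmod (z i))\<^sup>2)) * Q_f D \<alpha> m S' J K z"
  unfolding comm_Q_cutoff_def Q_f_alt bracket_mult_cutoff by (simp add: mult_cutoff_def algebra_simps)

text \<open>Off the origin all ingredients are smooth; near it the factor \<open>1 - \<rho>\<close>
  vanishes identically and removes the singularity of \<open>V_f\<close>.\<close>

lemma smooth_R_op:
  assumes \<alpha>: "smooth_pv D S UNIV \<alpha>"
  shows "smooth_pv D S UNIV (R_op D R \<alpha>)"
proof -
  obtain V where V: "open V" "coord_space S \<subseteq> punctured S \<union> V" "\<forall>z\<in>coord_space S \<inter> V. R (\<lambda>i. (cmod (z i))\<^sup>2) = 1"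
    using cutoff_near_zero[OF R maxcone_rays[OF D S]] by blast
  have "smooth_pv D S (punctured S) (mult_V D (geom_inv D \<alpha>))"
    by (intro smooth_mult_V smooth_geom_inv D S smooth_pv_subset[OF \<alpha>]) simp
  then have 1: "smooth_in S (punctured S) (R_op D R \<alpha> m S J K)" if "J \<subseteq> S" "K \<subseteq> {1..rk D}" for m J K
    unfolding R_op_def using that
    by (intro smooth_in_mult smooth_in_diff smooth_cutoff open_punctured smooth_in_const) (simp add: smooth_pv_def)
  have 2: "smooth_in S V (R_op D R \<alpha> m S J K)" for m J K
    by (rule smooth_in_zero_on[OF V(1)]) (use V(3) in \<open>simp add: R_op_def\<close>)
  show ?thesis unfolding smooth_pv_def
  proof (intro allI impI)
    fix m J K assume "J \<subseteq> S" "K \<subseteq> {1..rk D}"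
    from smooth_in_union[OF open_punctured V(1) 1[OF this] 2]
    show "smooth_in S UNIV (R_op D R \<alpha> m S J K)"
      by (rule smooth_in_region_eq[rotated]) (use V(2) in auto)
  qed
qed

text \<open>Off the origin this follows from \<open>homotopy_punctured\<close> by commuting
  \<open>Q_f\<close> with \<open>\<rho>\<close>. In a neighbourhood of the origin
  \<open>\<rho>\<close> is \<open>1\<close>, and both sides reduce to
  \<open>\<alpha>\<close>.\<close>

lemma T_op_eq:
  assumes \<alpha>: "smooth_pv D S UNIV \<alpha>"
  shows "agree D S UNIV M (T_op D R \<alpha>) S (padd 1 \<alpha> (-1) (padd 1 (Q_f D (R_op D R \<alpha>)) 1 (R_op D R (Q_f D \<alpha>)))) S"
proof (rule agreeI)
  fix m J K and z :: "nat \<Rightarrow> complex" assume *: "m \<le> M" "J \<subseteq> S" "K \<subseteq> {1..rk D}" "z \<in> coord_space S"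
  obtain V where V: "open V" "coord_space S \<subseteq> punctured S \<union> V" "\<forall>z\<in>coord_space S \<inter> V. R (\<lambda>i. (cmod (z i))\<^sup>2) = 1"
    using cutoff_near_zero[OF R maxcone_rays[OF D S]] by blast
  define X where "X = mult_V D (geom_inv D \<alpha>)"
  define r where "r = complex_of_real (R (\<lambda>i. (cmod (z i))\<^sup>2))"
  have T: "T_op D R \<alpha> m S J K z = r * \<alpha> m S J K z + (Q_f D (mult_cutoff R X) m S J K z - r * Q_f D X m S J K z)"
    unfolding T_op_def comm_Q_cutoff_eq X_def[symmetric] by (simp add: mult_cutoff_def r_def)
  have RX: "R_op D R \<alpha> = padd 1 X (-1) (mult_cutoff R X)"
    by (simp add: R_op_def X_def mult_cutoff_def fun_eq_iff padd_eq algebra_simps)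
  consider "z \<in> punctured S" | "z \<in> V" using V(2) *(4) by auto
  then show "T_op D R \<alpha> m S J K z = padd 1 \<alpha> (-1) (padd 1 (Q_f D (R_op D R \<alpha>)) 1 (R_op D R (Q_f D \<alpha>))) m S J K z"
  proof cases
    case 1
    have \<alpha>': "smooth_pv D S (punctured S) \<alpha>" by (rule smooth_pv_subset[OF \<alpha>]) simp
    have X: "smooth_pv D S (punctured S) X"
      unfolding X_def by (intro smooth_mult_V smooth_geom_inv D S \<alpha>')
    have e1: "Q_f D (R_op D R \<alpha>) m S J K z = padd 1 (Q_f D X) (-1) (Q_f D (mult_cutoff R X)) m S J K z"
      unfolding RX
      by (rule agreeD[OF Q_f_padd[OF maxcone_rays[OF D S] open_punctured X smooth_mult_cutoff[OF open_punctured X]] * 1])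
    have e2: "R_op D R (Q_f D \<alpha>) m S J K z = (1 - r) * (\<alpha> m S J K z - Q_f D X m S J K z)"
    proof -
      have "Q_f D X m S J K z + mult_V D (geom_inv D (Q_f D \<alpha>)) m S J K z = \<alpha> m S J K z"
        using agreeD[OF homotopy_punctured[OF D S \<alpha>'] * 1] by (simp add: padd_eq X_def)
      then have "mult_V D (geom_inv D (Q_f D \<alpha>)) m S J K z = \<alpha> m S J K z - Q_f D X m S J K z"
        by (simp add: eq_diff_eq add.commute)
      then show ?thesis by (simp add: R_op_def r_def)
    qed
    show ?thesis unfolding T padd_eq e1 e2 by (simp add: algebra_simps)
  next
    case 2
    have r: "r = 1" using V(3) 2 *(4) by (simp add: r_def)
    have "agree D S V M (mult_cutoff R X) S X S" "agree D S V M (R_op D R \<alpha>) S zero_u S"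
      using V(3) by (auto simp: agree_def mult_cutoff_def R_op_def)
    from this[THEN agree_Q_f[OF V(1)]]
    have "Q_f D (mult_cutoff R X) m S J K z = Q_f D X m S J K z" "Q_f D (R_op D R \<alpha>) m S J K z = 0"
      using agreeD[OF _ * 2] zero_pv(2) by metis+
    moreover have "R_op D R (Q_f D \<alpha>) m S J K z = 0" using V(3) 2 *(4) by (simp add: R_op_def)
    ultimately show ?thesis unfolding T r by (simp add: padd_eq)
  qed
qed

lemma smooth_T_op:
  assumes \<alpha>: "smooth_pv D S UNIV \<alpha>"
  shows "smooth_pv D S UNIV (T_op D R \<alpha>)"
proof (rule smooth_pv_cong[OF open_UNIV _ agree_sym[OF T_op_eq[OF \<alpha>]]])
  note Q = smooth_Q_f[OF maxcone_rays[OF D S] open_UNIV]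
  show "smooth_pv D S UNIV (padd 1 \<alpha> (-1) (padd 1 (Q_f D (R_op D R \<alpha>)) 1 (R_op D R (Q_f D \<alpha>))))"
    by (intro smooth_pv_padd open_UNIV \<alpha> Q smooth_R_op)
qed

end

section \<open>Global polyvector fields\<close>

text \<open>Smoothness is taken in the sense of \<open>smooth_in\<close>, which asks for fewer
  directions than \<open>PV_log\<close> and is preserved by all the operators applied below.\<close>

definition good :: "'n::finite toric \<Rightarrow> pvu \<Rightarrow> bool" where
  "good D \<alpha> \<longleftrightarrow> (\<forall>S\<in>maxcones D. smooth_pv D S UNIV \<alpha>) \<and>
     (\<forall>S\<in>maxcones D. \<forall>S'\<in>maxcones D. \<forall>M. agree D (S \<inter> S') UNIV M \<alpha> S \<alpha> S')"

definition eqv :: "'n::finite toric \<Rightarrow> pvu \<Rightarrow> pvu \<Rightarrow> bool" where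
  "eqv D \<alpha> \<beta> \<longleftrightarrow> (\<forall>S\<in>maxcones D. \<forall>M. agree D S UNIV M \<alpha> S \<beta> S)"

definition supported :: "'n::finite toric \<Rightarrow> real \<Rightarrow> pvu \<Rightarrow> bool" where
  "supported D B \<alpha> \<longleftrightarrow> (\<forall>S\<in>maxcones D. \<forall>M. agree D S {z. \<exists>i\<in>S. B < cmod (z i)} M \<alpha> S zero_u S)"

definition compactly_supported :: "'n::finite toric \<Rightarrow> pvu \<Rightarrow> bool" where
  "compactly_supported D \<alpha> \<longleftrightarrow> (\<exists>B. supported D B \<alpha>)"

lemma eqvD: "eqv D \<alpha> \<beta> \<Longrightarrow> S \<in> maxcones D \<Longrightarrow> J \<subseteq> S \<Longrightarrow> K \<subseteq> {1..rk D} \<Longrightarrow> z \<in> coord_space S \<Longrightarrow> \<alpha> m S J K z = \<beta> m S J K z"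
  unfolding eqv_def by (blast dest: agreeD[where M = m, OF _ order_refl] intro: UNIV_I)

lemma eqvI:
  "(\<And>S m J K z. S \<in> maxcones D \<Longrightarrow> J \<subseteq> S \<Longrightarrow> K \<subseteq> {1..rk D} \<Longrightarrow> z \<in> coord_space S \<Longrightarrow> \<alpha> m S J K z = \<beta> m S J K z) \<Longrightarrow> eqv D \<alpha> \<beta>"
  unfolding eqv_def by (auto intro: agreeI)

lemma eqv_refl: "eqv D \<alpha> \<alpha>" and eqv_sym: "eqv D \<alpha> \<beta> \<Longrightarrow> eqv D \<beta> \<alpha>"
  and eqv_trans: "eqv D \<alpha> \<beta> \<Longrightarrow> eqv D \<beta> \<gamma> \<Longrightarrow> eqv D \<alpha> \<gamma>"
  unfolding eqv_def by (blast intro: agree_refl agree_sym agree_trans)+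

lemma eqv_padd: "eqv D \<alpha> \<alpha>' \<Longrightarrow> eqv D \<beta> \<beta>' \<Longrightarrow> eqv D (padd c \<alpha> d \<beta>) (padd c \<alpha>' d \<beta>')"
  unfolding eqv_def by (blast intro: agree_padd)

lemma eqv_Q_f: "eqv D \<alpha> \<beta> \<Longrightarrow> eqv D (Q_f D \<alpha>) (Q_f D \<beta>)"
  and eqv_R_op: "eqv D \<alpha> \<beta> \<Longrightarrow> eqv D (R_op D R \<alpha>) (R_op D R \<beta>)"
  and eqv_T_op: "eqv D \<alpha> \<beta> \<Longrightarrow> eqv D (T_op D R \<alpha>) (T_op D R \<beta>)"
  unfolding eqv_def by (simp_all add: agree_Q_f agree_R_op agree_T_op)

lemma eqv_zero:
  "eqv D \<alpha> zero_u \<Longrightarrow> eqv D (Q_f D \<alpha>) zero_u" "eqv D \<alpha> zero_u \<Longrightarrow> eqv D (R_op D R \<alpha>) zero_u"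
  "eqv D \<alpha> zero_u \<Longrightarrow> eqv D (T_op D R \<alpha>) zero_u"
proof -
  have Q: "Q_f D zero_u = zero_u" "R_op D R zero_u = zero_u" "T_op D R zero_u = zero_u"
    by (simp_all add: fun_eq_iff zero_pv)
  show "eqv D \<alpha> zero_u \<Longrightarrow> eqv D (Q_f D \<alpha>) zero_u" "eqv D \<alpha> zero_u \<Longrightarrow> eqv D (R_op D R \<alpha>) zero_u"
    "eqv D \<alpha> zero_u \<Longrightarrow> eqv D (T_op D R \<alpha>) zero_u"
    using eqv_Q_f[of D \<alpha> zero_u] eqv_R_op[of D \<alpha> zero_u R] eqv_T_op[of D \<alpha> zero_u R] by (simp_all add: Q)
qed

lemma good_smooth: "good D \<alpha> \<Longrightarrow> S \<in> maxcones D \<Longrightarrow> smooth_pv D S UNIV \<alpha>"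
  by (simp add: good_def)

lemma PV_log_good:
  assumes "\<alpha> \<in> PV_log_u D"
  shows "good D \<alpha>"
  using assms smooth_coord_imp_smooth_in
  unfolding good_def PV_log_u_def PV_log_def smooth_pv_def agree_def by simp

lemma good_padd: "good D \<alpha> \<Longrightarrow> good D \<beta> \<Longrightarrow> good D (padd c \<alpha> d \<beta>)"
  unfolding good_def by (blast intro: smooth_pv_padd agree_padd open_UNIV)

lemma good_lincomb: "(\<And>x. x \<in> A \<Longrightarrow> good D (\<alpha> x)) \<Longrightarrow> good D (lincomb A c \<alpha>)"
  unfolding good_def by (intro conjI ballI allI smooth_pv_lincomb agree_lincomb open_UNIV) blast+

lemma supportedD:
  assumes "supported D B \<alpha>" "S \<in> maxcones D" "J \<subseteq> S" "K \<subseteq> {1..rk D}" "z \<in> coord_space S" "i \<in> S" "B < cmod (z i)"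
  shows "\<alpha> m S J K z = 0"
proof -
  have "agree D S {z. \<exists>i\<in>S. B < cmod (z i)} m \<alpha> S zero_u S" using assms by (simp add: supported_def)
  from agreeD[OF this order_refl assms(3-5)] assms(6,7) show ?thesis by blast
qed

lemma supportedI:
  assumes "\<And>S m J K z i. S \<in> maxcones D \<Longrightarrow> J \<subseteq> S \<Longrightarrow> K \<subseteq> {1..rk D} \<Longrightarrow> z \<in> coord_space S \<Longrightarrow> i \<in> S \<Longrightarrow>
    B < cmod (z i) \<Longrightarrow> \<alpha> m S J K z = 0"
  shows "supported D B \<alpha>"
  unfolding supported_def
proof (intro ballI allI agreeI)
  fix S and M m :: nat and J K and z :: "nat \<Rightarrow> complex"
  assume "S \<in> maxcones D" "m \<le> M" "J \<subseteq> S" "K \<subseteq> {1..rk D}" "z \<in> coord_space S" "z \<in> {z. \<exists>i\<in>S. B < cmod (z i)}"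
  then show "\<alpha> m S J K z = 0" using assms by blast
qed

lemma supported_mono: "supported D B \<alpha> \<Longrightarrow> B \<le> B' \<Longrightarrow> supported D B' \<alpha>"
  by (rule supportedI) (rule supportedD[of D B], auto)

lemma supported_Q_f: "supported D B \<alpha> \<Longrightarrow> supported D B (Q_f D \<alpha>)"
  and supported_R_op: "supported D B \<alpha> \<Longrightarrow> supported D B (R_op D R \<alpha>)"
proof -
  have Q: "Q_f D zero_u = zero_u" "R_op D R zero_u = zero_u"
    by (simp_all add: fun_eq_iff zero_pv)
  assume "supported D B \<alpha>"
  then have z: "agree D S {z. \<exists>i\<in>S. B < cmod (z i)} M \<alpha> S zero_u S" if "S \<in> maxcones D" for S M
    using that by (simp add: supported_def)
  show "supported D B (Q_f D \<alpha>)" "supported D B (R_op D R \<alpha>)"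
    unfolding supported_def
    using agree_Q_f[OF open_outside z, unfolded Q] agree_R_op[OF open_outside z, where R = R, unfolded Q] by simp_all
qed

lemma supported_lincomb:
  assumes "\<And>x. x \<in> A \<Longrightarrow> supported D B (\<alpha> x)"
  shows "supported D B (lincomb A c \<alpha>)"
proof (rule supportedI)
  fix S m J K and z :: "nat \<Rightarrow> complex" and i
  assume *: "S \<in> maxcones D" "J \<subseteq> S" "K \<subseteq> {1..rk D}" "z \<in> coord_space S" "i \<in> S" "B < cmod (z i)"
  have "\<alpha> x m S J K z = 0" if "x \<in> A" for x by (rule supportedD[OF assms[OF that] *])
  then show "lincomb A c \<alpha> m S J K z = 0" by (simp add: lincomb_def)
qed

lemma compactly_supported_padd:
  assumes "compactly_supported D \<alpha>" "compactly_supported D \<beta>"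
  shows "compactly_supported D (padd c \<alpha> d \<beta>)"
proof -
  obtain B where B: "supported D B \<alpha>" using assms(1) unfolding compactly_supported_def ..
  obtain B' where B': "supported D B' \<beta>" using assms(2) unfolding compactly_supported_def ..
  have "supported D (max B B') \<alpha>" "supported D (max B B') \<beta>"
    by (rule supported_mono[OF B], simp, rule supported_mono[OF B'], simp)
  then have "supported D (max B B') (padd c \<alpha> d \<beta>)" unfolding padd_def by (intro supported_lincomb) auto
  then show ?thesis unfolding compactly_supported_def ..
qed

lemma compactly_supported_R_op: "compactly_supported D \<alpha> \<Longrightarrow> compactly_supported D (R_op D R \<alpha>)"
  unfolding compactly_supported_def using supported_R_op by blast

context
  fixes D :: "'n::finite toric" and R :: "(nat \<Rightarrow> real) \<Rightarrow> real"
  assumes D: "log_LG D" and R: "is_cutoff D R"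
begin

lemma good_Q_f: "good D \<alpha> \<Longrightarrow> good D (Q_f D \<alpha>)"
  unfolding good_def using smooth_Q_f[OF maxcone_rays[OF D] open_UNIV] agree_Q_f[OF open_UNIV] by blast

lemma good_R_op: "good D \<alpha> \<Longrightarrow> good D (R_op D R \<alpha>)"
  unfolding good_def using smooth_R_op[OF D _ R] agree_R_op[OF open_UNIV] by blast

lemma good_T_op: "good D \<alpha> \<Longrightarrow> good D (T_op D R \<alpha>)"
  unfolding good_def using smooth_T_op[OF D _ R] agree_T_op[OF open_UNIV] by blast

lemma eqv_Q_f_padd: "good D \<alpha> \<Longrightarrow> good D \<beta> \<Longrightarrow> eqv D (Q_f D (padd c \<alpha> d \<beta>)) (padd c (Q_f D \<alpha>) d (Q_f D \<beta>))"
  unfolding eqv_def good_def using Q_f_padd[OF maxcone_rays[OF D] open_UNIV] by blast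

lemma eqv_Q_f_Q_f: "good D \<alpha> \<Longrightarrow> eqv D (Q_f D (Q_f D \<alpha>)) zero_u"
  unfolding eqv_def good_def using Q_f_Q_f[OF maxcone_rays[OF D] open_UNIV] by blast

lemma eqv_T_op_eq: "good D \<alpha> \<Longrightarrow> eqv D (T_op D R \<alpha>) (padd 1 \<alpha> (-1) (padd 1 (Q_f D (R_op D R \<alpha>)) 1 (R_op D R (Q_f D \<alpha>))))"
  unfolding eqv_def good_def using T_op_eq[OF D _ R] by blast

text \<open>Far out \<open>\<rho>\<close> is zero on an open subset of the component, hence so are
  both summands of \<open>T\<close>, including the derivatives in the commutator.\<close>

lemma compactly_supported_T_op: "compactly_supported D (T_op D R \<alpha>)"
proof -
  obtain B where B: "\<forall>S\<subseteq>{1..nrays D}. \<forall>z\<in>coord_space S \<inter> {z. \<exists>i\<in>S. B < cmod (z i)}. R (\<lambda>i. (cmod (z i))\<^sup>2) = 0"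
    using cutoff_far[OF R] by blast
  have "supported D B (T_op D R \<alpha>)" unfolding supported_def
  proof (intro ballI allI agreeI)
    fix S and M m :: nat and J K and z :: "nat \<Rightarrow> complex"
    assume S: "S \<in> maxcones D" and *: "m \<le> M" "J \<subseteq> S" "K \<subseteq> {1..rk D}" "z \<in> coord_space S" "z \<in> {z. \<exists>i\<in>S. B < cmod (z i)}"
    have z0: "mult_cutoff R \<beta> m' S J' K' z' = 0" if "z' \<in> coord_space S" "z' \<in> {z. \<exists>i\<in>S. B < cmod (z i)}" for \<beta> m' J' K' and z' :: "nat \<Rightarrow> complex"
      using B maxcone_rays[OF D S] that by (auto simp: mult_cutoff_def)
    have "agree D S {z. \<exists>i\<in>S. B < cmod (z i)} M (mult_cutoff R \<beta>) S zero_u S" for \<beta>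
      by (rule agreeI) (rule z0)
    from agreeD[OF agree_Q_op[OF open_outside this] *]
    have "Q_op D (mult_cutoff R \<beta>) m S J K z = 0" for \<beta> by (simp add: zero_pv)
    then show "T_op D R \<alpha> m S J K z = 0"
      unfolding T_op_def comm_Q_cutoff_def using z0 *(4,5) by simp
  qed
  then show ?thesis by (auto simp: compactly_supported_def)
qed

text \<open>\<open>C\<close> is closed, so \<open>C = T C + Q_f (R C)\<close>, and
  \<open>T C = T (Q_f \<delta>) = Q_f (T \<delta>)\<close>. The support of \<open>T \<delta>\<close>
  is compact by the cutoff, that of \<open>R C\<close> because \<open>R\<close> does not enlarge
  supports.\<close>

lemma exact_with_compact_support:
  assumes C: "good D C" "compactly_supported D C" and d: "good D \<delta>" "eqv D C (Q_f D \<delta>)"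
  shows "\<exists>Y. good D Y \<and> compactly_supported D Y \<and> eqv D C (Q_f D Y)"
proof (intro exI conjI)
  let ?Q = "Q_f D" and ?H = "R_op D R" and ?T = "T_op D R"
  let ?Y = "padd 1 (?T \<delta>) 1 (?H C)"
  note gQ = good_Q_f and gH = good_R_op
  show "good D ?Y" by (intro good_padd good_T_op good_R_op d C)
  show "compactly_supported D ?Y"
    by (intro compactly_supported_padd compactly_supported_T_op compactly_supported_R_op C)
  show "eqv D C (?Q ?Y)"
  proof (rule eqvI)
    fix S m J K and z :: "nat \<Rightarrow> complex" assume *: "S \<in> maxcones D" "J \<subseteq> S" "K \<subseteq> {1..rk D}" "z \<in> coord_space S"
    have QQ: "eqv D (?Q (?Q \<delta>)) zero_u" by (rule eqv_Q_f_Q_f[OF d(1)])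
    have QC: "eqv D (?Q C) zero_u" by (rule eqv_trans[OF eqv_Q_f[OF d(2)] QQ])
    have 1: "?T C m S J K z = C m S J K z - ?Q (?H C) m S J K z"
      using eqvD[OF eqv_T_op_eq[OF C(1)] *, of m] eqvD[OF eqv_zero(2)[OF QC] *] by (simp add: padd_eq)
    have 2: "?T C m S J K z = ?Q \<delta> m S J K z - ?Q (?H (?Q \<delta>)) m S J K z"
      using eqvD[OF eqv_T_op[OF d(2)] *, of R m] eqvD[OF eqv_T_op_eq[OF gQ[OF d(1)]] *, of m] eqvD[OF eqv_zero(2)[OF QQ] *]
      by (simp add: padd_eq)
    have "?Q (?T \<delta>) m S J K z = ?Q (padd 1 \<delta> (-1) (padd 1 (?Q (?H \<delta>)) 1 (?H (?Q \<delta>)))) m S J K z"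
      by (rule eqvD[OF eqv_Q_f[OF eqv_T_op_eq[OF d(1)]] *])
    also have "\<dots> = padd 1 (?Q \<delta>) (-1) (?Q (padd 1 (?Q (?H \<delta>)) 1 (?H (?Q \<delta>)))) m S J K z"
      by (rule eqvD[OF eqv_Q_f_padd *]) (intro good_padd gQ gH d)+
    also have "\<dots> = ?Q \<delta> m S J K z - padd 1 (?Q (?Q (?H \<delta>))) 1 (?Q (?H (?Q \<delta>))) m S J K z"
    proof -
      have "?Q (padd 1 (?Q (?H \<delta>)) 1 (?H (?Q \<delta>))) m S J K z = padd 1 (?Q (?Q (?H \<delta>))) 1 (?Q (?H (?Q \<delta>))) m S J K z"
        by (rule eqvD[OF eqv_Q_f_padd *]) (intro good_padd gQ gH d)+
      then show ?thesis by (simp add: padd_eq)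
    qed
    also have "\<dots> = ?Q \<delta> m S J K z - ?Q (?H (?Q \<delta>)) m S J K z"
      using eqvD[OF eqv_Q_f_Q_f[OF gH[OF d(1)]] *] by (simp add: padd_eq)
    finally have 3: "?Q (?T \<delta>) m S J K z = ?T C m S J K z" using 2 by simp
    have "?Q ?Y m S J K z = padd 1 (?Q (?T \<delta>)) 1 (?Q (?H C)) m S J K z"
      by (rule eqvD[OF eqv_Q_f_padd *]) (intro good_T_op gH d C)+
    then show "C m S J K z = ?Q ?Y m S J K z" using 1 3 by (simp add: padd_eq)
  qed
qed

end

section \<open>The trace pairing\<close>

lemma sum_Pow_remove:
  fixes F :: "'a \<Rightarrow> 'a set \<Rightarrow> 'b::comm_monoid_add"
  assumes "finite J"
  shows "(\<Sum>A\<in>Pow J. \<Sum>i\<in>A. F i (A - {i})) = (\<Sum>i\<in>J. \<Sum>A\<in>Pow (J - {i}). F i A)"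
proof -
  have "(\<Sum>A\<in>Pow J. \<Sum>i\<in>A. F i (A - {i})) = (\<Sum>(A, i)\<in>Sigma (Pow J) (\<lambda>A. A). F i (A - {i}))"
    by (rule sum.Sigma) (use assms finite_subset in auto)
  also have "\<dots> = (\<Sum>(i, A)\<in>Sigma J (\<lambda>i. Pow (J - {i})). F i A)"
    by (rule sum.reindex_bij_witness[of _ "\<lambda>(i, A). (insert i A, i)" "\<lambda>(A, i). (i, A - {i})"]) auto
  also have "\<dots> = (\<Sum>i\<in>J. \<Sum>A\<in>Pow (J - {i}). F i A)"
    by (rule sum.Sigma[symmetric]) (use assms in auto)
  finally show ?thesis .
qed

lemma sum_Pow_outside:
  fixes F :: "'a \<Rightarrow> 'a set \<Rightarrow> 'b::comm_monoid_add"
  assumes "finite J"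
  shows "(\<Sum>A\<in>Pow J. \<Sum>i\<in>J - A. F i A) = (\<Sum>i\<in>J. \<Sum>A\<in>Pow (J - {i}). F i A)"
proof -
  have "(\<Sum>A\<in>Pow J. \<Sum>i\<in>J - A. F i A) = (\<Sum>(A, i)\<in>Sigma (Pow J) (\<lambda>A. J - A). F i A)"
    by (rule sum.Sigma) (use assms in auto)
  also have "\<dots> = (\<Sum>(i, A)\<in>Sigma J (\<lambda>i. Pow (J - {i})). F i A)"
    by (rule sum.reindex_bij_witness[of _ "\<lambda>(i, A). (A, i)" "\<lambda>(A, i). (i, A)"]) auto
  also have "\<dots> = (\<Sum>i\<in>J. \<Sum>A\<in>Pow (J - {i}). F i A)"
    by (rule sum.Sigma[symmetric]) (use assms in auto)
  finally show ?thesis .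
qed

text \<open>The sign that an odd operator picks up when it passes the first factor of a
  product.\<close>

definition parity_twist :: "pv \<Rightarrow> pv" where
  "parity_twist a = (\<lambda>S J K z. (-1) ^ (card J + card K) * a S J K z)"

definition wedge_coeff :: "nat set \<Rightarrow> nat set \<Rightarrow> nat set \<Rightarrow> nat set \<Rightarrow> complex" where
  "wedge_coeff J1 J2 K1 K2 = (-1) ^ (card K1 * card J2) * shuffle_sign J1 J2 * shuffle_sign K1 K2"

lemma wedge_eq:
  "wedge a b S J K z = (\<Sum>J1\<in>Pow J. \<Sum>K1\<in>Pow K. wedge_coeff J1 (J - J1) K1 (K - K1) * (a S J1 K1 z * b S (J - J1) (K - K1) z))"
  unfolding wedge_def wedge_coeff_def by (simp add: mult.assoc)

lemma minus_one_power_square: "(-1 :: complex) ^ n * ((-1) ^ n * x) = x"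
  by (simp add: power_add[symmetric] mult.assoc[symmetric] flip: mult_2)

lemma wedge_coeff_dbar_left:
  assumes "finite J1" "finite J2" "J1 \<inter> J2 = {}" "i \<notin> J1" "i \<notin> J2"
  shows "wedge_coeff (insert i J1) J2 K1 K2 * shuffle_sign {i} J1 = shuffle_sign {i} (J1 \<union> J2) * wedge_coeff J1 J2 K1 K2"
proof -
  have "shuffle_sign (insert i J1) J2 = shuffle_sign {i} J2 * shuffle_sign J1 J2"
    using shuffle_sign_Un_left[of "{i}" J1 J2] assms by simp
  moreover have "shuffle_sign {i} (J1 \<union> J2) = shuffle_sign {i} J1 * shuffle_sign {i} J2"
    by (rule shuffle_sign_Un_right) (use assms in auto)
  ultimately show ?thesis by (simp add: wedge_coeff_def)
qed

lemma wedge_coeff_dbar_right: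
  assumes "finite J1" "finite J2" "J1 \<inter> J2 = {}" "i \<notin> J1" "i \<notin> J2"
  shows "wedge_coeff J1 (insert i J2) K1 K2 * ((-1) ^ (card J1 + card K1) * shuffle_sign {i} J2) =
     shuffle_sign {i} (J1 \<union> J2) * wedge_coeff J1 J2 K1 K2"
proof -
  have "shuffle_sign J1 (insert i J2) = shuffle_sign J1 {i} * shuffle_sign J1 J2"
    using shuffle_sign_Un_right[of J1 "{i}" J2] assms by simp
  then have 1: "shuffle_sign J1 (insert i J2) = (-1) ^ card J1 * shuffle_sign {i} J1 * shuffle_sign J1 J2"
    using shuffle_sign_swap[of J1 i] assms by simp
  have 2: "shuffle_sign {i} (J1 \<union> J2) = shuffle_sign {i} J1 * shuffle_sign {i} J2"
    by (rule shuffle_sign_Un_right) (use assms in auto)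
  have 3: "(-1 :: complex) ^ (card K1 * card (insert i J2)) = (-1) ^ (card K1 * card J2) * (-1) ^ card K1"
    using assms by (simp add: power_add)
  show ?thesis unfolding wedge_coeff_def 1 2 3
    by (simp add: power_add minus_one_power_square mult_ac)
qed

lemma wedge_coeff_iota:
  assumes "finite N" "k \<in> N" "K \<subseteq> N - {k}"
  shows "wedge_coeff J1 J2 (insert k K) (N - insert k K) * ((-1) ^ (card J1 + card (insert k K)) * ((-1) ^ card J2 * shuffle_sign {k} (N - insert k K))) =
    - (wedge_coeff J1 J2 K (N - K) * ((-1) ^ card J1 * shuffle_sign {k} K))"
proof -
  define C where "C = N - insert k K"
  have fK: "finite K" using assms finite_subset by blast
  have C: "finite C" "k \<notin> K" "k \<notin> C" "K \<inter> C = {}" "N - K = insert k C"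
    using assms by (auto simp: C_def)
  have "shuffle_sign K (insert k C) = shuffle_sign K {k} * shuffle_sign K C"
    using shuffle_sign_Un_right[of K "{k}" C] fK C by simp
  then have 1: "shuffle_sign K (N - K) = (-1) ^ card K * shuffle_sign {k} K * shuffle_sign K C"
    unfolding C(5) using shuffle_sign_swap[OF fK C(2)] by simp
  have 2: "shuffle_sign (insert k K) C = shuffle_sign {k} C * shuffle_sign K C"
    using shuffle_sign_Un_left[of "{k}" K C] fK C by simp
  have 3: "card (insert k K) = Suc (card K)" using fK C(2) by simp
  have 4: "(-1 :: complex) ^ (Suc (card K) * card J2) = (-1) ^ card J2 * (-1) ^ (card K * card J2)"
    by (simp add: power_add)
  show ?thesis unfolding C_def[symmetric] wedge_coeff_def 1 2 3 4
    by (simp add: power_add minus_one_power_square mult_ac)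
qed

text \<open>Together with the next two definitions: the conditions of \<open>good\<close> and
  \<open>supported\<close> for a single coefficient in \<open>u\<close>, on which \<open>Tr\<close>
  acts.\<close>

definition pv_smooth :: "'n::finite toric \<Rightarrow> pv \<Rightarrow> bool" where
  "pv_smooth D a \<longleftrightarrow> (\<forall>S\<in>maxcones D. \<forall>J\<subseteq>S. \<forall>K\<subseteq>{1..rk D}. smooth_in S UNIV (a S J K))"

definition pv_supp :: "'n::finite toric \<Rightarrow> real \<Rightarrow> pv \<Rightarrow> bool" where
  "pv_supp D B a \<longleftrightarrow> (\<forall>S\<in>maxcones D. \<forall>J\<subseteq>S. \<forall>K\<subseteq>{1..rk D}. \<forall>z\<in>coord_space S. (\<exists>i\<in>S. B < cmod (z i)) \<longrightarrow> a S J K z = 0)"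

definition pv_compat :: "'n::finite toric \<Rightarrow> pv \<Rightarrow> bool" where
  "pv_compat D a \<longleftrightarrow> (\<forall>S\<in>maxcones D. \<forall>S'\<in>maxcones D. \<forall>J\<subseteq>S \<inter> S'. \<forall>K\<subseteq>{1..rk D}. \<forall>z\<in>coord_space (S \<inter> S'). a S J K z = a S' J K z)"

lemma pv_smoothD: "pv_smooth D a \<Longrightarrow> S \<in> maxcones D \<Longrightarrow> J \<subseteq> S \<Longrightarrow> K \<subseteq> {1..rk D} \<Longrightarrow> smooth_in S UNIV (a S J K)"
  by (simp add: pv_smooth_def)

lemma pv_suppD: "pv_supp D B a \<Longrightarrow> S \<in> maxcones D \<Longrightarrow> J \<subseteq> S \<Longrightarrow> K \<subseteq> {1..rk D} \<Longrightarrow> z \<in> coord_space S \<Longrightarrow> i \<in> S \<Longrightarrow> B < cmod (z i) \<Longrightarrow> a S J K z = 0"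
  unfolding pv_supp_def by blast

lemma pv_smooth_wedge: "pv_smooth D a \<Longrightarrow> pv_smooth D b \<Longrightarrow> pv_smooth D (wedge a b)"
  unfolding pv_smooth_def wedge_def
  by (intro allI ballI impI smooth_in_sum smooth_in_mult open_UNIV smooth_in_const) (simp_all add: subset_Diff1 subset_trans)

lemma pv_supp_wedge:
  assumes "pv_supp D B a"
  shows "pv_supp D B (wedge a b)"
  unfolding pv_supp_def
proof (intro ballI allI impI)
  fix S J K z assume *: "S \<in> maxcones D" "J \<subseteq> S" "K \<subseteq> {1..rk D}" "z \<in> coord_space S" "\<exists>i\<in>S. B < cmod (z i)"
  then obtain i where i: "i \<in> S" "B < cmod (z i)" by blast
  have "a S J1 K1 z = 0" if "J1 \<subseteq> J" "K1 \<subseteq> K" for J1 K1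
    by (rule pv_suppD[OF assms *(1) _ _ *(4) i]) (use that * in auto)
  then show "wedge a b S J K z = 0" unfolding wedge_def by (intro sum.neutral ballI) auto
qed

lemma pv_compat_wedge:
  assumes "pv_compat D a" "pv_compat D b"
  shows "pv_compat D (wedge a b)"
  unfolding pv_compat_def
proof (intro ballI allI impI)
  fix S S' J K and z :: "nat \<Rightarrow> complex" assume *: "S \<in> maxcones D" "S' \<in> maxcones D" "J \<subseteq> S \<inter> S'" "K \<subseteq> {1..rk D}" "z \<in> coord_space (S \<inter> S')"
  have "c S J1 K1 z = c S' J1 K1 z" if "pv_compat D c" "J1 \<subseteq> J" "K1 \<subseteq> K" for c :: pv and J1 K1
  proof -
    have "J1 \<subseteq> S \<inter> S'" "K1 \<subseteq> {1..rk D}" using that * by auto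
    then show ?thesis using that(1) * unfolding pv_compat_def by blast
  qed
  then show "wedge a b S J K z = wedge a b S' J K z"
    unfolding wedge_def using assms by (intro sum.cong refl arg_cong2[of _ _ _ _ "(*)"]) auto
qed

lemma pv_smooth_twist: "pv_smooth D a \<Longrightarrow> pv_smooth D (parity_twist a)"
  unfolding pv_smooth_def parity_twist_def by (auto intro!: smooth_in_mult)

lemma pv_supp_twist: "pv_supp D B a \<Longrightarrow> pv_supp D B (parity_twist a)"
  unfolding pv_supp_def parity_twist_def by simp

lemma Tr_eq: "Tr D a = (\<Sum>S\<in>maxcones D. (2 * \<i>) ^ rk D / of_int (frame_det D S) * log_integral S (a S S {1..rk D}))"
  unfolding Tr_def log_integral_def ext_def Let_def ..

lemma Tr_cong: "(\<And>S z. S \<in> maxcones D \<Longrightarrow> z \<in> coord_space S \<Longrightarrow> a S S {1..rk D} z = b S S {1..rk D} z) \<Longrightarrow> Tr D a = Tr D b"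
  unfolding Tr_eq by (intro sum.cong refl arg_cong2[of _ _ _ _ "(*)"] log_integral_cong)

text \<open>The terms are regrouped by the index \<open>i\<close> of the derivative; the two
  summands of the product rule correspond to \<open>i\<close> belonging to the first or to the
  second part of \<open>J\<close>.\<close>

lemma dbar_wedge:
  assumes sm: "\<And>J K. J \<subseteq> S \<Longrightarrow> K \<subseteq> N \<Longrightarrow> smooth_in S UNIV (a S J K)" "\<And>J K. J \<subseteq> S \<Longrightarrow> K \<subseteq> N \<Longrightarrow> smooth_in S UNIV (b S J K)"
    and f: "finite S" "finite N" and J: "J \<subseteq> S" and K: "K \<subseteq> N" and z: "z \<in> coord_space S"
  shows "dbar (wedge a b) S J K z = wedge (dbar a) b S J K z + wedge (parity_twist a) (dbar b) S J K z"
proof -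
  have fJ: "finite J" and fK: "finite K" using f J K finite_subset by blast+
  have zz: "z \<in> coord_space S \<inter> UNIV" using z by simp
  let ?c = "\<lambda>i J1 K1. shuffle_sign {i} (J - {i}) * wedge_coeff J1 (J - {i} - J1) K1 (K - K1)"
  let ?l = "\<lambda>i J1. \<Sum>K1\<in>Pow K. ?c i J1 K1 * (d_zbar i (a S J1 K1) z * b S (J - {i} - J1) (K - K1) z)"
  let ?r = "\<lambda>i J1. \<Sum>K1\<in>Pow K. ?c i J1 K1 * (a S J1 K1 z * d_zbar i (b S (J - {i} - J1) (K - K1)) z)"
  have 1: "dbar (wedge a b) S J K z = (\<Sum>i\<in>J. \<Sum>J1\<in>Pow (J - {i}). ?l i J1 + ?r i J1)"
    unfolding dbar_def[of "wedge a b"]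
  proof (rule sum.cong[OF refl])
    fix i assume i: "i \<in> J"
    have iS: "i \<in> S" using i J by auto
    have sma: "smooth_in S UNIV (a S J1 K1)" if "J1 \<in> Pow (J - {i})" "K1 \<in> Pow K" for J1 K1
      by (rule sm(1)) (use that J K in auto)
    have smb: "smooth_in S UNIV (b S (J - {i} - J1) (K - K1))" for J1 K1
      by (rule sm(2)) (use J K in auto)
    have e: "wedge a b S (J - {i}) K = (\<lambda>z. \<Sum>p\<in>Pow (J - {i}) \<times> Pow K.
        wedge_coeff (fst p) (J - {i} - fst p) (snd p) (K - snd p) * (a S (fst p) (snd p) z * b S (J - {i} - fst p) (K - snd p) z))"
      unfolding wedge_eq[abs_def] by (simp add: sum.cartesian_product case_prod_unfold)
    have "d_zbar i (wedge a b S (J - {i}) K) z = (\<Sum>p\<in>Pow (J - {i}) \<times> Pow K.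
        wedge_coeff (fst p) (J - {i} - fst p) (snd p) (K - snd p) * d_zbar i (\<lambda>z. a S (fst p) (snd p) z * b S (J - {i} - fst p) (K - snd p) z) z)"
      unfolding e by (rule d_zbar_lin[OF iS zz open_UNIV]) (use sma smb in \<open>auto intro!: smooth_in_mult\<close>)
    also have "\<dots> = (\<Sum>p\<in>Pow (J - {i}) \<times> Pow K.
        wedge_coeff (fst p) (J - {i} - fst p) (snd p) (K - snd p) * (d_zbar i (a S (fst p) (snd p)) z * b S (J - {i} - fst p) (K - snd p) z +
          a S (fst p) (snd p) z * d_zbar i (b S (J - {i} - fst p) (K - snd p)) z))"
    proof (rule sum.cong[OF refl])
      fix p assume p: "p \<in> Pow (J - {i}) \<times> Pow K"
      have "fst p \<in> Pow (J - {i})" "snd p \<in> Pow K" using p by auto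
      from d_zbar_mult[OF iS zz sma[OF this] smb]
      show "wedge_coeff (fst p) (J - {i} - fst p) (snd p) (K - snd p) * d_zbar i (\<lambda>z. a S (fst p) (snd p) z * b S (J - {i} - fst p) (K - snd p) z) z =
        wedge_coeff (fst p) (J - {i} - fst p) (snd p) (K - snd p) * (d_zbar i (a S (fst p) (snd p)) z * b S (J - {i} - fst p) (K - snd p) z +
          a S (fst p) (snd p) z * d_zbar i (b S (J - {i} - fst p) (K - snd p)) z)" by simp
    qed
    also have "\<dots> = (\<Sum>J1\<in>Pow (J - {i}). \<Sum>K1\<in>Pow K.
        wedge_coeff J1 (J - {i} - J1) K1 (K - K1) * (d_zbar i (a S J1 K1) z * b S (J - {i} - J1) (K - K1) z +
          a S J1 K1 z * d_zbar i (b S (J - {i} - J1) (K - K1)) z))"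
      by (simp add: sum.cartesian_product case_prod_unfold)
    finally show "shuffle_sign {i} (J - {i}) * d_zbar i (wedge a b S (J - {i}) K) z = (\<Sum>J1\<in>Pow (J - {i}). ?l i J1 + ?r i J1)"
      by (simp add: sum_distrib_left distrib_left mult.assoc sum.distrib)
  qed
  have 2: "wedge (dbar a) b S J K z = (\<Sum>i\<in>J. \<Sum>J1\<in>Pow (J - {i}). ?l i J1)"
  proof -
    have "wedge (dbar a) b S J K z = (\<Sum>A\<in>Pow J. \<Sum>i\<in>A. ?l i (A - {i}))"
      unfolding wedge_eq
    proof (rule sum.cong[OF refl])
      fix A assume A: "A \<in> Pow J"
      have "(\<Sum>K1\<in>Pow K. wedge_coeff A (J - A) K1 (K - K1) * (dbar a S A K1 z * b S (J - A) (K - K1) z)) =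
        (\<Sum>K1\<in>Pow K. \<Sum>i\<in>A. ?c i (A - {i}) K1 * (d_zbar i (a S (A - {i}) K1) z * b S (J - {i} - (A - {i})) (K - K1) z))"
      proof (rule sum.cong[OF refl])
        fix K1
        have "wedge_coeff A (J - A) K1 (K - K1) * (dbar a S A K1 z * b S (J - A) (K - K1) z) =
          (\<Sum>i\<in>A. (wedge_coeff A (J - A) K1 (K - K1) * shuffle_sign {i} (A - {i})) * (d_zbar i (a S (A - {i}) K1) z * b S (J - A) (K - K1) z))"
          unfolding dbar_def by (simp add: sum_distrib_left sum_distrib_right mult_ac)
        also have "\<dots> = (\<Sum>i\<in>A. ?c i (A - {i}) K1 * (d_zbar i (a S (A - {i}) K1) z * b S (J - {i} - (A - {i})) (K - K1) z))"
        proof (rule sum.cong[OF refl])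
          fix i assume i: "i \<in> A"
          have s: "J - {i} - (A - {i}) = J - A" "insert i (A - {i}) = A" "(A - {i}) \<union> (J - A) = J - {i}" using i A by auto
          have "wedge_coeff (insert i (A - {i})) (J - A) K1 (K - K1) * shuffle_sign {i} (A - {i}) =
            shuffle_sign {i} ((A - {i}) \<union> (J - A)) * wedge_coeff (A - {i}) (J - A) K1 (K - K1)"
            by (rule wedge_coeff_dbar_left) (use i A fJ finite_subset in auto)
          then show "(wedge_coeff A (J - A) K1 (K - K1) * shuffle_sign {i} (A - {i})) * (d_zbar i (a S (A - {i}) K1) z * b S (J - A) (K - K1) z) =
            ?c i (A - {i}) K1 * (d_zbar i (a S (A - {i}) K1) z * b S (J - {i} - (A - {i})) (K - K1) z)"
            unfolding s by simp
        qed
        finally show "wedge_coeff A (J - A) K1 (K - K1) * (dbar a S A K1 z * b S (J - A) (K - K1) z) =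
          (\<Sum>i\<in>A. ?c i (A - {i}) K1 * (d_zbar i (a S (A - {i}) K1) z * b S (J - {i} - (A - {i})) (K - K1) z))" .
      qed
      also have "\<dots> = (\<Sum>i\<in>A. ?l i (A - {i}))" by (rule sum.swap)
      finally show "(\<Sum>K1\<in>Pow K. wedge_coeff A (J - A) K1 (K - K1) * (dbar a S A K1 z * b S (J - A) (K - K1) z)) = (\<Sum>i\<in>A. ?l i (A - {i}))" .
    qed
    also have "\<dots> = (\<Sum>i\<in>J. \<Sum>J1\<in>Pow (J - {i}). ?l i J1)" by (rule sum_Pow_remove[OF fJ])
    finally show ?thesis .
  qed
  have 3: "wedge (parity_twist a) (dbar b) S J K z = (\<Sum>i\<in>J. \<Sum>J1\<in>Pow (J - {i}). ?r i J1)"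
  proof -
    have "wedge (parity_twist a) (dbar b) S J K z = (\<Sum>A\<in>Pow J. \<Sum>i\<in>J - A. ?r i A)"
      unfolding wedge_eq
    proof (rule sum.cong[OF refl])
      fix A assume A: "A \<in> Pow J"
      have "(\<Sum>K1\<in>Pow K. wedge_coeff A (J - A) K1 (K - K1) * (parity_twist a S A K1 z * dbar b S (J - A) (K - K1) z)) =
        (\<Sum>K1\<in>Pow K. \<Sum>i\<in>J - A. ?c i A K1 * (a S A K1 z * d_zbar i (b S (J - {i} - A) (K - K1)) z))"
      proof (rule sum.cong[OF refl])
        fix K1
        have "wedge_coeff A (J - A) K1 (K - K1) * (parity_twist a S A K1 z * dbar b S (J - A) (K - K1) z) =
          (\<Sum>i\<in>J - A. (wedge_coeff A (J - A) K1 (K - K1) * ((-1) ^ (card A + card K1) * shuffle_sign {i} (J - A - {i}))) * (a S A K1 z * d_zbar i (b S (J - A - {i}) (K - K1)) z))"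
          unfolding dbar_def parity_twist_def by (simp add: sum_distrib_left mult_ac)
        also have "\<dots> = (\<Sum>i\<in>J - A. ?c i A K1 * (a S A K1 z * d_zbar i (b S (J - {i} - A) (K - K1)) z))"
        proof (rule sum.cong[OF refl])
          fix i assume i: "i \<in> J - A"
          have s: "J - {i} - A = J - A - {i}" "insert i (J - A - {i}) = J - A" "A \<union> (J - A - {i}) = J - {i}" using i A by auto
          have "wedge_coeff A (insert i (J - A - {i})) K1 (K - K1) * ((-1) ^ (card A + card K1) * shuffle_sign {i} (J - A - {i})) =
            shuffle_sign {i} (A \<union> (J - A - {i})) * wedge_coeff A (J - A - {i}) K1 (K - K1)"
            by (rule wedge_coeff_dbar_right) (use i A fJ finite_subset in auto)
          then show "(wedge_coeff A (J - A) K1 (K - K1) * ((-1) ^ (card A + card K1) * shuffle_sign {i} (J - A - {i}))) * (a S A K1 z * d_zbar i (b S (J - A - {i}) (K - K1)) z) =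
            ?c i A K1 * (a S A K1 z * d_zbar i (b S (J - {i} - A) (K - K1)) z)"
            unfolding s by simp
        qed
        finally show "wedge_coeff A (J - A) K1 (K - K1) * (parity_twist a S A K1 z * dbar b S (J - A) (K - K1) z) =
          (\<Sum>i\<in>J - A. ?c i A K1 * (a S A K1 z * d_zbar i (b S (J - {i} - A) (K - K1)) z))" .
      qed
      also have "\<dots> = (\<Sum>i\<in>J - A. ?r i A)" by (rule sum.swap)
      finally show "(\<Sum>K1\<in>Pow K. wedge_coeff A (J - A) K1 (K - K1) * (parity_twist a S A K1 z * dbar b S (J - A) (K - K1) z)) = (\<Sum>i\<in>J - A. ?r i A)" .
    qed
    also have "\<dots> = (\<Sum>i\<in>J. \<Sum>J1\<in>Pow (J - {i}). ?r i J1)" by (rule sum_Pow_outside[OF fJ])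
    finally show ?thesis .
  qed
  show ?thesis unfolding 1 2 3 by (simp add: sum.distrib)
qed

text \<open>Used together with \<open>wedge_iota_right\<close>: a product of
  \<open>theta\<close>-degree \<open>n + 1\<close> is zero, so contracting it by the Leibniz rule
  gives, for the two factors, sums with opposite signs. \<open>X\<close> is left abstract in order
  to cover both multiplication by \<open>g_f\<close> and the first-order operators in
  \<open>del\<close>.\<close>

lemma wedge_iota_left:
  assumes f: "finite N" "finite J"
    and E: "\<And>J1 K1. K1 \<subseteq> N \<Longrightarrow> J1 \<subseteq> J \<Longrightarrow> e S J1 K1 z = (-1) ^ card J1 * (\<Sum>k\<in>N - K1. shuffle_sign {k} K1 * X k J1 (insert k K1))"
  shows "wedge e b S J N z = (\<Sum>J1\<in>Pow J. \<Sum>k\<in>N. \<Sum>K1\<in>Pow (N - {k}).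
     wedge_coeff J1 (J - J1) K1 (N - K1) * ((-1) ^ card J1 * shuffle_sign {k} K1) * (X k J1 (insert k K1) * b S (J - J1) (N - K1) z))"
  unfolding wedge_eq
proof (rule sum.cong[OF refl])
  fix J1 assume J1: "J1 \<in> Pow J"
  let ?F = "\<lambda>k K1. wedge_coeff J1 (J - J1) K1 (N - K1) * ((-1) ^ card J1 * shuffle_sign {k} K1) * (X k J1 (insert k K1) * b S (J - J1) (N - K1) z)"
  have "(\<Sum>K1\<in>Pow N. wedge_coeff J1 (J - J1) K1 (N - K1) * (e S J1 K1 z * b S (J - J1) (N - K1) z)) = (\<Sum>K1\<in>Pow N. \<Sum>k\<in>N - K1. ?F k K1)"
    using E J1 by (intro sum.cong refl) (simp add: sum_distrib_left sum_distrib_right mult_ac)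
  also have "\<dots> = (\<Sum>k\<in>N. \<Sum>K1\<in>Pow (N - {k}). ?F k K1)" by (rule sum_Pow_outside[OF f(1)])
  finally show "(\<Sum>K1\<in>Pow N. wedge_coeff J1 (J - J1) K1 (N - K1) * (e S J1 K1 z * b S (J - J1) (N - K1) z)) = (\<Sum>k\<in>N. \<Sum>K1\<in>Pow (N - {k}). ?F k K1)" .
qed

lemma wedge_iota_right:
  assumes f: "finite N" "finite J"
    and E: "\<And>J1 K1. K1 \<subseteq> N \<Longrightarrow> J1 \<subseteq> J \<Longrightarrow> e S J1 K1 z = (-1) ^ card J1 * (\<Sum>k\<in>N - K1. shuffle_sign {k} K1 * X k J1 (insert k K1))"
  shows "wedge (parity_twist a) e S J N z = - (\<Sum>J1\<in>Pow J. \<Sum>k\<in>N. \<Sum>K1\<in>Pow (N - {k}).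
     wedge_coeff J1 (J - J1) K1 (N - K1) * ((-1) ^ card J1 * shuffle_sign {k} K1) * (a S J1 (insert k K1) z * X k (J - J1) (N - K1)))"
  unfolding wedge_eq sum_negf[symmetric]
proof (rule sum.cong[OF refl])
  fix J1 assume J1: "J1 \<in> Pow J"
  let ?F = "\<lambda>k K1. wedge_coeff J1 (J - J1) (insert k K1) (N - insert k K1) * ((-1) ^ (card J1 + card (insert k K1)) * ((-1) ^ card (J - J1) * shuffle_sign {k} (N - insert k K1))) *
      (a S J1 (insert k K1) z * X k (J - J1) (N - K1))"
  have "(\<Sum>K1\<in>Pow N. wedge_coeff J1 (J - J1) K1 (N - K1) * (parity_twist a S J1 K1 z * e S (J - J1) (N - K1) z)) = (\<Sum>K1\<in>Pow N. \<Sum>k\<in>K1. ?F k (K1 - {k}))"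
  proof (rule sum.cong[OF refl])
    fix K1 assume K1: "K1 \<in> Pow N"
    have c: "N - (N - K1) = K1" using K1 by auto
    have "e S (J - J1) (N - K1) z = (-1) ^ card (J - J1) * (\<Sum>k\<in>K1. shuffle_sign {k} (N - K1) * X k (J - J1) (insert k (N - K1)))"
      using E[of "N - K1" "J - J1"] unfolding c by simp
    then have "wedge_coeff J1 (J - J1) K1 (N - K1) * (parity_twist a S J1 K1 z * e S (J - J1) (N - K1) z) =
      (\<Sum>k\<in>K1. wedge_coeff J1 (J - J1) K1 (N - K1) * ((-1) ^ (card J1 + card K1) * ((-1) ^ card (J - J1) * shuffle_sign {k} (N - K1))) *
        (a S J1 K1 z * X k (J - J1) (insert k (N - K1))))"
      unfolding parity_twist_def by (simp add: sum_distrib_left mult_ac)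
    also have "\<dots> = (\<Sum>k\<in>K1. ?F k (K1 - {k}))"
    proof (rule sum.cong[OF refl])
      fix k assume k: "k \<in> K1"
      have s: "insert k (K1 - {k}) = K1" "N - (K1 - {k}) = insert k (N - K1)" using k K1 by auto
      show "wedge_coeff J1 (J - J1) K1 (N - K1) * ((-1) ^ (card J1 + card K1) * ((-1) ^ card (J - J1) * shuffle_sign {k} (N - K1))) *
        (a S J1 K1 z * X k (J - J1) (insert k (N - K1))) = ?F k (K1 - {k})" unfolding s ..
    qed
    finally show "wedge_coeff J1 (J - J1) K1 (N - K1) * (parity_twist a S J1 K1 z * e S (J - J1) (N - K1) z) = (\<Sum>k\<in>K1. ?F k (K1 - {k}))" .
  qed
  also have "\<dots> = (\<Sum>k\<in>N. \<Sum>K1\<in>Pow (N - {k}). ?F k K1)" by (rule sum_Pow_remove[OF f(1)])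
  also have "\<dots> = (\<Sum>k\<in>N. \<Sum>K1\<in>Pow (N - {k}). - (wedge_coeff J1 (J - J1) K1 (N - K1) * ((-1) ^ card J1 * shuffle_sign {k} K1) * (a S J1 (insert k K1) z * X k (J - J1) (N - K1))))"
  proof (intro sum.cong refl)
    fix k K1 assume "k \<in> N" "K1 \<in> Pow (N - {k})"
    then show "?F k K1 = - (wedge_coeff J1 (J - J1) K1 (N - K1) * ((-1) ^ card J1 * shuffle_sign {k} K1) * (a S J1 (insert k K1) z * X k (J - J1) (N - K1)))"
      using wedge_coeff_iota[OF f(1), of k K1 J1 "J - J1"] by simp
  qed
  finally show "(\<Sum>K1\<in>Pow N. wedge_coeff J1 (J - J1) K1 (N - K1) * (parity_twist a S J1 K1 z * e S (J - J1) (N - K1) z)) =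
    (\<Sum>k\<in>N. \<Sum>K1\<in>Pow (N - {k}). - (wedge_coeff J1 (J - J1) K1 (N - K1) * ((-1) ^ card J1 * shuffle_sign {k} K1) * (a S J1 (insert k K1) z * X k (J - J1) (N - K1))))" .
qed

lemma del_zero: "del D (\<lambda>S J K z. 0) S J K z = 0"
  and dbar_zero: "dbar (\<lambda>S J K z. 0) S J K z = 0"
  unfolding del_def dbar_def odd_deriv_def theta_euler
  by (intro sum.neutral ballI; simp)+

section \<open>Integration by parts for the three parts of the differential\<close>

context
  fixes D :: "'n::finite toric"
  assumes D: "log_LG D"
begin

lemma del_eq:
  assumes a: "pv_smooth D a" and S: "S \<in> maxcones D" "J \<subseteq> S" "K \<subseteq> {1..rk D}" and z: "z \<in> coord_space S"
  shows "del D a S J K z = (-1) ^ card J * (\<Sum>k\<in>{1..rk D} - K. shuffle_sign {k} K *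
     (\<Sum>i=1..nrays D. of_int (pairing (ray D i) (dual_vec D k)) * euler i (a S J (insert k K)) z))"
  unfolding del_def sum_distrib_left
proof (rule sum_restrict)
  fix k assume k: "k \<in> {1..rk D}"
  have zz: "z \<in> coord_space S \<inter> UNIV" using z by simp
  have sm: "smooth_in S UNIV (a S J (insert k K))" by (rule pv_smoothD[OF a S(1,2)]) (use S k in auto)
  have e: "euler i (odd_deriv k a S J K) z = (if k \<in> K then 0 else (-1) ^ card J * shuffle_sign {k} K * euler i (a S J (insert k K)) z)" for i
    using euler_cmult[OF zz sm, of i "(-1) ^ card J * shuffle_sign {k} K"] by (simp add: odd_deriv_def)
  show "theta D k (odd_deriv k a S J K) z = (if k \<in> K then 0 else
     (\<Sum>i=1..nrays D. (-1) ^ card J * (shuffle_sign {k} K * (of_int (pairing (ray D i) (dual_vec D k)) * euler i (a S J (insert k K)) z))))"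
    unfolding theta_euler e by (simp add: mult_ac)
qed simp

lemma pv_smooth_dbar: "pv_smooth D a \<Longrightarrow> pv_smooth D (dbar a)"
  unfolding pv_smooth_def dbar_def
  by (intro ballI allI impI smooth_in_sum smooth_in_mult smooth_in_const smooth_in_d_zbar open_UNIV)
    (auto simp: subset_Diff1)

lemma pv_smooth_odd_deriv:
  "pv_smooth D a \<Longrightarrow> S \<in> maxcones D \<Longrightarrow> J \<subseteq> S \<Longrightarrow> K \<subseteq> {1..rk D} \<Longrightarrow> k \<in> {1..rk D} \<Longrightarrow> smooth_in S UNIV (odd_deriv k a S J K)"
  using pv_smoothD[of D a S J "insert k K"] unfolding odd_deriv_def
  by (cases "k \<in> K") (auto intro!: smooth_in_mult)

lemma pv_smoothI: "(\<And>S J K. S \<in> maxcones D \<Longrightarrow> J \<subseteq> S \<Longrightarrow> K \<subseteq> {1..rk D} \<Longrightarrow> smooth_in S UNIV (a S J K)) \<Longrightarrow> pv_smooth D a"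
  unfolding pv_smooth_def by blast

lemma pv_smooth_bracket: "pv_smooth D a \<Longrightarrow> pv_smooth D (bracket_f D a)"
  unfolding bracket_f_def g_f_def
  by (rule pv_smoothI) (intro smooth_in_sum smooth_in_mult smooth_in_const smooth_in_coord open_UNIV pv_smooth_odd_deriv)

lemma pv_smooth_del: "pv_smooth D a \<Longrightarrow> pv_smooth D (del D a)"
  unfolding del_def theta_euler
  by (rule pv_smoothI) (intro smooth_in_sum smooth_in_mult smooth_in_const smooth_in_euler open_UNIV pv_smooth_odd_deriv)

lemma pv_supp_dbar:
  assumes "pv_supp D B a" shows "pv_supp D B (dbar a)"
  unfolding pv_supp_def
proof (intro ballI allI impI)
  fix S J K and z :: "nat \<Rightarrow> complex" assume *: "S \<in> maxcones D" "J \<subseteq> S" "K \<subseteq> {1..rk D}" "z \<in> coord_space S" "\<exists>i\<in>S. B < cmod (z i)"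
  have "dbar a S J K z = dbar (\<lambda>S J K z. 0) S J K z"
    by (rule dbar_cong[OF open_outside[of S B] *(2)]) (use * assms in \<open>auto simp: pv_supp_def\<close>)
  then show "dbar a S J K z = 0" by (simp add: dbar_zero)
qed

lemma pv_supp_del:
  assumes "pv_supp D B a" shows "pv_supp D B (del D a)"
  unfolding pv_supp_def
proof (intro ballI allI impI)
  fix S J K and z :: "nat \<Rightarrow> complex" assume *: "S \<in> maxcones D" "J \<subseteq> S" "K \<subseteq> {1..rk D}" "z \<in> coord_space S" "\<exists>i\<in>S. B < cmod (z i)"
  have "del D a S J K z = del D (\<lambda>S J K z. 0) S J K z"
    by (rule del_cong[OF open_outside[of S B] *(2,3)]) (use * assms in \<open>auto simp: pv_supp_def\<close>)
  then show "del D a S J K z = 0" by (simp add: del_zero)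
qed

lemma pv_supp_bracket:
  assumes "pv_supp D B a" shows "pv_supp D B (bracket_f D a)"
  unfolding pv_supp_def
proof (intro ballI allI impI)
  fix S J K and z :: "nat \<Rightarrow> complex" assume *: "S \<in> maxcones D" "J \<subseteq> S" "K \<subseteq> {1..rk D}" "z \<in> coord_space S" "\<exists>i\<in>S. B < cmod (z i)"
  have "a S J (insert k K) z = 0" if "k \<in> {1..rk D}" for k
    using assms * that unfolding pv_supp_def by (metis insert_subset)
  then show "bracket_f D a S J K z = 0" unfolding bracket_f_def odd_deriv_def
    by (intro sum.neutral ballI) simp
qed

lemma top_continuous: "pv_smooth D a \<Longrightarrow> S \<in> maxcones D \<Longrightarrow> continuous_on (coord_space S) (a S S {1..rk D})"
  using smooth_in_continuous[OF pv_smoothD] by force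

lemma Tr_sum:
  assumes "\<And>x. x \<in> A \<Longrightarrow> pv_smooth D (a x)" "\<And>x. x \<in> A \<Longrightarrow> pv_supp D B (a x)"
  shows "Tr D (\<lambda>S J K z. \<Sum>x\<in>A. c x * a x S J K z) = (\<Sum>x\<in>A. c x * Tr D (a x))"
proof -
  have "log_integral S (\<lambda>z. \<Sum>x\<in>A. c x * a x S S {1..rk D} z) = (\<Sum>x\<in>A. c x * log_integral S (a x S S {1..rk D}))"
    if S: "S \<in> maxcones D" for S
  proof (rule log_integral_lin[OF maxcone_finite[OF D S]])
    fix x assume x: "x \<in> A"
    show "continuous_on (coord_space S) (a x S S {1..rk D})" by (rule top_continuous[OF assms(1)[OF x] S])
    fix z i assume "z \<in> coord_space S" "i \<in> S" "B < cmod (z i)"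
    then show "a x S S {1..rk D} z = 0" by (intro pv_suppD[OF assms(2)[OF x] S]) auto
  qed
  then have "Tr D (\<lambda>S J K z. \<Sum>x\<in>A. c x * a x S J K z) =
    (\<Sum>S\<in>maxcones D. \<Sum>x\<in>A. c x * ((2 * \<i>) ^ rk D / of_int (frame_det D S) * log_integral S (a x S S {1..rk D})))"
    unfolding Tr_eq by (intro sum.cong refl) (simp add: sum_distrib_left mult_ac)
  also have "\<dots> = (\<Sum>x\<in>A. \<Sum>S\<in>maxcones D. c x * ((2 * \<i>) ^ rk D / of_int (frame_det D S) * log_integral S (a x S S {1..rk D})))"
    by (rule sum.swap)
  finally show ?thesis by (simp add: Tr_eq sum_distrib_left)
qed

lemma Tr_add:
  assumes "pv_smooth D a" "pv_supp D B a" "pv_smooth D b" "pv_supp D B b"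
  shows "Tr D (\<lambda>S J K z. a S J K z + b S J K z) = Tr D a + Tr D b"
  using Tr_sum[of "UNIV :: bool set" "\<lambda>x. if x then a else b" B "\<lambda>x. 1"] assms
  by (simp add: UNIV_bool add.commute)

text \<open>\<open>log_integral_d_zbar\<close> turns each term into an integral over a wall
  \<open>W = S - {i}\<close>. Compatibility makes this integral depend on \<open>W\<close> alone,
  and the coefficients at a fixed wall add up to zero by \<open>wall_balance\<close>.\<close>

lemma Tr_dbar_exact:
  assumes c: "pv_smooth D c" "pv_compat D c" "pv_supp D B c"
  shows "Tr D (dbar c) = 0"
proof -
  let ?N = "{1..rk D}"
  \<comment> \<open>An arbitrary maximal cone at the wall; all of them induce the same restriction
    to the wall.\<close>
  define pick where "pick W = (SOME S. S \<in> maxcones D \<and> W \<subseteq> S)" for W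
  define I where "I W = residue_const * log_integral W (c (pick W) W ?N)" for W
  define G where "G W i = (2 * \<i>) ^ rk D * I W * (shuffle_sign {i} W / of_int (frame_det D (insert i W)))" for W i
  have "(2 * \<i>) ^ rk D / of_int (frame_det D S) * log_integral S (dbar c S S ?N) = (\<Sum>i\<in>S. G (S - {i}) i)"
    if S: "S \<in> maxcones D" for S
  proof -
    have fS: "finite S" by (rule maxcone_finite[OF D S])
    have sm: "smooth_in S UNIV (c S (S - {i}) ?N)" for i by (rule pv_smoothD[OF c(1) S]) auto
    have smd: "smooth_in S UNIV (d_zbar i (c S (S - {i}) ?N))" if "i \<in> S" for i
      by (rule smooth_in_d_zbar[OF open_UNIV sm that])
    have sp: "c S (S - {i}) ?N z = 0" if "z \<in> coord_space S" "l \<in> S" "B < cmod (z l)" for i z l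
      by (rule pv_suppD[OF c(3) S _ _ that]) auto
    have "log_integral S (dbar c S S ?N) = (\<Sum>i\<in>S. shuffle_sign {i} (S - {i}) * log_integral S (d_zbar i (c S (S - {i}) ?N)))"
      unfolding dbar_def
    proof (rule log_integral_lin[OF fS])
      fix i assume i: "i \<in> S"
      show "continuous_on (coord_space S) (d_zbar i (c S (S - {i}) ?N))"
        using smooth_in_continuous[OF smd[OF i]] by simp
      fix z l assume z: "z \<in> coord_space S" "l \<in> S" "B < cmod (z l)"
      have ins: "insert i (S - {i}) = S" using i by auto
      show "d_zbar i (c S (S - {i}) ?N) z = 0"
        by (rule d_supp(2)[of "S - {i}" i _ B]; (unfold ins)?) (use fS sm sp z in auto)
    qed
    also have "\<dots> = (\<Sum>i\<in>S. shuffle_sign {i} (S - {i}) * I (S - {i}))"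
    proof (intro sum.cong refl arg_cong2[of _ _ _ _ "(*)"])
      fix i assume i: "i \<in> S"
      have ins: "insert i (S - {i}) = S" using i by auto
      have "log_integral (insert i (S - {i})) (d_zbar i (c S (S - {i}) ?N)) = residue_const * log_integral (S - {i}) (c S (S - {i}) ?N)"
        by (rule log_integral_d_zbar[where B = B]; (unfold ins)?) (use fS sm sp in auto)
      moreover have "log_integral (S - {i}) (c S (S - {i}) ?N) = log_integral (S - {i}) (c (pick (S - {i})) (S - {i}) ?N)"
      proof (rule log_integral_cong)
        fix z :: "nat \<Rightarrow> complex" assume z: "z \<in> coord_space (S - {i})"
        have "S \<in> maxcones D \<and> S - {i} \<subseteq> S" using S by auto
        then have "pick (S - {i}) \<in> maxcones D \<and> S - {i} \<subseteq> pick (S - {i})" unfolding pick_def by (rule someI)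
        then have p: "pick (S - {i}) \<in> maxcones D" "S - {i} \<subseteq> S \<inter> pick (S - {i})" by auto
        show "c S (S - {i}) ?N z = c (pick (S - {i})) (S - {i}) ?N z"
          using c(2) S p coord_space_mono[OF p(2) z] unfolding pv_compat_def by blast
      qed
      ultimately show "log_integral S (d_zbar i (c S (S - {i}) ?N)) = I (S - {i})" unfolding ins I_def by simp
    qed
    finally have li: "log_integral S (dbar c S S ?N) = (\<Sum>i\<in>S. shuffle_sign {i} (S - {i}) * I (S - {i}))" .
    show ?thesis unfolding li sum_distrib_left G_def
      by (rule sum.cong) (simp_all add: insert_absorb)
  qed
  then have "Tr D (dbar c) = (\<Sum>S\<in>maxcones D. \<Sum>i\<in>S. G (S - {i}) i)"
    unfolding Tr_eq by (rule sum.cong[OF refl])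
  also have "\<dots> = (\<Sum>(S, i)\<in>Sigma (maxcones D) (\<lambda>S. S). G (S - {i}) i)"
    by (rule sum.Sigma) (use finite_maxcones[OF D] maxcone_finite[OF D] in auto)
  \<comment> \<open>Pairs of a maximal cone and one of its rays are regrouped by the wall opposite
    to the ray.\<close>
  also have "\<dots> = (\<Sum>(W, i)\<in>Sigma (Pow {1..nrays D}) (\<lambda>W. {i. i \<notin> W \<and> insert i W \<in> maxcones D}). G W i)"
    by (rule sum.reindex_bij_witness[of _ "\<lambda>(W, i). (insert i W, i)" "\<lambda>(S, i). (S - {i}, i)"])
      (use maxcone_rays[OF D] in \<open>auto simp: insert_absorb\<close>)
  also have "\<dots> = (\<Sum>W\<in>Pow {1..nrays D}. \<Sum>i | i \<notin> W \<and> insert i W \<in> maxcones D. G W i)"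
  proof (rule sum.Sigma[symmetric])
    show "\<forall>W\<in>Pow {1..nrays D}. finite {i. i \<notin> W \<and> insert i W \<in> maxcones D}"
    proof
      fix W show "finite {i. i \<notin> W \<and> insert i W \<in> maxcones D}"
        by (rule finite_subset[of _ "{1..nrays D}"]) (use maxcone_rays[OF D] in auto)
    qed
  qed simp
  also have "\<dots> = 0"
    unfolding G_def sum_distrib_left[symmetric] using wall_balance[OF D] by simp
  finally show ?thesis .
qed

lemma log_integral_euler_zero:
  assumes S: "S \<in> maxcones D" and F: "smooth_in S UNIV F"
    and supp: "\<And>z l. z \<in> coord_space S \<Longrightarrow> l \<in> S \<Longrightarrow> B < cmod (z l) \<Longrightarrow> F z = 0"
  shows "log_integral S (euler i F) = 0"
proof (cases "i \<in> S")
  case True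
  then have ins: "insert i (S - {i}) = S" by auto
  have "log_integral (insert i (S - {i})) (euler i F) = 0"
    by (rule log_integral_euler[where B = B]; (unfold ins)?) (use maxcone_finite[OF D S] F supp in auto)
  then show ?thesis unfolding ins .
next
  case False
  have "log_integral S (euler i F) = log_integral S (\<lambda>z. 0)"
    by (rule log_integral_cong) (rule euler_outside[OF _ False])
  then show ?thesis by (simp add: log_integral_def)
qed

lemma Tr_minus: "Tr D (\<lambda>S J K z. - a S J K z) = - Tr D a"
  unfolding Tr_eq log_integral_def by (simp add: sum_negf)

lemma Tr_dbar:
  assumes "pv_smooth D a" "pv_compat D a" "pv_supp D B a" "pv_smooth D b" "pv_compat D b"
  shows "Tr D (wedge (dbar a) b) = - Tr D (wedge (parity_twist a) (dbar b))"
proof -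
  have "0 = Tr D (dbar (wedge a b))"
    by (rule Tr_dbar_exact[symmetric, where B = B]) (intro pv_smooth_wedge pv_compat_wedge pv_supp_wedge assms)+
  also have "\<dots> = Tr D (\<lambda>S J K z. wedge (dbar a) b S J K z + wedge (parity_twist a) (dbar b) S J K z)"
  proof (rule Tr_cong)
    fix S and z :: "nat \<Rightarrow> complex" assume S: "S \<in> maxcones D" and z: "z \<in> coord_space S"
    show "dbar (wedge a b) S S {1..rk D} z = wedge (dbar a) b S S {1..rk D} z + wedge (parity_twist a) (dbar b) S S {1..rk D} z"
      by (rule dbar_wedge[where N = "{1..rk D}"])
        (use pv_smoothD[OF assms(1) S] pv_smoothD[OF assms(4) S] maxcone_finite[OF D S] z in auto)
  qed
  also have "\<dots> = Tr D (wedge (dbar a) b) + Tr D (wedge (parity_twist a) (dbar b))"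
    by (rule Tr_add[where B = B]) (intro pv_smooth_wedge pv_supp_wedge pv_smooth_dbar pv_supp_dbar pv_smooth_twist pv_supp_twist assms)+
  finally show ?thesis by (simp add: eq_neg_iff_add_eq_0)
qed

lemma Tr_bracket: "Tr D (wedge (bracket_f D a) b) = - Tr D (wedge (parity_twist a) (bracket_f D b))"
  unfolding Tr_minus[symmetric]
proof (rule Tr_cong)
  fix S and z :: "nat \<Rightarrow> complex" assume S: "S \<in> maxcones D"
  have f: "finite {1..rk D}" "finite S" using maxcone_finite[OF D S] by auto
  have "wedge (bracket_f D a) b S S {1..rk D} z = (\<Sum>J1\<in>Pow S. \<Sum>k\<in>{1..rk D}. \<Sum>K1\<in>Pow ({1..rk D} - {k}).
     wedge_coeff J1 (S - J1) K1 ({1..rk D} - K1) * ((-1) ^ card J1 * shuffle_sign {k} K1) * (g_f D k z * a S J1 (insert k K1) z * b S (S - J1) ({1..rk D} - K1) z))"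
    by (rule wedge_iota_left[OF f, of _ _ _ "\<lambda>k J1 K'. g_f D k z * a S J1 K' z"]) (rule bracket_eq)
  moreover have "wedge (parity_twist a) (bracket_f D b) S S {1..rk D} z = - (\<Sum>J1\<in>Pow S. \<Sum>k\<in>{1..rk D}. \<Sum>K1\<in>Pow ({1..rk D} - {k}).
     wedge_coeff J1 (S - J1) K1 ({1..rk D} - K1) * ((-1) ^ card J1 * shuffle_sign {k} K1) * (a S J1 (insert k K1) z * (g_f D k z * b S (S - J1) ({1..rk D} - K1) z)))"
    by (rule wedge_iota_right[OF f, of _ _ _ "\<lambda>k J1 K'. g_f D k z * b S J1 K' z"]) (rule bracket_eq)
  ultimately show "wedge (bracket_f D a) b S S {1..rk D} z = - wedge (parity_twist a) (bracket_f D b) S S {1..rk D} z"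
    by (simp add: mult_ac)
qed

text \<open>Two minus signs, one from the contraction and one from integrating the Euler fields by
  parts, make the sign opposite to those of \<open>Tr_dbar\<close> and \<open>Tr_bracket\<close>.
  The change of \<open>u\<close> to \<open>- u\<close> in the pairing compensates for this.\<close>

lemma Tr_del:
  assumes a: "pv_smooth D a" "pv_supp D B a" and b: "pv_smooth D b"
  shows "Tr D (wedge (del D a) b) = Tr D (wedge (parity_twist a) (del D b))"
  unfolding Tr_eq
proof (intro sum.cong refl arg_cong2[of _ _ _ _ "(*)"])
  fix S assume S: "S \<in> maxcones D"
  let ?N = "{1..rk D}"
  let ?p = "\<lambda>i k. of_int (pairing (ray D i) (dual_vec D k)) :: complex"
  have f: "finite ?N" "finite S" using maxcone_finite[OF D S] by auto
  \<comment> \<open>One index set for all terms, so that the difference of the two sides is a single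
    linear combination of Euler derivatives of products.\<close>
  define P where "P = Pow S \<times> Sigma ?N (\<lambda>k. Pow (?N - {k})) \<times> {1..nrays D}"
  define c where "c = (\<lambda>(J1, (k, K1), i). wedge_coeff J1 (S - J1) K1 (?N - K1) * ((-1) ^ card J1 * shuffle_sign {k} K1) * ?p i k)"
  define G where "G = (\<lambda>(J1, (k, K1), i :: nat). \<lambda>z. a S J1 (insert k K1) z * b S (S - J1) (?N - K1) z)"
  have sm: "smooth_in S UNIV (a S J1 (insert k K1))" "smooth_in S UNIV (b S (S - J1) (?N - K1))"
    if "J1 \<in> Pow S" "k \<in> ?N" "K1 \<in> Pow (?N - {k})" for J1 k K1
  proof -
    show "smooth_in S UNIV (a S J1 (insert k K1))" by (rule pv_smoothD[OF a(1) S]) (use that in auto)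
    show "smooth_in S UNIV (b S (S - J1) (?N - K1))" by (rule pv_smoothD[OF b S]) auto
  qed
  have smG: "smooth_in S UNIV (G x)" if "x \<in> P" for x
  proof -
    obtain J1 k K1 i where x: "x = (J1, (k, K1), i)" by (metis prod.exhaust)
    with that have "J1 \<in> Pow S" "k \<in> ?N" "K1 \<in> Pow (?N - {k})" by (simp_all add: P_def)
    from smooth_in_mult[OF open_UNIV sm[OF this]] show ?thesis by (simp add: G_def x)
  qed
  have spG: "G x z = 0" if "x \<in> P" "z \<in> coord_space S" "l \<in> S" "B < cmod (z l)" for x z l
  proof -
    obtain J1 k K1 i where x: "x = (J1, (k, K1), i)" by (metis prod.exhaust)
    have "a S J1 (insert k K1) z = 0" by (rule pv_suppD[OF a(2) S _ _ that(2-4)]) (use that(1) x in \<open>auto simp: P_def\<close>)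
    then show ?thesis by (simp add: G_def x)
  qed
  have key: "wedge (del D a) b S S ?N z = wedge (parity_twist a) (del D b) S S ?N z + (\<Sum>x\<in>P. c x * euler (snd (snd x)) (G x) z)"
    if z: "z \<in> coord_space S" for z
  proof -
    have zz: "z \<in> coord_space S \<inter> UNIV" using z by simp
    let ?X = "\<lambda>e k J1 K'. \<Sum>i=1..nrays D. ?p i k * euler i (e S J1 K') z"
    let ?w = "\<lambda>J1 k K1. wedge_coeff J1 (S - J1) K1 (?N - K1) * ((-1) ^ card J1 * shuffle_sign {k} K1)"
    have 1: "wedge (del D a) b S S ?N z = (\<Sum>J1\<in>Pow S. \<Sum>k\<in>?N. \<Sum>K1\<in>Pow (?N - {k}).
       ?w J1 k K1 * (?X a k J1 (insert k K1) * b S (S - J1) (?N - K1) z))"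
      by (rule wedge_iota_left[OF f, of _ _ _ "?X a"]) (rule del_eq[OF a(1) S _ _ z])
    have 2: "wedge (parity_twist a) (del D b) S S ?N z = - (\<Sum>J1\<in>Pow S. \<Sum>k\<in>?N. \<Sum>K1\<in>Pow (?N - {k}).
       ?w J1 k K1 * (a S J1 (insert k K1) z * ?X b k (S - J1) (?N - K1)))"
      by (rule wedge_iota_right[OF f, of _ _ _ "?X b"]) (rule del_eq[OF b S _ _ z])
    have sg: "(\<Sum>y\<in>Sigma ?N (\<lambda>k. Pow (?N - {k})). h y) = (\<Sum>k\<in>?N. \<Sum>K1\<in>Pow (?N - {k}). h (k, K1))"
      for h :: "nat \<times> nat set \<Rightarrow> complex"
      using sum.Sigma[of ?N "\<lambda>k. Pow (?N - {k})" "\<lambda>k K1. h (k, K1)"] f by (simp add: case_prod_unfold)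
    have "(\<Sum>x\<in>P. c x * euler (snd (snd x)) (G x) z) = (\<Sum>J1\<in>Pow S. \<Sum>k\<in>?N. \<Sum>K1\<in>Pow (?N - {k}). \<Sum>i=1..nrays D.
       ?w J1 k K1 * ?p i k * euler i (\<lambda>z. a S J1 (insert k K1) z * b S (S - J1) (?N - K1) z) z)"
      unfolding P_def sum.cartesian_product' sg c_def G_def by simp
    also have "\<dots> = (\<Sum>J1\<in>Pow S. \<Sum>k\<in>?N. \<Sum>K1\<in>Pow (?N - {k}).
       ?w J1 k K1 * (?X a k J1 (insert k K1) * b S (S - J1) (?N - K1) z) + ?w J1 k K1 * (a S J1 (insert k K1) z * ?X b k (S - J1) (?N - K1)))"
    proof (intro sum.cong refl)
      fix J1 k K1 assume *: "J1 \<in> Pow S" "k \<in> ?N" "K1 \<in> Pow (?N - {k})"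
      show "(\<Sum>i=1..nrays D. ?w J1 k K1 * ?p i k * euler i (\<lambda>z. a S J1 (insert k K1) z * b S (S - J1) (?N - K1) z) z) =
        ?w J1 k K1 * (?X a k J1 (insert k K1) * b S (S - J1) (?N - K1) z) + ?w J1 k K1 * (a S J1 (insert k K1) z * ?X b k (S - J1) (?N - K1))"
        unfolding euler_mult[OF zz sm[OF *]]
        by (simp add: sum_distrib_left sum_distrib_right distrib_left sum.distrib mult_ac)
    qed
    finally show ?thesis unfolding 1 2 by (simp add: sum.distrib)
  qed
  have "log_integral S (wedge (del D a) b S S ?N) = log_integral S (\<lambda>z. wedge (parity_twist a) (del D b) S S ?N z + (\<Sum>x\<in>P. c x * euler (snd (snd x)) (G x) z))"
    by (rule log_integral_cong) (rule key)
  also have "\<dots> = log_integral S (wedge (parity_twist a) (del D b) S S ?N) + log_integral S (\<lambda>z. \<Sum>x\<in>P. c x * euler (snd (snd x)) (G x) z)"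
  proof -
    let ?F = "\<lambda>t. if t then wedge (parity_twist a) (del D b) S S ?N else (\<lambda>z. \<Sum>x\<in>P. c x * euler (snd (snd x)) (G x) z)"
    have "log_integral S (\<lambda>z. \<Sum>t\<in>UNIV. 1 * ?F t z) = (\<Sum>t\<in>UNIV. 1 * log_integral S (?F t))"
    proof (rule log_integral_lin[OF f(2)])
      fix t
      have sw: "pv_smooth D (wedge (parity_twist a) (del D b))" by (intro pv_smooth_wedge pv_smooth_twist pv_smooth_del a b)
      have "smooth_in S UNIV (\<lambda>z. \<Sum>x\<in>P. c x * euler (snd (snd x)) (G x) z)"
        by (intro smooth_in_sum smooth_in_mult smooth_in_const smooth_in_euler open_UNIV smG)
      then show "continuous_on (coord_space S) (?F t)" using top_continuous[OF sw S] smooth_in_continuous by force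
      fix z l assume z: "z \<in> coord_space S" "l \<in> S" "B < cmod (z l)"
      have "wedge (parity_twist a) (del D b) S S ?N z = 0"
        by (rule pv_suppD[OF pv_supp_wedge[OF pv_supp_twist[OF a(2)]] S _ _ z]) auto
      moreover have "wedge (del D a) b S S ?N z = 0"
        by (rule pv_suppD[OF pv_supp_wedge[OF pv_supp_del[OF a(2)]] S _ _ z]) auto
      ultimately show "?F t z = 0" using key[OF z(1)] by auto
    qed
    then show ?thesis by (simp add: UNIV_bool add.commute)
  qed
  also have "log_integral S (\<lambda>z. \<Sum>x\<in>P. c x * euler (snd (snd x)) (G x) z) = (\<Sum>x\<in>P. c x * log_integral S (euler (snd (snd x)) (G x)))"
  proof (rule log_integral_lin[OF f(2)])
    fix x assume x: "x \<in> P"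
    show "continuous_on (coord_space S) (euler (snd (snd x)) (G x))"
      using smooth_in_continuous[OF smooth_in_euler[OF open_UNIV smG[OF x]]] by simp
    fix z l assume z: "z \<in> coord_space S" "l \<in> S" "B < cmod (z l)"
    have "euler (snd (snd x)) (G x) z = euler (snd (snd x)) (\<lambda>z. 0) z"
      by (rule euler_cong[OF open_outside[of S B], where W = S]) (use z spG[OF x] in auto)
    then show "euler (snd (snd x)) (G x) z = 0" by simp
  qed
  also have "(\<Sum>x\<in>P. c x * log_integral S (euler (snd (snd x)) (G x))) = 0"
    using log_integral_euler_zero[OF S smG spG] by (intro sum.neutral ballI) simp
  finally show "log_integral S (wedge (del D a) b S S ?N) = log_integral S (wedge (parity_twist a) (del D b) S S ?N)" by simp
qed

end

section \<open>Stokes' theorem for the trace pairing\<close>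

definition trace_pairing :: "'n::finite toric \<Rightarrow> pvu \<Rightarrow> pvu \<Rightarrow> nat \<Rightarrow> complex" where
  "trace_pairing D \<alpha> \<beta> m = Tr D (wedge_u \<alpha> (bar_u \<beta>) m)"

definition twist_u :: "pvu \<Rightarrow> pvu" where
  "twist_u \<alpha> = (\<lambda>m. parity_twist (\<alpha> m))"

lemma twist_twist: "twist_u (twist_u \<alpha>) = \<alpha>"
  by (simp add: twist_u_def parity_twist_def minus_one_power_square)

lemma wedge_add_left: "wedge (\<lambda>S J K z. x S J K z + y S J K z) b = (\<lambda>S J K z. wedge x b S J K z + wedge y b S J K z)"
  by (intro ext) (simp add: wedge_eq distrib_left distrib_right sum.distrib)

lemma wedge_add_right: "wedge a (\<lambda>S J K z. x S J K z + y S J K z) = (\<lambda>S J K z. wedge a x S J K z + wedge a y S J K z)"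
  by (intro ext) (simp add: wedge_eq distrib_left sum.distrib)

lemma wedge_cmult_right: "wedge a (\<lambda>S J K z. c * x S J K z) = (\<lambda>S J K z. c * wedge a x S J K z)"
  by (intro ext) (simp add: wedge_eq sum_distrib_left mult_ac)

lemma good_pv: "good D \<alpha> \<Longrightarrow> pv_smooth D (\<alpha> m)" "good D \<alpha> \<Longrightarrow> pv_compat D (\<alpha> m)"
proof -
  assume g: "good D \<alpha>"
  show "pv_smooth D (\<alpha> m)" using g by (simp add: good_def smooth_pv_def pv_smooth_def)
  show "pv_compat D (\<alpha> m)" unfolding pv_compat_def
  proof (intro ballI allI impI)
    fix S S' J K and z :: "nat \<Rightarrow> complex"
    assume *: "S \<in> maxcones D" "S' \<in> maxcones D" "J \<subseteq> S \<inter> S'" "K \<subseteq> {1..rk D}" "z \<in> coord_space (S \<inter> S')"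
    have "agree D (S \<inter> S') UNIV m \<alpha> S \<alpha> S'" using g * by (simp add: good_def)
    from agreeD[OF this order_refl *(3-5)] show "\<alpha> m S J K z = \<alpha> m S' J K z" by simp
  qed
qed

lemma supported_pv: "supported D B \<alpha> \<Longrightarrow> pv_supp D B (\<alpha> m)"
  unfolding pv_supp_def by (blast dest: supportedD)

lemma good_twist: "good D \<alpha> \<Longrightarrow> good D (twist_u \<alpha>)"
  unfolding good_def twist_u_def smooth_pv_def agree_def parity_twist_def
  by (auto intro!: smooth_in_mult)

lemma supported_twist: "supported D B \<alpha> \<Longrightarrow> supported D B (twist_u \<alpha>)"
  unfolding supported_def agree_def twist_u_def parity_twist_def by simp

lemma trace_pairing_cong:
  assumes "eqv D \<alpha> \<alpha>'" "eqv D \<beta> \<beta>'"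
  shows "trace_pairing D \<alpha> \<beta> m = trace_pairing D \<alpha>' \<beta>' m"
  unfolding trace_pairing_def
proof (rule Tr_cong)
  fix S and z :: "nat \<Rightarrow> complex" assume S: "S \<in> maxcones D" and z: "z \<in> coord_space S"
  show "wedge_u \<alpha> (bar_u \<beta>) m S S {1..rk D} z = wedge_u \<alpha>' (bar_u \<beta>') m S S {1..rk D} z"
    unfolding wedge_u_def wedge_def bar_u_def
  proof (intro sum.cong refl)
    fix l J1 K1 assume "J1 \<in> Pow S" "K1 \<in> Pow {1..rk D}"
    then have "\<alpha> l S J1 K1 z = \<alpha>' l S J1 K1 z"
      "\<beta> (m - l) S (S - J1) ({1..rk D} - K1) z = \<beta>' (m - l) S (S - J1) ({1..rk D} - K1) z"
      by (auto intro!: eqvD[OF assms(1) S] eqvD[OF assms(2) S] z)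
    then show "(-1) ^ (card K1 * card (S - J1)) * shuffle_sign J1 (S - J1) * shuffle_sign K1 ({1..rk D} - K1) *
        \<alpha> l S J1 K1 z * ((-1) ^ (m - l) * \<beta> (m - l) S (S - J1) ({1..rk D} - K1) z) =
      (-1) ^ (card K1 * card (S - J1)) * shuffle_sign J1 (S - J1) * shuffle_sign K1 ({1..rk D} - K1) *
        \<alpha>' l S J1 K1 z * ((-1) ^ (m - l) * \<beta>' (m - l) S (S - J1) ({1..rk D} - K1) z)" by simp
  qed
qed

text \<open>\<open>A\<close> is a compactly supported stand-in for \<open>a\<close>; the primitive
  \<open>\<delta>\<close> of the difference may have any support.\<close>

definition represents :: "'n::finite toric \<Rightarrow> pvu \<Rightarrow> pvu \<Rightarrow> bool" where
  "represents D A a \<longleftrightarrow> good D A \<and> compactly_supported D A \<and> (\<exists>\<delta>. good D \<delta> \<and> eqv D A (padd 1 a 1 (Q_f D \<delta>)))"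

lemma common_support:
  assumes "finite A" "\<And>x. x \<in> A \<Longrightarrow> compactly_supported D (F x)"
  shows "\<exists>B. \<forall>x\<in>A. supported D B (F x)"
proof -
  obtain b where b: "\<forall>x\<in>A. supported D (b x) (F x)"
    using assms(2) unfolding compactly_supported_def by metis
  have "supported D (Max (b ` A)) (F x)" if "x \<in> A" for x
    by (rule supported_mono[OF bspec[OF b that]]) (use assms(1) that in auto)
  then show ?thesis by blast
qed

definition mono_trace :: "'n::finite toric \<Rightarrow> nat set \<Rightarrow> pvu \<Rightarrow> nat \<Rightarrow> complex" where
  "mono_trace D b \<alpha> m = Tr D (\<lambda>S J K z. (\<Prod>i\<in>b. z i) * \<alpha> m S J K z)"

text \<open>A monomial has degree zero and no positive powers of \<open>u\<close>, so one term of
  the wedge product and one of the Cauchy product survive, and the bar leaves no sign.\<close>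

lemma trace_pairing_P_mon:
  assumes D: "log_LG D" shows "trace_pairing D \<alpha> (P_mon b) m = mono_trace D b \<alpha> m"
  unfolding trace_pairing_def mono_trace_def
proof (rule Tr_cong)
  fix S and z :: "nat \<Rightarrow> complex" assume S: "S \<in> maxcones D"
  let ?N = "{1..rk D}"
  let ?v = "(\<Prod>i\<in>b. z i) * \<alpha> m S S ?N z"
  have fS: "finite S" by (rule maxcone_finite[OF D S])
  have s: "shuffle_sign S {} = 1" "shuffle_sign ?N {} = 1" by (simp_all add: shuffle_sign_def)
  have w: "wedge (\<alpha> l) (bar_u (P_mon b) (m - l)) S S ?N z = (if l = m then ?v else 0)" if "l \<le> m" for l
  proof -
    have "wedge (\<alpha> l) (bar_u (P_mon b) (m - l)) S S ?N z = (\<Sum>J1\<in>Pow S. \<Sum>K1\<in>Pow ?N. if K1 = ?N then if J1 = S then if l = m then ?v else 0 else 0 else 0)"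
      unfolding wedge_def
    proof (intro sum.cong refl)
      fix J1 K1 assume "J1 \<in> Pow S" "K1 \<in> Pow ?N"
      then have e: "S - J1 = {} \<longleftrightarrow> J1 = S" "?N - K1 = {} \<longleftrightarrow> K1 = ?N" by blast+
      have i: "m - l = 0 \<longleftrightarrow> l = m" using that by auto
      show "(-1) ^ (card K1 * card (S - J1)) * shuffle_sign J1 (S - J1) * shuffle_sign K1 (?N - K1) * \<alpha> l S J1 K1 z *
          bar_u (P_mon b) (m - l) S (S - J1) (?N - K1) z =
        (if K1 = ?N then if J1 = S then if l = m then ?v else 0 else 0 else 0)"
        unfolding bar_u_def P_mon_def e i using s by auto
    qed
    also have "\<dots> = (if l = m then ?v else 0)" using fS by (simp only: sum.delta finite_Pow_iff finite_atLeastAtMost) simp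
    finally show ?thesis .
  qed
  show "wedge_u \<alpha> (bar_u (P_mon b)) m S S ?N z = ?v"
    unfolding wedge_u_def using w by simp
qed

section \<open>Stokes' theorem and invariance of the pairing under exact terms\<close>

context
  fixes D :: "'n::finite toric" and R :: "(nat \<Rightarrow> real) \<Rightarrow> real"
  assumes D: "log_LG D" and R: "is_cutoff D R"
begin

text \<open>Each part of \<open>Q_f\<close> changes the degree \<open>card J + card K\<close> by
  one.\<close>

lemma Q_f_twist:
  assumes \<alpha>: "good D \<alpha>"
  shows "eqv D (Q_f D (twist_u \<alpha>)) (\<lambda>m S J K z. - ((-1) ^ (card J + card K) * Q_f D \<alpha> m S J K z))"
proof (rule eqvI)
  fix S m J K and z :: "nat \<Rightarrow> complex" assume *: "S \<in> maxcones D" "J \<subseteq> S" "K \<subseteq> {1..rk D}" "z \<in> coord_space S"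
  have zz: "z \<in> coord_space S \<inter> UNIV" using * by simp
  have f: "finite J" "finite K" using * maxcone_finite[OF D *(1)] finite_subset by blast+
  note SU = maxcone_rays[OF D *(1)] open_UNIV
  have sp: "Q_f D \<beta> m S J K z = dbar_u \<beta> m S J K z + iota_part D \<beta> m S J K z" if "good D \<beta>" for \<beta>
    using agreeD[OF Q_f_split[OF SU good_smooth[OF that *(1)]] order_refl *(2-4) UNIV_I, of m] .
  have 1: "dbar_u (twist_u \<alpha>) m S J K z = - ((-1) ^ (card J + card K) * dbar_u \<alpha> m S J K z)"
    unfolding dbar_u_def dbar_def sum_distrib_left sum_negf[symmetric]
  proof (rule sum.cong[OF refl])
    fix i assume i: "i \<in> J"
    have sm: "smooth_in S UNIV (\<alpha> m S (J - {i}) K)"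
      by (rule smooth_pvD[OF good_smooth[OF \<alpha> *(1)]]) (use * in auto)
    have c: "card J = Suc (card (J - {i}))" using card_Suc_Diff1[OF f(1) i] by simp
    have iS: "i \<in> S" using i * by auto
    show "shuffle_sign {i} (J - {i}) * d_zbar i (twist_u \<alpha> m S (J - {i}) K) z =
      - ((-1) ^ (card J + card K) * (shuffle_sign {i} (J - {i}) * d_zbar i (\<alpha> m S (J - {i}) K) z))"
      unfolding twist_u_def parity_twist_def c d_zbar_cmult[OF iS zz sm] by simp
  qed
  have 2: "iota_part D (twist_u \<alpha>) m S J K z = - ((-1) ^ (card J + card K) * iota_part D \<alpha> m S J K z)"
  proof -
    have B: "Bop D S k (\<lambda>m. twist_u \<alpha> m S J (insert k K)) m z = - ((-1) ^ (card J + card K)) * Bop D S k (\<lambda>m. \<alpha> m S J (insert k K)) m z"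
      if k: "k \<in> {1..rk D} - K" for k
    proof -
      have sm: "smooth_us S UNIV (\<lambda>m. \<alpha> m S J (insert k K))"
        by (rule smooth_pv_us[OF good_smooth[OF \<alpha> *(1)]]) (use * k in auto)
      have c: "card (insert k K) = Suc (card K)" using f k by simp
      have "Bop D S k (\<lambda>m z. \<Sum>x\<in>{0::nat}. - ((-1) ^ (card J + card K)) * \<alpha> m S J (insert k K) z) m z =
        (\<Sum>x\<in>{0::nat}. - ((-1) ^ (card J + card K)) * Bop D S k (\<lambda>m. \<alpha> m S J (insert k K)) m z)"
        by (rule Bop_lin[OF SU zz]) (rule sm)
      then show ?thesis by (simp add: twist_u_def parity_twist_def c)
    qed
    have "(\<Sum>k\<in>{1..rk D} - K. shuffle_sign {k} K * Bop D S k (\<lambda>m. twist_u \<alpha> m S J (insert k K)) m z) =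
      - ((-1) ^ (card J + card K)) * (\<Sum>k\<in>{1..rk D} - K. shuffle_sign {k} K * Bop D S k (\<lambda>m. \<alpha> m S J (insert k K)) m z)"
      unfolding sum_distrib_left by (rule sum.cong[OF refl]) (simp only: B mult_ac)
    then show ?thesis unfolding iota_part_def by (simp add: mult_ac)
  qed
  show "Q_f D (twist_u \<alpha>) m S J K z = - ((-1) ^ (card J + card K) * Q_f D \<alpha> m S J K z)"
    unfolding sp[OF \<alpha>] sp[OF good_twist[OF \<alpha>]] 1 2 by (simp add: distrib_left)
qed

lemma trace_pairing_eq:
  assumes "good D \<alpha>" "supported D B \<alpha>" "good D \<beta>"
  shows "trace_pairing D \<alpha> \<beta> m = (\<Sum>l\<le>m. (-1) ^ (m - l) * Tr D (wedge (\<alpha> l) (\<beta> (m - l))))"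
proof -
  have "trace_pairing D \<alpha> \<beta> m = Tr D (\<lambda>S J K z. \<Sum>l\<in>{..m}. (-1) ^ (m - l) * wedge (\<alpha> l) (\<beta> (m - l)) S J K z)"
    unfolding trace_pairing_def wedge_u_def bar_u_def wedge_cmult_right ..
  also have "\<dots> = (\<Sum>l\<le>m. (-1) ^ (m - l) * Tr D (wedge (\<alpha> l) (\<beta> (m - l))))"
    by (rule Tr_sum[OF D, where B = B]) (intro pv_smooth_wedge pv_supp_wedge good_pv supported_pv assms)+
  finally show ?thesis .
qed

lemma Tr_Q_f_left:
  assumes a: "good D \<alpha>" "supported D B \<alpha>" and b: "pv_smooth D b"
  shows "Tr D (wedge (Q_f D \<alpha> l) b) = Tr D (wedge (dbar (\<alpha> l)) b) +
     (if l = 0 then 0 else Tr D (wedge (del D (\<alpha> (l - 1))) b)) + Tr D (wedge (bracket_f D (\<alpha> l)) b)"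
proof -
  note s = pv_smooth_wedge[OF _ b] pv_supp_wedge pv_smooth_dbar[OF D] pv_smooth_del[OF D] pv_smooth_bracket[OF D]
    pv_supp_dbar[OF D] pv_supp_del[OF D] pv_supp_bracket[OF D] good_pv[OF a(1)] supported_pv[OF a(2)]
  have z: "pv_smooth D (\<lambda>S J K z. 0)" "pv_supp D B (\<lambda>S J K z. 0)" by (simp_all add: pv_smooth_def pv_supp_def)
  define e where "e = (if l = 0 then (\<lambda>S J K z. 0) else wedge (del D (\<alpha> (l - 1))) b)"
  have e: "pv_smooth D e" "pv_supp D B e" unfolding e_def using z by (auto intro!: s)
  have z0: "Tr D (\<lambda>S J K z. 0) = 0" by (simp add: Tr_eq log_integral_def)
  have "wedge (Q_f D \<alpha> l) b = (\<lambda>S J K z. (wedge (dbar (\<alpha> l)) b S J K z + e S J K z) + wedge (bracket_f D (\<alpha> l)) b S J K z)"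
    unfolding Q_f_def Q_op_def wedge_add_left e_def by (auto simp: fun_eq_iff wedge_def)
  moreover have "Tr D (\<lambda>S J K z. (wedge (dbar (\<alpha> l)) b S J K z + e S J K z) + wedge (bracket_f D (\<alpha> l)) b S J K z) =
    Tr D (\<lambda>S J K z. wedge (dbar (\<alpha> l)) b S J K z + e S J K z) + Tr D (wedge (bracket_f D (\<alpha> l)) b)"
  proof (rule Tr_add[OF D, where B = B])
    show "pv_smooth D (\<lambda>S J K z. wedge (dbar (\<alpha> l)) b S J K z + e S J K z)"
      by (rule pv_smoothI[OF D]) (intro smooth_in_add open_UNIV pv_smoothD[OF e(1)] pv_smoothD[OF s(1)] s)
    show "pv_supp D B (\<lambda>S J K z. wedge (dbar (\<alpha> l)) b S J K z + e S J K z)"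
    proof -
      have "pv_supp D B (wedge (dbar (\<alpha> l)) b)" by (intro s)
      then show ?thesis using e(2) unfolding pv_supp_def by simp
    qed
  qed (intro s)+
  moreover have "Tr D (\<lambda>S J K z. wedge (dbar (\<alpha> l)) b S J K z + e S J K z) = Tr D (wedge (dbar (\<alpha> l)) b) + Tr D e"
    by (rule Tr_add[OF D, where B = B]) (intro s e)+
  ultimately show ?thesis by (simp add: e_def z0)
qed

lemma Tr_Q_f_right:
  assumes a: "pv_smooth D a" "pv_supp D B a" and b: "good D \<beta>"
  shows "Tr D (wedge a (Q_f D \<beta> l)) = Tr D (wedge a (dbar (\<beta> l))) +
     (if l = 0 then 0 else Tr D (wedge a (del D (\<beta> (l - 1))))) + Tr D (wedge a (bracket_f D (\<beta> l)))"
proof -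
  note s = pv_smooth_wedge[OF a(1)] pv_supp_wedge[OF a(2)] pv_smooth_dbar[OF D] pv_smooth_del[OF D] pv_smooth_bracket[OF D] good_pv[OF b]
  have z: "pv_smooth D (\<lambda>S J K z. 0)" "pv_supp D B (\<lambda>S J K z. 0)" by (simp_all add: pv_smooth_def pv_supp_def)
  define e where "e = (if l = 0 then (\<lambda>S J K z. 0) else wedge a (del D (\<beta> (l - 1))))"
  have e: "pv_smooth D e" "pv_supp D B e" unfolding e_def using z by (auto intro!: s)
  have z0: "Tr D (\<lambda>S J K z. 0) = 0" by (simp add: Tr_eq log_integral_def)
  have "wedge a (Q_f D \<beta> l) = (\<lambda>S J K z. (wedge a (dbar (\<beta> l)) S J K z + e S J K z) + wedge a (bracket_f D (\<beta> l)) S J K z)"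
    unfolding Q_f_def Q_op_def wedge_add_right e_def by (auto simp: fun_eq_iff wedge_def)
  moreover have "Tr D (\<lambda>S J K z. (wedge a (dbar (\<beta> l)) S J K z + e S J K z) + wedge a (bracket_f D (\<beta> l)) S J K z) =
    Tr D (\<lambda>S J K z. wedge a (dbar (\<beta> l)) S J K z + e S J K z) + Tr D (wedge a (bracket_f D (\<beta> l)))"
  proof (rule Tr_add[OF D, where B = B])
    show "pv_smooth D (\<lambda>S J K z. wedge a (dbar (\<beta> l)) S J K z + e S J K z)"
      by (rule pv_smoothI[OF D]) (intro smooth_in_add open_UNIV pv_smoothD[OF e(1)] pv_smoothD[OF s(1)] s)
    show "pv_supp D B (\<lambda>S J K z. wedge a (dbar (\<beta> l)) S J K z + e S J K z)"
      using e(2) s(2)[of "dbar (\<beta> l)"] unfolding pv_supp_def by simp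
  qed (intro s)+
  moreover have "Tr D (\<lambda>S J K z. wedge a (dbar (\<beta> l)) S J K z + e S J K z) = Tr D (wedge a (dbar (\<beta> l))) + Tr D e"
    by (rule Tr_add[OF D, where B = B]) (intro s e)+
  ultimately show ?thesis by (simp add: e_def z0)
qed

lemma Stokes:
  assumes a: "good D \<alpha>" "supported D B \<alpha>" and b: "good D \<beta>"
  shows "trace_pairing D (Q_f D \<alpha>) \<beta> m = - trace_pairing D (twist_u \<alpha>) (Q_f D \<beta>) m"
proof -
  let ?d = "\<lambda>l r. Tr D (wedge (twist_u \<alpha> l) (dbar (\<beta> r)))"
  let ?e = "\<lambda>l r. Tr D (wedge (twist_u \<alpha> l) (del D (\<beta> r)))"
  let ?h = "\<lambda>l r. Tr D (wedge (twist_u \<alpha> l) (bracket_f D (\<beta> r)))"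
  have 1: "Tr D (wedge (Q_f D \<alpha> l) (\<beta> r)) = - ?d l r + (if l = 0 then 0 else ?e (l - 1) r) - ?h l r" for l r
    unfolding Tr_Q_f_left[OF a good_pv(1)[OF b]] twist_u_def
    using Tr_dbar[OF D good_pv[OF a(1)] supported_pv[OF a(2)] good_pv[OF b], of l r] Tr_bracket[OF D, of "\<alpha> l" "\<beta> r"]
      Tr_del[OF D good_pv(1)[OF a(1)] supported_pv[OF a(2)] good_pv(1)[OF b], of "l - 1" r]
    by simp
  have 2: "Tr D (wedge (twist_u \<alpha> l) (Q_f D \<beta> r)) = ?d l r + (if r = 0 then 0 else ?e l (r - 1)) + ?h l r" for l r
    by (rule Tr_Q_f_right[OF good_pv(1)[OF good_twist[OF a(1)]] supported_pv[OF supported_twist[OF a(2)]] b])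
  \<comment> \<open>\<open>del\<close> carries a factor \<open>u\<close>, so moving it to the second
    factor shifts \<open>l\<close> by one, and the sign \<open>(-1) ^ (m - l)\<close> of the bar
    turns the plus of \<open>Tr_del\<close> into a minus.\<close>
  have 3: "(\<Sum>l\<le>m. (-1) ^ (m - l) * (if l = 0 then 0 else ?e (l - 1) (m - l))) =
    - (\<Sum>l\<le>m. (-1) ^ (m - l) * (if m - l = 0 then 0 else ?e l (m - l - 1)))"
  proof (cases m)
    case (Suc n)
    have "(\<Sum>l\<le>Suc n. (-1) ^ (Suc n - l) * (if l = 0 then 0 else ?e (l - 1) (Suc n - l))) = (\<Sum>l\<le>n. (-1) ^ (n - l) * ?e l (n - l))"
      unfolding sum.atMost_Suc_shift by simp
    also have "\<dots> = - (\<Sum>l\<le>Suc n. (-1) ^ (Suc n - l) * (if Suc n - l = 0 then 0 else ?e l (Suc n - l - 1)))"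
      unfolding sum.atMost_Suc sum_negf[symmetric] by (simp add: sum_negf[symmetric] Suc_diff_le)
    finally show ?thesis unfolding Suc .
  qed simp
  have "trace_pairing D (Q_f D \<alpha>) \<beta> m = (\<Sum>l\<le>m. (-1) ^ (m - l) * (- ?d l (m - l) + (if l = 0 then 0 else ?e (l - 1) (m - l)) - ?h l (m - l)))"
    unfolding trace_pairing_eq[OF good_Q_f[OF D R a(1)] supported_Q_f[OF a(2)] b] 1 ..
  also have "\<dots> = (\<Sum>l\<le>m. (-1) ^ (m - l) * (if l = 0 then 0 else ?e (l - 1) (m - l))) - (\<Sum>l\<le>m. (-1) ^ (m - l) * (?d l (m - l) + ?h l (m - l)))"
    unfolding sum_subtractf[symmetric] by (rule sum.cong[OF refl]) (simp add: algebra_simps)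
  also have "\<dots> = - (\<Sum>l\<le>m. (-1) ^ (m - l) * (?d l (m - l) + (if m - l = 0 then 0 else ?e l (m - l - 1)) + ?h l (m - l)))"
    unfolding 3 sum_negf[symmetric] sum_subtractf[symmetric] by (rule sum.cong[OF refl]) (simp add: algebra_simps)
  also have "\<dots> = - trace_pairing D (twist_u \<alpha>) (Q_f D \<beta>) m"
    unfolding trace_pairing_eq[OF good_twist[OF a(1)] supported_twist[OF a(2)] good_Q_f[OF D R b]] 2 ..
  finally show ?thesis .
qed

lemma eqv_zero_twist: "eqv D \<alpha> zero_u \<Longrightarrow> eqv D (\<lambda>m S J K z. - ((-1) ^ (card J + card K) * \<alpha> m S J K z)) zero_u"
  unfolding eqv_def agree_def by simp

lemma trace_pairing_zero: "eqv D \<alpha> zero_u \<Longrightarrow> trace_pairing D \<alpha> \<beta> m = 0" "eqv D \<beta> zero_u \<Longrightarrow> trace_pairing D \<alpha> \<beta> m = 0"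
proof -
  have z: "Tr D (\<lambda>S J K z. 0) = 0" by (simp add: Tr_eq log_integral_def)
  have "trace_pairing D zero_u \<beta> m = 0" "trace_pairing D \<alpha> zero_u m = 0"
    unfolding trace_pairing_def wedge_u_def wedge_def bar_u_def using z by simp_all
  then show "eqv D \<alpha> zero_u \<Longrightarrow> trace_pairing D \<alpha> \<beta> m = 0" "eqv D \<beta> zero_u \<Longrightarrow> trace_pairing D \<alpha> \<beta> m = 0"
    using trace_pairing_cong[OF _ eqv_refl, of D \<alpha> zero_u \<beta>] trace_pairing_cong[OF eqv_refl, of D \<beta> zero_u \<alpha>] by simp_all
qed

text \<open>The given primitive may have noncompact support, so
  \<open>exact_with_compact_support\<close> replaces it before Stokes' theorem is applied.\<close>

lemma trace_pairing_exact_left: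
  assumes C: "good D C" "compactly_supported D C" and d: "good D \<delta>" "eqv D C (Q_f D \<delta>)"
    and b: "good D \<beta>" "eqv D (Q_f D \<beta>) zero_u"
  shows "trace_pairing D C \<beta> m = 0"
proof -
  obtain Y where Y: "good D Y" "compactly_supported D Y" "eqv D C (Q_f D Y)"
    using exact_with_compact_support[OF D R C d] by blast
  obtain B where B: "supported D B Y" using Y(2) unfolding compactly_supported_def ..
  have "trace_pairing D C \<beta> m = trace_pairing D (Q_f D Y) \<beta> m" by (rule trace_pairing_cong[OF Y(3) eqv_refl])
  also have "\<dots> = - trace_pairing D (twist_u Y) (Q_f D \<beta>) m" by (rule Stokes[OF Y(1) B b(1)])
  also have "\<dots> = 0" using trace_pairing_zero(2)[OF b(2)] by simp
  finally show ?thesis .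
qed

text \<open>Here the first factor supplies the compact support; Stokes' theorem is applied to its
  twist, which is closed as well.\<close>

lemma trace_pairing_exact_right:
  assumes a: "good D \<alpha>" "supported D B \<alpha>" "eqv D (Q_f D \<alpha>) zero_u" and b: "good D \<gamma>"
  shows "trace_pairing D \<alpha> (Q_f D \<gamma>) m = 0"
proof -
  have "eqv D (Q_f D (twist_u \<alpha>)) zero_u"
    by (rule eqv_trans[OF Q_f_twist[OF a(1)] eqv_zero_twist[OF a(3)]])
  then have "trace_pairing D (Q_f D (twist_u \<alpha>)) \<gamma> m = 0" by (rule trace_pairing_zero(1))
  with Stokes[OF good_twist[OF a(1)] supported_twist[OF a(2)] b, of m] show ?thesis by (simp add: twist_twist)
qed

lemma trace_pairing_padd_right:
  assumes a: "good D \<alpha>" "supported D B \<alpha>" and b: "good D \<beta>" "good D \<gamma>"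
  shows "trace_pairing D \<alpha> (padd 1 \<beta> 1 \<gamma>) m = trace_pairing D \<alpha> \<beta> m + trace_pairing D \<alpha> \<gamma> m"
proof -
  have "Tr D (wedge (\<alpha> l) (padd 1 \<beta> 1 \<gamma> r)) = Tr D (wedge (\<alpha> l) (\<beta> r)) + Tr D (wedge (\<alpha> l) (\<gamma> r))" for l r
  proof -
    have "padd 1 \<beta> 1 \<gamma> r = (\<lambda>S J K z. \<beta> r S J K z + \<gamma> r S J K z)" by (simp add: padd_eq fun_eq_iff)
    moreover have "Tr D (\<lambda>S J K z. wedge (\<alpha> l) (\<beta> r) S J K z + wedge (\<alpha> l) (\<gamma> r) S J K z) = Tr D (wedge (\<alpha> l) (\<beta> r)) + Tr D (wedge (\<alpha> l) (\<gamma> r))"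
      by (rule Tr_add[OF D, where B = B]) (intro pv_smooth_wedge pv_supp_wedge good_pv supported_pv a b)+
    ultimately show ?thesis by (simp add: wedge_add_right)
  qed
  then show ?thesis
    unfolding trace_pairing_eq[OF a good_padd[OF b]] trace_pairing_eq[OF a b(1)] trace_pairing_eq[OF a b(2)]
    by (simp add: distrib_left sum.distrib)
qed

text \<open>For closed \<open>\<alpha>\<close> the homotopy formula becomes
  \<open>T \<alpha> = \<alpha> - Q_f (R \<alpha>)\<close>.\<close>

lemma represents_T_op:
  assumes "good D \<alpha>" "eqv D (Q_f D \<alpha>) zero_u" "good D \<gamma>" "eqv D \<alpha> (padd 1 a 1 (Q_f D \<gamma>))"
  shows "represents D (T_op D R \<alpha>) a"
  unfolding represents_def
proof (intro conjI exI)
  let ?\<delta> = "padd 1 \<gamma> (-1) (R_op D R \<alpha>)"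
  note gR = good_R_op[OF D R assms(1)]
  show "good D (T_op D R \<alpha>)" by (rule good_T_op[OF D R assms(1)])
  show "compactly_supported D (T_op D R \<alpha>)" by (rule compactly_supported_T_op[OF D R])
  show "good D ?\<delta>" by (intro good_padd assms gR)
  show "eqv D (T_op D R \<alpha>) (padd 1 a 1 (Q_f D ?\<delta>))"
  proof (rule eqvI)
    fix S m J K and z :: "nat \<Rightarrow> complex" assume *: "S \<in> maxcones D" "J \<subseteq> S" "K \<subseteq> {1..rk D}" "z \<in> coord_space S"
    show "T_op D R \<alpha> m S J K z = padd 1 a 1 (Q_f D ?\<delta>) m S J K z"
      using eqvD[OF eqv_T_op_eq[OF D R assms(1)] *, of m] eqvD[OF eqv_zero(2)[OF assms(2)] *, of R m]
        eqvD[OF assms(4) *, of m] eqvD[OF eqv_Q_f_padd[OF D R assms(3) gR] *, of 1 "-1" m]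
      by (simp add: padd_eq)
  qed
qed

lemma represents_closed:
  assumes "represents D A a" "good D a" "eqv D (Q_f D a) zero_u"
  shows "eqv D (Q_f D A) zero_u"
proof -
  obtain \<delta> where d: "good D \<delta>" "eqv D A (padd 1 a 1 (Q_f D \<delta>))" using assms(1) by (auto simp: represents_def)
  show ?thesis
  proof (rule eqvI)
    fix S m J K and z :: "nat \<Rightarrow> complex" assume *: "S \<in> maxcones D" "J \<subseteq> S" "K \<subseteq> {1..rk D}" "z \<in> coord_space S"
    show "Q_f D A m S J K z = 0"
      using eqvD[OF eqv_Q_f[OF d(2)] *, of m] eqvD[OF eqv_Q_f_padd[OF D R assms(2) good_Q_f[OF D R d(1)]] *, of 1 1 m]
        eqvD[OF assms(3) *, of m] eqvD[OF eqv_Q_f_Q_f[OF D R d(1)] *, of m]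
      by (simp add: padd_eq)
  qed
qed

lemma eqv_Q_f_lincomb: "(\<And>x. x \<in> A \<Longrightarrow> good D (\<delta> x)) \<Longrightarrow> eqv D (Q_f D (lincomb A c \<delta>)) (lincomb A c (\<lambda>x. Q_f D (\<delta> x)))"
  unfolding eqv_def by (intro ballI allI Q_f_lincomb[OF maxcone_rays[OF D] open_UNIV] good_smooth)

lemma represents_lincomb:
  assumes A: "finite A" and r: "\<And>x. x \<in> A \<Longrightarrow> represents D (F x) (f x)"
  shows "represents D (lincomb A c F) (lincomb A c f)"
proof -
  have "\<forall>x\<in>A. \<exists>\<delta>. good D \<delta> \<and> eqv D (F x) (padd 1 (f x) 1 (Q_f D \<delta>))" using r by (auto simp: represents_def)
  then obtain \<delta> where d: "\<forall>x\<in>A. good D (\<delta> x) \<and> eqv D (F x) (padd 1 (f x) 1 (Q_f D (\<delta> x)))"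
    by (rule bchoice[THEN exE])
  obtain B where B: "\<forall>x\<in>A. supported D B (F x)"
    using common_support[OF A, of D F] r by (auto simp: represents_def)
  have "compactly_supported D (lincomb A c F)"
    unfolding compactly_supported_def using supported_lincomb[of A D B F] B by blast
  moreover have "good D (lincomb A c F)" "good D (lincomb A c \<delta>)"
    using r d by (auto intro!: good_lincomb simp: represents_def)
  moreover have "eqv D (lincomb A c F) (padd 1 (lincomb A c f) 1 (Q_f D (lincomb A c \<delta>)))"
  proof (rule eqvI)
    fix S m J K and z :: "nat \<Rightarrow> complex" assume *: "S \<in> maxcones D" "J \<subseteq> S" "K \<subseteq> {1..rk D}" "z \<in> coord_space S"
    have "F x m S J K z = f x m S J K z + Q_f D (\<delta> x) m S J K z" if "x \<in> A" for x
      using eqvD[OF _ *, of "F x" "padd 1 (f x) 1 (Q_f D (\<delta> x))" m] d that by (simp add: padd_eq)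
    moreover have "Q_f D (lincomb A c \<delta>) m S J K z = lincomb A c (\<lambda>x. Q_f D (\<delta> x)) m S J K z"
      by (rule eqvD[OF eqv_Q_f_lincomb *]) (use d in auto)
    ultimately show "lincomb A c F m S J K z = padd 1 (lincomb A c f) 1 (Q_f D (lincomb A c \<delta>)) m S J K z"
      by (simp add: padd_eq lincomb_def distrib_left sum.distrib)
  qed
  ultimately show ?thesis unfolding represents_def by blast
qed

lemma represents_padd: "represents D A a \<Longrightarrow> represents D B b \<Longrightarrow> represents D (padd c A d B) (padd c a d b)"
  unfolding padd_def by (rule represents_lincomb) auto

text \<open>The primitive of \<open>c\<close> and that of the difference \<open>C - c\<close> add up
  to a primitive of \<open>C\<close>.\<close>

lemma represents_exact:
  assumes "represents D C c" "eqv D c (Q_f D \<gamma>)" "good D \<gamma>" "good D \<beta>" "eqv D (Q_f D \<beta>) zero_u"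
  shows "trace_pairing D C \<beta> m = 0"
proof -
  obtain \<delta> where d: "good D \<delta>" "eqv D C (padd 1 c 1 (Q_f D \<delta>))" using assms(1) by (auto simp: represents_def)
  have "eqv D C (Q_f D (padd 1 \<gamma> 1 \<delta>))"
  proof (rule eqvI)
    fix S m J K and z :: "nat \<Rightarrow> complex" assume *: "S \<in> maxcones D" "J \<subseteq> S" "K \<subseteq> {1..rk D}" "z \<in> coord_space S"
    show "C m S J K z = Q_f D (padd 1 \<gamma> 1 \<delta>) m S J K z"
      using eqvD[OF d(2) *, of m] eqvD[OF assms(2) *, of m] eqvD[OF eqv_Q_f_padd[OF D R assms(3) d(1)] *, of 1 1 m]
      by (simp add: padd_eq)
  qed
  then show ?thesis
    using trace_pairing_exact_left[OF _ _ good_padd[OF assms(3) d(1)] _ assms(4,5)] assms(1)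
    unfolding represents_def by blast
qed

lemma mono_trace_lincomb:
  assumes A: "finite A" and r: "\<And>x. x \<in> A \<Longrightarrow> good D (F x)" "\<And>x. x \<in> A \<Longrightarrow> compactly_supported D (F x)"
  shows "mono_trace D b (lincomb A c F) m = (\<Sum>x\<in>A. c x * mono_trace D b (F x) m)"
proof -
  obtain B where B: "\<forall>x\<in>A. supported D B (F x)" using common_support[OF A, of D F] r by auto
  have "mono_trace D b (lincomb A c F) m = Tr D (\<lambda>S J K z. \<Sum>x\<in>A. c x * ((\<Prod>i\<in>b. z i) * F x m S J K z))"
    unfolding mono_trace_def lincomb_def by (simp add: sum_distrib_left mult_ac)
  also have "\<dots> = (\<Sum>x\<in>A. c x * Tr D (\<lambda>S J K z. (\<Prod>i\<in>b. z i) * F x m S J K z))"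
  proof (rule Tr_sum[OF D])
    fix x assume x: "x \<in> A"
    show "pv_smooth D (\<lambda>S J K z. (\<Prod>i\<in>b. z i) * F x m S J K z)"
      by (rule pv_smoothI[OF D]) (intro smooth_in_mult smooth_in_prod smooth_in_coord open_UNIV pv_smoothD[OF good_pv(1)[OF r(1)[OF x]]])
    show "pv_supp D B (\<lambda>S J K z. (\<Prod>i\<in>b. z i) * F x m S J K z)"
      using supported_pv[of D B "F x" m] B x by (simp add: pv_supp_def)
  qed
  finally show ?thesis unfolding mono_trace_def .
qed

end

section \<open>Operators acting on coefficients\<close>

text \<open>The operator may depend on the \<open>theta\<close>-degree \<open>card K\<close>, as the
  grading operator does.\<close>

definition coeffwise :: "(nat \<Rightarrow> useries \<Rightarrow> useries) \<Rightarrow> pvu \<Rightarrow> pvu" where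
  "coeffwise X \<alpha> = (\<lambda>m S J K z. X (card K) (\<lambda>m. \<alpha> m S J K) m z)"

text \<open>The hypotheses of \<open>Q_f_coefficientwise\<close>, uniform in the component and the
  region. By \<open>lin\<close> and \<open>cong\<close> such an operator is local, so it preserves
  gluing and compact supports; as it also commutes with \<open>Q_f\<close>, it passes to
  representatives.\<close>

locale coefficient_op =
  fixes D :: "'n::finite toric" and X :: "nat \<Rightarrow> useries \<Rightarrow> useries"
  assumes log: "log_LG D"
    and lin: "\<And>S U k F m z. \<And>A :: nat set. \<And>c. S \<subseteq> {1..nrays D} \<Longrightarrow> open U \<Longrightarrow> z \<in> coord_space S \<inter> U \<Longrightarrow>
      (\<And>x. x \<in> A \<Longrightarrow> smooth_us S U (F x)) \<Longrightarrow>
      X k (\<lambda>m z. \<Sum>x\<in>A. c x * F x m z) m z = (\<Sum>x\<in>A. c x * X k (F x) m z)"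
    and dz: "\<And>S U F i k m z. S \<subseteq> {1..nrays D} \<Longrightarrow> open U \<Longrightarrow> z \<in> coord_space S \<inter> U \<Longrightarrow> smooth_us S U F \<Longrightarrow> i \<in> S \<Longrightarrow>
      d_zbar i (X k F m) z = X k (\<lambda>m. d_zbar i (F m)) m z"
    and dop: "\<And>S U F i k m z. S \<subseteq> {1..nrays D} \<Longrightarrow> open U \<Longrightarrow> z \<in> coord_space S \<inter> U \<Longrightarrow> smooth_us S U F \<Longrightarrow>
      X k (Dop i F) m z = Dop i (X (Suc k) F) m z"
    and sm: "\<And>S U F k. S \<subseteq> {1..nrays D} \<Longrightarrow> open U \<Longrightarrow> smooth_us S U F \<Longrightarrow> smooth_us S U (X k F)"
    and cong: "\<And>S U F G k m z. S \<subseteq> {1..nrays D} \<Longrightarrow> open U \<Longrightarrow> z \<in> coord_space S \<inter> U \<Longrightarrow>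
      (\<And>l z. l \<le> m \<Longrightarrow> z \<in> coord_space S \<inter> U \<Longrightarrow> F l z = G l z) \<Longrightarrow> X k F m z = X k G m z"
begin

lemma add:
  assumes "S \<subseteq> {1..nrays D}" "open U" "z \<in> coord_space S \<inter> U" "smooth_us S U F" "smooth_us S U G"
  shows "X k (\<lambda>m z. F m z + G m z) m z = X k F m z + X k G m z"
  using lin[OF assms(1-3), of "{0, 1}" "\<lambda>x. if x = 0 then F else G" k "\<lambda>x. 1" m] assms(4,5) by simp

lemma zero: "S \<subseteq> {1..nrays D} \<Longrightarrow> open U \<Longrightarrow> z \<in> coord_space S \<inter> U \<Longrightarrow> X k (\<lambda>m z. 0) m z = 0"
  using lin[of S U z "{}"] by simp

lemma agree_coeffwise:
  assumes "W \<subseteq> {1..nrays D}" "open U" "agree D W U M \<alpha> S \<beta> S'"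
  shows "agree D W U M (coeffwise X \<alpha>) S (coeffwise X \<beta>) S'"
proof (rule agreeI)
  fix m J K z assume *: "m \<le> M" "J \<subseteq> W" "K \<subseteq> {1..rk D}" "z \<in> coord_space W" "z \<in> U"
  show "coeffwise X \<alpha> m S J K z = coeffwise X \<beta> m S' J K z" unfolding coeffwise_def
    by (rule cong[OF assms(1,2)]) (use * agreeD[OF assms(3)] in auto)
qed

lemma eqv_coeffwise: "eqv D \<alpha> \<beta> \<Longrightarrow> eqv D (coeffwise X \<alpha>) (coeffwise X \<beta>)"
  unfolding eqv_def using agree_coeffwise[OF maxcone_rays[OF log] open_UNIV] by blast

lemma good_coeffwise:
  assumes "good D \<alpha>"
  shows "good D (coeffwise X \<alpha>)"
proof -
  have "agree D (S \<inter> S') UNIV M (coeffwise X \<alpha>) S (coeffwise X \<alpha>) S'" if "S \<in> maxcones D" "S' \<in> maxcones D" for S S' M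
    by (rule agree_coeffwise[OF _ open_UNIV]) (use that assms maxcone_rays[OF log] in \<open>auto simp: good_def\<close>)
  moreover have "smooth_pv D S UNIV (coeffwise X \<alpha>)" if "S \<in> maxcones D" for S
    unfolding smooth_pv_def coeffwise_def
    using sm[OF maxcone_rays[OF log that] open_UNIV smooth_pv_us[OF good_smooth[OF assms that]]] by (simp add: smooth_us_def)
  ultimately show ?thesis by (simp add: good_def)
qed

lemma supported_coeffwise:
  assumes "supported D B \<alpha>"
  shows "supported D B (coeffwise X \<alpha>)"
proof -
  have "agree D S {z. \<exists>i\<in>S. B < cmod (z i)} M (coeffwise X \<alpha>) S zero_u S" if S: "S \<in> maxcones D" for S M
  proof -
    let ?U = "{z. \<exists>i\<in>S. B < cmod (z i)}"
    note SU = maxcone_rays[OF log S] open_outside[of S B]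
    have "agree D S ?U M (coeffwise X \<alpha>) S (coeffwise X zero_u) S"
      by (rule agree_coeffwise[OF SU]) (use assms S in \<open>simp add: supported_def\<close>)
    moreover have "agree D S ?U M (coeffwise X zero_u) S zero_u S"
      by (rule agreeI) (use zero[OF SU] in \<open>simp add: coeffwise_def\<close>)
    ultimately show ?thesis by (rule agree_trans)
  qed
  then show ?thesis by (simp add: supported_def)
qed

lemma compactly_supported_coeffwise: "compactly_supported D \<alpha> \<Longrightarrow> compactly_supported D (coeffwise X \<alpha>)"
  unfolding compactly_supported_def using supported_coeffwise by blast

lemma eqv_coeffwise_lincomb:
  fixes A :: "nat set"
  assumes "\<And>x. x \<in> A \<Longrightarrow> good D (\<alpha> x)"
  shows "eqv D (coeffwise X (lincomb A c \<alpha>)) (lincomb A c (\<lambda>x. coeffwise X (\<alpha> x)))"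
proof (rule eqvI)
  fix S m J K and z :: "nat \<Rightarrow> complex" assume *: "S \<in> maxcones D" "J \<subseteq> S" "K \<subseteq> {1..rk D}" "z \<in> coord_space S"
  have zz: "z \<in> coord_space S \<inter> UNIV" using * by simp
  show "coeffwise X (lincomb A c \<alpha>) m S J K z = lincomb A c (\<lambda>x. coeffwise X (\<alpha> x)) m S J K z"
    unfolding coeffwise_def lincomb_def
    by (rule lin[OF maxcone_rays[OF log *(1)] open_UNIV zz]) (rule smooth_pv_us[OF good_smooth[OF assms *(1)] *(2,3)])
qed

lemma eqv_coeffwise_add:
  assumes "good D \<alpha>" "good D \<beta>"
  shows "eqv D (coeffwise X (padd 1 \<alpha> 1 \<beta>)) (padd 1 (coeffwise X \<alpha>) 1 (coeffwise X \<beta>))"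
proof (rule eqvI)
  fix S m J K and z :: "nat \<Rightarrow> complex" assume *: "S \<in> maxcones D" "J \<subseteq> S" "K \<subseteq> {1..rk D}" "z \<in> coord_space S"
  have zz: "z \<in> coord_space S \<inter> UNIV" using * by simp
  note us = smooth_pv_us[OF good_smooth[OF _ *(1)] *(2,3)]
  show "coeffwise X (padd 1 \<alpha> 1 \<beta>) m S J K z = padd 1 (coeffwise X \<alpha>) 1 (coeffwise X \<beta>) m S J K z"
    unfolding coeffwise_def padd_eq using add[OF maxcone_rays[OF log *(1)] open_UNIV zz us[OF assms(1)] us[OF assms(2)], of "card K" m] by simp
qed

lemma eqv_Q_f_coeffwise:
  assumes "good D \<alpha>"
  shows "eqv D (Q_f D (coeffwise X \<alpha>)) (coeffwise X (Q_f D \<alpha>))"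
  unfolding eqv_def coeffwise_def
proof (intro ballI allI)
  fix S M assume S: "S \<in> maxcones D"
  note SU = maxcone_rays[OF log S] open_UNIV
  show "agree D S UNIV M (Q_f D (\<lambda>m S J K z. X (card K) (\<lambda>m. \<alpha> m S J K) m z)) S (\<lambda>m S J K z. X (card K) (\<lambda>m. Q_f D \<alpha> m S J K) m z) S"
    by (rule Q_f_coefficientwise[OF SU];
      (rule good_smooth[OF assms S] | rule lin[OF SU] | rule add[OF SU] | rule dz[OF SU] | rule dop[OF SU] | rule sm[OF SU] | rule cong[OF SU]);
      (assumption | blast))
qed

lemma represents_coeffwise:
  assumes R: "is_cutoff D R" and r: "represents D A a" and a: "good D a"
  shows "represents D (coeffwise X A) (coeffwise X a)"
proof -
  obtain \<delta> where d: "good D \<delta>" "eqv D A (padd 1 a 1 (Q_f D \<delta>))" using r by (auto simp: represents_def)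
  have "eqv D (coeffwise X A) (padd 1 (coeffwise X a) 1 (Q_f D (coeffwise X \<delta>)))"
    by (rule eqv_trans[OF eqv_coeffwise[OF d(2)] eqv_trans[OF eqv_coeffwise_add[OF a good_Q_f[OF log R d(1)]]
      eqv_padd[OF eqv_refl eqv_sym[OF eqv_Q_f_coeffwise[OF d(1)]]]]])
  then show ?thesis
    using r good_coeffwise[OF d(1)] unfolding represents_def by (blast intro: good_coeffwise compactly_supported_coeffwise)
qed

end

lemma coefficient_op_Dop:
  assumes "log_LG D" shows "coefficient_op D (\<lambda>k. Dop i)"
  by (unfold_locales; (rule assms | rule Dop_lin | rule d_zbar_Dop | rule Dop_Dop | rule smooth_us_Dop | rule Dop_cong); (assumption | blast)?)

definition weight_op :: "nat \<Rightarrow> nat \<Rightarrow> useries \<Rightarrow> useries" where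
  "weight_op d k F = (\<lambda>m z. of_nat (m + k) * F m z + (\<Sum>j=1..d. euler j (F m) z))"

text \<open>\<open>Dop i\<close> has weight one, since both multiplication by \<open>z i\<close> and
  multiplication by \<open>u\<close> raise the weight by one. The drop of the
  \<open>theta\<close>-degree from \<open>Suc k\<close> to \<open>k\<close> makes up for this, which
  is the rule \<open>dop\<close>.\<close>

lemma coefficient_op_weight:
  assumes "log_LG (D :: 'n::finite toric)"
  shows "coefficient_op D (weight_op (nrays D))"
proof
  show "log_LG D" by fact
next
  fix S U k m c and F :: "nat \<Rightarrow> useries" and z and A :: "nat set"
  assume SU: "S \<subseteq> {1..nrays D}" "open U" "z \<in> coord_space S \<inter> U" "\<And>x. x \<in> A \<Longrightarrow> smooth_us S U (F x)"
  have "euler j (\<lambda>z. \<Sum>x\<in>A. c x * F x m z) z = (\<Sum>x\<in>A. c x * euler j (F x m) z)" for j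
    by (rule euler_lin[OF SU(2,3)]) (use SU(4) in \<open>simp add: smooth_us_def\<close>)
  then show "weight_op (nrays D) k (\<lambda>m z. \<Sum>x\<in>A. c x * F x m z) m z = (\<Sum>x\<in>A. c x * weight_op (nrays D) k (F x) m z)"
    unfolding weight_op_def
    by (simp add: distrib_left sum.distrib sum_distrib_left sum.swap[of _ A] mult_ac)
next
  fix S U i k m z and F :: useries
  assume SU: "S \<subseteq> {1..nrays D}" "open U" "z \<in> coord_space S \<inter> U" "smooth_us S U F" "i \<in> S"
  have F: "smooth_in S U (F m)" using SU(4) by (simp add: smooth_us_def)
  \<comment> \<open>The index \<open>0\<close>, which is no ray, holds the scalar part, so that the
    linearity lemmas apply to the whole operator.\<close>
  define G where "G j = (if j = 0 then F m else euler j (F m))" for j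
  have G: "smooth_in S U (G j)" for j unfolding G_def using F SU(2) by (auto intro: smooth_in_euler)
  have w: "weight_op (nrays D) k F m = (\<lambda>z. \<Sum>j\<in>{0..nrays D}. (if j = 0 then of_nat (m + k) else 1) * G j z)"
    by (simp add: weight_op_def fun_eq_iff sum.atLeast_Suc_atMost[of 0] G_def)
  have "d_zbar i (weight_op (nrays D) k F m) z = (\<Sum>j\<in>{0..nrays D}. (if j = 0 then of_nat (m + k) else 1) * d_zbar i (G j) z)"
    unfolding w by (rule d_zbar_lin[OF SU(5,3,2) G])
  also have "\<dots> = weight_op (nrays D) k (\<lambda>m. d_zbar i (F m)) m z"
    by (simp add: weight_op_def sum.atLeast_Suc_atMost[of 0] G_def d_zbar_euler[OF SU(2) F SU(3,5)])
  finally show "d_zbar i (weight_op (nrays D) k F m) z = weight_op (nrays D) k (\<lambda>m. d_zbar i (F m)) m z" .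
next
  fix S U i k m z and F :: useries
  assume SU: "S \<subseteq> {1..nrays D}" "open U" "z \<in> coord_space S \<inter> U" "smooth_us S U F"
  have F: "smooth_in S U (F m)" for m using SU(4) by (simp add: smooth_us_def)
  \<comment> \<open>A label \<open>i\<close> that is not a ray is allowed; then \<open>z i\<close>
    is zero on the component.\<close>
  have zi: "(if i \<in> {1..nrays D} then z i else 0) = z i"
    using SU(1,3) coord_space_zero[of z S i] by (cases "i \<in> S") auto
  have 1: "(\<Sum>j=1..nrays D. if j = i then z j * F m z else 0) = z i * F m z" for m
    using zi by (simp add: sum.delta split: if_splits)
  have 2: "euler i (weight_op (nrays D) (Suc k) F m) z = of_nat (m + Suc k) * euler i (F m) z + (\<Sum>j=1..nrays D. euler j (euler i (F m)) z)" for m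
  proof -
    define G where "G j = (if j = 0 then F m else euler j (F m))" for j
    have G: "smooth_in S U (G j)" for j unfolding G_def using F SU(2) by (auto intro: smooth_in_euler)
    have w: "weight_op (nrays D) (Suc k) F m = (\<lambda>z. \<Sum>j\<in>{0..nrays D}. (if j = 0 then of_nat (m + Suc k) else 1) * G j z)"
      by (simp add: weight_op_def fun_eq_iff sum.atLeast_Suc_atMost[of 0] G_def)
    have "euler i (weight_op (nrays D) (Suc k) F m) z = (\<Sum>j\<in>{0..nrays D}. (if j = 0 then of_nat (m + Suc k) else 1) * euler i (G j) z)"
      unfolding w by (rule euler_lin[OF SU(2,3) G])
    then show ?thesis by (simp add: sum.atLeast_Suc_atMost[of 0] G_def euler_euler[OF SU(2) F SU(3), of i])
  qed
  have 3: "(\<Sum>j=1..nrays D. euler j (Dop i F m) z) = z i * F m z + (\<Sum>j=1..nrays D. z i * euler j (F m) z) +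
      (if m = 0 then 0 else \<Sum>j=1..nrays D. euler j (euler i (F (m - 1))) z)"
    unfolding euler_Dop[OF SU(2,4,3)] by (simp only: sum.distrib 1) simp
  show "weight_op (nrays D) k (Dop i F) m z = Dop i (weight_op (nrays D) (Suc k) F) m z"
  proof (cases m)
    case 0
    then show ?thesis unfolding weight_op_def[of _ k] 3 Dop_def[of i "weight_op (nrays D) (Suc k) F"]
      by (simp add: Dop_0 weight_op_def sum_distrib_left algebra_simps)
  next
    case (Suc n)
    then show ?thesis unfolding weight_op_def[of _ k] 3 Dop_def[of i "weight_op (nrays D) (Suc k) F"] 2
      by (simp add: Dop_Suc weight_op_def sum_distrib_left algebra_simps)
  qed
next
  fix S U k and F :: useries
  assume "S \<subseteq> {1..nrays D}" "open U" "smooth_us S U F"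
  then show "smooth_us S U (weight_op (nrays D) k F)"
    unfolding smooth_us_def weight_op_def by (auto intro!: smooth_in_add smooth_in_mult smooth_in_sum smooth_in_euler)
next
  fix S U k m z and F G :: useries
  assume SU: "S \<subseteq> {1..nrays D}" "open U" "z \<in> coord_space S \<inter> U"
    and eq: "\<And>l z. l \<le> m \<Longrightarrow> z \<in> coord_space S \<inter> U \<Longrightarrow> F l z = G l z"
  have "euler j (F m) z = euler j (G m) z" for j by (rule euler_cong[OF SU(2,3)]) (rule eq, auto)
  then show "weight_op (nrays D) k F m z = weight_op (nrays D) k G m z"
    unfolding weight_op_def using eq[OF order_refl SU(3)] by simp
qed

section \<open>Traces of words\<close>

abbreviation coord_op :: "nat \<Rightarrow> pvu \<Rightarrow> pvu" where
  "coord_op i \<equiv> coeffwise (\<lambda>k. Dop i)"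

definition word :: "nat list \<Rightarrow> pvu \<Rightarrow> pvu" where
  "word w \<alpha> = foldr coord_op w \<alpha>"

lemma word_Nil: "word [] \<alpha> = \<alpha>" and word_Cons: "word (i # w) \<alpha> = coord_op i (word w \<alpha>)"
  and word_append: "word (v @ w) \<alpha> = word v (word w \<alpha>)"
  by (simp_all add: word_def)

lemma euler_prod_outside: "i \<notin> T \<Longrightarrow> euler i (\<lambda>z. \<Prod>j\<in>T. z j) z = 0"
proof -
  assume i: "i \<notin> T"
  have "(\<Prod>j\<in>T. (z(i := v)) j) = (\<Prod>j\<in>T. z j)" for v using i by (intro prod.cong) auto
  then have "dir_deriv (i, v) (\<lambda>z. \<Prod>j\<in>T. z j) z = 0" for v :: complex
    unfolding dir_deriv_def by simp
  then show ?thesis by (simp add: euler_def d_z_def)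
qed

text \<open>Since \<open>i\<close> is not in \<open>T\<close>, the Euler derivative of the monomial
  vanishes and the operator acts as multiplication.\<close>

lemma coord_op_P_mon:
  assumes "finite T" "i \<notin> T"
  shows "coord_op i (P_mon T) = P_mon (insert i T)"
proof (intro ext)
  fix m S J K and z :: "nat \<Rightarrow> complex"
  have "euler i (\<lambda>z. if C then \<Prod>j\<in>T. z j else 0) z = 0" for C
    using euler_prod_outside[OF assms(2)] by (cases C) simp_all
  then show "coord_op i (P_mon T) m S J K z = P_mon (insert i T) m S J K z"
    using assms by (simp add: coeffwise_def Dop_def P_mon_def)
qed

lemma word_P_mon: "distinct w \<Longrightarrow> word w (P_mon {}) = P_mon (set w)"
  by (induction w) (simp_all add: word_Nil word_Cons coord_op_P_mon)

definition theta_field :: "nat \<Rightarrow> pvu" where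
  "theta_field k = (\<lambda>m S J K z. if m = 0 \<and> J = {} \<and> K = {k} then 1 else 0)"

lemma good_const_field: "good D (\<lambda>m S J K z. if P m J K then 1 else 0)"
  by (simp add: good_def smooth_pv_def agree_def)

lemma P_mon_empty: "P_mon {} = (\<lambda>m S J K z. if m = 0 \<and> J = {} \<and> K = {} then 1 else 0)"
  by (simp add: P_mon_def cong: if_cong)

lemma good_one: "good D (P_mon {})" and good_theta_field: "good D (theta_field k)"
  using good_const_field[of D "\<lambda>m J K. m = 0 \<and> J = {} \<and> K = {}"] good_const_field[of D "\<lambda>m J K. m = 0 \<and> J = {} \<and> K = {k}"]
  by (simp_all add: P_mon_empty theta_field_def)

lemma Q_f_one: "eqv D (Q_f D (P_mon {})) zero_u"
proof -
  have "odd_deriv k (P_mon {} m) S J K = (\<lambda>z. 0)" for k m S J K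
    by (simp add: odd_deriv_def P_mon_empty fun_eq_iff)
  then have "del D (P_mon {} m) S J K z = 0" "bracket_f D (P_mon {} m) S J K z = 0" for m S J K z
    by (simp_all add: del_def bracket_f_def theta_euler)
  moreover have "dbar (P_mon {} m) S J K z = 0" for m S J K z
    by (simp add: dbar_def P_mon_empty)
  ultimately show ?thesis by (intro eqvI) (simp add: Q_f_def Q_op_def)
qed

lemma weight_op_one: "coeffwise (weight_op d) (P_mon {}) = zero_u"
  by (auto simp: fun_eq_iff coeffwise_def weight_op_def P_mon_empty)

text \<open>The field has constant coefficients, so only \<open>{f, -}\<close> acts on it, with
  value \<open>g_k\<close>; on the other side \<open>D_i\<close> takes \<open>1\<close> to
  \<open>z i\<close>.\<close>

lemma Q_f_theta_field:
  assumes k: "k \<in> {1..rk D}"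
  shows "eqv D (lincomb {1..nrays D} (\<lambda>i. of_int (pairing (ray D i) (dual_vec D k))) (\<lambda>i. coord_op i (P_mon {}))) (Q_f D (theta_field k))"
proof (rule eqvI)
  fix S m J K and z :: "nat \<Rightarrow> complex" assume *: "S \<in> maxcones D" "J \<subseteq> S" "K \<subseteq> {1..rk D}" "z \<in> coord_space S"
  let ?p = "\<lambda>i. of_int (pairing (ray D i) (dual_vec D k)) :: complex"
  have L: "lincomb {1..nrays D} ?p (\<lambda>i. coord_op i (P_mon {})) m S J K z = (if m = 0 \<and> J = {} \<and> K = {} then g_f D k z else 0)"
  proof -
    have "coord_op i (P_mon {}) m S J K z = (if m = 0 \<and> J = {} \<and> K = {} then z i else 0)" for i
      by (auto simp: coeffwise_def Dop_def P_mon_empty)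
    then show ?thesis unfolding lincomb_def g_f_def by (cases "m = 0 \<and> J = {} \<and> K = {}") auto
  qed
  have o: "odd_deriv k' (theta_field k l) S J K = (\<lambda>z. if k' = k \<and> l = 0 \<and> J = {} \<and> K = {} then 1 else 0)" for k' l
    by (auto simp: odd_deriv_def theta_field_def shuffle_sign_def fun_eq_iff)
  have b: "bracket_f D (theta_field k m) S J K z = (if m = 0 \<and> J = {} \<and> K = {} then g_f D k z else 0)"
  proof -
    have "bracket_f D (theta_field k m) S J K z = (\<Sum>k'\<in>{1..rk D}. if k' = k then (if m = 0 \<and> J = {} \<and> K = {} then g_f D k z else 0) else 0)"
      unfolding bracket_f_def o by (rule sum.cong) auto
    also have "\<dots> = (if m = 0 \<and> J = {} \<and> K = {} then g_f D k z else 0)" using k by (simp only: sum.delta finite_atLeastAtMost) simp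
    finally show ?thesis .
  qed
  have d: "del D (theta_field k l) S J K z = 0" for l
    unfolding del_def o theta_euler by (intro sum.neutral ballI) simp
  have e: "dbar (theta_field k m) S J K z = 0"
    unfolding dbar_def theta_field_def by (intro sum.neutral ballI) simp
  show "lincomb {1..nrays D} ?p (\<lambda>i. coord_op i (P_mon {})) m S J K z = Q_f D (theta_field k) m S J K z"
    unfolding L Q_f_def Q_op_def b d e by simp
qed

section \<open>Relations among traces of words\<close>

context
  fixes D :: "'n::finite toric" and R :: "(nat \<Rightarrow> real) \<Rightarrow> real"
  assumes D: "log_LG D" and R: "is_cutoff D R"
begin

interpretation mult: coefficient_op D "\<lambda>k. Dop i" for i
  by (rule coefficient_op_Dop[OF D])

interpretation weight: coefficient_op D "weight_op (nrays D)"
  by (rule coefficient_op_weight[OF D])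

lemma good_word: "good D \<alpha> \<Longrightarrow> good D (word w \<alpha>)"
  by (induction w) (simp_all add: word_Nil word_Cons mult.good_coeffwise)

lemma eqv_word: "eqv D \<alpha> \<beta> \<Longrightarrow> eqv D (word w \<alpha>) (word w \<beta>)"
  by (induction w) (simp_all add: word_Nil word_Cons mult.eqv_coeffwise)

lemma represents_word: "represents D A a \<Longrightarrow> good D a \<Longrightarrow> represents D (word w A) (word w a)"
  by (induction w) (simp_all add: word_Nil word_Cons mult.represents_coeffwise[OF R] good_word)

lemma eqv_Q_f_word: "good D \<alpha> \<Longrightarrow> eqv D (Q_f D (word w \<alpha>)) (word w (Q_f D \<alpha>))"
proof (induction w)
  case (Cons i w)
  then show ?case unfolding word_Cons
    using eqv_trans[OF mult.eqv_Q_f_coeffwise[OF good_word] mult.eqv_coeffwise] by blast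
qed (simp add: word_Nil eqv_refl)

lemma eqv_word_lincomb:
  fixes A :: "nat set"
  assumes "\<And>x. x \<in> A \<Longrightarrow> good D (\<alpha> x)"
  shows "eqv D (word w (lincomb A c \<alpha>)) (lincomb A c (\<lambda>x. word w (\<alpha> x)))"
proof (induction w)
  case (Cons i w)
  show ?case unfolding word_Cons
    by (rule eqv_trans[OF mult.eqv_coeffwise[OF Cons.IH] mult.eqv_coeffwise_lincomb[OF good_word[OF assms]]])
qed (simp add: word_Nil eqv_refl)

lemma coord_op_commute:
  assumes "good D \<alpha>"
  shows "eqv D (coord_op i (coord_op j \<alpha>)) (coord_op j (coord_op i \<alpha>))"
proof (rule eqvI)
  fix S m J K and z :: "nat \<Rightarrow> complex" assume *: "S \<in> maxcones D" "J \<subseteq> S" "K \<subseteq> {1..rk D}" "z \<in> coord_space S"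
  have zz: "z \<in> coord_space S \<inter> UNIV" using * by simp
  show "coord_op i (coord_op j \<alpha>) m S J K z = coord_op j (coord_op i \<alpha>) m S J K z"
    using Dop_Dop[OF open_UNIV smooth_pv_us[OF good_smooth[OF assms *(1)] *(2,3)] zz]
    by (simp add: coeffwise_def)
qed

lemma word_coord_op: "good D \<alpha> \<Longrightarrow> eqv D (word w (coord_op i \<alpha>)) (coord_op i (word w \<alpha>))"
proof (induction w)
  case (Cons j w)
  then show ?case unfolding word_Cons
    using eqv_trans[OF mult.eqv_coeffwise coord_op_commute[OF good_word]] by blast
qed (simp add: word_Nil eqv_refl)

lemma word_move: "good D \<alpha> \<Longrightarrow> eqv D (word (xs @ i # ys) \<alpha>) (word (i # xs @ ys) \<alpha>)"
  unfolding word_append word_Cons by (rule word_coord_op[OF good_word])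

lemma word_closed: "eqv D (Q_f D (word w (P_mon {}))) zero_u"
proof -
  have "coord_op i zero_u = zero_u" for i by (simp add: coeffwise_def Dop_def fun_eq_iff)
  then have z: "word w zero_u = zero_u" by (induction w) (simp_all add: word_Nil word_Cons)
  show ?thesis
    using eqv_trans[OF eqv_Q_f_word[OF good_one] eqv_word[OF Q_f_one], of w] by (simp add: z)
qed

text \<open>For each maximal cone some letter lies outside of it; moved to the front of the word,
  this letter acts by zero on the component.\<close>

lemma word_not_cone:
  assumes "set w \<notin> cones D" "good D \<alpha>"
  shows "eqv D (word w \<alpha>) zero_u"
proof (rule eqvI)
  fix S m J K and z :: "nat \<Rightarrow> complex" assume *: "S \<in> maxcones D" "J \<subseteq> S" "K \<subseteq> {1..rk D}" "z \<in> coord_space S"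
  have "\<not> set w \<subseteq> S" using assms(1) cone_face[OF D maxcone_cone[OF D *(1)]] by blast
  then obtain i where i: "i \<in> set w" "i \<notin> S" by blast
  then obtain xs ys where w: "w = xs @ i # ys" by (metis split_list)
  have "word w \<alpha> m S J K z = word (i # xs @ ys) \<alpha> m S J K z"
    unfolding w by (rule eqvD[OF word_move[OF assms(2)] *])
  then show "word w \<alpha> m S J K z = 0" by (simp add: word_Cons coeffwise_def Dop_outside[OF *(4) i(2)])
qed

lemma weight_word: "eqv D (coeffwise (weight_op (nrays D)) (word w (P_mon {}))) (\<lambda>m S J K z. of_nat (length w) * word w (P_mon {}) m S J K z)"
proof (induction w)
  case Nil
  show ?case by (simp add: word_Nil weight_op_one eqv_refl)
next
  case (Cons i w)
  show ?case
  proof (rule eqvI)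
    fix S m J K and z :: "nat \<Rightarrow> complex" assume *: "S \<in> maxcones D" "J \<subseteq> S" "K \<subseteq> {1..rk D}" "z \<in> coord_space S"
    let ?W = "weight_op (nrays D)"
    let ?x = "word w (P_mon {})"
    let ?F = "\<lambda>m. ?x m S J K"
    have zz: "z \<in> coord_space S \<inter> UNIV" using * by simp
    note SU = maxcone_rays[OF D *(1)] open_UNIV zz
    have F: "smooth_us S UNIV ?F" by (rule smooth_pv_us[OF good_smooth[OF good_word[OF good_one] *(1)] *(2,3)])
    \<comment> \<open>\<open>Suc (card K)\<close> adds one to the weight in the induction
      hypothesis, and this counts the new letter.\<close>
    have "?W (Suc (card K)) ?F l z' = of_nat (Suc (length w)) * ?F l z'" if "z' \<in> coord_space S" for l z'
      using eqvD[OF Cons.IH *(1-3) that, of l] by (simp add: coeffwise_def weight_op_def algebra_simps)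
    then have "Dop i (?W (Suc (card K)) ?F) m z = Dop i (\<lambda>m z. \<Sum>x\<in>{0::nat}. of_nat (Suc (length w)) * ?F m z) m z"
      by (intro Dop_cong[OF SU(2,3)]) simp
    also have "\<dots> = (\<Sum>x\<in>{0::nat}. of_nat (Suc (length w)) * Dop i ?F m z)"
      by (rule Dop_lin[OF SU(2,3) F])
    finally show "coeffwise ?W (word (i # w) (P_mon {})) m S J K z = of_nat (length (i # w)) * word (i # w) (P_mon {}) m S J K z"
      using weight.dop[OF SU F, of "card K" i m] by (simp add: word_Cons coeffwise_def)
  qed
qed

lemma euler_trace:
  assumes a: "pv_smooth D a" "pv_supp D B a"
  shows "Tr D (\<lambda>S J K. euler i (a S J K)) = 0" "pv_smooth D (\<lambda>S J K. euler i (a S J K))" "pv_supp D B (\<lambda>S J K. euler i (a S J K))"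
proof -
  have "log_integral S (euler i (a S S {1..rk D})) = 0" if S: "S \<in> maxcones D" for S
    by (rule log_integral_euler_zero[OF D S pv_smoothD[OF a(1) S] pv_suppD[OF a(2) S]]) auto
  then show "Tr D (\<lambda>S J K. euler i (a S J K)) = 0" by (simp add: Tr_eq)
  show "pv_smooth D (\<lambda>S J K. euler i (a S J K))"
    by (rule pv_smoothI[OF D]) (intro smooth_in_euler open_UNIV pv_smoothD[OF a(1)])
  show "pv_supp D B (\<lambda>S J K. euler i (a S J K))" unfolding pv_supp_def
  proof (intro ballI allI impI)
    fix S J K and z :: "nat \<Rightarrow> complex" assume *: "S \<in> maxcones D" "J \<subseteq> S" "K \<subseteq> {1..rk D}" "z \<in> coord_space S" "\<exists>i\<in>S. B < cmod (z i)"
    have "euler i (a S J K) z = euler i (\<lambda>z. 0) z"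
      by (rule euler_cong[OF open_outside[of S B], where W = S]) (use * a(2) in \<open>auto simp: pv_supp_def\<close>)
    then show "euler i (a S J K) z = 0" by simp
  qed
qed

text \<open>The monomial over \<open>b\<close> does not involve \<open>z i\<close>, so the
  \<open>u\<close>-part of the operator becomes an Euler derivative of the whole integrand, whose
  trace is zero; multiplication by \<open>z i\<close> remains.\<close>

lemma mono_trace_coord_op:
  assumes a: "good D \<alpha>" "supported D B \<alpha>" and b: "finite b" "i \<notin> b"
  shows "mono_trace D b (coord_op i \<alpha>) m = mono_trace D (insert i b) \<alpha> m"
proof -
  let ?c = "\<lambda>b m S J K z. (\<Prod>j\<in>b. z j) * \<alpha> m S J K z"
  have c: "pv_smooth D (?c b m)" "pv_supp D B (?c b m)" for b m
    using supported_pv[OF a(2), of m]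
    by (auto simp: pv_supp_def intro!: pv_smoothI[OF D] smooth_in_mult smooth_in_prod smooth_in_coord pv_smoothD[OF good_pv(1)[OF a(1)]])
  have e: "(\<Prod>j\<in>b. z j) * coord_op i \<alpha> m S J K z = ?c (insert i b) m S J K z + (if m = 0 then 0 else euler i (?c b (m - 1) S J K) z)"
    if "S \<in> maxcones D" "J \<subseteq> S" "K \<subseteq> {1..rk D}" "z \<in> coord_space S" for S J K z
  proof -
    have zz: "z \<in> coord_space S \<inter> UNIV" using that by simp
    have s: "smooth_in S UNIV (\<lambda>z :: nat \<Rightarrow> complex. \<Prod>j\<in>b. z j)" by (intro smooth_in_prod smooth_in_coord open_UNIV)
    have "euler i (?c b (m - 1) S J K) z = (\<Prod>j\<in>b. z j) * euler i (\<alpha> (m - 1) S J K) z"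
      unfolding euler_mult[OF zz s pv_smoothD[OF good_pv(1)[OF a(1)] that(1-3)]] euler_prod_outside[OF b(2)] by simp
    then show ?thesis using b by (simp add: coeffwise_def Dop_def algebra_simps)
  qed
  show ?thesis
  proof (cases m)
    case 0
    show ?thesis unfolding mono_trace_def by (rule Tr_cong) (use e 0 in simp)
  next
    case (Suc n)
    have "mono_trace D b (coord_op i \<alpha>) m = Tr D (\<lambda>S J K z. ?c (insert i b) m S J K z + euler i (?c b n S J K) z)"
      unfolding mono_trace_def by (rule Tr_cong) (use e Suc in simp)
    also have "\<dots> = Tr D (?c (insert i b) m) + Tr D (\<lambda>S J K. euler i (?c b n S J K))"
      by (rule Tr_add[OF D c euler_trace(2,3)[OF c]])
    also have "\<dots> = mono_trace D (insert i b) \<alpha> m"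
      unfolding euler_trace(1)[OF c] by (simp add: mono_trace_def)
    finally show ?thesis .
  qed
qed

lemma mono_trace_word:
  assumes a: "good D \<alpha>" "compactly_supported D \<alpha>"
  shows "distinct w \<Longrightarrow> mono_trace D {} (word w \<alpha>) m = mono_trace D (set w) \<alpha> m"
proof -
  obtain B where B: "supported D B \<alpha>" using a(2) unfolding compactly_supported_def ..
  have sw: "supported D B (word w \<alpha>)" for w
    by (induction w) (simp_all add: word_Nil word_Cons B mult.supported_coeffwise)
  \<comment> \<open>Letters move one by one from the word into the monomial, so the induction has to
    carry along the letters \<open>v\<close> already moved.\<close>
  have "distinct (w @ v) \<Longrightarrow> mono_trace D (set v) (word w \<alpha>) m = mono_trace D (set (w @ v)) \<alpha> m" for v
  proof (induction w arbitrary: v)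
    case (Cons i w)
    have "mono_trace D (set v) (word (i # w) \<alpha>) m = mono_trace D (set (i # v)) (word w \<alpha>) m"
      unfolding word_Cons using mono_trace_coord_op[OF good_word[OF a(1)] sw, of "set v" i w m] Cons.prems by simp
    also have "\<dots> = mono_trace D (set (w @ i # v)) \<alpha> m" by (rule Cons.IH) (use Cons.prems in auto)
    finally show ?case by simp
  qed (simp add: word_Nil)
  from this[of "[]"] show "distinct w \<Longrightarrow> mono_trace D {} (word w \<alpha>) m = mono_trace D (set w) \<alpha> m" by simp
qed

definition unit_rep :: pvu where
  "unit_rep = T_op D R (P_mon {})"

definition word_trace :: "nat list \<Rightarrow> nat \<Rightarrow> complex" where
  "word_trace w m = mono_trace D {} (word w unit_rep) m"

lemma unit_rep: "represents D unit_rep (P_mon {})"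
proof -
  have g: "good D zero_u" using good_const_field[of D "\<lambda>m J K. False"] by simp
  have "Q_f D zero_u = zero_u" by (simp add: fun_eq_iff zero_pv)
  then have "eqv D (P_mon {}) (padd 1 (P_mon {}) 1 (Q_f D zero_u))" by (intro eqvI) (simp add: padd_eq)
  from represents_T_op[OF D R good_one Q_f_one g this] show ?thesis unfolding unit_rep_def .
qed

lemma good_unit_rep: "good D unit_rep" and compact_unit_rep: "compactly_supported D unit_rep"
  using unit_rep by (simp_all add: represents_def)

lemma word_unit_rep: "represents D (word w unit_rep) (word w (P_mon {}))"
  by (rule represents_word[OF unit_rep good_one])

lemma represents_trace:
  assumes "represents D C c" "eqv D c (Q_f D \<gamma>)" "good D \<gamma>"
  shows "mono_trace D {} C m = 0"
  using represents_exact[OF D R assms good_one Q_f_one] by (simp add: trace_pairing_P_mon[OF D])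

lemma word_trace_move: "word_trace (xs @ i # ys) m = word_trace (i # xs @ ys) m"
proof -
  have "eqv D (word (xs @ i # ys) unit_rep) (word (i # xs @ ys) unit_rep)" by (rule word_move[OF good_unit_rep])
  then show ?thesis unfolding word_trace_def trace_pairing_P_mon[OF D, symmetric] by (rule trace_pairing_cong[OF _ eqv_refl])
qed

lemma word_trace_not_cone: "set w \<notin> cones D \<Longrightarrow> word_trace w m = 0"
  unfolding word_trace_def trace_pairing_P_mon[OF D, symmetric]
  by (rule trace_pairing_zero(1)[OF D R word_not_cone[OF _ good_unit_rep]])

lemma word_trace_linear:
  assumes k: "k \<in> {1..rk D}"
  shows "(\<Sum>i=1..nrays D. of_int (pairing (ray D i) (dual_vec D k)) * word_trace (i # w) m) = 0"
proof -
  let ?p = "\<lambda>i. of_int (pairing (ray D i) (dual_vec D k)) :: complex"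
  let ?I = "{1..nrays D}"
  have r: "represents D (word (i # w) unit_rep) (word (i # w) (P_mon {}))" for i by (rule word_unit_rep)
  have 1: "eqv D (lincomb ?I ?p (\<lambda>i. word (i # w) (P_mon {}))) (lincomb ?I ?p (\<lambda>i. word w (coord_op i (P_mon {}))))"
    unfolding eqv_def word_Cons
    by (intro ballI allI agree_lincomb) (use eqv_sym[OF word_coord_op[OF good_one]] in \<open>simp add: eqv_def\<close>)
  have 2: "eqv D (lincomb ?I ?p (\<lambda>i. word w (coord_op i (P_mon {})))) (word w (lincomb ?I ?p (\<lambda>i. coord_op i (P_mon {}))))"
    by (rule eqv_sym[OF eqv_word_lincomb]) (rule mult.good_coeffwise[OF good_one])
  have 3: "eqv D (word w (lincomb ?I ?p (\<lambda>i. coord_op i (P_mon {})))) (word w (Q_f D (theta_field k)))"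
    by (rule eqv_word[OF Q_f_theta_field[OF k]])
  have 4: "eqv D (word w (Q_f D (theta_field k))) (Q_f D (word w (theta_field k)))"
    by (rule eqv_sym[OF eqv_Q_f_word[OF good_theta_field]])
  have "mono_trace D {} (lincomb ?I ?p (\<lambda>i. word (i # w) unit_rep)) m = 0"
    by (rule represents_trace[OF represents_lincomb[OF D R _ r] eqv_trans[OF 1 eqv_trans[OF 2 eqv_trans[OF 3 4]]] good_word[OF good_theta_field]]) simp
  moreover have "mono_trace D {} (lincomb ?I ?p (\<lambda>i. word (i # w) unit_rep)) m = (\<Sum>i\<in>?I. ?p i * mono_trace D {} (word (i # w) unit_rep) m)"
    by (rule mono_trace_lincomb[OF D R]) (use r in \<open>simp_all add: represents_def\<close>)
  ultimately show ?thesis by (simp add: word_trace_def)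
qed

lemma word_trace_degree: "(of_nat (m + rk D) - of_nat (length w)) * word_trace w m = 0"
proof -
  let ?W = "coeffwise (weight_op (nrays D))"
  let ?A = "word w unit_rep" and ?x = "word w (P_mon {})"
  have r: "represents D ?A ?x" by (rule word_unit_rep)
  have rW: "represents D (?W ?A) (?W ?x)" by (rule weight.represents_coeffwise[OF R r good_word[OF good_one]])
  have z: "Q_f D zero_u = zero_u" by (simp add: fun_eq_iff zero_pv)
  have g: "good D zero_u" using good_const_field[of D "\<lambda>m J K. False"] by simp
  define F where "F t = (if t then ?W ?A else ?A)" for t
  have P: "padd 1 (?W ?A) (- of_nat (length w)) ?A = lincomb UNIV (\<lambda>t. if t then 1 else - of_nat (length w)) F"
    by (simp add: padd_def F_def[abs_def])
  have "eqv D (padd 1 (?W ?x) (- of_nat (length w)) ?x) (Q_f D zero_u)"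
    unfolding z by (rule eqvI) (use eqvD[OF weight_word] in \<open>simp add: padd_eq\<close>)
  from represents_trace[OF represents_padd[OF D R rW r] this g]
  have "0 = mono_trace D {} (lincomb UNIV (\<lambda>t. if t then 1 else - of_nat (length w)) F) m" unfolding P by simp
  also have "\<dots> = (\<Sum>t\<in>UNIV. (if t then 1 else - of_nat (length w)) * mono_trace D {} (F t) m)"
    by (rule mono_trace_lincomb[OF D R]) (use r rW in \<open>auto simp: F_def represents_def\<close>)
  also have "\<dots> = mono_trace D {} (?W ?A) m - of_nat (length w) * word_trace w m"
    by (simp add: UNIV_bool F_def word_trace_def)
  \<comment> \<open>Only the coefficient with \<open>K = {1..rk D}\<close> enters the trace, so the
    \<open>theta\<close>-degree contributes \<open>rk D\<close>, while the Euler parts integrate to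
    zero.\<close>
  also have "mono_trace D {} (?W ?A) m = of_nat (m + rk D) * word_trace w m"
  proof -
    obtain B where B: "supported D B ?A" using r unfolding represents_def compactly_supported_def by blast
    have gA: "good D ?A" using r by (simp add: represents_def)
    define G where "G j = (if j = 0 then ?A m else (\<lambda>S J K. euler j (?A m S J K)))" for j
    have G: "pv_smooth D (G j)" "pv_supp D B (G j)" for j
      unfolding G_def using euler_trace(2,3)[OF good_pv(1)[OF gA] supported_pv[OF B]] good_pv(1)[OF gA] supported_pv[OF B] by auto
    have "mono_trace D {} (?W ?A) m = Tr D (\<lambda>S J K z. \<Sum>j\<in>{0..nrays D}. (if j = 0 then of_nat (m + rk D) else 1) * G j S J K z)"
      unfolding mono_trace_def
      by (rule Tr_cong) (simp add: coeffwise_def weight_op_def sum.atLeast_Suc_atMost[of 0] G_def)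
    also have "\<dots> = (\<Sum>j\<in>{0..nrays D}. (if j = 0 then of_nat (m + rk D) else 1) * Tr D (G j))"
      by (rule Tr_sum[OF D G])
    also have "\<dots> = of_nat (m + rk D) * Tr D (?A m)"
      using euler_trace(1)[OF good_pv(1)[OF gA] supported_pv[OF B]] by (simp add: sum.atLeast_Suc_atMost[of 0] G_def)
    finally show ?thesis by (simp add: word_trace_def mono_trace_def)
  qed
  finally show ?thesis by (simp add: algebra_simps)
qed

lemma word_trace_long: "length w > rk D \<Longrightarrow> word_trace w m = 0"
\<comment> \<open>The induction ends because more than \<open>rk D\<close> distinct letters cannot
  lie in a common cone.\<close>
proof (induction "rk D + 1 - card (set w)" arbitrary: w rule: less_induct)
  case less
  show ?case
  proof (cases "set w \<in> cones D")
    case True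
    have le: "card (set w) \<le> rk D" by (rule cone_card_le[OF D True])
    then have "\<not> distinct w" using less.prems distinct_card[of w] by auto
    then obtain xs ys zs i where w: "w = xs @ [i] @ ys @ [i] @ zs" using not_distinct_decomp by blast
    define v where "v = xs @ ys @ [i] @ zs"
    have v: "word_trace w m = word_trace (i # v) m" "set v = set w" "length w = Suc (length v)"
      using word_trace_move[of xs i "ys @ [i] @ zs" m] by (auto simp: w v_def)
    \<comment> \<open>One copy of \<open>i\<close> stays in \<open>v\<close>, so
      \<open>set v = set w\<close>. The relation adapted to \<open>i\<close> in the cone
      \<open>set w\<close> then replaces the other copy by letters outside of \<open>w\<close>,
      which increases the number of distinct letters.\<close>
    obtain c where c: "\<forall>j\<in>set w. (\<Sum>k=1..rk D. c k * pairing (ray D j) (dual_vec D k)) = (if i = j then 1 else 0)"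
      using dual_functional[OF D True, of i] by (auto simp: w)
    let ?p = "\<lambda>j k. pairing (ray D j) (dual_vec D k)"
    have far: "word_trace (j # v) m = 0" if "j \<notin> set w" for j
    proof (rule less.hyps)
      show "rk D + 1 - card (set (j # v)) < rk D + 1 - card (set w)" using that v(2) le by simp
      show "rk D < length (j # v)" using less.prems v(3) by simp
    qed
    have "0 = (\<Sum>k=1..rk D. of_int (c k) * (\<Sum>j=1..nrays D. of_int (?p j k) * word_trace (j # v) m))"
      using word_trace_linear by (intro sum.neutral[symmetric] ballI) simp
    also have "\<dots> = (\<Sum>j=1..nrays D. of_int (\<Sum>k=1..rk D. c k * ?p j k) * word_trace (j # v) m)"
    proof -
      have "(\<Sum>k=1..rk D. of_int (c k) * (\<Sum>j=1..nrays D. of_int (?p j k) * word_trace (j # v) m)) =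
        (\<Sum>j=1..nrays D. \<Sum>k=1..rk D. of_int (c k) * (of_int (?p j k) * word_trace (j # v) m))"
        unfolding sum_distrib_left by (rule sum.swap)
      then show ?thesis by (simp add: sum_distrib_right mult.assoc)
    qed
    also have "\<dots> = (\<Sum>j\<in>{1..nrays D}. if i = j then word_trace (i # v) m else 0)"
    proof (rule sum.cong[OF refl])
      fix j
      show "of_int (\<Sum>k=1..rk D. c k * ?p j k) * word_trace (j # v) m = (if i = j then word_trace (i # v) m else 0)"
      proof (cases "j \<in> set w")
        case True
        show ?thesis unfolding bspec[OF c True] by simp
      next
        case False
        have "i \<noteq> j" using False by (auto simp: w)
        then show ?thesis using far[OF False] by simp
      qed
    qed
    also have "\<dots> = word_trace (i # v) m"
    proof -
      have "i \<in> {1..nrays D}" using cone_rays[OF D True] by (auto simp: w)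
      then show ?thesis by (simp only: sum.delta' finite_atLeastAtMost if_True)
    qed
    finally show ?thesis using v(1) by simp
  qed (rule word_trace_not_cone)
qed

lemma word_trace_positive: "m > 0 \<Longrightarrow> word_trace w m = 0"
proof (cases "length w = m + rk D")
  case True
  then show "m > 0 \<Longrightarrow> word_trace w m = 0" by (intro word_trace_long) simp
next
  case False
  then have "of_nat (m + rk D) - of_nat (length w) \<noteq> (0 :: complex)" by (metis eq_iff_diff_eq_0 of_nat_eq_iff)
  then show ?thesis using word_trace_degree[of m w] by simp
qed

lemma P_mon_closed:
  assumes "finite b"
  shows "good D (P_mon b)" "eqv D (Q_f D (P_mon b)) zero_u"
proof -
  obtain w where w: "set w = b" "distinct w" using finite_distinct_list[OF assms] by blast
  have e: "P_mon b = word w (P_mon {})" using word_P_mon[OF w(2)] w(1) by simp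
  show "good D (P_mon b)" "eqv D (Q_f D (P_mon b)) zero_u"
    unfolding e by (rule good_word[OF good_one], rule word_closed)
qed

text \<open>Both factors are changed within their classes: first \<open>B\<close> to the monomial
  itself, the compact support being supplied by \<open>A\<close>, then \<open>A\<close> to a word
  applied to \<open>unit_rep\<close>. The pairing becomes the trace of the concatenation of two
  words.\<close>

lemma trace_pairing_positive:
  assumes A: "represents D A (P_mon a)" and B: "represents D B (P_mon b)"
    and f: "finite a" "finite b" and m: "m > 0"
  shows "trace_pairing D A B m = 0"
proof -
  obtain v where v: "set v = a" "distinct v" using finite_distinct_list[OF f(1)] by blast
  obtain w where w: "set w = b" "distinct w" using finite_distinct_list[OF f(2)] by blast
  obtain \<delta> where d: "good D \<delta>" "eqv D B (padd 1 (P_mon b) 1 (Q_f D \<delta>))" using B by (auto simp: represents_def)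
  obtain r where r: "supported D r A" using A unfolding represents_def compactly_supported_def by blast
  have gA: "good D A" using A by (simp add: represents_def)
  have cA: "eqv D (Q_f D A) zero_u" by (rule represents_closed[OF D R A P_mon_closed[OF f(1)]])
  have "trace_pairing D A B m = trace_pairing D A (padd 1 (P_mon b) 1 (Q_f D \<delta>)) m"
    by (rule trace_pairing_cong[OF eqv_refl d(2)])
  also have "\<dots> = trace_pairing D A (P_mon b) m + trace_pairing D A (Q_f D \<delta>) m"
    by (rule trace_pairing_padd_right[OF D R gA r P_mon_closed(1)[OF f(2)] good_Q_f[OF D R d(1)]])
  also have "trace_pairing D A (Q_f D \<delta>) m = 0" by (rule trace_pairing_exact_right[OF D R gA r cA d(1)])
  finally have 1: "trace_pairing D A B m = mono_trace D b A m" by (simp add: trace_pairing_P_mon[OF D])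
  have A': "represents D (word v unit_rep) (P_mon a)" using word_unit_rep[of v] word_P_mon[OF v(2)] v(1) by simp
  define F where "F t = (if t then A else word v unit_rep)" for t
  have P: "padd 1 A (-1) (word v unit_rep) = lincomb UNIV (\<lambda>t. if t then 1 else -1) F"
    by (simp add: padd_def F_def[abs_def])
  have z: "Q_f D zero_u = zero_u" by (simp add: fun_eq_iff zero_pv)
  have g: "good D zero_u" using good_const_field[of D "\<lambda>m J K. False"] by simp
  have "eqv D (padd 1 (P_mon a) (-1) (P_mon a)) (Q_f D zero_u)" unfolding z by (rule eqvI) (simp add: padd_eq)
  from represents_exact[OF D R represents_padd[OF D R A A'] this g P_mon_closed[OF f(2)], of m]
  have "0 = mono_trace D b (lincomb UNIV (\<lambda>t. if t then 1 else -1) F) m" unfolding P by (simp add: trace_pairing_P_mon[OF D])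
  also have "\<dots> = (\<Sum>t\<in>UNIV. (if t then 1 else -1) * mono_trace D b (F t) m)"
    by (rule mono_trace_lincomb[OF D R]) (use A A' in \<open>auto simp: F_def represents_def\<close>)
  finally have 2: "mono_trace D b A m = mono_trace D b (word v unit_rep) m"
    by (simp add: UNIV_bool F_def)
  have "mono_trace D b (word v unit_rep) m = word_trace (w @ v) m"
    using mono_trace_word[of "word v unit_rep" w m] A' w by (simp add: word_trace_def word_append represents_def)
  with 1 2 show ?thesis using word_trace_positive[OF m] by simp
qed

lemma represents_class:
  assumes "finite T" "\<alpha> \<in> brieskorn_class D (P_mon T)"
  shows "represents D (T_op D R \<alpha>) (P_mon T)"
proof -
  obtain \<gamma> where g: "\<alpha> \<in> PV_log_u D" "\<gamma> \<in> PV_log_u D"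
    and e: "\<forall>m. \<forall>S\<in>maxcones D. \<forall>J\<subseteq>S. \<forall>K\<subseteq>{1..rk D}. \<forall>z\<in>coord_space S. \<alpha> m S J K z = P_mon T m S J K z + Q_f D \<gamma> m S J K z"
    using assms(2) unfolding brieskorn_class_def by blast
  note gd = PV_log_good[OF g(1)] PV_log_good[OF g(2)]
  have eq: "eqv D \<alpha> (padd 1 (P_mon T) 1 (Q_f D \<gamma>))" by (rule eqvI) (use e in \<open>simp add: padd_eq\<close>)
  have "eqv D (Q_f D \<alpha>) zero_u"
  proof (rule eqvI)
    fix S m J K and z :: "nat \<Rightarrow> complex" assume *: "S \<in> maxcones D" "J \<subseteq> S" "K \<subseteq> {1..rk D}" "z \<in> coord_space S"
    show "Q_f D \<alpha> m S J K z = 0"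
      using eqvD[OF eqv_Q_f[OF eq] *, of m] eqvD[OF eqv_Q_f_padd[OF D R P_mon_closed(1)[OF assms(1)] good_Q_f[OF D R gd(2)]] *, of 1 1 m]
        eqvD[OF P_mon_closed(2)[OF assms(1)] *, of m] eqvD[OF eqv_Q_f_Q_f[OF D R gd(2)] *, of m]
      by (simp add: padd_eq)
  qed
  then show ?thesis by (rule represents_T_op[OF D R gd(1) _ gd(2) eq])
qed

end

theorem theorem2p21:
  fixes D :: "'n::finite toric"
    and sg :: "nat \<Rightarrow> nat set"
    and R :: "(nat \<Rightarrow> real) \<Rightarrow> real"
    and i j :: nat
    and \<alpha> \<beta> :: pvu
  assumes "log_LG D"
    and "cone_ordering D sg"
    and "is_cutoff D R"
    and "i \<in> {1..card (maxcones D)}"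
    and "j \<in> {1..card (maxcones D)}"
    and "\<alpha> \<in> brieskorn_class D (P_mon (tau D sg i))"
    and "\<beta> \<in> brieskorn_class D (P_mon (tau D sg j))"
  shows "K_f D R \<alpha> \<beta> \<in> range fps_const"
proof -
  have fin: "finite (tau D sg l)" if "l \<in> {1..card (maxcones D)}" for l
  proof -
    have "sg l \<in> maxcones D" using assms(2) that unfolding cone_ordering_def by (blast dest: bij_betwE)
    moreover have "tau D sg l \<subseteq> sg l" by (auto simp: tau_def)
    ultimately show ?thesis using maxcone_finite[OF assms(1)] finite_subset by blast
  qed
  have "fps_nth (K_f D R \<alpha> \<beta>) m = 0" if "m > 0" for m
    using trace_pairing_positive[OF assms(1,3) represents_class[OF assms(1,3) fin[OF assms(4)] assms(6)]
      represents_class[OF assms(1,3) fin[OF assms(5)] assms(7)] fin[OF assms(4)] fin[OF assms(5)] that]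
    by (simp add: K_f_def trace_pairing_def)
  then have "K_f D R \<alpha> \<beta> = fps_const (fps_nth (K_f D R \<alpha> \<beta>) 0)"
    by (intro fps_ext) auto
  then show ?thesis by (rule range_eqI)
qed

end
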